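(* Let $\alpha$ be a faithful action of a second countable compact group $G$ on a separable C$^*$-algebra $A$. Assume that $\alpha$ is minimal, i.e. the relative commutant $(A^\alpha)'\cap M(A)$ is trivial ($=\mathbb{C}1$), and assume that the fixed point algebra $A^\alpha$ is simple. Then $\alpha$ is quasi-product.
   Context: An action of a topological group $G$ on a C$^*$-algebra $A$ is a homomorphism $\alpha:G\to\mathrm{Aut}(A)$ that is continuous for the point-norm topology; it is faithful if it is injective. $A^\alpha=\{x\in A:\alpha_g(x)=x\ \forall g\in G\}$ is the fixed point algebra, and $M(A)$ is the multiplier algebra of $A$. An inclusion $A\supset B$ of separable C$^*$-algebras has the property (BEK) if for all $x,y\in A$, $\sup_{b\in B,\ \|b\|\le 1}\|xby\|=\|x\|\,\|y\|$. Bratteli–Elliott–Kishimoto showed that a list of conditions on a compact group action are mutually equivalent, and an action satisfying them is called quasi-product. For a faithful minimal action $\alpha$ of a second countable compact group on a separable C$^*$-algebra $A$ with $A^\alpha$ simple, $\alpha$ is quasi-product if and only if the inclusion $A\supset A^\alpha$ has the property (BEK); this may be taken as the definition here (it is equivalent to the existence of an $\alpha$-invariant pure state of $A$). *)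

theory Defs
  imports "HOL-Analysis.Analysis"
begin

section \<open>C*-algebras\<close>

text \<open>No unit is required. Submultiplicativity of the norm and completeness come from the classes
  \<^class>\<open>real_normed_algebra\<close> and \<^class>\<open>banach\<close>; the complex scalar multiplication extends the real one.\<close>

class cstar_algebra = real_normed_algebra + banach +
  fixes scaleC :: "complex \<Rightarrow> 'a \<Rightarrow> 'a"  (infixr "*\<^sub>C" 75)
    and star :: "'a \<Rightarrow> 'a"
  assumes scaleR_scaleC: "scaleR r x = complex_of_real r *\<^sub>C x"
    and scaleC_add_right: "c *\<^sub>C (x + y) = c *\<^sub>C x + c *\<^sub>C y"
    and scaleC_add_left: "(c + d) *\<^sub>C x = c *\<^sub>C x + d *\<^sub>C x"
    and scaleC_scaleC: "c *\<^sub>C d *\<^sub>C x = (c * d) *\<^sub>C x"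
    and mult_scaleC_left: "(c *\<^sub>C x) * y = c *\<^sub>C (x * y)"
    and mult_scaleC_right: "x * (c *\<^sub>C y) = c *\<^sub>C (x * y)"
    and norm_scaleC: "norm (c *\<^sub>C x) = cmod c * norm x"
    and star_star: "star (star x) = x"
    and star_add: "star (x + y) = star x + star y"
    and star_scaleC: "star (c *\<^sub>C x) = cnj c *\<^sub>C star x"
    and star_mult: "star (x * y) = star y * star x"
    and cstar_identity: "norm (star x * x) = (norm x)\<^sup>2"

definition complex_linear :: "('a::cstar_algebra \<Rightarrow> 'a) \<Rightarrow> bool" where
  "complex_linear f \<longleftrightarrow> (\<forall>x y. f (x + y) = f x + f y) \<and> (\<forall>c x. f (c *\<^sub>C x) = c *\<^sub>C f x)"

definition complex_subspace :: "'a::cstar_algebra set \<Rightarrow> bool" where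
  "complex_subspace S \<longleftrightarrow>
     0 \<in> S \<and> (\<forall>x\<in>S. \<forall>y\<in>S. x + y \<in> S) \<and> (\<forall>c. \<forall>x\<in>S. c *\<^sub>C x \<in> S)"

text \<open>The next two notions are meant for a C*-subalgebra \<open>B\<close>, given by its underlying set.\<close>

definition closed_two_sided_ideal :: "'a::cstar_algebra set \<Rightarrow> 'a set \<Rightarrow> bool" where
  "closed_two_sided_ideal I B \<longleftrightarrow>
     I \<subseteq> B \<and> complex_subspace I \<and> closed I \<and> (\<forall>b\<in>B. \<forall>x\<in>I. b * x \<in> I \<and> x * b \<in> I)"

definition simple_subalgebra :: "'a::cstar_algebra set \<Rightarrow> bool" where
  "simple_subalgebra B \<longleftrightarrow> B \<noteq> {0} \<and> (\<forall>I. closed_two_sided_ideal I B \<longrightarrow> I = {0} \<or> I = B)"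


section \<open>The multiplier algebra\<close>

text \<open>\<open>M(A)\<close> is realised as the algebra of double centralizers of \<open>A\<close>: a multiplier \<open>m\<close> is the pair
  of maps \<open>L x = m x\<close> and \<open>R x = x m\<close>. Composition of the right maps is therefore reversed in the
  product.\<close>

type_synonym 'a double_map = "('a \<Rightarrow> 'a) \<times> ('a \<Rightarrow> 'a)"

definition multiplier_algebra :: "'a::cstar_algebra double_map set" where
  "multiplier_algebra = {(L, R).
     bounded_linear L \<and> complex_linear L \<and> bounded_linear R \<and> complex_linear R \<and>
     (\<forall>x y. L (x * y) = L x * y) \<and>
     (\<forall>x y. R (x * y) = x * R y) \<and>
     (\<forall>x y. R x * y = x * L y)}"

definition multiplier_mult :: "'a double_map \<Rightarrow> 'a double_map \<Rightarrow> 'a double_map" where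
  "multiplier_mult m n = (fst m \<circ> fst n, snd n \<circ> snd m)"

definition multiplier_one :: "'a double_map" where
  "multiplier_one = (id, id)"

definition multiplier_scaleC :: "complex \<Rightarrow> 'a::cstar_algebra double_map \<Rightarrow> 'a double_map" where
  "multiplier_scaleC c m = ((\<lambda>x. c *\<^sub>C fst m x), (\<lambda>x. c *\<^sub>C snd m x))"

definition multiplier_embed :: "'a::cstar_algebra \<Rightarrow> 'a double_map" where
  "multiplier_embed a = ((\<lambda>x. a * x), (\<lambda>x. x * a))"

definition relative_commutant :: "'a::cstar_algebra set \<Rightarrow> 'a double_map set" where
  "relative_commutant B = {m \<in> multiplier_algebra.
     \<forall>b\<in>B. multiplier_mult m (multiplier_embed b) = multiplier_mult (multiplier_embed b) m}"


section \<open>Group actions\<close>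

definition star_automorphism :: "('a::cstar_algebra \<Rightarrow> 'a) \<Rightarrow> bool" where
  "star_automorphism f \<longleftrightarrow>
     bij f \<and> complex_linear f \<and> (\<forall>x y. f (x * y) = f x * f y) \<and> (\<forall>x. f (star x) = star (f x))"

text \<open>The library's topological groups are written additively, but \<^class>\<open>topological_group_add\<close> does
  not assume commutativity. The last conjunct is continuity for the point-norm topology.\<close>

definition cstar_action ::
    "('g::topological_group_add \<Rightarrow> 'a::cstar_algebra \<Rightarrow> 'a) \<Rightarrow> bool" where
  "cstar_action \<alpha> \<longleftrightarrow>
     (\<forall>g. star_automorphism (\<alpha> g)) \<and>
     (\<forall>g h. \<alpha> (g + h) = \<alpha> g \<circ> \<alpha> h) \<and>
     (\<forall>x. continuous_on UNIV (\<lambda>g. \<alpha> g x))"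

definition faithful_action :: "('g \<Rightarrow> 'a \<Rightarrow> 'a) \<Rightarrow> bool" where
  "faithful_action \<alpha> \<longleftrightarrow> inj \<alpha>"

definition fixed_point_algebra :: "('g \<Rightarrow> 'a \<Rightarrow> 'a) \<Rightarrow> 'a set" where
  "fixed_point_algebra \<alpha> = {x. \<forall>g. \<alpha> g x = x}"

definition minimal_action :: "('g \<Rightarrow> 'a::cstar_algebra \<Rightarrow> 'a) \<Rightarrow> bool" where
  "minimal_action \<alpha> \<longleftrightarrow>
     relative_commutant (fixed_point_algebra \<alpha>) = range (\<lambda>c. multiplier_scaleC c multiplier_one)"

text \<open>The property (BEK) of the inclusion of \<open>B\<close> in the whole algebra. The supremum is over a nonempty
  bounded set of reals as soon as \<open>0 \<in> B\<close>.\<close>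

definition BEK :: "'a::cstar_algebra set \<Rightarrow> bool" where
  "BEK B \<longleftrightarrow> (\<forall>x y. (SUP b\<in>{b \<in> B. norm b \<le> 1}. norm (x * b * y)) = norm x * norm y)"

text \<open>For faithful minimal actions of second countable compact groups on separable C*-algebras with
  simple fixed point algebra, being quasi-product means property (BEK) for the fixed point algebra.\<close>

definition quasi_product :: "('g \<Rightarrow> 'a::cstar_algebra \<Rightarrow> 'a) \<Rightarrow> bool" where
  "quasi_product \<alpha> \<longleftrightarrow> BEK (fixed_point_algebra \<alpha>)"

end

theory Submission
  imports Defs
begin

text \<open>Adjoin a unit to \<open>A\<close>, and let \<open>E\<close> be the Haar mean onto the fixed point algebra \<open>B\<close> and
  \<open>N x = \<parallel>E (x\<^sup>* x)\<parallel>\<^sup>1\<^sup>/\<^sup>2\<close>. Shrinking supports inside \<open>B\<close> so that \<open>N (e y e)\<close> becomes almost minimal gives positive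
  \<open>e\<^sub>n\<close> in \<open>B\<close> of norm one with \<open>e\<^sub>n e\<^sub>n\<^sub>+\<^sub>1 = e\<^sub>n\<^sub>+\<^sub>1\<close> below which \<open>N\<close> is flat at every \<open>y\<close> in \<open>A\<close>. They excise a state
  \<open>\<phi>\<close> of \<open>B\<close>. By flatness the sums \<open>\<Sum> z\<^sub>l\<^sup>* e y e z\<^sub>l\<close> with \<open>\<Sum> z\<^sub>l\<^sup>* e\<^sup>2 z\<^sub>l \<approx> 1\<close> asymptotically commute with \<open>B\<close>, so that
  their convolutions converge strictly to multipliers, which are scalars by minimality. Hence
  \<open>e\<^sub>n y e\<^sub>n - \<phi>(y) e\<^sub>n\<^sup>2 \<rightarrow> 0\<close> for every \<open>y\<close> in \<open>A\<close>, where \<open>\<phi>\<close> is an invariant state of \<open>A\<close>.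

  Let \<open>S\<close> be a \<open>\<phi>\<close>-orthonormal basis of a finite-dimensional invariant subspace of \<open>A\<close>. There are almost orthogonal almost
  isometries \<open>X\<^sub>i\<^sub>l\<close>, for \<open>i, l \<in> S\<close>, behaving like \<open>i \<otimes> l\<close>, and \<open>v = \<Sum> X\<^sub>i\<^sub>l X\<^sub>l\<^sub>i\<^sup>*\<close> is an almost contractive element of \<open>B\<close>
  that flips tensors. If the span of \<open>S\<close> nearly contains vectors \<open>a\<close> and \<open>a'\<close> that are norming for \<open>x\<close> and \<open>y\<^sup>*\<close>, then \<open>v\<close> maps
  \<open>a' \<otimes> a\<close>, which is norming for \<open>y\<^sup>*\<close>, to \<open>a \<otimes> a'\<close>, which is norming for \<open>x\<close>, and \<open>\<parallel>x v y\<parallel>\<close> is close to \<open>\<parallel>x\<parallel> \<parallel>y\<parallel>\<close>.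
  The construction of the \<open>X\<^sub>i\<^sub>l\<close> fails only if the \<open>e\<^sub>n\<^sup>2\<close> converge to a minimal projection \<open>p\<close>; then \<open>A = B\<close>, and \<open>v\<close> can
  be taken of the form \<open>b p c\<^sup>*\<close>.\<close>

text \<open>For a general inclusion, an excising sequence for a state of \<open>B\<close> gives no
  control over the larger algebra; the passage from \<open>B\<close> to \<open>A\<close> is the
  place where minimality has to enter. Elements of \<open>A\<close> outside \<open>B\<close> have no
  spectral cuts in \<open>B\<close>, so cutting inside \<open>B\<close> cannot be aimed at their
  C*-norm. It can be aimed at \<open>N\<close>, whose square is the norm of a fixed element. The
  middle of the proof therefore works in \<open>N\<close>, in general weaker than the norm. Two
  facts lead back: convolution with a fixed continuous function is bounded from \<open>N\<close> to
  the norm, and suitable convolutions approximate the identity at a given element. Hilbert space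
  arguments take place on the algebra itself: the GNS length of \<open>z\<close> is the limit of the
  norms of \<open>z e\<^sub>n\<close>. Simplicity of \<open>B\<close> makes the GNS representation
  of \<open>\<phi>\<close> isometric on \<open>B\<close> and lets the sums over
  \<open>z\<^sub>l\<close> reach approximate units. Square roots stand in for functional calculus,
  finite averages of translates for the Haar measure, and one compact equivariant operator for the
  representation theory of the group.\<close>

abbreviation eventually_seq (binder "\<forall>\<^sub>s " 10) where
  "eventually_seq P \<equiv> eventually P sequentially"

class unital_cstar = cstar_algebra + real_normed_algebra_1

section \<open>Elementary C*-identities\<close>

lemmas mult_scaleC = mult_scaleC_left mult_scaleC_right

lemma scaleC_zero_left [simp]: "0 *\<^sub>C (x::'a::cstar_algebra) = 0"
  using scaleC_add_left[of 0 0 x] by simp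

lemma scaleC_zero_right [simp]: "c *\<^sub>C (0::'a::cstar_algebra) = 0"
  using scaleC_add_right[of c 0 "0::'a"] by simp

lemma scaleC_one [simp]: "1 *\<^sub>C (x::'a::cstar_algebra) = x"
  using scaleR_scaleC[of 1 x] by simp

lemma scaleC_minus_left: "(- c) *\<^sub>C (x::'a::cstar_algebra) = - (c *\<^sub>C x)"
  using scaleC_add_left[of c "-c" x] by (simp add: add_eq_0_iff)

lemma scaleC_minus_right: "c *\<^sub>C (- x) = - (c *\<^sub>C (x::'a::cstar_algebra))"
  using scaleC_add_right[of c x "-x"] by (simp add: add_eq_0_iff)

lemma scaleC_diff_left: "(c - d) *\<^sub>C (x::'a::cstar_algebra) = c *\<^sub>C x - d *\<^sub>C x"
  using scaleC_add_left[of c "-d" x] by (simp add: scaleC_minus_left)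

lemma scaleC_diff_right: "c *\<^sub>C (x - y) = c *\<^sub>C x - c *\<^sub>C (y::'a::cstar_algebra)"
  using scaleC_add_right[of c x "-y"] by (simp add: scaleC_minus_right)

lemma scaleC_of_real: "of_real r *\<^sub>C (x::'a::cstar_algebra) = r *\<^sub>R x"
  by (simp add: scaleR_scaleC)

lemma scaleC_sum_right: "c *\<^sub>C (\<Sum>i\<in>S. f i) = (\<Sum>i\<in>S. c *\<^sub>C (f i :: 'a::cstar_algebra))"
  by (induction S rule: infinite_finite_induct) (auto simp: scaleC_add_right)

lemma scaleC_sum_left: "(\<Sum>i\<in>S. f i) *\<^sub>C x = (\<Sum>i\<in>S. f i *\<^sub>C (x :: 'a::cstar_algebra))"
  by (induction S rule: infinite_finite_induct) (auto simp: scaleC_add_left)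

lemma star_zero [simp]: "star (0::'a::cstar_algebra) = 0"
  using star_add[of "0::'a" 0] by simp

lemma star_minus: "star (- x) = - star (x::'a::cstar_algebra)"
  using star_add[of x "-x"] by (simp add: add_eq_0_iff)

lemma star_diff: "star (x - y) = star x - star (y::'a::cstar_algebra)"
  using star_add[of x "-y"] by (simp add: star_minus)

lemma star_scaleR: "star (r *\<^sub>R x) = r *\<^sub>R star (x::'a::cstar_algebra)"
  by (simp add: scaleR_scaleC star_scaleC)

lemma star_sum: "star (\<Sum>i\<in>S. f i) = (\<Sum>i\<in>S. star (f i :: 'a::cstar_algebra))"
  by (induction S rule: infinite_finite_induct) (auto simp: star_add)

lemma norm_star [simp]: "norm (star x) = norm (x::'a::cstar_algebra)"
proof -
  have le: "norm y \<le> norm (star y)" for y :: 'a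
  proof (cases "y = 0")
    case False
    have "norm y * norm y \<le> norm (star y) * norm y"
      using cstar_identity[of y] norm_mult_ineq[of "star y" y] by (simp add: power2_eq_square)
    then show ?thesis using False by simp
  qed simp
  show ?thesis using le[of x] le[of "star x"] by (simp add: star_star)
qed

lemma cstar_identity': "norm (x * star x) = (norm (x::'a::cstar_algebra))\<^sup>2"
  using cstar_identity[of "star x"] by (simp add: star_star)

lemma bounded_linear_star: "bounded_linear (star :: 'a::cstar_algebra \<Rightarrow> 'a)"
  by (rule bounded_linear_intro[where K=1]) (auto simp: star_add star_scaleR)

lemma bounded_linear_scaleC: "bounded_linear (\<lambda>x::'a::cstar_algebra. c *\<^sub>C x)"
  by (rule bounded_linear_intro[where K="cmod c"])
     (auto simp: scaleC_add_right scaleR_scaleC scaleC_scaleC norm_scaleC mult.commute)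

lemma bounded_bilinear_scaleC: "bounded_bilinear (scaleC :: complex \<Rightarrow> 'a::cstar_algebra \<Rightarrow> 'a)"
proof
  fix c d :: complex and x y :: 'a and r :: real
  show "(c + d) *\<^sub>C x = c *\<^sub>C x + d *\<^sub>C x" by (rule scaleC_add_left)
  show "c *\<^sub>C (x + y) = c *\<^sub>C x + c *\<^sub>C y" by (rule scaleC_add_right)
  show "(r *\<^sub>R c) *\<^sub>C x = r *\<^sub>R c *\<^sub>C x"
    by (simp add: scaleR_scaleC[of r "c *\<^sub>C x"] scaleC_scaleC scaleR_conv_of_real)
  show "c *\<^sub>C r *\<^sub>R x = r *\<^sub>R c *\<^sub>C x"
    by (simp add: scaleR_scaleC scaleC_scaleC mult.commute)
  show "\<exists>K. \<forall>(a::complex) b::'a. norm (a *\<^sub>C b) \<le> norm a * norm b * K"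
    by (rule exI[of _ 1]) (simp add: norm_scaleC)
qed

lemmas tendsto_star [tendsto_intros] = bounded_linear.tendsto[OF bounded_linear_star]
lemmas tendsto_scaleC [tendsto_intros] = bounded_bilinear.tendsto[OF bounded_bilinear_scaleC]
lemmas continuous_on_star [continuous_intros] = bounded_linear.continuous_on[OF bounded_linear_star]
lemmas continuous_on_scaleC [continuous_intros] =
  bounded_bilinear.continuous_on[OF bounded_bilinear_scaleC]

lemma star_one [simp]: "star (1::'a::unital_cstar) = 1"
  by (metis mult.left_neutral mult.right_neutral star_mult star_star)

definition sa :: "'a::cstar_algebra \<Rightarrow> bool" where "sa x \<longleftrightarrow> star x = x"

lemma sa_simps:
  "sa (0::'a::cstar_algebra)" "sa (star x * (x::'a))" "sa (x * star x)"
  by (auto simp: sa_def star_mult star_star)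

lemma sa_one: "sa (1::'a::unital_cstar)" by (simp add: sa_def)
lemma sa_add: "sa x \<Longrightarrow> sa y \<Longrightarrow> sa (x + y)" by (simp add: sa_def star_add)
lemma sa_diff: "sa x \<Longrightarrow> sa y \<Longrightarrow> sa (x - y)" by (simp add: sa_def star_diff)
lemma sa_minus: "sa x \<Longrightarrow> sa (- x)" by (simp add: sa_def star_minus)
lemma sa_scaleR: "sa x \<Longrightarrow> sa (r *\<^sub>R x)" by (simp add: sa_def star_scaleR)
lemma sa_of_real: "sa (of_real r :: 'a::unital_cstar)" by (simp add: of_real_def sa_scaleR sa_one)
lemma sa_mult: "sa x \<Longrightarrow> sa y \<Longrightarrow> x * y = y * x \<Longrightarrow> sa (x * y)" by (simp add: sa_def star_mult)
lemma sa_sum: "(\<And>i. i \<in> S \<Longrightarrow> sa (f i)) \<Longrightarrow> sa (\<Sum>i\<in>S. f i)"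
  by (induction S rule: infinite_finite_induct) (auto intro: sa_add simp: sa_simps)

lemma commute_mult: "v * a = a * v \<Longrightarrow> v * b = b * v \<Longrightarrow> v * (a * b) = a * b * (v::'a::semigroup_mult)"
  by (metis mult.assoc)

lemma sa_closed: "closed {x::'a::cstar_algebra. sa x}"
  unfolding sa_def by (intro closed_Collect_eq continuous_intros)

lemma sa_norm_square: "sa x \<Longrightarrow> norm (x * x) = (norm x)\<^sup>2"
  using cstar_identity[of x] by (simp add: sa_def)

lemma sa_square_zero: "sa x \<Longrightarrow> x * x = 0 \<Longrightarrow> x = 0"
  using sa_norm_square[of x] by simp

lemma star_mult_zero: "star x * x = 0 \<Longrightarrow> x = (0::'a::cstar_algebra)"
  using cstar_identity[of x] by simp

section \<open>Positive elements and square roots\<close>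

text \<open>The Visser iteration \<open>y \<mapsto> (x + y\<^sup>2) / 2\<close> converges to \<open>1 - sqrt (1 - x)\<close> on the whole closed unit ball,
  because it is dominated by the scalar iteration at \<open>x = 1\<close>.\<close>

primrec visser :: "'a::real_normed_algebra_1 \<Rightarrow> nat \<Rightarrow> 'a" where
  "visser x 0 = 0"
| "visser x (Suc n) = (1/2) *\<^sub>R (x + visser x n * visser x n)"

lemma visser_scalar: "0 \<le> visser (1::real) n \<and> visser (1::real) n \<le> 1
    \<and> visser (1::real) n \<le> visser 1 (Suc n)"
proof (induction n)
  case (Suc n)
  let ?t = "visser (1::real) n"
  have "?t * ?t \<le> 1" using Suc mult_le_one[of ?t ?t] by simp
  moreover have "visser (1::real) n * visser 1 n \<le> visser 1 (Suc n) * visser 1 (Suc n)"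
    using Suc by (intro mult_mono) auto
  ultimately show ?case by simp
qed simp

lemma visser_bounds:
  assumes "norm x \<le> 1"
  shows "norm (visser x n) \<le> visser 1 n
    \<and> norm (visser x (Suc n) - visser x n) \<le> visser 1 (Suc n) - visser 1 n"
proof (induction n)
  case 0 then show ?case using assms by simp
next
  case (Suc n)
  let ?y = "visser x" and ?t = "visser (1::real)"
  have n1: "norm (?y (Suc n)) \<le> ?t (Suc n)"
  proof -
    have "norm (x + ?y n * ?y n) \<le> norm x + norm (?y n) * norm (?y n)"
      by (rule order_trans[OF norm_triangle_ineq]) (simp add: norm_mult_ineq)
    also have "\<dots> \<le> 1 + ?t n * ?t n"
      using assms Suc by (intro add_mono mult_mono) (auto simp: visser_scalar)
    finally show ?thesis by simp
  qed
  have "?y (Suc (Suc n)) - ?y (Suc n) =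
     (1/2) *\<^sub>R ((?y (Suc n) - ?y n) * ?y (Suc n) + ?y n * (?y (Suc n) - ?y n))"
    by (simp del: visser.simps(2) add: visser.simps(2)[of x "Suc n"] visser.simps(2)[of x n, THEN arg_cong, of "\<lambda>z. z"])
       (simp add: algebra_simps)
  also have "norm \<dots> \<le> (1/2) * (norm (?y (Suc n) - ?y n) * norm (?y (Suc n))
       + norm (?y n) * norm (?y (Suc n) - ?y n))"
    by (simp del: visser.simps)
      (meson add_mono norm_mult_ineq norm_triangle_le)
  also have "\<dots> \<le> (1/2) * ((?t (Suc n) - ?t n) * ?t (Suc n) + ?t n * (?t (Suc n) - ?t n))"
    using Suc n1 by (intro mult_left_mono add_mono mult_mono) (auto simp: visser_scalar simp del: visser.simps)
  also have "\<dots> = ?t (Suc (Suc n)) - ?t (Suc n)"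
    by (simp add: algebra_simps)
  finally show ?case using n1 by (simp del: visser.simps)
qed

lemma visser_convergent:
  fixes x :: "'a::{real_normed_algebra_1, banach}"
  assumes "norm x \<le> 1"
  shows "convergent (visser x)"
proof -
  let ?t = "visser (1::real)"
  have mono: "norm (visser x (n + k) - visser x n) \<le> ?t (n + k) - ?t n" for n k
  proof (induction k)
    case (Suc k)
    have "norm (visser x (n + Suc k) - visser x n) \<le>
       norm (visser x (Suc (n + k)) - visser x (n + k)) + norm (visser x (n + k) - visser x n)"
      by (rule order_trans[OF _ norm_triangle_ineq]) (simp del: visser.simps)
    also have "\<dots> \<le> (?t (Suc (n + k)) - ?t (n + k)) + (?t (n + k) - ?t n)"
      using visser_bounds[OF assms, of "n + k"] Suc by linarith
    finally show ?case by simp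
  qed simp
  have "convergent ?t"
    using visser_scalar by (intro Bseq_mono_convergent BseqI'[of _ 1] allI impI)
      (auto simp del: visser.simps intro: lift_Suc_mono_le)
  then have "Cauchy ?t" by (simp add: convergent_Cauchy)
  have "Cauchy (visser x)"
  proof (rule metric_CauchyI)
    fix e :: real assume "e > 0"
    then obtain M where M: "\<And>m n. m \<ge> M \<Longrightarrow> n \<ge> M \<Longrightarrow> dist (?t m) (?t n) < e"
      using \<open>Cauchy ?t\<close> by (meson metric_CauchyD)
    have *: "dist (visser x m) (visser x n) < e" if mn: "M \<le> n" "n \<le> m" for m n
    proof -
      obtain k where k: "m = n + k" using le_Suc_ex[OF mn(2)] by auto
      have "dist (?t m) (?t n) < e" using M[of m n] mn by simp
      then have "?t (n + k) - ?t n < e" by (simp add: k dist_norm abs_less_iff del: visser.simps)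
      then show ?thesis using mono[of n k] by (simp add: k dist_norm del: visser.simps)
    qed
    show "\<exists>M. \<forall>m\<ge>M. \<forall>n\<ge>M. dist (visser x m) (visser x n) < e"
      by (rule exI[of _ M]) (metis * dist_commute nat_le_linear)
  qed
  then show ?thesis by (simp add: Cauchy_convergent_iff)
qed

text \<open>A fixed point \<open>y\<close> of the iteration at \<open>1 - h\<close> satisfies
  \<open>y + y = (1 - h) + y * y\<close>, that is, \<open>(1 - y) * (1 - y) = h\<close>. The
  commutation clause holds for every iterate and passes to the limit; it later stands in for
  functional calculus.\<close>

lemma sqrt_in_unit_ball:
  fixes h :: "'a::unital_cstar"
  assumes "sa h" "norm (1 - h) \<le> 1"
  shows "\<exists>k. sa k \<and> norm (1 - k) \<le> 1 \<and> k * k = h \<and> (\<forall>x. x * h = h * x \<longrightarrow> x * k = k * x)"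
proof -
  define x where "x = 1 - h"
  have x: "norm x \<le> 1" using assms x_def by simp
  obtain y where y: "visser x \<longlonglongrightarrow> y"
    using visser_convergent[OF x] by (auto simp: convergent_def)
  have "(\<lambda>n. visser x (Suc n)) \<longlonglongrightarrow> (1/2) *\<^sub>R (x + y * y)"
    unfolding visser.simps by (intro tendsto_intros y)
  then have eq: "y = (1/2) *\<^sub>R (x + y * y)"
    using LIMSEQ_unique y LIMSEQ_Suc by blast
  then have eq2: "y + y = x + y * y"
  proof -
    have "2 *\<^sub>R y = 2 *\<^sub>R ((1/2) *\<^sub>R (x + y * y))" using eq by (rule arg_cong)
    then show ?thesis unfolding scaleR_scaleR by (simp add: scaleR_2)
  qed
  have ny: "norm (visser x n) \<le> 1" for n
    using visser_bounds[OF x, of n] visser_scalar[of n] by linarith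
  have "sa (visser x n)" for n
    by (induction n) (auto simp: sa_simps x_def intro!: sa_scaleR sa_add sa_diff sa_one assms(1) sa_mult)
  then have say: "sa y" using y closed_sequentially[OF sa_closed] by blast
  have cv: "z * visser x n = visser x n * z" if "z * h = h * z" for z n
  proof (induction n)
    case (Suc n)
    then show ?case using that
      by (simp add: x_def algebra_simps) (metis Suc mult.assoc)
  qed simp
  have comm: "z * y = y * z" if "z * h = h * z" for z
  proof (rule LIMSEQ_unique)
    show "(\<lambda>n. z * visser x n) \<longlonglongrightarrow> z * y" by (intro tendsto_intros y)
    show "(\<lambda>n. z * visser x n) \<longlonglongrightarrow> y * z" unfolding cv[OF that] by (intro tendsto_intros y)
  qed
  show ?thesis
  proof (intro exI[of _ "1 - y"] conjI allI impI)
    show "sa (1 - y)" by (intro sa_diff sa_one say)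
    show "norm (1 - (1 - y)) \<le> 1" using Lim_bounded[OF tendsto_norm[OF y]] ny by simp
    have "(1 - y) * (1 - y) = 1 - (y + y) + y * y" by (simp add: algebra_simps)
    also have "\<dots> = h" by (simp add: eq2 x_def)
    finally show "(1 - y) * (1 - y) = h" .
    show "z * (1 - y) = (1 - y) * z" if "z * h = h * z" for z
      using comm[OF that] by (simp add: algebra_simps)
  qed
qed

text \<open>The spectrum lies in \<open>[0, 2 t]\<close>, said in terms of the norm alone. In this
  form sums are visibly positive, since the witnesses \<open>t\<close> add up, and square roots come
  from rescaling into the unit ball around 1.\<close>

definition pos :: "'a::unital_cstar \<Rightarrow> bool" where
  "pos h \<longleftrightarrow> sa h \<and> (\<exists>t\<ge>0. norm (of_real t - h) \<le> t)"

lemma pos_sa: "pos h \<Longrightarrow> sa h" by (simp add: pos_def)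

lemma pos_star: "pos h \<Longrightarrow> star h = h" by (simp add: pos_def sa_def)

lemma pos_zero [simp]: "pos 0" by (auto simp: pos_def sa_simps intro!: exI[of _ 0])

lemma pos_add: "pos a \<Longrightarrow> pos b \<Longrightarrow> pos (a + b)"
proof -
  assume "pos a" "pos b"
  then obtain s t where st: "s \<ge> 0" "norm (of_real s - a) \<le> s" "t \<ge> 0" "norm (of_real t - b) \<le> t"
    and "sa a" "sa b" by (auto simp: pos_def)
  have "norm (of_real (s + t) - (a + b)) \<le> norm (of_real s - a) + norm (of_real t - b)"
    by (rule order_trans[OF _ norm_triangle_ineq]) (simp add: algebra_simps)
  with st show ?thesis unfolding pos_def
    by (intro conjI sa_add \<open>sa a\<close> \<open>sa b\<close> exI[of _ "s + t"]) auto
qed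

lemma pos_scaleR: "pos a \<Longrightarrow> r \<ge> 0 \<Longrightarrow> pos (r *\<^sub>R a)"
proof -
  assume "pos a" and r: "r \<ge> 0"
  then obtain t where t: "t \<ge> 0" "norm (of_real t - a) \<le> t" and "sa a" by (auto simp: pos_def)
  have "of_real (r * t) - r *\<^sub>R a = r *\<^sub>R (of_real t - a)" by (simp add: algebra_simps of_real_def)
  then have "norm (of_real (r * t) - r *\<^sub>R a) \<le> r * t"
    using t r by (simp add: mult_left_mono)
  with t r show ?thesis unfolding pos_def
    by (intro conjI sa_scaleR \<open>sa a\<close> exI[of _ "r * t"]) auto
qed

lemma pos_sum: "(\<And>i. i \<in> S \<Longrightarrow> pos (f i)) \<Longrightarrow> pos (\<Sum>i\<in>S. f i)"
  by (induction S rule: infinite_finite_induct) (auto intro: pos_add)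

lemma pos_sqrt_exists:
  assumes "pos (h::'a::unital_cstar)"
  shows "\<exists>k. pos k \<and> k * k = h \<and> (\<forall>x. x * h = h * x \<longrightarrow> x * k = k * x)"
proof -
  obtain t where t: "t \<ge> 0" "norm (of_real t - h) \<le> t" and sah: "sa h" using assms by (auto simp: pos_def)
  show ?thesis
  proof (cases "t = 0")
    case True
    then have "h = 0" using t by simp
    then show ?thesis by (intro exI[of _ 0]) auto
  next
    case False
    then have t0: "t > 0" using t by simp
    define h' where "h' = (1/t) *\<^sub>R h"
    have hh: "h = t *\<^sub>R h'" using t0 by (simp add: h'_def)
    have "1 - h' = (1/t) *\<^sub>R (of_real t - h)"
      using t0 by (simp add: h'_def algebra_simps of_real_def)
    then have "norm (1 - h') = norm (of_real t - h) / t" using t0 by (simp only: norm_scaleR) simp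
    then have "norm (1 - h') \<le> 1" using t t0 by (simp add: divide_le_eq_1)
    then obtain k where k: "sa k" "norm (1 - k) \<le> 1" "k * k = h'"
      "\<And>x. x * h' = h' * x \<Longrightarrow> x * k = k * x"
      using sqrt_in_unit_ball[OF sa_scaleR[OF sah, of "1/t"]] unfolding h'_def by blast
    have "pos k" using k(1,2) by (auto simp: pos_def intro!: exI[of _ 1])
    show ?thesis
    proof (intro exI[of _ "sqrt t *\<^sub>R k"] conjI allI impI)
      show "pos (sqrt t *\<^sub>R k)" using \<open>pos k\<close> t0 by (simp add: pos_scaleR)
      show "sqrt t *\<^sub>R k * sqrt t *\<^sub>R k = h" using t0 k(3) hh by simp
      fix x assume "x * h = h * x"
      then have "x * k = k * x" using k(4)[of x] by (simp add: h'_def)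
      then show "x * sqrt t *\<^sub>R k = sqrt t *\<^sub>R k * x" by simp
    qed
  qed
qed

text \<open>If \<open>r\<close> is a square root of \<open>1 - k * k\<close> commuting with
  \<open>k\<close>, then \<open>u = k + i r\<close> is unitary; hence its imaginary part
  \<open>r\<close> is a contraction, and so is \<open>r * r = 1 - k * k\<close>.\<close>

lemma pos_square_unit:
  assumes "sa (k::'a::unital_cstar)" "norm k \<le> 1"
  shows "norm (1 - k * k) \<le> 1"
proof -
  have n: "norm (k * k) \<le> 1" using assms sa_norm_square[of k] by (simp add: power_le_one)
  have "sa (1 - k * k)" by (intro sa_diff sa_one sa_mult assms) simp
  then obtain r where r: "sa r" "r * r = 1 - k * k" "k * r = r * k"
  proof -
    have "k * (1 - k * k) = (1 - k * k) * k" by (simp add: algebra_simps)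
    moreover have "norm (1 - (1 - k * k)) \<le> 1" using n by simp
    ultimately show ?thesis using sqrt_in_unit_ball[OF \<open>sa (1 - k * k)\<close>] that by metis
  qed
  define u where "u = k + \<i> *\<^sub>C r"
  have su: "star u = k - \<i> *\<^sub>C r"
    using assms r by (simp add: u_def star_add star_scaleC sa_def scaleC_minus_left)
  have "star u * u = k * k + r * r + (\<i> *\<^sub>C (k * r) - \<i> *\<^sub>C (r * k))"
    unfolding su by (simp add: u_def algebra_simps mult_scaleC scaleC_scaleC scaleC_minus_left
        scaleC_add_right scaleC_diff_right)
  then have "star u * u = 1" using r by simp
  then have "norm u = 1" using cstar_identity[of u] norm_ge_zero[of u] by (simp add: power2_eq_1_iff)
  have "2 *\<^sub>R (\<i> *\<^sub>C r) = u - star u" unfolding su by (simp add: u_def scaleR_2)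
  then have "2 * norm (\<i> *\<^sub>C r) \<le> norm u + norm (star u)"
    by (metis norm_scaleR norm_triangle_ineq4 abs_numeral)
  then have "norm r \<le> 1" using \<open>norm u = 1\<close> by (simp add: norm_scaleC)
  then show ?thesis using sa_norm_square[OF r(1)] r(2) by (simp add: power_le_one)
qed

lemma pos_square_bound:
  assumes "sa (k::'a::unital_cstar)" "norm (k * k) \<le> t"
  shows "norm (of_real t - k * k) \<le> t"
proof (cases "t = 0")
  case True then show ?thesis using assms by simp
next
  case False
  then have t: "t > 0" using assms norm_ge_zero[of "k * k"] by linarith
  define k' where "k' = (1 / sqrt t) *\<^sub>R k"
  have e: "k' * k' = (1 / t) *\<^sub>R (k * k)" using t by (simp add: k'_def)
  have sak: "sa k'" using assms by (simp add: k'_def sa_scaleR)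
  have "norm (k' * k') \<le> 1" unfolding e using assms t by (simp add: field_simps)
  then have "norm k' \<le> 1" using sa_norm_square[OF sak] by (simp add: power2_le_iff_abs_le abs_square_le_1)
  then have "norm (1 - k' * k') \<le> 1" using pos_square_unit sak by blast
  moreover have "of_real t - k * k = t *\<^sub>R (1 - k' * k')"
    unfolding e using t by (simp add: algebra_simps of_real_def)
  ultimately show ?thesis using t by simp
qed

lemma sa_square_pos: "sa k \<Longrightarrow> pos (k * k)"
  unfolding pos_def by (intro conjI sa_mult exI[of _ "norm (k * k)"] pos_square_bound) auto

lemma pos_one [simp]: "pos 1" using sa_square_pos[OF sa_one] by simp

lemma pos_of_real: "r \<ge> 0 \<Longrightarrow> pos (of_real r)"
  unfolding of_real_def by (intro pos_scaleR) auto

lemma pos_norm_bound: "pos h \<Longrightarrow> norm h \<le> t \<Longrightarrow> norm (of_real t - h) \<le> t"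
  using pos_sqrt_exists[of h] pos_square_bound pos_sa by metis

lemma pos_closed: "closed {h::'a::unital_cstar. pos h}"
  unfolding closed_sequential_limits
proof -
  show "\<forall>x l. (\<forall>n. x n \<in> {h. pos h}) \<and> x \<longlonglongrightarrow> l \<longrightarrow> l \<in> {h::'a. pos h}"
  proof (intro allI impI)
    fix x :: "nat \<Rightarrow> 'a" and l assume a: "(\<forall>n. x n \<in> {h. pos h}) \<and> x \<longlonglongrightarrow> l"
    then have p: "pos (x n)" for n by simp
    have lim: "x \<longlonglongrightarrow> l" using a by simp
    obtain t where t: "\<And>n. norm (x n) \<le> t" using lim
      by (metis Bseq_def convergent_imp_Bseq convergentI)
    have "sa l" using closed_sequentially[OF sa_closed _ lim] p pos_sa by auto
    moreover have "norm (of_real t - l) \<le> t"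
      by (rule Lim_bounded[OF tendsto_norm[OF tendsto_diff[OF tendsto_const lim]], of 0])
         (use p t in \<open>auto intro: pos_norm_bound\<close>)
    moreover have "t \<ge> 0" using t[of 0] norm_ge_zero order_trans by blast
    ultimately show "l \<in> {h. pos h}" by (auto simp: pos_def)
  qed
qed

lemma commute_square_roots:
  assumes "k * k = a" "l * l = b" "a * b = b * (a::'a::unital_cstar)"
    "\<And>x. x * a = a * x \<Longrightarrow> x * k = k * x" "\<And>x. x * b = b * x \<Longrightarrow> x * l = l * x"
  shows "k * l = l * k"
  using assms by metis

lemma pos_mult:
  assumes "pos a" "pos b" "a * b = b * (a::'a::unital_cstar)"
  shows "pos (a * b)"
proof -
  obtain k where k: "pos k" "k * k = a" "\<And>x. x * a = a * x \<Longrightarrow> x * k = k * x"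
    using pos_sqrt_exists[OF assms(1)] by blast
  obtain l where l: "pos l" "l * l = b" "\<And>x. x * b = b * x \<Longrightarrow> x * l = l * x"
    using pos_sqrt_exists[OF assms(2)] by blast
  have "k * l = l * k" using commute_square_roots[OF k(2) l(2) assms(3) k(3) l(3)] .
  then have "a * b = (k * l) * (k * l)" "sa (k * l)"
    using k(1,2) l(1,2) by (auto simp: sa_mult pos_sa) (metis mult.assoc)
  then show ?thesis using sa_square_pos by metis
qed

lemma pos_le_norm:
  assumes "pos h" "pos (of_real s - h)"
  shows "norm (h::'a::unital_cstar) \<le> s" "0 \<le> s"
proof -
  obtain k where k: "pos k" "k * k = h" "\<And>x. x * h = h * x \<Longrightarrow> x * k = k * x"
    using pos_sqrt_exists[OF assms(1)] by blast
  obtain l where l: "pos l" "l * l = of_real s - h" "\<And>x. x * (of_real s - h) = (of_real s - h) * x \<Longrightarrow> x * l = l * x"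
    using pos_sqrt_exists[OF assms(2)] by blast
  have kl: "k * l = l * k"
    by (rule commute_square_roots[OF k(2) l(2) _ k(3) l(3)]) (auto simp: algebra_simps of_real_def)
  \<comment> \<open>Here \<open>star u * u\<close> is the scalar \<open>s\<close>, and the real part
    \<open>k\<close> of \<open>u\<close> cannot exceed \<open>u\<close> in norm. The sign of
    \<open>s\<close> is settled only afterwards, hence the absolute values.\<close>
  define u where "u = k + \<i> *\<^sub>C l"
  have su: "star u = k - \<i> *\<^sub>C l"
    using k(1) l(1) by (simp add: u_def star_add star_scaleC pos_star scaleC_minus_left)
  have "star u * u = k * k + l * l + (\<i> *\<^sub>C (k * l) - \<i> *\<^sub>C (l * k))"
    unfolding su by (simp add: u_def algebra_simps mult_scaleC scaleC_scaleC scaleC_minus_left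
        scaleC_add_right scaleC_diff_right)
  then have "star u * u = of_real s" using k(2) l(2) kl by simp
  then have nu: "(norm u)\<^sup>2 = \<bar>s\<bar>" using cstar_identity[of u] by simp
  have "2 *\<^sub>R k = u + star u" unfolding su by (simp add: u_def scaleR_2)
  then have "2 * norm k \<le> norm u + norm (star u)"
    by (metis norm_scaleR norm_triangle_ineq abs_numeral)
  then have "norm k \<le> norm u" by simp
  then have "(norm k)\<^sup>2 \<le> \<bar>s\<bar>" using nu by (metis norm_ge_zero power_mono)
  moreover have "norm h = (norm k)\<^sup>2" using sa_norm_square[OF pos_sa[OF k(1)]] k(2) by simp
  ultimately have *: "norm h \<le> \<bar>s\<bar>" by simp
  show "0 \<le> s"
  proof (rule ccontr)
    assume "\<not> 0 \<le> s"
    have "pos (of_real s :: 'a)" using pos_add[OF assms] by simp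
    then obtain t where "t \<ge> 0" "norm (of_real t - of_real s :: 'a) \<le> t" by (auto simp: pos_def)
    then show False using \<open>\<not> 0 \<le> s\<close> by (simp flip: of_real_diff)
  qed
  with * show "norm h \<le> s" by simp
qed

lemma sa_le_norm:
  assumes "sa (h::'a::unital_cstar)" "norm h \<le> s"
  shows "pos (of_real s - h)" "pos (of_real s + h)"
proof -
  have "s \<ge> 0" using assms norm_ge_zero order_trans by blast
  then show "pos (of_real s - h)" "pos (of_real s + h)"
    using assms by (auto simp: pos_def sa_diff sa_add sa_of_real intro!: exI[of _ s])
qed

lemma sa_norm_le:
  assumes "pos (of_real s - h)" "pos (of_real s + h)"
  shows "norm (h::'a::unital_cstar) \<le> s"
proof -
  have s: "s \<ge> 0"
  proof (rule ccontr)
    assume "\<not> 0 \<le> s"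
    have "(of_real s - h) + (of_real s + h) = of_real (s + s)" by (simp only: of_real_add) (simp add: algebra_simps)
    then have "pos (of_real (s + s) :: 'a)" using pos_add[OF assms] by metis
    then obtain t where "t \<ge> 0" "norm (of_real t - of_real (s + s) :: 'a) \<le> t" unfolding pos_def by blast
    then have "norm (of_real (t - (s + s)) :: 'a) \<le> t" by (simp only: of_real_diff)
    then show False using \<open>\<not> 0 \<le> s\<close> unfolding norm_of_real by linarith
  qed
  have "sa ((of_real s + h) - of_real s)" using assms by (intro sa_diff sa_of_real pos_sa)
  then have sah: "sa h" by simp
  have "pos ((of_real s - h) * (of_real s + h))"
    by (rule pos_mult[OF assms]) (simp add: algebra_simps of_real_def)
  moreover have "(of_real s - h) * (of_real s + h) = of_real (s * s) - h * h"
    by (simp add: algebra_simps of_real_def)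
  ultimately have "norm (h * h) \<le> s * s" using pos_le_norm[OF sa_square_pos[OF sah]] by metis
  then show ?thesis using sa_norm_square[OF sah] s
    by (simp add: power2_eq_square) (metis abs_le_square_iff abs_norm_cancel abs_of_nonneg power2_eq_square)
qed

lemma pos_antisym: "pos h \<Longrightarrow> pos (- h) \<Longrightarrow> h = 0"
  using pos_le_norm[of h 0] by simp

lemma pos_add_zero: "pos a \<Longrightarrow> pos b \<Longrightarrow> a + b = 0 \<Longrightarrow> a = 0"
  by (metis add_eq_0_iff pos_antisym)

text \<open>With \<open>d = a - b\<close>, the positive elements \<open>d * d * a\<close> and
  \<open>d * d * b\<close> add up to \<open>d * (a * a - b * b) = 0\<close>; so both vanish, and
  with them the cube of \<open>d\<close>.\<close>

lemma pos_sqrt_unique: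
  assumes "pos a" "pos b" "a * a = b * b" "a * b = b * (a::'a::unital_cstar)"
  shows "a = b"
proof -
  let ?d = "a - b"
  have sad: "sa ?d" by (intro sa_diff pos_sa assms)
  have d: "?d * a = a * ?d" "?d * b = b * ?d" using assms(4) by (simp_all add: algebra_simps)
  have c: "?d * ?d * a = a * (?d * ?d)" "?d * ?d * b = b * (?d * ?d)"
    by (simp_all only: mult.assoc d) (simp_all only: mult.assoc[symmetric] d)
  have "?d * ?d * a + ?d * ?d * b = ?d * (?d * (a + b))" by (simp only: mult.assoc distrib_left)
  also have "?d * (a + b) = a * a - b * b" using assms(4) by (simp add: algebra_simps)
  finally have z: "?d * ?d * a + ?d * ?d * b = 0" using assms by simp
  have pa: "pos (?d * ?d * a)" "pos (?d * ?d * b)"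
    using pos_mult[OF sa_square_pos[OF sad] assms(1) c(1)]
      pos_mult[OF sa_square_pos[OF sad] assms(2) c(2)] by auto
  have "?d * ?d * a = 0" "?d * ?d * b = 0"
    using pos_add_zero[OF pa z] z by auto
  then have "?d * ?d * ?d = 0" by (simp add: right_diff_distrib)
  then have "(?d * ?d) * (?d * ?d) = 0" by (simp add: mult.assoc)
  then have "?d * ?d = 0" using sa_square_zero[OF pos_sa[OF sa_square_pos[OF sad]]] by simp
  then show ?thesis using sa_square_zero[OF sad] by simp
qed

definition psqrt :: "'a::unital_cstar \<Rightarrow> 'a" where
  "psqrt h = (SOME k. pos k \<and> k * k = h \<and> (\<forall>x. x * h = h * x \<longrightarrow> x * k = k * x))"

lemma psqrt:
  assumes "pos h"
  shows "pos (psqrt h)" "psqrt h * psqrt h = h" "x * h = h * x \<Longrightarrow> x * psqrt h = psqrt h * x"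
  using someI_ex[OF pos_sqrt_exists[OF assms]] unfolding psqrt_def[symmetric] by blast+

lemma psqrt_eqI:
  assumes "pos k" "k * k = h"
  shows "psqrt h = k"
proof -
  have h: "pos h" using assms sa_square_pos pos_sa by metis
  have "k * psqrt h = psqrt h * k" by (rule psqrt(3)[OF h]) (simp add: mult.assoc flip: assms(2))
  then show ?thesis using pos_sqrt_unique[OF psqrt(1)[OF h] assms(1)] psqrt(2)[OF h] assms(2) by simp
qed

text \<open>If \<open>w\<^sup>3\<close> is positive then \<open>\<bar>w\<bar>\<^sup>3 = w\<^sup>3\<close>, and hence \<open>w = \<bar>w\<bar>\<close>.\<close>

lemma pos_cubeD:
  assumes "sa w" "pos (w * w * (w::'a::unital_cstar))"
  shows "pos w"
proof -
  define v where "v = psqrt (w * w)"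
  have p2: "pos (w * w)" by (rule sa_square_pos[OF assms(1)])
  have v: "pos v" "v * v = w * w" unfolding v_def using psqrt(1,2)[OF p2] by auto
  have vw: "w * v = v * w" unfolding v_def by (rule psqrt(3)[OF p2]) (simp add: mult.assoc)
  have "pos (v * v * v)" by (intro pos_mult sa_square_pos pos_sa v) (simp add: mult.assoc)
  moreover have "(v * v * v) * (v * v * v) = (w * w * w) * (w * w * w)"
  proof -
    have "(v * v * v) * (v * v * v) = (v * v) * (v * v) * (v * v)" by (simp only: mult.assoc)
    then show ?thesis unfolding v(2) by (simp only: mult.assoc)
  qed
  moreover have "(v * v * v) * (w * w * w) = (w * w * w) * (v * v * v)"
  proof -
    have c: "v * (w * w * w) = (w * w * w) * v"
      by (intro commute_mult vw[symmetric])
    have "(v * v * v) * (w * w * w) = w * w * (v * (w * w * w))" by (simp only: v(2) mult.assoc)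
    also have "\<dots> = w * w * w * (w * w) * v" unfolding c by (simp only: mult.assoc)
    finally show ?thesis by (simp only: v(2)[symmetric] mult.assoc)
  qed
  ultimately have "v * v * v = w * w * w" using pos_sqrt_unique assms(2) by blast
  then have z: "w * w * (v - w) = 0" by (simp add: v(2) right_diff_distrib)
  define y where "y = v - w"
  have say: "sa y" unfolding y_def by (intro sa_diff pos_sa v assms)
  have yw: "w * y = y * w" unfolding y_def by (simp add: algebra_simps vw)
  have "y * y = (v * v - v * w) - (w * v - w * w)" by (simp add: y_def algebra_simps)
  also have "\<dots> = - (w * y + w * y)" by (simp add: v(2) vw y_def algebra_simps)
  finally have yy: "y * y = - (w * y + w * y)" .
  have "(w * y) * (w * y) = w * (y * w) * y" by (simp only: mult.assoc)
  also have "\<dots> = (w * w * y) * y" by (simp only: mult.assoc yw[symmetric])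
  finally have "(w * y) * (w * y) = 0" using z by (simp add: y_def)
  then have "(y * y) * (y * y) = 0" unfolding yy by (simp add: algebra_simps)
  then have "y * y = 0" using sa_square_zero[OF pos_sa[OF sa_square_pos[OF say]]] by simp
  then have "y = 0" using sa_square_zero[OF say] by simp
  then show ?thesis using v by (simp add: y_def)
qed

definition ppart :: "'a::unital_cstar \<Rightarrow> 'a" where
  "ppart h = (1/2) *\<^sub>R (psqrt (h * h) + h)"

text \<open>For \<open>v\<close> the modulus of \<open>h\<close> and \<open>w = v + h\<close> one
  has \<open>w * w = 2 v w\<close>, so the cube of \<open>w\<close> is \<open>2 w w v\<close>, a
  product of commuting positive elements. Thus \<open>pos_cubeD\<close> applies.\<close>

lemma ppart_pos_aux:
  assumes "sa (h::'a::unital_cstar)"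
  shows "pos (psqrt (h * h) + h)"
proof -
  define v w where "v = psqrt (h * h)" and "w = v + h"
  have p2: "pos (h * h)" by (rule sa_square_pos[OF assms(1)])
  have v: "pos v" "v * v = h * h" unfolding v_def using psqrt(1,2)[OF p2] by auto
  have vh: "h * v = v * h" unfolding v_def by (rule psqrt(3)[OF p2]) (simp add: mult.assoc)
  have saw: "sa w" unfolding w_def by (intro sa_add pos_sa v assms)
  have "w * w = 2 *\<^sub>R (v * w)"
    by (simp add: w_def algebra_simps v(2) vh scaleR_2)
  moreover have wv: "w * v = v * w" by (simp add: w_def algebra_simps vh)
  have c: "v * (w * w) = w * w * v" by (intro commute_mult wv[symmetric])
  ultimately have "w * w * w = 2 *\<^sub>R ((w * w) * v)" by (simp add: mult.assoc flip: c)
  moreover have "pos ((w * w) * v)"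
    using pos_mult[OF sa_square_pos[OF saw] v(1)] c by simp
  ultimately have "pos (w * w * w)" by (simp add: pos_scaleR)
  then show ?thesis using pos_cubeD[OF saw] by (simp add: w_def v_def)
qed

lemma ppart:
  assumes "sa (h::'a::unital_cstar)"
  shows "pos (ppart h)" "pos (ppart h - h)" "ppart h * (ppart h - h) = 0"
    "(ppart h - h) * ppart h = 0"
    "h * ppart h = ppart h * ppart h" "ppart h * h = ppart h * ppart h"
proof -
  show "pos (ppart h)" unfolding ppart_def by (intro pos_scaleR ppart_pos_aux assms) simp
  have "h = (1/2) *\<^sub>R (h + h)" by (simp flip: scaleR_2)
  then have "ppart h - h = (1/2) *\<^sub>R (psqrt (h * h) + h) - (1/2) *\<^sub>R (h + h)" by (simp add: ppart_def)
  also have "\<dots> = (1/2) *\<^sub>R (psqrt ((- h) * (- h)) + (- h))"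
    unfolding scaleR_diff_right[symmetric] by simp
  finally have e: "ppart h - h = (1/2) *\<^sub>R (psqrt ((- h) * (- h)) + (- h))" .
  show "pos (ppart h - h)"
    unfolding e by (intro pos_scaleR ppart_pos_aux sa_minus assms) simp
  have p2: "pos (h * h)" by (rule sa_square_pos[OF assms(1)])
  have vh: "h * psqrt (h * h) = psqrt (h * h) * h" by (rule psqrt(3)[OF p2]) (simp add: mult.assoc)
  have e: "4 *\<^sub>R (ppart h * ppart h) = 2 *\<^sub>R (h * h) + 2 *\<^sub>R (h * psqrt (h * h))"
    using psqrt(2)[OF p2] by (simp add: ppart_def algebra_simps vh scaleR_2)
  have e2: "4 *\<^sub>R (h * ppart h) = 2 *\<^sub>R (h * h) + 2 *\<^sub>R (h * psqrt (h * h))"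
    by (simp add: ppart_def algebra_simps)
  have "4 *\<^sub>R (h * ppart h) = 4 *\<^sub>R (ppart h * ppart h)" using e e2 by simp
  then show 1: "h * ppart h = ppart h * ppart h" by simp
  have c: "h * ppart h = ppart h * h" by (simp add: ppart_def algebra_simps vh)
  then show 2: "ppart h * h = ppart h * ppart h" using 1 by simp
  show "ppart h * (ppart h - h) = 0" "(ppart h - h) * ppart h = 0"
    using 1 2 by (simp_all add: algebra_simps)
qed

section \<open>The operator order and the positivity of \<open>star x * x\<close>\<close>

abbreviation ple :: "'a::unital_cstar \<Rightarrow> 'a \<Rightarrow> bool" (infix "\<preceq>" 50) where
  "a \<preceq> b \<equiv> pos (b - a)"

lemma ple_trans: "a \<preceq> b \<Longrightarrow> b \<preceq> c \<Longrightarrow> a \<preceq> (c::'a::unital_cstar)"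
  using pos_add[of "b - a" "c - b"] by (simp add: algebra_simps)

lemma ple_pos: "pos a \<Longrightarrow> a \<preceq> b \<Longrightarrow> pos (b::'a::unital_cstar)"
  using pos_add[of a "b - a"] by simp

lemma ple_scaleR: "a \<preceq> b \<Longrightarrow> r \<ge> 0 \<Longrightarrow> r *\<^sub>R a \<preceq> r *\<^sub>R (b::'a::unital_cstar)"
  using pos_scaleR[of "b - a" r] by (simp add: algebra_simps)

lemma ple_norm: "sa a \<Longrightarrow> norm a \<le> r \<Longrightarrow> a \<preceq> of_real r"
  using sa_le_norm by blast

lemma norm_mono: "pos a \<Longrightarrow> a \<preceq> b \<Longrightarrow> norm a \<le> norm (b::'a::unital_cstar)"
  by (rule pos_le_norm(1)[OF _ ple_trans[OF _ ple_norm[OF pos_sa[OF ple_pos[of a b]]]]]) auto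

text \<open>This is the core of the theorem that \<open>star x * x\<close> is positive; a norm
  estimate replaces the comparison of the spectra of the two products. With \<open>t\<close> the
  squared norm of \<open>y\<close>, the identity \<open>y (t - q) = (t + p) y\<close> bounds
  \<open>(t + p) p (t + p)\<close> in norm by the cube of \<open>t\<close>, while this element
  dominates \<open>2 t p p\<close>, whose norm is twice that cube.\<close>

lemma neg_star_mult_zero:
  assumes "pos (- (star y * (y::'a::unital_cstar)))"
  shows "y = 0"
proof -
  define q p t where "q = - (star y * y)" and "p = y * star y" and "t = (norm y)\<^sup>2"
  have nq: "norm q = t" "norm p = t" by (simp_all add: q_def p_def t_def cstar_identity cstar_identity')
  define s d where "s = y + star y" and "d = \<i> *\<^sub>C (y - star y)"
  have "sa s" "sa d" by (auto simp: s_def d_def sa_def star_add star_diff star_scaleC star_star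
     scaleC_diff_right scaleC_minus_left)
  then have "pos (s * s + d * d)" by (intro pos_add sa_square_pos)
  moreover have "d * d = - ((y - star y) * (y - star y))"
    by (simp only: d_def mult_scaleC scaleC_scaleC)
       (simp add: scaleC_minus_left)
  then have "s * s + d * d = 2 *\<^sub>R (p - q)"
    by (simp add: s_def p_def q_def algebra_simps scaleR_2)
  ultimately have "pos (2 *\<^sub>R (p - q))" by simp
  from pos_scaleR[OF this, of "1/2"] have "pos (p - q)" by simp
  then have "pos ((p - q) + q)" using assms by (intro pos_add) (simp_all add: q_def)
  then have pp: "pos p" by simp
  have tp: "of_real t * p = p * of_real t" by (simp add: of_real_def)
  have "y * (of_real t - q) = (of_real t + p) * y"
    by (simp add: q_def p_def algebra_simps of_real_def)
  then have "norm ((of_real t + p) * y) \<le> norm y * norm (of_real t - q)" by (metis norm_mult_ineq)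
  also have "norm (of_real t - q) \<le> t" using pos_norm_bound[of q t] assms nq by (simp add: q_def)
  finally have "norm ((of_real t + p) * y) \<le> norm y * t" by (simp add: mult_left_mono)
  then have "(norm ((of_real t + p) * y))\<^sup>2 \<le> (norm y * t)\<^sup>2" by (intro power_mono) auto
  then have "norm ((of_real t + p) * y * star ((of_real t + p) * y)) \<le> t * t\<^sup>2"
    by (simp add: cstar_identity' power_mult_distrib t_def)
  moreover have "star ((of_real t + p) * y) = star y * (of_real t + p)"
    using pos_star[OF pp] sa_of_real[of t, where 'a='a] by (simp add: star_mult star_add sa_def)
  then have "(of_real t + p) * y * star ((of_real t + p) * y) = (of_real t + p) * p * (of_real t + p)"
    by (simp add: p_def mult.assoc)
  moreover have "(of_real t + p) * p * (of_real t + p) - (2 * t) *\<^sub>R (p * p) = (t * t) *\<^sub>R p + p * p * p"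
  proof -
    have "(2 * t) *\<^sub>R (p * p) = t *\<^sub>R (p * p) + t *\<^sub>R (p * p)" by (simp flip: scaleR_add_left)
    then show ?thesis by (simp add: algebra_simps of_real_def)
  qed
  then have "(2 * t) *\<^sub>R (p * p) \<preceq> (of_real t + p) * p * (of_real t + p)"
    using pp by (auto simp: t_def intro!: pos_add pos_scaleR pos_mult sa_square_pos pos_sa mult.assoc)
  moreover have "pos ((2 * t) *\<^sub>R (p * p))" using pp by (auto simp: t_def intro!: pos_scaleR sa_square_pos pos_sa)
  ultimately have "norm ((2 * t) *\<^sub>R (p * p)) \<le> t * t\<^sup>2" using norm_mono by fastforce
  moreover have "norm ((2 * t) *\<^sub>R (p * p)) = 2 * t * t\<^sup>2"
    using sa_norm_square[OF pos_sa[OF pp]] nq by (simp add: t_def)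
  ultimately have "t * t\<^sup>2 \<le> 0" by simp
  moreover have "t * t\<^sup>2 = (norm y) ^ 6" by (simp add: t_def flip: power_mult power_Suc power_add)
  ultimately show ?thesis by (simp add: power_le_zero_eq)
qed

text \<open>If \<open>g\<close> is the negative part of \<open>star x * x\<close>, then
  \<open>star (x * g) * (x * g)\<close> is minus the cube of \<open>g\<close>, so
  \<open>x * g = 0\<close> by the preceding lemma.\<close>

lemma star_mult_pos [simp]: "pos (star x * (x::'a::unital_cstar))"
proof -
  define h g where "h = star x * x" and "g = ppart h - h"
  have h: "sa h" by (simp add: h_def sa_simps)
  note pp = ppart[OF h]
  have g: "pos g" using pp g_def by simp
  have "h * g = - (g * g)" using pp by (simp add: g_def algebra_simps)
  then have "star (x * g) * (x * g) = - (g * g * g)"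
    using pos_star[OF g] by (simp add: star_mult h_def mult.assoc)
  moreover have "pos (g * g * g)" using g by (intro pos_mult sa_square_pos pos_sa) (simp_all add: mult.assoc)
  ultimately have "x * g = 0" using neg_star_mult_zero[of "x * g"] by simp
  then have "h * g = 0" by (simp add: h_def mult.assoc)
  then have "g * g = 0" using \<open>h * g = - (g * g)\<close> by simp
  then have "g = 0" using sa_square_zero[OF pos_sa[OF g]] by simp
  then show ?thesis using pp(1) by (simp add: g_def h_def)
qed

lemma mult_star_pos [simp]: "pos (x * star (x::'a::unital_cstar))"
  using star_mult_pos[of "star x"] by (simp add: star_star)

lemma pos_conj: "pos a \<Longrightarrow> pos (star x * a * (x::'a::unital_cstar))"
proof -
  assume "pos a"
  then obtain k where "pos k" "k * k = a" using pos_sqrt_exists by blast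
  then have "star x * a * x = star (k * x) * (k * x)" by (auto simp: star_mult pos_star mult.assoc)
  then show ?thesis by simp
qed

lemma pos_conj': "pos a \<Longrightarrow> pos (x * a * star (x::'a::unital_cstar))"
  using pos_conj[of a "star x"] by (simp add: star_star)

lemma ple_conj: "a \<preceq> b \<Longrightarrow> star x * a * x \<preceq> star x * b * (x::'a::unital_cstar)"
  using pos_conj[of "b - a" x] by (simp add: algebra_simps)

lemma ple_conj_sa: "a \<preceq> b \<Longrightarrow> sa x \<Longrightarrow> x * a * x \<preceq> x * b * (x::'a::unital_cstar)"
  using ple_conj[of b a x] unfolding sa_def by metis

lemma pos_conj_sa: "pos a \<Longrightarrow> sa x \<Longrightarrow> pos (x * a * (x::'a::unital_cstar))"
  using pos_conj[of a x] by (simp add: sa_def)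

lemma conj_ple_norm: "sa a \<Longrightarrow> norm a \<le> r \<Longrightarrow> star x * a * x \<preceq> r *\<^sub>R (star x * (x::'a::unital_cstar))"
  using ple_conj[OF ple_norm, of a r x] by (simp add: of_real_def)

text \<open>With \<open>r\<close> the square root of \<open>Z\<close>, the C*-identity turns
  \<open>norm (e * Z * e)\<close> into \<open>norm (r * (e * e) * r)\<close>, where the inequality
  between the squares sits in the middle and can be used.\<close>

lemma norm_sandwich_mono:
  fixes Z :: "'a::unital_cstar"
  assumes "pos Z" "sa e" "sa d" "e * e \<preceq> c *\<^sub>R (d * d)" "c \<ge> 0"
  shows "norm (e * Z * e) \<le> c * norm (d * Z * d)"
proof -
  obtain r where r: "pos r" "r * r = Z" using pos_sqrt_exists[OF assms(1)] by blast
  have eq: "norm (x * Z * x) = norm (r * (x * x) * r)" if "sa x" for x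
  proof -
    have "x * Z * x = star (r * x) * (r * x)" "r * (x * x) * r = (r * x) * star (r * x)"
      using that r pos_star[OF r(1)] by (auto simp: star_mult sa_def mult.assoc)
    then show ?thesis by (simp only: cstar_identity cstar_identity')
  qed
  have "r * (e * e) * r \<preceq> r * (c *\<^sub>R (d * d)) * r"
    using ple_conj[OF assms(4), of r] pos_star[OF r(1)] by simp
  then have "norm (r * (e * e) * r) \<le> norm (r * (c *\<^sub>R (d * d)) * r)"
    by (intro norm_mono) (use pos_conj[OF sa_square_pos[OF assms(2)], of r] pos_star[OF r(1)] in auto)
  then show ?thesis using assms by (simp add: eq)
qed

lemma star_add_ple:
  fixes x y :: "'a::unital_cstar"
  assumes "t > 0"
  shows "star (x + y) * (x + y) \<preceq> (1 + t) *\<^sub>R (star x * x) + (1 + 1/t) *\<^sub>R (star y * y)"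
proof -
  define z where "z = sqrt t *\<^sub>R x - (1 / sqrt t) *\<^sub>R y"
  have "star z * z = t *\<^sub>R (star x * x) + (1/t) *\<^sub>R (star y * y) - star x * y - star y * x"
    using assms by (simp add: z_def star_diff star_scaleR algebra_simps)
  then have "(1 + t) *\<^sub>R (star x * x) + (1 + 1/t) *\<^sub>R (star y * y) - star (x + y) * (x + y) = star z * z"
    by (simp add: algebra_simps star_add)
  then show ?thesis by simp
qed

text \<open>Expand \<open>\<Sum>\<^sub>i (w\<^sub>i - s\<^sub>i\<^sup>* x / c)\<^sup>* (w\<^sub>i - s\<^sub>i\<^sup>* x / c)\<close>, which is positive.\<close>

lemma row_inequality:
  fixes s w :: "'i \<Rightarrow> 'a::unital_cstar"
  assumes "norm (\<Sum>i\<in>I. s i * star (s i)) \<le> c" "c > 0"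
  defines "x \<equiv> (\<Sum>i\<in>I. s i * w i)"
  shows "star x * x \<preceq> c *\<^sub>R (\<Sum>i\<in>I. star (w i) * w i)"
proof -
  define S where "S = (\<Sum>i\<in>I. s i * star (s i))"
  define v where "v i = w i - (1/c) *\<^sub>R (star (s i) * x)" for i
  have v: "star (v i) * v i = star (w i) * w i - (1/c) *\<^sub>R (star (s i * w i) * x)
     - (1/c) *\<^sub>R (star x * (s i * w i)) + (1/c\<^sup>2) *\<^sub>R (star x * (s i * star (s i)) * x)" for i
    by (simp add: v_def star_diff star_scaleR star_mult star_star algebra_simps power2_eq_square)
  have xs: "star x = (\<Sum>i\<in>I. star (s i * w i))" by (simp add: x_def star_sum)
  have e1: "(\<Sum>i\<in>I. (1/c) *\<^sub>R (star (s i * w i) * x)) = (1/c) *\<^sub>R (star x * x)"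
    by (simp add: xs sum_distrib_right scaleR_sum_right)
  have e2: "(\<Sum>i\<in>I. (1/c) *\<^sub>R (star x * (s i * w i))) = (1/c) *\<^sub>R (star x * x)"
    by (simp add: x_def sum_distrib_left scaleR_sum_right)
  have e3: "(\<Sum>i\<in>I. (1/c\<^sup>2) *\<^sub>R (star x * (s i * star (s i)) * x)) = (1/c\<^sup>2) *\<^sub>R (star x * S * x)"
    by (simp add: S_def sum_distrib_left sum_distrib_right scaleR_sum_right)
  have "(\<Sum>i\<in>I. star (v i) * v i) = (\<Sum>i\<in>I. star (w i) * w i) - (1/c) *\<^sub>R (star x * x)
     - (1/c) *\<^sub>R (star x * x) + (1/c\<^sup>2) *\<^sub>R (star x * S * x)"
    unfolding v sum.distrib sum_subtractf e1 e2 e3 ..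
  moreover have "pos (\<Sum>i\<in>I. star (v i) * v i)" by (intro pos_sum) simp
  ultimately have A: "pos ((\<Sum>i\<in>I. star (w i) * w i) - (1/c) *\<^sub>R (star x * x)
     - (1/c) *\<^sub>R (star x * x) + (1/c\<^sup>2) *\<^sub>R (star x * S * x))" by metis
  have "sa S" unfolding S_def by (intro sa_sum) (simp add: sa_simps)
  then have "star x * S * x \<preceq> c *\<^sub>R (star x * x)" using conj_ple_norm[of S c x] assms(1) by (simp add: S_def)
  then have "(1/c\<^sup>2) *\<^sub>R (star x * S * x) \<preceq> (1/c\<^sup>2) *\<^sub>R (c *\<^sub>R (star x * x))" by (intro ple_scaleR) auto
  moreover have "(1/c\<^sup>2) *\<^sub>R (c *\<^sub>R (star x * x)) = (1/c) *\<^sub>R (star x * x)"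
    using assms(2) by (simp add: power2_eq_square)
  ultimately have B: "(1/c\<^sup>2) *\<^sub>R (star x * S * x) \<preceq> (1/c) *\<^sub>R (star x * x)" by metis
  have "pos ((\<Sum>i\<in>I. star (w i) * w i) - (1/c) *\<^sub>R (star x * x))"
    using pos_add[OF A B] by (simp add: algebra_simps)
  then have "pos (c *\<^sub>R ((\<Sum>i\<in>I. star (w i) * w i) - (1/c) *\<^sub>R (star x * x)))"
    using assms(2) by (intro pos_scaleR) auto
  then show ?thesis using assms(2) by (simp add: algebra_simps)
qed

lemma norm_row_le:
  fixes s w :: "'i \<Rightarrow> 'a::unital_cstar"
  assumes "norm (\<Sum>i\<in>I. s i * star (s i)) \<le> c"
  shows "(norm (\<Sum>i\<in>I. s i * w i))\<^sup>2 \<le> c * norm (\<Sum>i\<in>I. star (w i) * w i)"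
proof -
  have c0: "c \<ge> 0" using assms norm_ge_zero order_trans by blast
  have *: "(norm (\<Sum>i\<in>I. s i * w i))\<^sup>2 \<le> d * norm (\<Sum>i\<in>I. star (w i) * w i)" if "d > c" for d
    using norm_mono[OF star_mult_pos row_inequality[where I=I and s=s and c=d and w=w]] assms that c0
    by (simp add: cstar_identity)
  show ?thesis
  proof (rule field_le_epsilon)
    fix e :: real assume e: "e > 0"
    let ?W = "norm (\<Sum>i\<in>I. star (w i) * w i)"
    have "(norm (\<Sum>i\<in>I. s i * w i))\<^sup>2 \<le> (c + e / (?W + 1)) * ?W"
      using e by (intro *) (simp add: add_nonneg_pos)
    also have "\<dots> \<le> c * ?W + e"
    proof -
      have "e * (?W / (?W + 1)) \<le> e * 1"
        using e by (intro mult_left_mono) (auto simp: divide_le_eq_1 add_nonneg_pos)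
      then have "e / (?W + 1) * ?W \<le> e" by simp
      then show ?thesis by (simp add: algebra_simps)
    qed
    finally show "(norm (\<Sum>i\<in>I. s i * w i))\<^sup>2 \<le> c * ?W + e" .
  qed
qed

section \<open>Powers and truncations of positive elements\<close>

lemma pos_power: "pos a \<Longrightarrow> pos (a ^ n :: 'a::unital_cstar)"
  by (induction n) (auto intro!: pos_mult simp: power_commutes)

text \<open>The scalar bound \<open>x (1 - x)^n \<le> 1 / (n + 1)\<close> for operators: the
  \<open>n + 1\<close> elements \<open>P Q^k\<close> with \<open>k \<le> n\<close> all dominate
  \<open>P Q^n\<close>, and their sum telescopes to \<open>1 - Q^(n + 1)\<close>.\<close>

lemma power_decay:
  assumes "pos P" "P \<preceq> (1::'a::unital_cstar)"
  shows "real (Suc n) * norm (P * (1 - P) ^ n) \<le> 1"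
proof -
  define Q where "Q = 1 - P"
  have Q: "pos Q" using assms Q_def by simp
  have PQ: "P * Q ^ k = Q ^ k * P" for k
    by (rule power_commuting_commutes[symmetric]) (simp add: Q_def algebra_simps)
  have a: "pos (P * Q ^ k)" for k by (intro pos_mult pos_power assms Q PQ)
  have step: "P * Q ^ Suc k \<preceq> P * Q ^ k" for k
  proof -
    have "P * Q ^ k - P * Q ^ Suc k = P * Q ^ k * P"
      by (simp only: power_Suc2) (simp add: Q_def algebra_simps)
    also have "pos \<dots>" 
      by (rule pos_mult[OF a assms(1) commute_mult[OF refl PQ, symmetric]])
    finally show ?thesis .
  qed
  have dec: "P * Q ^ n \<preceq> P * Q ^ k" if "k \<le> n" for k
    using that
  proof (induction rule: inc_induct)
    case (step m) then show ?case using ple_trans \<open>\<And>k. P * Q ^ Suc k \<preceq> P * Q ^ k\<close> by blast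
  qed simp
  have tele: "(\<Sum>k\<le>n. P * Q ^ k) = 1 - Q ^ Suc n" for n
    by (induction n) (auto simp: Q_def algebra_simps)
  have "pos (\<Sum>k\<le>n. P * Q ^ k - P * Q ^ n)" by (intro pos_sum) (use dec in auto)
  then have "real (Suc n) *\<^sub>R (P * Q ^ n) \<preceq> 1 - Q ^ Suc n"
    by (simp add: sum_subtractf tele of_nat_mult scaleR_conv_of_real)
  moreover have "1 - Q ^ Suc n \<preceq> of_real 1" using pos_power[OF Q, of "Suc n"] by simp
  ultimately have "real (Suc n) *\<^sub>R (P * Q ^ n) \<preceq> of_real 1" by (rule ple_trans)
  then have "norm (real (Suc n) *\<^sub>R (P * Q ^ n)) \<le> 1"
    using pos_le_norm(1)[of "real (Suc n) *\<^sub>R (P * Q ^ n)" 1] pos_scaleR[OF a] by auto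
  then show ?thesis by (simp add: Q_def)
qed

text \<open>\<open>e\<close> is \<open>min (d / c, 1)\<close>. It acts as a unit on
  \<open>p\<close>, the part of \<open>d\<close> above the level \<open>c\<close>, which is nonzero
  because \<open>c\<close> is below the norm of \<open>d\<close>. Since \<open>c e\<close> lies
  below \<open>d\<close> and commutes with it, the squares compare as well.\<close>

lemma spectral_cut:
  fixes d :: "'a::unital_cstar"
  assumes d: "pos d" "norm d = 1" and c: "0 < c" "c < 1"
  defines "p \<equiv> ppart (d - of_real c)"
  defines "e \<equiv> (1/c) *\<^sub>R (d - p)"
  shows "pos e" "norm e = 1" "e * p = p" "p * e = p" "pos p" "p \<noteq> 0" "c\<^sup>2 *\<^sub>R (e * e) \<preceq> d * d"
proof -
  define u where "u = d - of_real c"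
  have u: "sa u" unfolding u_def by (intro sa_diff sa_of_real pos_sa d)
  note pp = ppart[OF u]
  have pu: "p = ppart u" by (simp add: p_def u_def)
  define g where "g = p - u"
  have g: "pos g" "p * g = 0" "g * p = 0" using pp by (simp_all add: g_def pu)
  show p: "pos p" using pp pu by simp
  have e: "e = 1 - (1/c) *\<^sub>R g"
    using c by (simp add: e_def g_def u_def algebra_simps of_real_def)
  have dp: "d * p = p * d" using pp by (simp add: pu u_def algebra_simps of_real_def)
  have dg: "d * g = g * d" using dp by (simp add: g_def u_def algebra_simps of_real_def)
  \<comment> \<open>\<open>g\<close> is the part of \<open>c - d\<close> above 0; its square is
    \<open>c g - d g\<close>, which is at most \<open>c g\<close>. This bounds the norm of
    \<open>g\<close> by \<open>c\<close>.\<close>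
  have "g * g = - (u * g)" using g(2) by (simp add: g_def algebra_simps)
  then have "g * g = c *\<^sub>R g - d * g" by (simp add: u_def algebra_simps of_real_def)
  then have "g * g \<preceq> c *\<^sub>R g" using pos_mult[OF d(1) g(1) dg] by simp
  then have "norm (g * g) \<le> norm (c *\<^sub>R g)" by (intro norm_mono sa_square_pos pos_sa g)
  then have "norm g * norm g \<le> c * norm g"
    using sa_norm_square[OF pos_sa[OF g(1)]] c by (simp add: power2_eq_square)
  then have ng: "norm g \<le> c" using c by (cases "norm g = 0") auto
  then have "norm ((1/c) *\<^sub>R g) \<le> 1" using c by simp
  then have "pos (of_real 1 - (1/c) *\<^sub>R g)" by (intro sa_le_norm(1) sa_scaleR pos_sa g)
  then show pe: "pos e" by (simp add: e)
  show ep: "e * p = p" "p * e = p" using g by (simp_all add: e algebra_simps)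
  show p0: "p \<noteq> 0"
  proof
    assume "p = 0"
    then have "pos (of_real c - d)" using g(1) by (simp add: g_def u_def)
    then show False using pos_le_norm(1)[OF d(1)] d c by fastforce
  qed
  have "e \<preceq> of_real 1" using pos_scaleR[OF g(1), of "1/c"] c by (simp add: e)
  then have "norm e \<le> 1" using pos_le_norm(1)[OF pe] by blast
  moreover have "norm p \<le> norm e * norm p" using norm_mult_ineq[of e p] ep by simp
  ultimately show "norm e = 1" using p0 by simp
  have "d - c *\<^sub>R e = p" using c by (simp add: e_def)
  have de: "d * e = e * d" by (simp add: e_def algebra_simps dp)
  have "d * d - c\<^sup>2 *\<^sub>R (e * e) = (d - c *\<^sub>R e) * (d + c *\<^sub>R e)"
    by (simp add: algebra_simps de power2_eq_square)
  also have "\<dots> = p * (d + c *\<^sub>R e)" using \<open>d - c *\<^sub>R e = p\<close> by simp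
  also have "pos \<dots>"
    by (rule pos_mult[OF p]) (use c in \<open>auto intro!: pos_add pos_scaleR d pe simp: algebra_simps dp ep\<close>)
  finally show "c\<^sup>2 *\<^sub>R (e * e) \<preceq> d * d" .
qed

section \<open>The Haar mean of a continuous function on a compact group\<close>

text \<open>The Haar integral is obtained, after von Neumann, as the common limiting value of finite
  averages of translates whose oscillation tends to 0. Left averages define the mean; right averages
  serve for comparison.\<close>

inductive left_avg :: "('g::group_add \<Rightarrow> 'v::real_vector) \<Rightarrow> ('g \<Rightarrow> 'v) \<Rightarrow> bool" for F where
  base: "left_avg F F"
| step: "left_avg F p \<Longrightarrow> N > 0 \<Longrightarrow> left_avg F (\<lambda>h. (1 / real N) *\<^sub>R (\<Sum>i<N. p (t i + h)))"

inductive right_avg :: "('g::group_add \<Rightarrow> 'v::real_vector) \<Rightarrow> ('g \<Rightarrow> 'v) \<Rightarrow> bool" for F where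
  base: "right_avg F F"
| step: "right_avg F p \<Longrightarrow> N > 0 \<Longrightarrow> right_avg F (\<lambda>h. (1 / real N) *\<^sub>R (\<Sum>i<N. p (h + t i)))"

lemma left_avg_trans: "left_avg p q \<Longrightarrow> left_avg F p \<Longrightarrow> left_avg F q"
  by (induction rule: left_avg.induct) (auto intro: left_avg.intros)

lemma left_avg_linear:
  assumes "linear T" "left_avg F p"
  shows "left_avg (\<lambda>g. T (F g)) (\<lambda>g. T (p g))"
  using assms(2)
proof induction
  case (step p N t)
  have "left_avg (\<lambda>g. T (F g)) (\<lambda>h. (1 / real N) *\<^sub>R (\<Sum>i<N. T (p (t i + h))))"
    by (rule left_avg.step[OF step.IH step.hyps(2)])
  then show ?case by (simp add: linear_scale[OF assms(1)] linear_sum[OF assms(1)])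
qed (rule left_avg.base)

lemma right_avg_left_translate: "right_avg F p \<Longrightarrow> right_avg (\<lambda>g. F (s + g)) (\<lambda>g. p (s + g))"
proof (induction rule: right_avg.induct)
  case (step p N t)
  show ?case using right_avg.step[OF step.IH step.hyps(2), of t] by (simp add: add.assoc)
qed (rule right_avg.base)

lemma left_avg_right_translate: "left_avg F p \<Longrightarrow> left_avg (\<lambda>g. F (g + s)) (\<lambda>g. p (g + s))"
proof (induction rule: left_avg.induct)
  case (step p N t)
  show ?case using left_avg.step[OF step.IH step.hyps(2), of t] by (simp add: add.assoc)
qed (rule left_avg.base)

lemma left_avg_uminus: "left_avg (\<lambda>g. F (- g)) p \<Longrightarrow> right_avg F (\<lambda>g. p (- g))"
proof (induction rule: left_avg.induct)
  case base then show ?case by (simp add: right_avg.base)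
next
  case (step p N t)
  show ?case using right_avg.step[OF step.IH step.hyps(2), of "\<lambda>i. - t i"] by (simp add: minus_add)
qed

lemma left_right_step:
  assumes "right_avg F q" "N > 0"
  shows "right_avg (\<lambda>h. (1 / real N) *\<^sub>R (\<Sum>i<N. F (t i + h))) (\<lambda>h. (1 / real N) *\<^sub>R (\<Sum>i<N. q (t i + h)))"
  using assms(1)
proof induction
  case (step p M s)
  have "(\<lambda>h. (1 / real N) *\<^sub>R (\<Sum>i<N. (1 / real M) *\<^sub>R (\<Sum>j<M. p (t i + h + s j)))) =
    (\<lambda>h. (1 / real M) *\<^sub>R (\<Sum>j<M. (1 / real N) *\<^sub>R (\<Sum>i<N. p (t i + (h + s j)))))"
  proof
    fix h
    have "(\<Sum>i<N. \<Sum>j<M. p (t i + (h + s j))) = (\<Sum>j<M. \<Sum>i<N. p (t i + (h + s j)))" by (rule sum.swap)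
    then show "(1 / real N) *\<^sub>R (\<Sum>i<N. (1 / real M) *\<^sub>R (\<Sum>j<M. p (t i + h + s j))) =
        (1 / real M) *\<^sub>R (\<Sum>j<M. (1 / real N) *\<^sub>R (\<Sum>i<N. p (t i + (h + s j))))"
      by (simp add: scaleR_sum_right[symmetric] add.assoc mult.commute)
  qed
  then show ?case using right_avg.step[OF step.IH step.hyps(2), of s] by simp
qed (rule right_avg.base)

text \<open>Left and right translations commute. Averaging \<open>p\<close> on the right as
  \<open>q\<close> was formed, or \<open>q\<close> on the left as \<open>p\<close> was formed,
  therefore gives the same function. Two left averages need not have a common average of this
  kind.\<close>

lemma left_right_common:
  assumes "left_avg F p" "right_avg F q"
  shows "\<exists>r. right_avg p r \<and> left_avg q r"
  using assms(1)
proof induction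
  case base then show ?case using assms(2) left_avg.base by blast
next
  case (step p N t)
  then obtain r where "right_avg p r" "left_avg q r" by blast
  then show ?case using left_right_step left_avg.step step.hyps(2) by blast
qed

lemma convex_average:
  assumes "convex C" "N > 0" "\<And>i. i < N \<Longrightarrow> x i \<in> C"
  shows "(1 / real N) *\<^sub>R (\<Sum>i<N. x i) \<in> C"
proof -
  have "(\<Sum>i<N. (1 / real N) *\<^sub>R x i) \<in> C"
    using assms by (intro convex_sum) auto
  then show ?thesis by (simp add: scaleR_sum_right)
qed

lemma left_avg_convex: "left_avg F p \<Longrightarrow> convex C \<Longrightarrow> (\<And>g. F g \<in> C) \<Longrightarrow> p h \<in> C"
  by (induction arbitrary: h rule: left_avg.induct) (auto intro!: convex_average)

lemma right_avg_convex: "right_avg F p \<Longrightarrow> convex C \<Longrightarrow> (\<And>g. F g \<in> C) \<Longrightarrow> p h \<in> C"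
  by (induction arbitrary: h rule: right_avg.induct) (auto intro!: convex_average)

lemma norm_diff_average:
  fixes x y :: "nat \<Rightarrow> 'v::real_normed_vector"
  assumes "N > 0" "\<And>i. i < N \<Longrightarrow> norm (x i - y i) \<le> e"
  shows "norm ((1 / real N) *\<^sub>R (\<Sum>i<N. x i) - (1 / real N) *\<^sub>R (\<Sum>i<N. y i)) \<le> e"
proof -
  have "(1 / real N) *\<^sub>R (\<Sum>i<N. x i - y i) \<in> cball 0 e"
    using assms by (intro convex_average) auto
  then show ?thesis by (simp add: sum_subtractf scaleR_diff_right)
qed

text \<open>Uniform continuity with the small element \<open>u\<close> between two arbitrary ones.
  Left averaging only changes the factor on the far left, so every left average inherits the same
  \<open>U\<close> (\<open>left_avg_modulus\<close>).\<close>

lemma compact_group_modulus: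
  fixes F :: "'g::topological_group_add \<Rightarrow> 'v::real_normed_vector"
  assumes "compact (UNIV :: 'g set)" "continuous_on UNIV F" "e > 0"
  shows "\<exists>U. open U \<and> 0 \<in> U \<and> (\<forall>x h. \<forall>u\<in>U. norm (F (x + u + h) - F (x + h)) < e)"
proof -
  define K where "K = (\<lambda>(u, x, h). norm (F (x + u + h) - F (x + h)))"
  have "continuous_on UNIV (\<lambda>z::'g \<times> 'g \<times> 'g. norm (F (fst (snd z) + fst z + snd (snd z)) - F (fst (snd z) + snd (snd z))))"
    by (intro continuous_on_norm continuous_on_diff continuous_on_compose2[OF assms(2)] continuous_on_add
        continuous_on_fst continuous_on_snd continuous_on_id subset_UNIV)
  then have "continuous_on UNIV K"
    by (simp add: K_def case_prod_unfold)
  then have W: "open {z. K z < e}"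
    by (intro open_Collect_less continuous_on_const)
  have "compact ((UNIV :: 'g set) \<times> (UNIV :: 'g set))" by (intro compact_Times assms)
  then have C: "compact (UNIV :: ('g \<times> 'g) set)" by simp
  have "{0::'g} \<times> UNIV \<subseteq> {z. K z < e}" using assms(3) by (auto simp: K_def)
  then obtain U where "open U" "0 \<in> U" "U \<times> UNIV \<subseteq> {z. K z < e}"
    using Elementary_Topology.tube_lemma[OF C W, of 0] by auto
  then show ?thesis by (intro exI[of _ U]) (auto simp: K_def subset_iff)
qed

lemma compact_group_cover:
  fixes W :: "'g::topological_group_add set"
  assumes "compact (UNIV :: 'g set)" "open W" "w \<in> W"
  shows "\<exists>N t. N > 0 \<and> (\<forall>s. \<exists>i<N. (t::nat \<Rightarrow> 'g) i + s \<in> W)"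
proof -
  have op: "open {s. c + s \<in> W}" for c
    using open_vimage[OF assms(2), of "\<lambda>s. c + s"]
    by (simp add: vimage_def continuous_on_add continuous_on_const continuous_on_id)
  have "UNIV \<subseteq> (\<Union>c\<in>UNIV. {s. c + s \<in> W})"
  proof
    fix s :: 'g
    have "(w - s) + s \<in> W" using assms(3) by simp
    then show "s \<in> (\<Union>c\<in>UNIV. {s. c + s \<in> W})" by blast
  qed
  then obtain T where T: "finite T" "UNIV \<subseteq> (\<Union>c\<in>T. {s. c + s \<in> W})"
    using compactE_image[OF assms(1), of UNIV "\<lambda>c. {s. c + s \<in> W}"] op by auto
  obtain t :: "nat \<Rightarrow> 'g" where t: "bij_betw t {..<card T} T"
    using ex_bij_betw_nat_finite[OF T(1)] by (auto simp: atLeast0LessThan)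
  have "T \<noteq> {}" using T by auto
  then have "card T > 0" using T by (simp add: card_gt_0_iff)
  moreover have "\<exists>i<card T. t i + s \<in> W" for s
  proof -
    obtain c where "c \<in> T" "c + s \<in> W" using T by blast
    then have "c \<in> t ` {..<card T}" using t by (simp add: bij_betw_def)
    then obtain i where "i < card T" "t i = c" by blast
    then show ?thesis using \<open>c + s \<in> W\<close> by blast
  qed
  ultimately show ?thesis by blast
qed

lemma left_avg_modulus:
  assumes "left_avg F p" "\<And>x h u. u \<in> U \<Longrightarrow> norm (F (x + u + h) - F (x + h)) \<le> (e::real)"
  shows "u \<in> U \<Longrightarrow> norm (p (x + u + h) - p (x + h)) \<le> e"
  using assms(1)
proof (induction arbitrary: x h)
  case base then show ?case using assms(2) by blast
next
  case (step p N t)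
  show ?case
    by (rule norm_diff_average[OF step.hyps(2)]) (use step in \<open>simp add: add.assoc[symmetric]\<close>)
qed

text \<open>Averaging over a finite net strictly decreases the oscillation, unless it is already small: for
  any two arguments, two of the translates nearly agree and can be cancelled against each other.\<close>

lemma left_avg_small_oscillation:
  fixes F :: "'g::topological_group_add \<Rightarrow> 'v::real_normed_vector"
  assumes G: "compact (UNIV :: 'g set)" and F: "continuous_on UNIV F" and e: "e > 0"
  shows "\<exists>p. left_avg F p \<and> (\<forall>h h'. norm (p h - p h') \<le> e)"
proof -
  define osc where "osc s \<longleftrightarrow> (\<exists>p. left_avg F p \<and> (\<forall>h h'. norm (p h - p h') \<le> s))" for s
  have osc_mono: "osc s \<Longrightarrow> s \<le> s' \<Longrightarrow> osc s'" for s s' unfolding osc_def by (meson order_trans)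
  obtain U where U: "open U" "0 \<in> U" "\<And>x h u. u \<in> U \<Longrightarrow> norm (F (x + u + h) - F (x + h)) \<le> e/2"
    using compact_group_modulus[OF G F, of "e/2"] e by (meson half_gt_zero less_imp_le)
  have "open (uminus -` U)" by (rule open_vimage[OF U(1)]) (intro continuous_intros)
  then obtain N and c :: "nat \<Rightarrow> 'g" where N: "N > 0" and c: "\<And>s. \<exists>i<N. c i + s \<in> uminus -` U"
    using compact_group_cover[OF G, of "uminus -` U" 0] U by auto
  define t where "t i = - c i" for i
  have t: "\<exists>i<N. s + t i \<in> U" for s using c[of "- s"] by (auto simp: t_def minus_add)
  have improve: "osc (s - (s - e/2) / real N)" if os: "osc s" for s
  proof -
    obtain p where p: "left_avg F p" "\<And>h h'. norm (p h - p h') \<le> s" using os osc_def by blast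
    have "norm ((1 / real N) *\<^sub>R (\<Sum>i<N. p (t i + h)) - (1 / real N) *\<^sub>R (\<Sum>i<N. p (t i + h'))) \<le> s - (s - e/2) / real N"
      for h h'
    proof -
      obtain j where j: "j < N" "- (t 0 + h - h') + t j \<in> U" using t by blast
      \<comment> \<open>The transposition matches the translate number 0 at \<open>h\<close> with
        number \<open>j\<close> at \<open>h'\<close>, where \<open>p\<close> differs by at most
        \<open>e/2\<close>; the other \<open>N - 1\<close> pairs cost at most \<open>s\<close>
        each.\<close>
      define w where "w = Transposition.transpose 0 j"
      have bij: "bij_betw w {..<N} {..<N}" unfolding w_def using j N
        by (intro bij_betwI[of _ _ _ "Transposition.transpose 0 j"]) (auto simp: Transposition.transpose_def)
      have "(\<Sum>i<N. p (t i + h')) = (\<Sum>i<N. p (t (w i) + h'))"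
        by (rule sum.reindex_bij_betw[OF bij, symmetric])
      then have "(\<Sum>i<N. p (t i + h)) - (\<Sum>i<N. p (t i + h')) = (\<Sum>i<N. p (t i + h) - p (t (w i) + h'))"
        by (simp add: sum_subtractf)
      also have "norm \<dots> \<le> (\<Sum>i<N. if i = 0 then e/2 else s)"
      proof (rule sum_norm_le)
        fix i assume "i \<in> {..<N}"
        have "norm (p ((t 0 + h - h') + (- (t 0 + h - h') + t j) + h') - p ((t 0 + h - h') + h')) \<le> e/2"
          by (rule left_avg_modulus[OF p(1) U(3) j(2)])
        moreover have "(t 0 + h - h') + (- (t 0 + h - h') + t j) + h' = t j + h'"
          by (simp only: add.assoc[symmetric] right_minus add_0_left)
        ultimately have "norm (p (t 0 + h) - p (t j + h')) \<le> e/2"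
          by (simp add: norm_minus_commute)
        then show "norm (p (t i + h) - p (t (w i) + h')) \<le> (if i = 0 then e/2 else s)"
          using p(2) by (auto simp: w_def)
      qed
      also have "\<dots> = e/2 + (real N - 1) * s"
      proof -
        have "(\<Sum>i<N. if i = 0 then e/2 else s) = e/2 + (\<Sum>i\<in>{..<N} - {0}. s)"
          using N by (subst sum.remove[of _ 0]) auto
        then show ?thesis using N by (simp add: of_nat_diff)
      qed
      finally have "(1 / real N) * norm ((\<Sum>i<N. p (t i + h)) - (\<Sum>i<N. p (t i + h'))) \<le> (1 / real N) * (e/2 + (real N - 1) * s)"
        by (intro mult_left_mono) auto
      moreover have "(1 / real N) * (e/2 + (real N - 1) * s) = s - (s - e/2) / real N"
        using N by (simp add: field_simps)
      moreover have "norm ((1 / real N) *\<^sub>R x - (1 / real N) *\<^sub>R y) = (1 / real N) * norm (x - y)" for x y :: 'v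
        by (simp flip: scaleR_diff_right)
      ultimately show ?thesis by simp
    qed
    then show ?thesis using left_avg.step[OF p(1) N, of t] unfolding osc_def by blast
  qed
  define I where "I = Inf {s. s \<ge> 0 \<and> osc s}"
  obtain B where B: "\<And>g. norm (F g) \<le> B"
    using compact_imp_bounded[OF compact_continuous_image[OF F G]] by (auto simp: bounded_iff)
  have "norm (F h - F h') \<le> B + B" for h h'
    using norm_triangle_ineq4[of "F h" "F h'"] B[of h] B[of h'] by linarith
  then have "osc (B + B)" unfolding osc_def using left_avg.base by blast
  moreover have "B + B \<ge> 0" using B norm_ge_zero order_trans by (metis add_nonneg_nonneg)
  ultimately have ne: "{s. s \<ge> 0 \<and> osc s} \<noteq> {}" by blast
  have bd: "bdd_below {s. s \<ge> 0 \<and> osc s}" by (intro bdd_belowI[of _ 0]) auto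
  have "I < e"
  proof (rule ccontr)
    assume "\<not> I < e"
    then have Ie: "I \<ge> e" by simp
    \<comment> \<open>If \<open>s \<ge> e\<close>, then \<open>improve\<close> lowers
      \<open>s\<close> by at least \<open>e / (2 N) = 2 d\<close>. A value \<open>s\<close> within
      \<open>d\<close> of the infimum \<open>I\<close> would thus be improved to one below
      \<open>I\<close>.\<close>
    define d where "d = e / (4 * real N)"
    have d: "d > 0" using e N by (simp add: d_def)
    obtain s where s: "s \<ge> 0" "osc s" "s < I + d"
      using cInf_lessD[OF ne, of "I + d"] d I_def by auto
    have "I \<le> s" unfolding I_def using s by (intro cInf_lower bd) auto
    then have "(s - e/2) / real N \<ge> 2 * d" using Ie N by (simp add: d_def field_simps)
    then have "s - (s - e/2) / real N < I" using s d by linarith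
    moreover have "s - (s - e/2) / real N \<ge> 0"
    proof -
      have "(s - e/2) / real N \<le> (s - e/2) / 1" using N Ie \<open>I \<le> s\<close> e by (intro divide_left_mono) auto
      then show ?thesis using e by simp
    qed
    ultimately show False using cInf_lower[OF _ bd] improve[OF s(2)] by (fastforce simp: I_def)
  qed
  then obtain s where "osc s" "s < e" using cInf_lessD[OF ne, of e] I_def by auto
  then show ?thesis using osc_mono[of s e] by (auto simp: osc_def)
qed

lemma right_avg_small_oscillation:
  fixes F :: "'g::topological_group_add \<Rightarrow> 'v::real_normed_vector"
  assumes "compact (UNIV :: 'g set)" "continuous_on UNIV F" "e > 0"
  shows "\<exists>p. right_avg F p \<and> (\<forall>h h'. norm (p h - p h') \<le> e)"
proof -
  have "continuous_on UNIV (\<lambda>g. F (- g))"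
    by (rule continuous_on_compose2[OF assms(2)]) (auto intro: continuous_intros)
  then obtain p where "left_avg (\<lambda>g. F (- g)) p" "\<And>h h'. norm (p h - p h') \<le> e"
    using left_avg_small_oscillation[OF assms(1) _ assms(3)] by blast
  then show ?thesis using left_avg_uminus by blast
qed

lemma left_right_near:
  fixes F :: "'g::group_add \<Rightarrow> 'v::real_normed_vector"
  assumes "left_avg F p" "\<And>h. norm (p h - v) \<le> a" "right_avg F q" "\<And>h. norm (q h - w) \<le> b"
  shows "norm (v - w) \<le> a + b"
proof -
  obtain r where r: "right_avg p r" "left_avg q r" using left_right_common assms by blast
  have "r 0 \<in> cball v a" by (rule right_avg_convex[OF r(1)]) (use assms in \<open>auto simp: dist_norm norm_minus_commute\<close>)
  moreover have "r 0 \<in> cball w b" by (rule left_avg_convex[OF r(2)]) (use assms in \<open>auto simp: dist_norm norm_minus_commute\<close>)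
  ultimately show ?thesis
    using norm_triangle_ineq[of "v - r 0" "r 0 - w"] by (simp add: dist_norm norm_minus_commute)
qed

section \<open>Existence and uniqueness of the mean\<close>

definition is_mean :: "('g::group_add \<Rightarrow> 'v::real_normed_vector) \<Rightarrow> 'v \<Rightarrow> bool" where
  "is_mean F v \<longleftrightarrow> (\<forall>e>0. \<exists>p. left_avg F p \<and> (\<forall>h. norm (p h - v) \<le> e))"

definition hmean :: "('g::group_add \<Rightarrow> 'v::real_normed_vector) \<Rightarrow> 'v" where
  "hmean F = (THE v. is_mean F v)"

lemma right_mean:
  fixes F :: "'g::topological_group_add \<Rightarrow> 'v::real_normed_vector"
  assumes "compact (UNIV :: 'g set)" "continuous_on UNIV F" "is_mean F v" "e > 0"
  shows "\<exists>q. right_avg F q \<and> (\<forall>h. norm (q h - v) \<le> e)"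
proof -
  obtain q where q: "right_avg F q" "\<And>h h'. norm (q h - q h') \<le> e/3"
    using right_avg_small_oscillation[OF assms(1,2), of "e/3"] assms(4) by auto
  obtain p where p: "left_avg F p" "\<And>h. norm (p h - v) \<le> e/3"
    using assms(3,4) unfolding is_mean_def by (meson divide_pos_pos zero_less_numeral)
  have "norm (v - q 0) \<le> e/3 + e/3" by (rule left_right_near[OF p q(1)]) (rule q(2))
  then have "norm (q h - v) \<le> e" for h
    using norm_triangle_ineq[of "q h - q 0" "q 0 - v"] q(2)[of h 0] by (simp add: norm_minus_commute)
  then show ?thesis using q(1) by blast
qed

lemma is_mean_unique:
  fixes F :: "'g::topological_group_add \<Rightarrow> 'v::real_normed_vector"
  assumes "compact (UNIV :: 'g set)" "continuous_on UNIV F" "is_mean F v" "is_mean F w"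
  shows "v = w"
proof -
  have "norm (v - w) \<le> e" if e: "e > 0" for e
  proof -
    obtain p where p: "left_avg F p" "\<And>h. norm (p h - v) \<le> e/2"
      using assms(3) e unfolding is_mean_def by (meson half_gt_zero)
    obtain q where q: "right_avg F q" "\<And>h. norm (q h - w) \<le> e/2"
      using right_mean[OF assms(1,2,4), of "e/2"] e by auto
    show ?thesis using left_right_near[OF p q] by simp
  qed
  then show ?thesis using field_le_epsilon[of "norm (v - w)" 0] by simp
qed

lemma is_mean_exists:
  fixes F :: "'g::topological_group_add \<Rightarrow> 'v::banach"
  assumes "compact (UNIV :: 'g set)" "continuous_on UNIV F"
  shows "\<exists>v. is_mean F v"
proof -
  have "\<forall>n. \<exists>p. left_avg F p \<and> (\<forall>h h'. norm (p h - p h') \<le> 1 / real (Suc n))"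
    using left_avg_small_oscillation[OF assms] by simp
  then obtain p where p: "\<And>n. left_avg F (p n)" "\<And>n h h'. norm (p n h - p n h') \<le> 1 / real (Suc n)" by metis
  \<comment> \<open>Two left averages are compared through a right average \<open>q\<close> of small
    oscillation, whose own error \<open>e\<close> is arbitrary and drops out.\<close>
  have diff: "norm (p n 0 - p m 0) \<le> 1 / real (Suc n) + 1 / real (Suc m)" for n m
  proof (rule field_le_epsilon)
    fix e :: real assume "e > 0"
    then obtain q where q: "right_avg F q" "\<And>h h'. norm (q h - q h') \<le> e/2"
      using right_avg_small_oscillation[OF assms, of "e/2"] by auto
    have *: "norm (p n 0 - q 0) \<le> 1 / real (Suc n) + e/2" for n
      by (rule left_right_near[OF p(1)[of n] _ q(1)]) (use p(2)[of n] q(2) in auto)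
    have "norm (p n 0 - p m 0) \<le> norm (p n 0 - q 0) + norm (p m 0 - q 0)"
      using norm_triangle_ineq4[of "p n 0 - q 0" "p m 0 - q 0"] by simp
    with *[of n] *[of m] show "norm (p n 0 - p m 0) \<le> 1 / real (Suc n) + 1 / real (Suc m) + e" by simp
  qed
  have "Cauchy (\<lambda>n. p n 0)"
  proof (rule metric_CauchyI)
    fix e :: real assume "e > 0"
    then obtain M where M: "1 / real (Suc M) < e/2" using nat_approx_posE half_gt_zero by blast
    have "1 / real (Suc n) < e/2" if "n \<ge> M" for n
      using M that by (meson frac_le less_imp_le order_le_less_trans of_nat_0_less_iff of_nat_mono Suc_le_mono zero_less_Suc zero_le_one le_numeral_extra(4))
    then show "\<exists>M. \<forall>m\<ge>M. \<forall>n\<ge>M. dist (p m 0) (p n 0) < e"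
      using diff unfolding dist_norm by (intro exI[of _ M]) (smt (verit) field_sum_of_halves)
  qed
  then obtain v where v: "(\<lambda>n. p n 0) \<longlonglongrightarrow> v" by (auto simp: Cauchy_convergent_iff convergent_def)
  have "is_mean F v" unfolding is_mean_def
  proof (intro allI impI)
    fix e :: real assume e: "e > 0"
    have "(\<lambda>n. 1 / real (Suc n)) \<longlonglongrightarrow> 0" by (rule LIMSEQ_Suc[OF lim_1_over_n])
    then have "\<forall>\<^sub>s n. 1 / real (Suc n) < e/2" using e by (intro order_tendstoD(2)) auto
    moreover have "\<forall>\<^sub>s n. dist (p n 0) v < e/2" using tendstoD[OF v, of "e/2"] e by simp
    ultimately obtain n where n: "1 / real (Suc n) < e/2" "dist (p n 0) v < e/2"
      using eventually_happens[OF eventually_conj] by (metis (mono_tags, lifting) trivial_limit_sequentially)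
    have "norm (p n h - v) \<le> e" for h
      using n p(2)[of n h 0] norm_triangle_ineq[of "p n h - p n 0" "p n 0 - v"] by (simp add: dist_norm)
    then show "\<exists>p. left_avg F p \<and> (\<forall>h. norm (p h - v) \<le> e)" using p(1) by blast
  qed
  then show ?thesis ..
qed

section \<open>The mean as an invariant positive functional\<close>

locale compact_group =
  fixes grp :: "'g::topological_group_add itself"
  assumes compact_G: "compact (UNIV :: 'g set)"
begin

lemma hmean:
  fixes F :: "'g \<Rightarrow> 'v::banach"
  assumes "continuous_on UNIV F"
  shows "is_mean F (hmean F)"
  unfolding hmean_def using is_mean_exists[OF compact_G assms] is_mean_unique[OF compact_G assms]
  by (metis theI)

lemma hmean_eqI:
  fixes F :: "'g \<Rightarrow> 'v::banach"
  assumes "continuous_on UNIV F" "is_mean F v"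
  shows "hmean F = v"
  using hmean[OF assms(1)] assms is_mean_unique[OF compact_G] by blast

lemma hmean_linear:
  fixes F :: "'g \<Rightarrow> 'v::banach" and T :: "'v \<Rightarrow> 'w::banach"
  assumes "continuous_on UNIV F" "bounded_linear T"
  shows "hmean (\<lambda>g. T (F g)) = T (hmean F)"
proof (rule hmean_eqI)
  show "continuous_on UNIV (\<lambda>g. T (F g))" by (rule bounded_linear.continuous_on[OF assms(2,1)])
  obtain K where K: "K > 0" "\<And>x. norm (T x) \<le> norm x * K" using bounded_linear.pos_bounded[OF assms(2)] by blast
  show "is_mean (\<lambda>g. T (F g)) (T (hmean F))" unfolding is_mean_def
  proof (intro allI impI)
    fix e :: real assume "e > 0"
    then obtain p where p: "left_avg F p" "\<And>h. norm (p h - hmean F) \<le> e / K"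
      using hmean[OF assms(1)] K unfolding is_mean_def by (meson divide_pos_pos)
    have "norm (T (p h) - T (hmean F)) \<le> e" for h
    proof -
      have "norm (T (p h - hmean F)) \<le> e / K * K" using K p(2)[of h] by (meson less_imp_le mult_right_mono order_trans)
      then show ?thesis using K by (simp add: linear_diff[OF bounded_linear.linear[OF assms(2)]])
    qed
    then show "\<exists>p. left_avg (\<lambda>g. T (F g)) p \<and> (\<forall>h. norm (p h - T (hmean F)) \<le> e)"
      using left_avg_linear[OF bounded_linear.linear[OF assms(2)] p(1)] by blast
  qed
qed

lemma hmean_closed_convex:
  fixes F :: "'g \<Rightarrow> 'v::banach"
  assumes "continuous_on UNIV F" "closed C" "convex C" "\<And>g. F g \<in> C"
  shows "hmean F \<in> C"
proof -
  have "\<exists>y\<in>C. dist y (hmean F) < e" if "e > 0" for e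
  proof -
    obtain p where p: "left_avg F p" "\<And>h. norm (p h - hmean F) \<le> e / 2"
      using hmean[OF assms(1)] \<open>e > 0\<close> unfolding is_mean_def by (meson half_gt_zero)
    have "dist (p 0) (hmean F) < e" using p(2)[of 0] \<open>e > 0\<close> by (simp add: dist_norm)
    then show ?thesis using left_avg_convex[OF p(1) assms(3,4)] by blast
  qed
  then show ?thesis using assms(2) closure_approachable closure_closed by blast
qed

text \<open>Additivity is not immediate, because the averages that approximate the means of two
  functions may be different. Taking the mean of the pair supplies simultaneous averages; additivity
  and the comparison of \<open>norm (hmean F)\<close> with \<open>hmean b\<close> follow.\<close>

lemma hmean_pair:
  fixes F :: "'g \<Rightarrow> 'v::banach" and H :: "'g \<Rightarrow> 'w::banach"
  assumes "continuous_on UNIV F" "continuous_on UNIV H"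
  shows "hmean (\<lambda>g. (F g, H g)) = (hmean F, hmean H)"
proof -
  have c: "continuous_on UNIV (\<lambda>g. (F g, H g))" by (intro continuous_intros assms)
  show ?thesis
    using hmean_linear[OF c bounded_linear_fst] hmean_linear[OF c bounded_linear_snd]
    by (simp add: prod_eq_iff)
qed

lemma hmean_add:
  fixes F H :: "'g \<Rightarrow> 'v::banach"
  assumes "continuous_on UNIV F" "continuous_on UNIV H"
  shows "hmean (\<lambda>g. F g + H g) = hmean F + hmean H"
proof -
  have c: "continuous_on UNIV (\<lambda>g. (F g, H g))" by (intro continuous_intros assms)
  have "bounded_linear (\<lambda>p::'v \<times> 'v. fst p + snd p)"
    by (intro bounded_linear_add bounded_linear_fst bounded_linear_snd)
  from hmean_linear[OF c this] show ?thesis by (simp add: hmean_pair assms)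
qed

lemma hmean_scaleR: "continuous_on UNIV F \<Longrightarrow> hmean (\<lambda>g::'g. r *\<^sub>R F g) = r *\<^sub>R (hmean F :: 'v::banach)"
  by (rule hmean_linear[OF _ bounded_linear_scaleR_right])

lemma hmean_minus: "continuous_on UNIV F \<Longrightarrow> hmean (\<lambda>g::'g. - F g) = - (hmean F :: 'v::banach)"
  by (rule hmean_linear[OF _ bounded_linear_minus[OF bounded_linear_ident]])

lemma hmean_diff:
  fixes F H :: "'g \<Rightarrow> 'v::banach"
  assumes "continuous_on UNIV F" "continuous_on UNIV H"
  shows "hmean (\<lambda>g. F g - H g) = hmean F - hmean H"
  using hmean_add[OF assms(1), of "\<lambda>g. - H g"] assms(2) by (simp add: hmean_minus continuous_on_minus)

lemma hmean_const [simp]: "hmean (\<lambda>g::'g. v) = (v :: 'v::banach)"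
  by (rule hmean_eqI) (auto simp: is_mean_def intro: exI[of _ "\<lambda>g. v"] left_avg.base)

lemma hmean_norm_le:
  fixes F :: "'g \<Rightarrow> 'v::banach" and b :: "'g \<Rightarrow> real"
  assumes "continuous_on UNIV F" "continuous_on UNIV b" "\<And>g. norm (F g) \<le> b g"
  shows "norm (hmean F) \<le> hmean b"
proof -
  have "hmean (\<lambda>g. (F g, b g)) \<in> {p. norm (fst p) \<le> snd p}"
  proof (rule hmean_closed_convex)
    show "convex {p::'v \<times> real. norm (fst p) \<le> snd p}"
    proof (rule convexI)
      fix x y :: "'v \<times> real" and u v :: real
      assume a: "x \<in> {p. norm (fst p) \<le> snd p}" "y \<in> {p. norm (fst p) \<le> snd p}" "0 \<le> u" "0 \<le> v"
      have "norm (u *\<^sub>R fst x + v *\<^sub>R fst y) \<le> u * norm (fst x) + v * norm (fst y)"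
        using norm_triangle_ineq[of "u *\<^sub>R fst x" "v *\<^sub>R fst y"] a by simp
      also have "\<dots> \<le> u * snd x + v * snd y" using a by (intro add_mono mult_left_mono) auto
      finally show "u *\<^sub>R x + v *\<^sub>R y \<in> {p. norm (fst p) \<le> snd p}" by simp
    qed
    show "closed {p::'v \<times> real. norm (fst p) \<le> snd p}"
      by (intro closed_Collect_le continuous_intros)
    show "continuous_on UNIV (\<lambda>g. (F g, b g))" by (intro continuous_intros assms)
  qed (use assms in auto)
  then show ?thesis by (simp add: hmean_pair assms)
qed

lemma hmean_mono:
  fixes F H :: "'g \<Rightarrow> real"
  assumes "continuous_on UNIV F" "continuous_on UNIV H" "\<And>g. F g \<le> H g"
  shows "hmean F \<le> hmean H"
proof -
  have "hmean (\<lambda>g. H g - F g) \<in> {0..}"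
    using assms by (intro hmean_closed_convex continuous_intros) auto
  then show ?thesis using assms by (simp add: hmean_diff)
qed

text \<open>A left translate of a right average is a right average of the translated function, so
  invariance on this side is read off from right averages, by \<open>right_mean\<close>. The other
  side follows directly from the left averages.\<close>

lemma hmean_left_translate:
  fixes F :: "'g \<Rightarrow> 'v::banach"
  assumes "continuous_on UNIV F"
  shows "hmean (\<lambda>g. F (s + g)) = hmean F"
proof -
  have c: "continuous_on UNIV (\<lambda>g. F (s + g))"
    by (rule continuous_on_compose2[OF assms]) (auto intro: continuous_intros)
  have "norm (hmean (\<lambda>g. F (s + g)) - hmean F) \<le> e" if e: "e > 0" for e
  proof -
    obtain q where q: "right_avg F q" "\<And>h. norm (q h - hmean F) \<le> e/2"
      using right_mean[OF compact_G assms hmean[OF assms], of "e/2"] e by auto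
    obtain p where p: "left_avg (\<lambda>g. F (s + g)) p" "\<And>h. norm (p h - hmean (\<lambda>g. F (s + g))) \<le> e/2"
      using hmean[OF c] e unfolding is_mean_def by (meson half_gt_zero)
    show ?thesis using left_right_near[OF p right_avg_left_translate[OF q(1), of s], of "hmean F" "e/2"] q(2) by simp
  qed
  then show ?thesis using field_le_epsilon[of "norm (hmean (\<lambda>g. F (s + g)) - hmean F)" 0] by simp
qed

lemma hmean_right_translate:
  fixes F :: "'g \<Rightarrow> 'v::banach"
  assumes "continuous_on UNIV F"
  shows "hmean (\<lambda>g. F (g + s)) = hmean F"
proof (rule hmean_eqI)
  show "continuous_on UNIV (\<lambda>g. F (g + s))"
    by (rule continuous_on_compose2[OF assms]) (auto intro: continuous_intros)
  show "is_mean (\<lambda>g. F (g + s)) (hmean F)"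
    unfolding is_mean_def
  proof (intro allI impI)
    fix e :: real assume "e > 0"
    then obtain p where "left_avg F p" "\<And>h. norm (p h - hmean F) \<le> e"
      using hmean[OF assms] unfolding is_mean_def by meson
    then show "\<exists>p. left_avg (\<lambda>g. F (g + s)) p \<and> (\<forall>h. norm (p h - hmean F) \<le> e)"
      using left_avg_right_translate[of F p s] by blast
  qed
qed

lemma hmean_left_avg:
  fixes F :: "'g \<Rightarrow> 'v::banach"
  assumes "continuous_on UNIV F" "continuous_on UNIV p" "left_avg F p"
  shows "hmean p = hmean F"
proof -
  have "is_mean F (hmean p)"
    using hmean[OF assms(2)] left_avg_trans[OF _ assms(3)] unfolding is_mean_def by meson
  then show ?thesis using hmean_eqI[OF assms(1)] by simp
qed

text \<open>Finitely many translates of the set where \<open>F\<close> exceeds half of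
  \<open>F w\<close> cover the group, so one left average of \<open>F\<close> has a positive lower
  bound; passing to it does not change the mean.\<close>

lemma hmean_pos:
  fixes F :: "'g \<Rightarrow> real"
  assumes F: "continuous_on UNIV F" and nonneg: "\<And>g. F g \<ge> 0" and "F w > 0"
  shows "hmean F > 0"
proof -
  have "open {g. F g > F w / 2}"
    by (rule open_Collect_less[OF continuous_on_const F])
  moreover have "w \<in> {g. F g > F w / 2}" using assms by auto
  ultimately obtain N and t :: "nat \<Rightarrow> 'g" where N: "N > 0" and t: "\<And>s. \<exists>i<N. F (t i + s) > F w / 2"
    using compact_group_cover[OF compact_G, of "{g. F g > F w / 2}" w] by auto
  define p where "p h = (1 / real N) *\<^sub>R (\<Sum>i<N. F (t i + h))" for h
  have c: "continuous_on UNIV p" unfolding p_def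
    by (intro continuous_intros continuous_on_compose2[OF F]) auto
  have av: "left_avg F p" unfolding p_def by (rule left_avg.step[OF left_avg.base N])
  have "p h \<ge> F w / 2 / real N" for h
  proof -
    obtain i where i: "i < N" "F (t i + h) > F w / 2" using t by blast
    have "F (t i + h) \<le> (\<Sum>i<N. F (t i + h))" using i nonneg by (intro member_le_sum) auto
    then show ?thesis using i N by (simp add: p_def field_simps)
  qed
  then have "hmean (\<lambda>g::'g. F w / 2 / real N) \<le> hmean p" by (intro hmean_mono c continuous_intros)
  then have "F w / 2 / real N \<le> hmean F" using hmean_left_avg[OF F c av] by simp
  moreover have "F w / 2 / real N > 0" using assms N by simp
  ultimately show ?thesis by linarith
qed

end

lemma norm_mult3: "norm (a * b * c) \<le> norm a * norm b * norm (c::'a::real_normed_algebra)"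
  by (rule order_trans[OF norm_mult_ineq mult_right_mono[OF norm_mult_ineq norm_ge_zero]])

lemma convex_pos: "convex {x::'a::unital_cstar. pos x}"
  by (rule convexI) (auto intro: pos_add pos_scaleR)

section \<open>Compact group actions on a unitization\<close>

text \<open>The character \<open>ch\<close> singles out the algebra under consideration as its kernel \<open>A\<close>.\<close>

locale unitized_action = compact_group "TYPE('g::topological_group_add)" +
  fixes act :: "'g::topological_group_add \<Rightarrow> 'u::unital_cstar \<Rightarrow> 'u" and ch :: "'u \<Rightarrow> complex"
  assumes act_add: "act g (x + y) = act g x + act g y"
    and act_scaleC: "act g (c *\<^sub>C x) = c *\<^sub>C act g x"
    and act_mult: "act g (x * y) = act g x * act g y"
    and act_star: "act g (star x) = star (act g x)"
    and act_one: "act g 1 = 1"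
    and act_plus: "act (g + h) x = act g (act h x)"
    and act_zero: "act 0 x = x"
    and act_cont: "continuous_on UNIV (\<lambda>g. act g x)"
    and ch_add: "ch (x + y) = ch x + ch y"
    and ch_scaleC: "ch (c *\<^sub>C x) = c * ch x"
    and ch_mult: "ch (x * y) = ch x * ch y"
    and ch_star: "ch (star x) = cnj (ch x)"
    and ch_one: "ch 1 = 1"
    and ch_act: "ch (act g x) = ch x"
begin

lemma act_scaleR: "act g (r *\<^sub>R x) = r *\<^sub>R act g x"
  by (simp add: scaleR_scaleC act_scaleC)

lemma act_of_real: "act g (of_real r) = of_real r"
  by (simp add: of_real_def act_scaleR act_one)

lemma act_0 [simp]: "act g 0 = 0" using act_scaleR[of g 0 0] by simp

lemma act_minus: "act g (- x) = - act g x" using act_scaleR[of g "-1" x] by simp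

lemma act_diff: "act g (x - y) = act g x - act g y"
  using act_add[of g x "-y"] by (simp add: act_minus)

lemma act_sum: "act g (\<Sum>i\<in>I. f i) = (\<Sum>i\<in>I. act g (f i))"
  by (induction I rule: infinite_finite_induct) (auto simp: act_add)

lemma act_inverse: "act g (act (- g) x) = x" "act (- g) (act g x) = x"
  using act_plus[of g "-g" x] act_plus[of "-g" g x] by (auto simp: act_zero)

lemma act_pos: "pos x \<Longrightarrow> pos (act g x)"
proof -
  assume "pos x"
  then obtain k where "pos k" "k * k = x" using pos_sqrt_exists by blast
  then have "act g x = star (act g k) * act g k" using pos_star[of k] by (metis act_mult act_star)
  then show ?thesis by simp
qed

lemma act_norm [simp]: "norm (act g x) = norm x"
proof -
  have le: "norm (act g x) \<le> norm x" for g x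
  proof -
    have "star x * x \<preceq> of_real ((norm x)\<^sup>2)"
      by (rule ple_norm[OF pos_sa]) (simp_all add: cstar_identity)
    from act_pos[OF this, of g] have "star (act g x) * act g x \<preceq> of_real ((norm x)\<^sup>2)"
      by (simp only: act_diff act_of_real act_mult act_star)
    then have "(norm (act g x))\<^sup>2 \<le> (norm x)\<^sup>2"
      using pos_le_norm(1)[OF star_mult_pos] by (metis cstar_identity)
    then show ?thesis by simp
  qed
  show ?thesis using le[of g x] le[of "- g" "act g x"] by (simp add: act_inverse)
qed

lemma bounded_linear_act: "bounded_linear (act g)"
  by (rule bounded_linear_intro[where K=1]) (auto simp: act_add act_scaleR)

lemma ch_0 [simp]: "ch 0 = 0" using ch_scaleC[of 0 0] by simp
lemma ch_scaleR: "ch (r *\<^sub>R x) = r *\<^sub>R ch x" by (simp only: scaleR_scaleC[of r x] ch_scaleC) (simp add: scaleR_conv_of_real)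
lemma ch_minus: "ch (- x) = - ch x" using ch_scaleR[of "-1" x] by simp
lemma ch_diff: "ch (x - y) = ch x - ch y" using ch_add[of x "-y"] by (simp add: ch_minus)
lemma ch_of_real: "ch (of_real r) = of_real r" unfolding of_real_def[where 'a='u] ch_scaleR ch_one by (rule of_real_def[symmetric])
lemma ch_sum: "ch (\<Sum>i\<in>I. f i) = (\<Sum>i\<in>I. ch (f i))"
  by (induction I rule: infinite_finite_induct) (auto simp: ch_add)

lemma ch_pos: "pos x \<Longrightarrow> \<exists>r\<ge>0. ch x = of_real r"
proof -
  assume "pos x"
  then obtain k where k: "pos k" "k * k = x" using pos_sqrt_exists by blast
  then have "cnj (ch k) = ch k" using pos_star[of k] ch_star[of k] by simp
  then obtain s where s: "ch k = of_real s" by (metis Reals_cases Reals_cnj_iff)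
  then have "ch x = of_real (s * s)" using k ch_mult by auto
  then show ?thesis using zero_le_square by blast
qed

lemma ch_norm: "cmod (ch x) \<le> norm x"
proof -
  have "pos (of_real ((norm x)\<^sup>2) - star x * x)"
    by (rule ple_norm[OF pos_sa]) (simp_all add: cstar_identity)
  then obtain r where r: "r \<ge> 0" "ch (of_real ((norm x)\<^sup>2) - star x * x) = of_real r" using ch_pos by blast
  have "ch (of_real ((norm x)\<^sup>2) - star x * x) = of_real ((norm x)\<^sup>2 - (cmod (ch x))\<^sup>2)"
    by (simp only: ch_diff ch_of_real ch_mult ch_star of_real_diff complex_norm_square) (simp only: mult.commute)
  then have "(norm x)\<^sup>2 - (cmod (ch x))\<^sup>2 = r" using r by (metis of_real_eq_iff)
  then have "(cmod (ch x))\<^sup>2 \<le> (norm x)\<^sup>2" using r(1) by linarith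
  then show ?thesis by simp
qed

lemma bounded_linear_ch: "bounded_linear ch"
  by (rule bounded_linear_intro[where K=1]) (auto simp: ch_add ch_scaleR ch_norm)

definition A :: "'u set" where "A = {a. ch a = 0}"
definition F :: "'u set" where "F = {a. \<forall>g. act g a = a}"
definition B :: "'u set" where "B = F \<inter> A"

lemma A_closed_ops:
  "0 \<in> A" "x \<in> A \<Longrightarrow> y \<in> A \<Longrightarrow> x + y \<in> A" "x \<in> A \<Longrightarrow> y \<in> A \<Longrightarrow> x - y \<in> A" "x \<in> A \<Longrightarrow> star x \<in> A"
  "x \<in> A \<Longrightarrow> x * z \<in> A" "x \<in> A \<Longrightarrow> z * x \<in> A" "x \<in> A \<Longrightarrow> c *\<^sub>C x \<in> A" "x \<in> A \<Longrightarrow> r *\<^sub>R x \<in> A"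
  "x \<in> A \<Longrightarrow> act g x \<in> A" "x \<in> A \<Longrightarrow> - x \<in> A"
  by (auto simp: A_def ch_add ch_diff ch_star ch_mult ch_scaleC ch_scaleR ch_act ch_minus)

lemma A_sum: "(\<And>i. i \<in> I \<Longrightarrow> f i \<in> A) \<Longrightarrow> (\<Sum>i\<in>I. f i) \<in> A"
  by (simp add: A_def ch_sum)

lemma closed_A: "closed A"
  unfolding A_def by (intro closed_Collect_eq linear_continuous_on[OF bounded_linear_ch] continuous_on_const)

lemma F_D: "f \<in> F \<Longrightarrow> act g f = f" by (simp add: F_def)

lemma F_closed_ops:
  "0 \<in> F" "1 \<in> F" "of_real r \<in> F" "x \<in> F \<Longrightarrow> y \<in> F \<Longrightarrow> x + y \<in> F" "x \<in> F \<Longrightarrow> y \<in> F \<Longrightarrow> x - y \<in> F" "x \<in> F \<Longrightarrow> star x \<in> F"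
  "x \<in> F \<Longrightarrow> y \<in> F \<Longrightarrow> x * y \<in> F" "x \<in> F \<Longrightarrow> c *\<^sub>C x \<in> F" "x \<in> F \<Longrightarrow> r *\<^sub>R x \<in> F"
  "x \<in> F \<Longrightarrow> - x \<in> F"
  by (auto simp: F_def act_add act_diff act_star act_mult act_scaleC act_scaleR act_one act_minus act_of_real)

lemma F_sum: "(\<And>i. i \<in> I \<Longrightarrow> f i \<in> F) \<Longrightarrow> (\<Sum>i\<in>I. f i) \<in> F"
  by (simp add: F_def act_sum)

lemma F_power: "x \<in> F \<Longrightarrow> x ^ n \<in> F"
  by (induction n) (auto intro: F_closed_ops)

lemma closed_F: "closed F"
  unfolding F_def
  by (intro closed_Collect_all closed_Collect_eq linear_continuous_on[OF bounded_linear_act] continuous_on_id)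

lemma F_psqrt: "pos x \<Longrightarrow> x \<in> F \<Longrightarrow> psqrt x \<in> F"
proof -
  assume x: "pos x" "x \<in> F"
  have "psqrt x = act g (psqrt x)" for g
    by (rule psqrt_eqI) (use x in \<open>auto intro!: act_pos psqrt simp: psqrt(2) F_D simp flip: act_mult\<close>)
  then show ?thesis by (simp add: F_def)
qed

lemma F_ppart: "sa x \<Longrightarrow> x \<in> F \<Longrightarrow> ppart x \<in> F"
  unfolding ppart_def by (intro F_closed_ops F_psqrt sa_square_pos)

lemma BI: "x \<in> F \<Longrightarrow> x \<in> A \<Longrightarrow> x \<in> B" by (simp add: B_def)
lemma B_A: "x \<in> B \<Longrightarrow> x \<in> A" by (simp add: B_def)
lemma B_F: "x \<in> B \<Longrightarrow> x \<in> F" by (simp add: B_def)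

lemma B_closed_ops:
  "0 \<in> B" "x \<in> B \<Longrightarrow> y \<in> B \<Longrightarrow> x + y \<in> B" "x \<in> B \<Longrightarrow> y \<in> B \<Longrightarrow> x - y \<in> B" "x \<in> B \<Longrightarrow> star x \<in> B"
  "x \<in> B \<Longrightarrow> f \<in> F \<Longrightarrow> x * f \<in> B" "x \<in> B \<Longrightarrow> f \<in> F \<Longrightarrow> f * x \<in> B" "x \<in> B \<Longrightarrow> c *\<^sub>C x \<in> B" "x \<in> B \<Longrightarrow> r *\<^sub>R x \<in> B"
  "x \<in> B \<Longrightarrow> - x \<in> B"
  by (auto simp: B_def intro: A_closed_ops F_closed_ops)

lemma B_mult: "x \<in> B \<Longrightarrow> y \<in> B \<Longrightarrow> x * y \<in> B"
  by (simp add: B_closed_ops B_F)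

lemma B_sum: "(\<And>i. i \<in> I \<Longrightarrow> f i \<in> B) \<Longrightarrow> (\<Sum>i\<in>I. f i) \<in> B"
  by (simp add: B_def A_sum F_sum)

lemma closed_B: "closed B"
  unfolding B_def by (intro closed_Int closed_A closed_F)

text \<open>The character takes \<open>d - c\<close> to \<open>-c\<close> and its modulus to
  \<open>c\<close>; in the positive part the two cancel. With \<open>c \<ge> 0\<close> the cut thus
  stays inside the kernel of the character.\<close>

lemma A_ppart:
  assumes "sa d" "d \<in> A" "c \<ge> 0"
  shows "ppart (d - of_real c) \<in> A"
proof -
  define u where "u = d - of_real c"
  have u: "sa u" unfolding u_def by (intro sa_diff sa_of_real assms)
  have chu: "ch u = - of_real c" using assms by (simp add: u_def A_def ch_diff ch_of_real)
  have p2: "pos (u * u)" by (rule sa_square_pos[OF u])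
  obtain r where r: "r \<ge> 0" "ch (psqrt (u * u)) = of_real r" using ch_pos[OF psqrt(1)[OF p2]] by blast
  have "ch (psqrt (u * u)) * ch (psqrt (u * u)) = ch u * ch u"
    using psqrt(2)[OF p2] ch_mult by metis
  then have "of_real (r * r) = (of_real (c * c) :: complex)" using r chu by simp
  then have "r * r = c * c" by (metis of_real_eq_iff)
  then have "r = c" using r assms(3) by (metis abs_of_nonneg real_sqrt_abs2)
  then show ?thesis using r chu by (simp add: ppart_def A_def u_def ch_scaleR ch_add)
qed

lemma B_ppart: "sa d \<Longrightarrow> d \<in> B \<Longrightarrow> c \<ge> 0 \<Longrightarrow> ppart (d - of_real c) \<in> B"
  by (intro BI A_ppart F_ppart sa_diff sa_of_real F_closed_ops) (auto intro: B_A B_F)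

lemma B_ppart0: "sa d \<Longrightarrow> d \<in> B \<Longrightarrow> ppart d \<in> B"
  using B_ppart[of d 0] by simp

section \<open>The conditional expectation and the Hilbert module norm\<close>

definition E :: "'u \<Rightarrow> 'u" where "E x = hmean (\<lambda>g. act g x)"

lemma E_add: "E (x + y) = E x + E y" by (simp add: E_def act_add hmean_add act_cont)
lemma E_diff: "E (x - y) = E x - E y" by (simp add: E_def act_diff hmean_diff act_cont)
lemma E_scaleR: "E (r *\<^sub>R x) = r *\<^sub>R E x" by (simp add: E_def act_scaleR hmean_scaleR act_cont)
lemma E_scaleC: "E (c *\<^sub>C x) = c *\<^sub>C E x"
  by (simp add: E_def act_scaleC hmean_linear[OF act_cont bounded_linear_scaleC])
lemma E_star: "E (star x) = star (E x)"
  by (simp add: E_def act_star hmean_linear[OF act_cont bounded_linear_star])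
lemma E_left: "f \<in> F \<Longrightarrow> E (f * x) = f * E x"
  by (simp add: E_def act_mult F_D hmean_linear[OF act_cont bounded_linear_mult_right])
lemma E_right: "f \<in> F \<Longrightarrow> E (x * f) = E x * f"
  by (simp add: E_def act_mult F_D hmean_linear[OF act_cont bounded_linear_mult_left])
lemma E_fixed: "f \<in> F \<Longrightarrow> E f = f" by (simp add: E_def F_D)
lemma E_0 [simp]: "E 0 = 0" by (simp add: E_def)
lemma E_sum: "E (\<Sum>i\<in>I. f i) = (\<Sum>i\<in>I. E (f i))"
  by (induction I rule: infinite_finite_induct) (auto simp: E_add)

lemma E_in_F: "E x \<in> F"
proof -
  have "act s (E x) = E x" for s
  proof -
    have "act s (E x) = hmean (\<lambda>g. act s (act g x))"
      unfolding E_def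
      by (rule hmean_linear[where T="act s" and F="\<lambda>g. act g x", OF act_cont bounded_linear_act, symmetric])
    also have "\<dots> = E x" unfolding E_def act_plus[symmetric] by (rule hmean_left_translate[OF act_cont])
    finally show ?thesis .
  qed
  then show ?thesis by (simp add: F_def)
qed

lemma E_act: "E (act s x) = E x"
  unfolding E_def act_plus[symmetric] by (rule hmean_right_translate[OF act_cont])

lemma ch_E: "ch (E x) = ch x"
  unfolding E_def hmean_linear[OF act_cont bounded_linear_ch, symmetric] by (simp add: ch_act)

lemma E_in_B: "x \<in> A \<Longrightarrow> E x \<in> B"
  using E_in_F by (auto intro!: BI simp: A_def ch_E)

lemma E_pos: "pos x \<Longrightarrow> pos (E x)"
  using hmean_closed_convex[OF act_cont pos_closed convex_pos] act_pos by (simp add: E_def)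

lemma E_mono: "x \<preceq> y \<Longrightarrow> E x \<preceq> E y"
  using E_pos[of "y - x"] by (simp add: E_diff)

lemma E_norm: "norm (E x) \<le> norm x"
  using hmean_norm_le[OF act_cont continuous_on_const, of x "norm x"] by (simp add: E_def)

lemma bounded_linear_E: "bounded_linear E"
  by (rule bounded_linear_intro[where K=1]) (auto simp: E_add E_scaleR E_norm)

text \<open>The length of \<open>x\<close> in the Hilbert module over \<open>F\<close> whose inner
  product of \<open>x\<close> and \<open>y\<close> is \<open>E (star x * y)\<close>. Right
  multiplication by \<open>f\<close> in \<open>F\<close> conjugates \<open>E (star x * x)\<close> by
  \<open>f\<close>.\<close>

definition N :: "'u \<Rightarrow> real" where "N x = sqrt (norm (E (star x * x)))"

lemma N_nonneg [simp]: "N x \<ge> 0" by (simp add: N_def)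
lemma N_sq: "(N x)\<^sup>2 = norm (E (star x * x))" by (simp add: N_def)
lemma N_0 [simp]: "N 0 = 0" by (simp add: N_def)

lemma N_leI: "norm (E (star x * x)) \<le> c\<^sup>2 \<Longrightarrow> c \<ge> 0 \<Longrightarrow> N x \<le> c"
  by (simp add: N_def real_le_lsqrt)

lemma N_monoI: "star x * x \<preceq> c\<^sup>2 *\<^sub>R (star y * y) \<Longrightarrow> c \<ge> 0 \<Longrightarrow> N x \<le> c * N y"
proof (rule N_leI)
  assume a: "star x * x \<preceq> c\<^sup>2 *\<^sub>R (star y * y)" "c \<ge> 0"
  have "norm (E (star x * x)) \<le> norm (E (c\<^sup>2 *\<^sub>R (star y * y)))"
    by (rule norm_mono[OF E_pos[OF star_mult_pos] E_mono[OF a(1)]])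
  then show "norm (E (star x * x)) \<le> (c * N y)\<^sup>2" by (simp add: E_scaleR power_mult_distrib N_sq)
  show "c * N y \<ge> 0" using a by simp
qed

lemma N_le_norm: "N x \<le> norm x"
  using E_norm[of "star x * x"] by (intro N_leI) (auto simp: cstar_identity)

lemma N_left: "N (a * x) \<le> norm a * N x"
proof (rule N_monoI)
  have "star x * (star a * a) * x \<preceq> (norm a)\<^sup>2 *\<^sub>R (star x * x)"
    by (rule conj_ple_norm) (simp_all add: sa_simps cstar_identity)
  then show "star (a * x) * (a * x) \<preceq> (norm a)\<^sup>2 *\<^sub>R (star x * x)" by (simp add: star_mult mult.assoc)
qed simp

lemma E_conj: "f \<in> F \<Longrightarrow> E (star f * x * f) = star f * E x * f"
  by (simp add: E_left E_right F_closed_ops)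

lemma N_right: "f \<in> F \<Longrightarrow> N (x * f) \<le> N x * norm f"
proof (rule N_leI)
  assume f: "f \<in> F"
  have "star (x * f) * (x * f) = star f * (star x * x) * f" by (simp add: star_mult mult.assoc)
  then have "norm (E (star (x * f) * (x * f))) = norm (star f * E (star x * x) * f)" using E_conj[OF f] by metis
  also have "\<dots> \<le> norm f * norm (E (star x * x)) * norm f"
    using norm_mult3[of "star f" "E (star x * x)" f] by simp
  finally show "norm (E (star (x * f) * (x * f))) \<le> (N x * norm f)\<^sup>2"
    by (simp add: power_mult_distrib N_sq) (simp add: power2_eq_square mult_ac)
qed simp

lemma N_fixed: "f \<in> F \<Longrightarrow> N f = norm f"
  by (simp add: N_def E_fixed F_closed_ops cstar_identity)

lemma N_scaleC: "N (c *\<^sub>C x) = cmod c * N x"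
proof -
  have "star (c *\<^sub>C x) * (c *\<^sub>C x) = (cnj c * c) *\<^sub>C (star x * x)"
    by (simp add: star_scaleC mult_scaleC scaleC_scaleC mult.commute)
  then show ?thesis by (simp add: N_def E_scaleC norm_scaleC norm_mult real_sqrt_mult)
qed

lemma N_minus: "N (- x) = N x" by (simp add: N_def star_minus)
lemma N_commute: "N (x - y) = N (y - x)" using N_minus[of "x - y"] by simp
lemma N_scaleR: "N (r *\<^sub>R x) = \<bar>r\<bar> * N x" by (simp add: scaleR_scaleC N_scaleC)

lemma N_triangle: "N (x + y) \<le> N x + N y"
proof -
  have *: "(N (x + y))\<^sup>2 \<le> (1 + t) * (N x)\<^sup>2 + (1 + 1/t) * (N y)\<^sup>2" if t: "t > 0" for t
  proof -
    have "E (star (x + y) * (x + y)) \<preceq> (1 + t) *\<^sub>R E (star x * x) + (1 + 1/t) *\<^sub>R E (star y * y)"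
      using E_mono[OF star_add_ple[OF t, of x y]] by (simp only: E_add E_scaleR)
    then have "(N (x + y))\<^sup>2 \<le> norm ((1 + t) *\<^sub>R E (star x * x) + (1 + 1/t) *\<^sub>R E (star y * y))"
      unfolding N_sq by (intro norm_mono E_pos star_mult_pos)
    also have "\<dots> \<le> norm ((1 + t) *\<^sub>R E (star x * x)) + norm ((1 + 1/t) *\<^sub>R E (star y * y))"
      by (rule norm_triangle_ineq)
    finally show ?thesis using t by (simp add: N_sq)
  qed
  have "(N (x + y))\<^sup>2 \<le> (N x + d + (N y + d))\<^sup>2" if d: "d > 0" for d
  proof -
    \<comment> \<open>The best weight is \<open>t = N y / N x\<close>; adding \<open>d > 0\<close>
      to both lengths keeps it meaningful when one of them is 0.\<close>
    define a b where "a = N x + d" and "b = N y + d"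
    have ab: "a > 0" "b > 0" "N x \<le> a" "N y \<le> b"
      using d N_nonneg[of x] N_nonneg[of y] by (auto simp: a_def b_def simp del: N_nonneg)
    have "(N (x + y))\<^sup>2 \<le> (1 + b/a) * (N x)\<^sup>2 + (1 + 1/(b/a)) * (N y)\<^sup>2" using ab by (intro *) simp
    also have "\<dots> \<le> (1 + b/a) * a\<^sup>2 + (1 + 1/(b/a)) * b\<^sup>2"
      using ab by (intro add_mono mult_left_mono power_mono) auto
    also have "\<dots> = (a + b)\<^sup>2" using ab by (simp add: field_simps power2_eq_square)
    finally show ?thesis by (simp add: a_def b_def)
  qed
  then have *: "N (x + y) \<le> N x + d + (N y + d)" if "d > 0" for d
    using power2_le_imp_le[of "N (x + y)" "N x + d + (N y + d)"] that by simp
  show ?thesis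
  proof (rule field_le_epsilon)
    fix e :: real assume "e > 0"
    then show "N (x + y) \<le> N x + N y + e" using *[of "e/2"] by simp
  qed
qed

lemma N_triangle_diff: "N (x - y) \<le> N x + N y"
  using N_triangle[of x "-y"] by (simp add: N_minus)

lemma N_diff_triangle: "N (x - z) \<le> N (x - y) + N (y - z)"
  using N_triangle[of "x - y" "y - z"] by simp

lemma N_abs_diff: "\<bar>N x - N y\<bar> \<le> N (x - y)"
  using N_triangle[of "x - y" y] N_triangle[of "y - x" x] N_commute[of x y] by simp

lemma N_row:
  assumes "norm (\<Sum>i\<in>I. s i * star (s i)) \<le> c"
  shows "(N (\<Sum>i\<in>I. s i * w i))\<^sup>2 \<le> c * (\<Sum>i\<in>I. (N (w i))\<^sup>2)"
proof -
  define x where "x = (\<Sum>i\<in>I. s i * w i)"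
  have c0: "c \<ge> 0" using assms norm_ge_zero order_trans by blast
  have *: "(N x)\<^sup>2 \<le> d * (\<Sum>i\<in>I. (N (w i))\<^sup>2)" if d: "d > c" for d
  proof -
    have "star x * x \<preceq> d *\<^sub>R (\<Sum>i\<in>I. star (w i) * w i)"
      unfolding x_def by (rule row_inequality) (use assms d c0 in auto)
    then have "E (star x * x) \<preceq> d *\<^sub>R (\<Sum>i\<in>I. E (star (w i) * w i))" using E_mono by (metis E_scaleR E_sum)
    then have "(N x)\<^sup>2 \<le> norm (d *\<^sub>R (\<Sum>i\<in>I. E (star (w i) * w i)))"
      unfolding N_sq by (intro norm_mono E_pos star_mult_pos)
    also have "\<dots> \<le> d * (\<Sum>i\<in>I. (N (w i))\<^sup>2)"
      using d c0 by (simp add: N_sq sum_norm_le mult_left_mono)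
    finally show ?thesis .
  qed
  let ?W = "\<Sum>i\<in>I. (N (w i))\<^sup>2"
  have W: "?W \<ge> 0" by (intro sum_nonneg) simp
  have "(N x)\<^sup>2 \<le> c * ?W"
  proof (rule field_le_epsilon)
    fix e :: real assume e: "e > 0"
    have "(N x)\<^sup>2 \<le> (c + e / (?W + 1)) * ?W" using e W by (intro *) (simp add: add_nonneg_pos)
    also have "e * (?W / (?W + 1)) \<le> e * 1" using e W by (intro mult_left_mono) (auto simp: divide_le_eq_1)
    then have "(c + e / (?W + 1)) * ?W \<le> c * ?W + e" by (simp add: algebra_simps)
    finally show "(N x)\<^sup>2 \<le> c * ?W + e" .
  qed
  then show ?thesis by (simp add: x_def)
qed

section \<open>Convolution\<close>

definition cv :: "('g \<Rightarrow> real) \<Rightarrow> 'u \<Rightarrow> 'u" where "cv f x = hmean (\<lambda>g. f g *\<^sub>R act g x)"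

lemma cv_cont: "continuous_on UNIV f \<Longrightarrow> continuous_on UNIV (\<lambda>g. f g *\<^sub>R act g x)"
  by (intro continuous_on_scaleR act_cont)

context
  fixes f :: "'g \<Rightarrow> real"
  assumes f: "continuous_on UNIV f"
begin

lemma cv_diff: "cv f (x - y) = cv f x - cv f y"
  by (simp add: cv_def act_diff scaleR_diff_right hmean_diff cv_cont f)
lemma cv_left: "b \<in> F \<Longrightarrow> cv f (b * x) = b * cv f x"
  using hmean_linear[OF cv_cont[OF f] bounded_linear_mult_right[of b], of x] by (simp add: cv_def act_mult F_D)
lemma cv_right: "b \<in> F \<Longrightarrow> cv f (x * b) = cv f x * b"
  using hmean_linear[OF cv_cont[OF f] bounded_linear_mult_left[of b], of x] by (simp add: cv_def act_mult F_D)
lemma cv_fixed: "b \<in> F \<Longrightarrow> cv f b = hmean f *\<^sub>R b"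
  using hmean_linear[OF f bounded_linear_scaleR_left[of b]] by (simp add: cv_def F_D)
lemma cv_A: "x \<in> A \<Longrightarrow> cv f x \<in> A"
  using hmean_linear[OF cv_cont[OF f] bounded_linear_ch, of x] by (simp add: cv_def A_def ch_scaleR ch_act)

text \<open>Integrate \<open>(act g x - f g z / c)\<^sup>* (act g x - f g z / c) \<ge> 0\<close>, where \<open>z = cv f x\<close>.\<close>

lemma cv_norm_le: "\<exists>K>0. \<forall>x. norm (cv f x) \<le> K * N x"
proof -
  define c where "c = hmean (\<lambda>g. (f g)\<^sup>2) + 1"
  have f2: "continuous_on UNIV (\<lambda>g. (f g)\<^sup>2)" by (intro continuous_intros f)
  have "hmean (\<lambda>g::'g. 0::real) \<le> hmean (\<lambda>g. (f g)\<^sup>2)" by (intro hmean_mono f2 continuous_intros) auto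
  then have c: "c \<ge> 1" by (simp add: c_def)
  have "norm (cv f x) \<le> sqrt c * N x" for x
  proof -
    define z where "z = cv f x"
    define P where "P g = act g (star x * x)" for g
    define Q where "Q g = star (f g *\<^sub>R act g x) * z + star z * (f g *\<^sub>R act g x)" for g
    define R where "R g = (f g)\<^sup>2 *\<^sub>R (star z * z)" for g
    have cP: "continuous_on UNIV P" unfolding P_def by (rule act_cont)
    have cQ: "continuous_on UNIV Q" unfolding Q_def by (intro continuous_intros cv_cont f)
    have cR: "continuous_on UNIV R" unfolding R_def by (intro continuous_intros f)
    have hP: "hmean P = E (star x * x)" by (simp add: P_def[abs_def] E_def)
    have hQ: "hmean Q = star z * z + star z * z"
    proof -
      have 1: "continuous_on UNIV (\<lambda>g. star (f g *\<^sub>R act g x))" by (intro continuous_intros cv_cont f)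
      have "hmean (\<lambda>g. star (f g *\<^sub>R act g x) * z) = star z * z"
        using hmean_linear[OF 1 bounded_linear_mult_left[of z]]
          hmean_linear[OF cv_cont[OF f] bounded_linear_star, of x] by (simp add: z_def cv_def)
      moreover have "hmean (\<lambda>g. star z * (f g *\<^sub>R act g x)) = star z * z"
        using hmean_linear[OF cv_cont[OF f] bounded_linear_mult_right[of "star z"], of x] by (simp add: z_def cv_def)
      ultimately show ?thesis unfolding Q_def
        by (subst hmean_add) (auto intro!: continuous_intros cv_cont f act_cont)
    qed
    have hR: "hmean R = (c - 1) *\<^sub>R (star z * z)"
      using hmean_linear[OF f2 bounded_linear_scaleR_left[of "star z * z"]] by (simp add: R_def[abs_def] c_def)
    define H where "H g = P g + ((-1/c) *\<^sub>R Q g + (1/c\<^sup>2) *\<^sub>R R g)" for g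
    have "H g = star (act g x - (1/c) *\<^sub>R (f g *\<^sub>R z)) * (act g x - (1/c) *\<^sub>R (f g *\<^sub>R z))" for g
      by (simp add: H_def P_def Q_def R_def act_mult act_star star_diff star_scaleR algebra_simps power2_eq_square)
    then have "pos (H g)" for g by simp
    moreover have cH: "continuous_on UNIV H" unfolding H_def by (intro continuous_intros cP cQ cR)
    ultimately have "pos (hmean H)" using hmean_closed_convex[OF cH pos_closed convex_pos] by simp
    moreover have "hmean H = hmean P + ((-1/c) *\<^sub>R hmean Q + (1/c\<^sup>2) *\<^sub>R hmean R)"
      unfolding H_def by (subst hmean_add hmean_scaleR, intro continuous_intros cP cQ cR, (intro continuous_intros cP cQ cR)?)+ simp
    ultimately have p: "pos (E (star x * x) + ((-2/c + (c - 1)/c\<^sup>2) *\<^sub>R (star z * z)))"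
      unfolding hP hQ hR scaleR_2[symmetric] scaleR_scaleR scaleR_add_left[symmetric] by (simp add: mult.commute)
    have "-2/c + (c - 1)/c\<^sup>2 \<le> -1/c" using c by (simp add: field_simps power2_eq_square)
    then have "pos (((-1/c) - (-2/c + (c - 1)/c\<^sup>2)) *\<^sub>R (star z * z))" by (intro pos_scaleR) auto
    from pos_add[OF p this] have "pos (E (star x * x) - (1/c) *\<^sub>R (star z * z))"
      unfolding add.assoc scaleR_add_left[symmetric] by (simp add: algebra_simps)
    then have "norm ((1/c) *\<^sub>R (star z * z)) \<le> norm (E (star x * x))" using c by (intro norm_mono pos_scaleR) auto
    then have "(norm z)\<^sup>2 \<le> c * (N x)\<^sup>2" using c by (simp add: N_sq cstar_identity field_simps)
    then have "(norm z)\<^sup>2 \<le> (sqrt c * N x)\<^sup>2" using c by (simp add: power_mult_distrib)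
    then show ?thesis using c by (simp add: z_def)
  qed
  then show ?thesis using c by (intro exI[of _ "sqrt c"]) auto
qed

text \<open>\<open>f\<close> is a probability density, and the \<open>f\<close>-average of the
  positive elements \<open>star (act g x - z) * (act g x - z)\<close>, with
  \<open>z = cv f x\<close>, is the variance. So \<open>star z * z\<close> is at most the
  \<open>f\<close>-average of the translates of \<open>star x * x\<close>, and \<open>E\<close> does
  not see translations.\<close>

lemma cv_N_le:
  assumes f0: "\<And>g. f g \<ge> 0" and f1: "hmean f = 1"
  shows "N (cv f x) \<le> N x"
proof -
  define z where "z = cv f x"
  define P where "P g = f g *\<^sub>R act g (star x * x)" for g
  define Q where "Q g = star (f g *\<^sub>R act g x) * z + star z * (f g *\<^sub>R act g x)" for g
  define R where "R g = f g *\<^sub>R (star z * z)" for g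
  have cP: "continuous_on UNIV P" unfolding P_def by (intro cv_cont f)
  have cQ: "continuous_on UNIV Q" unfolding Q_def by (intro continuous_intros cv_cont f)
  have cR: "continuous_on UNIV R" unfolding R_def by (intro continuous_intros f)
  have hQ: "hmean Q = star z * z + star z * z"
  proof -
    have 1: "continuous_on UNIV (\<lambda>g. star (f g *\<^sub>R act g x))" by (intro continuous_intros cv_cont f)
    have "hmean (\<lambda>g. star (f g *\<^sub>R act g x) * z) = star z * z"
      using hmean_linear[OF 1 bounded_linear_mult_left[of z]]
        hmean_linear[OF cv_cont[OF f] bounded_linear_star, of x] by (simp add: z_def cv_def)
    moreover have "hmean (\<lambda>g. star z * (f g *\<^sub>R act g x)) = star z * z"
      using hmean_linear[OF cv_cont[OF f] bounded_linear_mult_right[of "star z"], of x] by (simp add: z_def cv_def)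
    ultimately show ?thesis unfolding Q_def
      by (subst hmean_add) (auto intro!: continuous_intros cv_cont f act_cont)
  qed
  have hR: "hmean R = star z * z"
    using hmean_linear[OF f bounded_linear_scaleR_left[of "star z * z"]] f1 by (simp add: R_def[abs_def])
  define H where "H g = (P g - Q g) + R g" for g
  have "H g = f g *\<^sub>R (star (act g x - z) * (act g x - z))" for g
    by (simp add: H_def P_def Q_def R_def act_mult act_star star_diff star_scaleR algebra_simps)
  then have "pos (H g)" for g using f0 by (simp add: pos_scaleR)
  moreover have cH: "continuous_on UNIV H" unfolding H_def by (intro continuous_intros cP cQ cR)
  ultimately have "pos (hmean H)" using hmean_closed_convex[OF cH pos_closed convex_pos] by simp
  moreover have "hmean H = (hmean P - hmean Q) + hmean R"
    unfolding H_def by (simp add: hmean_add hmean_diff continuous_on_diff cP cQ cR)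
  ultimately have "star z * z \<preceq> hmean P" unfolding hQ hR by simp
  then have "E (star z * z) \<preceq> E (hmean P)" by (rule E_mono)
  moreover have "E (hmean P) = hmean (\<lambda>g. E (P g))" by (rule hmean_linear[OF cP bounded_linear_E, symmetric])
  moreover have "\<dots> = E (star x * x)"
    using hmean_linear[OF f bounded_linear_scaleR_left[of "E (star x * x)"]] f1 by (simp add: P_def E_scaleR E_act)
  ultimately have "E (star z * z) \<preceq> E (star x * x)" by simp
  then show ?thesis unfolding N_def z_def[symmetric] by (intro real_sqrt_le_mono norm_mono E_pos star_mult_pos)
qed

end

lemma cv_approx:
  assumes "e > 0"
  shows "\<exists>f. continuous_on UNIV f \<and> (\<forall>g. f g \<ge> 0) \<and> hmean f = 1 \<and> norm (cv f x - x) \<le> e"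
proof -
  \<comment> \<open>The bump is cut from the displacement of \<open>x\<close> itself: it vanishes
    wherever \<open>act g x\<close> is farther than \<open>e\<close> from \<open>x\<close>, so no
    neighbourhood of 0 has to be chosen.\<close>
  define b where "b g = max 0 (e - norm (act g x - x))" for g
  have cb: "continuous_on UNIV b" unfolding b_def by (intro continuous_intros act_cont)
  have "b 0 > 0" using assms by (simp add: b_def act_zero)
  then have hb: "hmean b > 0" using hmean_pos[OF cb, of 0] by (auto simp: b_def)
  define f where "f g = (1 / hmean b) * b g" for g
  have cf: "continuous_on UNIV f" unfolding f_def by (intro continuous_intros cb)
  have f0: "f g \<ge> 0" for g using hb by (simp add: f_def b_def)
  have f1: "hmean f = 1" using hmean_scaleR[OF cb, of "1 / hmean b"] hb by (simp add: f_def[abs_def])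
  have "cv f x - x = hmean (\<lambda>g. f g *\<^sub>R act g x) - hmean (\<lambda>g. f g *\<^sub>R x)"
    using hmean_linear[OF cf bounded_linear_scaleR_left[of x]] f1 by (simp add: cv_def)
  also have "\<dots> = hmean (\<lambda>g. f g *\<^sub>R (act g x - x))"
    by (subst hmean_diff[symmetric]) (auto intro!: continuous_intros cv_cont cf act_cont simp: scaleR_diff_right)
  also have "norm \<dots> \<le> hmean (\<lambda>g. e * f g)"
  proof (rule hmean_norm_le)
    fix g
    have "norm (act g x - x) \<le> e \<or> f g = 0" by (auto simp: f_def b_def)
    then show "norm (f g *\<^sub>R (act g x - x)) \<le> e * f g"
      using f0[of g] by (auto simp: mult.commute[of e] intro: mult_left_mono)
  qed (intro continuous_intros cf act_cont)+
  also have "\<dots> = e" using hmean_scaleR[OF cf, of e] f1 by simp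
  finally show ?thesis using cf f0 f1 by blast
qed

text \<open>By \<open>cv_norm_le\<close> every convolution of \<open>x\<close> vanishes, yet some
  convolutions approximate \<open>x\<close>. This is the faithfulness of \<open>E\<close>.\<close>

lemma N_zeroD: "N x = 0 \<Longrightarrow> x = 0"
proof -
  assume N: "N x = 0"
  have "norm x \<le> e" if e: "e > 0" for e
  proof -
    obtain f where f: "continuous_on UNIV f" "norm (cv f x - x) \<le> e" using cv_approx[OF e] by blast
    obtain K where "norm (cv f x) \<le> K * N x" using cv_norm_le[OF f(1)] by blast
    then show ?thesis using f N by simp
  qed
  then show ?thesis using field_le_epsilon[of "norm x" 0] by simp
qed

lemma E_zeroD: "E (star x * x) = 0 \<Longrightarrow> x = 0"
  using N_zeroD[of x] by (simp add: N_def)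

end

section \<open>Excising sequences\<close>

text \<open>The assumption \<open>minimal\<close> says that strictly convergent sequences that asymptotically commute with \<open>B\<close>
  converge to scalars; the limits are the multipliers of \<open>A\<close> that commute with \<open>B\<close>.\<close>

locale simple_action = unitized_action act ch
  for act :: "'g::topological_group_add \<Rightarrow> 'u::unital_cstar \<Rightarrow> 'u" and ch +
  assumes simple_B: "\<And>I. I \<subseteq> B \<Longrightarrow> closed I \<Longrightarrow> 0 \<in> I \<Longrightarrow> (\<And>x y. x \<in> I \<Longrightarrow> y \<in> I \<Longrightarrow> x + y \<in> I) \<Longrightarrow>
      (\<And>c x. x \<in> I \<Longrightarrow> c *\<^sub>C x \<in> I) \<Longrightarrow> (\<And>b x. b \<in> B \<Longrightarrow> x \<in> I \<Longrightarrow> b * x \<in> I) \<Longrightarrow>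
      (\<And>b x. b \<in> B \<Longrightarrow> x \<in> I \<Longrightarrow> x * b \<in> I) \<Longrightarrow> I = {0} \<or> I = B"
    and B_nonzero: "\<exists>b\<in>B. b \<noteq> 0"
    and separable: "\<exists>D::nat \<Rightarrow> 'u. (\<forall>n. D n \<in> A) \<and> (\<forall>x\<in>A. \<forall>e>0. \<exists>n. norm (x - D n) < e)"
    and minimal: "\<And>S::nat \<Rightarrow> 'u. (\<And>k. S k \<in> A) \<Longrightarrow> bounded (range S) \<Longrightarrow>
      (\<And>x. x \<in> A \<Longrightarrow> convergent (\<lambda>k. S k * x)) \<Longrightarrow> (\<And>x. x \<in> A \<Longrightarrow> convergent (\<lambda>k. x * S k)) \<Longrightarrow>
      (\<And>b. b \<in> B \<Longrightarrow> (\<lambda>k. S k * b - b * S k) \<longlonglongrightarrow> 0) \<Longrightarrow> \<exists>c. \<forall>x\<in>A. (\<lambda>k. S k * x) \<longlonglongrightarrow> c *\<^sub>C x"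
begin

section \<open>Localization inside \<open>B\<close> and flatness\<close>

definition valid :: "'u \<Rightarrow> bool" where
  "valid e \<longleftrightarrow> e \<in> B \<and> pos e \<and> norm e = 1 \<and> (\<exists>p\<in>B. pos p \<and> norm p = 1 \<and> e * p = p \<and> p * e = p)"

text \<open>The part of \<open>B\<close> on which \<open>e\<close> acts as a unit; for a positive
  contraction it lies under the spectral projection of \<open>e\<close> at 1, which need not belong
  to \<open>B\<close>. The element \<open>p\<close> in \<open>valid\<close> keeps
  \<open>loc e\<close> nonzero, so that one can go on below \<open>e\<close>.\<close>

definition loc :: "'u \<Rightarrow> 'u set" where "loc e = {d \<in> B. e * d = d \<and> d * e = d}"

lemma locD: "d \<in> loc e \<Longrightarrow> d \<in> B" "d \<in> loc e \<Longrightarrow> e * d = d" "d \<in> loc e \<Longrightarrow> d * e = d"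
  by (auto simp: loc_def)

lemma loc_trans: "d \<in> loc e' \<Longrightarrow> e' \<in> loc e \<Longrightarrow> d \<in> loc e"
  unfolding loc_def by (auto simp: mult.assoc) (metis mult.assoc)+

text \<open>A norm one element \<open>d\<close> need not be valid, but its truncation at a level
  \<open>c\<close> is, and the price \<open>1 / c^2\<close> tends to 1 with \<open>c\<close>. The
  last clause holds because \<open>x * d = 0\<close> implies \<open>x * e = 0\<close>; this is used
  for \<open>x = z - 1\<close> and \<open>x = star z - 1\<close>.\<close>

lemma valid_below:
  assumes d: "d \<in> B" "pos d" "norm d = 1" and c: "0 < c" "c < 1"
  shows "\<exists>e. valid e \<and> c\<^sup>2 *\<^sub>R (e * e) \<preceq> d * d \<and> (\<forall>z. d \<in> loc z \<longrightarrow> e \<in> loc z)"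
proof -
  define p e where "p = ppart (d - of_real c)" and "e = (1/c) *\<^sub>R (d - p)"
  note sc = spectral_cut[OF d(2,3) c, folded p_def, folded e_def]
  have pB: "p \<in> B" unfolding p_def using B_ppart[OF pos_sa[OF d(2)] d(1)] c by simp
  then have eB: "e \<in> B" unfolding e_def using d by (intro B_closed_ops)
  have "valid e" unfolding valid_def
  proof (intro conjI bexI[of _ "(1 / norm p) *\<^sub>R p"])
    show "pos ((1 / norm p) *\<^sub>R p)" "norm ((1 / norm p) *\<^sub>R p) = 1" using sc by (auto intro: pos_scaleR)
  qed (use sc eB pB in \<open>auto intro: B_closed_ops\<close>)
  moreover have "e \<in> loc z" if "d \<in> loc z" for z
  proof -
    have 1: "x * e = 0" if x: "x * d = 0" for x
    proof -
      have "c\<^sup>2 *\<^sub>R (x * (e * e) * star x) \<preceq> x * (d * d) * star x"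
        using pos_conj'[OF sc(7), of x] by (simp add: algebra_simps)
      also have "x * (d * d) * star x = 0" using x by (simp flip: mult.assoc)
      finally have "- (c\<^sup>2 *\<^sub>R (x * (e * e) * star x)) = 0"
        using pos_antisym[of "- (c\<^sup>2 *\<^sub>R (x * (e * e) * star x))"] pos_scaleR[OF pos_conj'[OF sa_square_pos[OF pos_sa[OF sc(1)]]], of "c\<^sup>2" x]
        by simp
      then have "star (star (x * e)) * star (x * e) = 0"
        using c pos_star[OF sc(1)] by (simp add: star_mult star_star mult.assoc)
      then show ?thesis using star_mult_zero[of "star (x * e)"] by (metis star_star star_zero)
    qed
    have "star z * d = d" using pos_star[OF d(2)] locD(3)[OF that] by (metis star_mult)
    then have "(z - 1) * d = 0" "(star z - 1) * d = 0"
      using locD(2)[OF that] by (simp_all add: algebra_simps)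
    then have "(z - 1) * e = 0" "(star z - 1) * e = 0" using 1 by auto
    then have "z * e = e" "star z * e = e" by (simp_all add: algebra_simps)
    then have "z * e = e" "e * z = e" using pos_star[OF sc(1)] by (metis star_mult star_star)+
    then show ?thesis using eB by (simp add: loc_def)
  qed
  ultimately show ?thesis using sc(7) by blast
qed

lemma N_conj: "f \<in> F \<Longrightarrow> sa f \<Longrightarrow> (N (x * f))\<^sup>2 = norm (f * E (star x * x) * f)"
  using E_conj[of f "star x * x"] by (simp add: N_sq star_mult sa_def mult.assoc)

text \<open>Each of the two factors costs \<open>1 / c\<close>: the left one by monotonicity of
  \<open>E\<close>, the right one by \<open>norm_sandwich_mono\<close>.\<close>

lemma N_shrink:
  assumes "e \<in> F" "d \<in> F" "sa e" "sa d" "c > 0" "c\<^sup>2 *\<^sub>R (e * e) \<preceq> d * d"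
  shows "N (e * y * e) \<le> N (d * y * d) / c\<^sup>2"
proof -
  define Z Z' where "Z = E (star y * (e * e) * y)" and "Z' = E (star y * (d * d) * y)"
  have N: "(N (f * y * f))\<^sup>2 = norm (f * E (star y * (f * f) * y) * f)" if "f \<in> F" "sa f" for f
    using N_conj[of f "f * y"] that by (simp add: star_mult sa_def mult.assoc)
  have ple: "e * e \<preceq> (1/c\<^sup>2) *\<^sub>R (d * d)"
    using ple_scaleR[OF assms(6), of "1/c\<^sup>2"] assms(5) by simp
  have "Z \<preceq> (1/c\<^sup>2) *\<^sub>R Z'"
    using E_mono[OF ple_conj[OF ple, of y]] by (simp add: Z_def Z'_def E_scaleR)
  then have "d * Z * d \<preceq> (1/c\<^sup>2) *\<^sub>R (d * Z' * d)"
    using ple_conj_sa[OF _ assms(4)] by fastforce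
  moreover have Z: "pos Z" unfolding Z_def by (intro E_pos pos_conj sa_square_pos assms)
  ultimately have "norm (d * Z * d) \<le> norm ((1/c\<^sup>2) *\<^sub>R (d * Z' * d))" by (intro norm_mono pos_conj_sa assms)
  moreover have "norm (e * Z * e) \<le> (1/c\<^sup>2) * norm (d * Z * d)"
    by (rule norm_sandwich_mono[OF Z assms(3,4) ple]) simp
  ultimately have "norm (e * Z * e) \<le> (1/c\<^sup>2) * ((1/c\<^sup>2) * norm (d * Z' * d))"
    by (smt (verit) assms(5) mult_left_mono norm_scaleR abs_of_nonneg zero_le_power2 divide_nonneg_nonneg)
  then have "(N (e * y * e))\<^sup>2 \<le> (N (d * y * d) / c\<^sup>2)\<^sup>2"
    using N[OF assms(1,3)] N[OF assms(2,4)] by (simp add: Z_def Z'_def power_divide power2_eq_square)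
  then show ?thesis by (rule power2_le_imp_le) simp
qed

lemma N_sandwich: "f \<in> F \<Longrightarrow> N (a * y * f) \<le> norm a * N y * norm f"
  using N_right[of f "a * y"] N_left[of a y] by (meson mult_right_mono norm_ge_zero order_trans)

definition flat :: "'u \<Rightarrow> 'u \<Rightarrow> real \<Rightarrow> bool" where
  "flat e y \<delta> \<longleftrightarrow> (\<forall>d\<in>loc e. pos d \<longrightarrow> N (d * y * d) \<ge> (N (e * y * e) - \<delta>) * (norm d)\<^sup>2)"

lemma flat_below:
  assumes "valid e" "r > 0"
  shows "\<exists>e'. valid e' \<and> e' \<in> loc e \<and> flat e' y r"
proof -
  define S where "S = {N (e' * y * e') | e'. valid e' \<and> e' \<in> loc e}"
  have bd: "bdd_below S" by (intro bdd_belowI[of _ 0]) (auto simp: S_def)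
  obtain p where p: "p \<in> B" "pos p" "norm p = 1" "p \<in> loc e"
    using assms(1) by (auto simp: valid_def loc_def)
  obtain e1 where "valid e1" "e1 \<in> loc e" using valid_below[OF p(1-3), of "1/2"] p(4) by auto
  then have "S \<noteq> {}" by (auto simp: S_def)
  then obtain e' where e': "valid e'" "e' \<in> loc e" "N (e' * y * e') < Inf S + r/2"
    using cInf_lessD[of S "Inf S + r/2"] assms(2) by (auto simp: S_def)
  have unit: "N (d * y * d) \<ge> N (e' * y * e') - r" if d: "d \<in> loc e'" "pos d" "norm d = 1" for d
  proof (rule ccontr)
    assume "\<not> ?thesis"
    then have less: "N (d * y * d) < N (e' * y * e') - r" by simp
    define M where "M = N (d * y * d)"
    \<comment> \<open>A \<open>d\<close> that violates flatness is not itself valid, so it is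
      truncated at a level with \<open>1 / c^2 = k\<close>. The choice gives
      \<open>M k \<le> M + r/2\<close>, which is still below the infimum; the 1 in the denominator
      allows for \<open>M = 0\<close>.\<close>
    define k where "k = 1 + r / (2 * (M + 1))"
    have M: "M \<ge> 0" by (simp add: M_def)
    then have k: "k > 1" using assms(2) by (simp add: k_def)
    define c where "c = 1 / sqrt k"
    have c: "0 < c" "c < 1" "1 / c\<^sup>2 = k" using k by (auto simp: c_def power_divide)
    obtain e2 where e2: "valid e2" "c\<^sup>2 *\<^sub>R (e2 * e2) \<preceq> d * d" "e2 \<in> loc e'"
      using valid_below[OF locD(1)[OF d(1)] d(2,3) c(1,2)] d(1) by blast
    have "N (e2 * y * e2) \<le> M / c\<^sup>2" unfolding M_def
      using e2 d by (intro N_shrink pos_sa c) (auto simp: valid_def intro: B_F locD)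
    also have "M / c\<^sup>2 = M * k" using c(3) by (metis times_divide_eq_right mult.right_neutral)
    also have "\<dots> \<le> M + r/2"
    proof -
      have "r * (M / (M + 1)) \<le> r * 1" using M assms(2) by (intro mult_left_mono) auto
      then show ?thesis using M by (simp add: k_def field_simps)
    qed
    also have "\<dots> < Inf S" using less e'(3) by (simp add: M_def)
    finally have "N (e2 * y * e2) < Inf S" .
    moreover have "N (e2 * y * e2) \<in> S" using e2 e'(2) loc_trans by (auto simp: S_def)
    ultimately show False using cInf_lower[OF _ bd] by fastforce
  qed
  have "flat e' y r" unfolding flat_def
  proof (intro ballI impI)
    fix d assume d: "d \<in> loc e'" "pos d"
    show "(N (e' * y * e') - r) * (norm d)\<^sup>2 \<le> N (d * y * d)"
    proof (cases "d = 0")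
      case False
      define d1 where "d1 = (1 / norm d) *\<^sub>R d"
      have dd: "d = norm d *\<^sub>R d1" "norm d1 = 1" using False by (auto simp: d1_def)
      have "N (d1 * y * d1) \<ge> N (e' * y * e') - r"
        using d dd by (intro unit) (auto simp: d1_def loc_def intro: B_closed_ops pos_scaleR)
      moreover have "N (d * y * d) = (norm d)\<^sup>2 * N (d1 * y * d1)"
        by (subst (1 2) dd(1)) (simp add: N_scaleR power2_eq_square abs_mult)
      ultimately show ?thesis by (simp add: mult.commute mult_left_mono)
    qed simp
  qed
  then show ?thesis using e' by blast
qed

lemma exists_valid: "\<exists>e. valid e"
proof -
  obtain b where b: "b \<in> B" "b \<noteq> 0" using B_nonzero by blast
  define d where "d = (1 / (norm b)\<^sup>2) *\<^sub>R (star b * b)"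
  have "d \<in> B" "pos d" "norm d = 1"
    using b by (auto simp: d_def cstar_identity intro!: B_closed_ops B_F pos_scaleR)
  then show ?thesis using valid_below[of d "1/2"] by auto
qed

lemma flat_sequence_exists:
  "\<exists>e. (\<forall>n. valid (e n)) \<and> (\<forall>n. e (Suc n) \<in> loc (e n)) \<and> (\<forall>y\<in>A. \<forall>r>0. \<exists>n. flat (e n) y r)"
proof -
  obtain Y :: "nat \<Rightarrow> 'u" where Y: "\<And>n. Y n \<in> A" "\<And>x e. x \<in> A \<Longrightarrow> e > 0 \<Longrightarrow> \<exists>n. norm (x - Y n) < e"
    using separable by blast
  \<comment> \<open>Stage \<open>n\<close> treats the pair of a dense element and a precision coded
    by \<open>n\<close>. Replacing the dense element by a neighbour at distance \<open>r/3\<close>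
    costs \<open>r/3\<close> on each side of the flatness inequality, which leaves
    \<open>r/3\<close> for the precision.\<close>
  define Q where "Q n e e' \<longleftrightarrow> e' \<in> loc e \<and> flat e' (Y (fst (prod_decode n))) (1 / real (Suc (snd (prod_decode n))))" for n e e'
  have "\<exists>e. \<forall>n. valid (e n) \<and> Q n (e n) (e (Suc n))"
  proof (rule dependent_nat_choice)
    show "\<exists>e. valid e" by (rule exists_valid)
    fix e n assume "valid e"
    then show "\<exists>e'. valid e' \<and> Q n e e'" unfolding Q_def using flat_below[of e] by simp
  qed
  then obtain e where e: "\<And>n. valid (e n)" "\<And>n. Q n (e n) (e (Suc n))" by blast
  have "\<exists>n. flat (e n) y r" if y: "y \<in> A" "r > 0" for y r
  proof -
    obtain k where k: "norm (y - Y k) < r/3" using Y(2)[OF y(1), of "r/3"] y(2) by auto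
    obtain j where j: "1 / real (Suc j) < r/3" using nat_approx_posE[of "r/3"] y(2) by auto
    define n where "n = Suc (prod_encode (k, j))"
    have fl: "flat (e n) (Y k) (1 / real (Suc j))"
      using e(2)[of "prod_encode (k, j)"] by (simp add: n_def Q_def)
    have close: "\<bar>N (f * y * f) - N (f * Y k * f)\<bar> \<le> r/3 * (norm f)\<^sup>2" if f: "f \<in> B" for f
    proof -
      have "\<bar>N (f * y * f) - N (f * Y k * f)\<bar> \<le> N (f * (y - Y k) * f)"
        using N_abs_diff[of "f * y * f" "f * Y k * f"] by (simp add: algebra_simps)
      also have "\<dots> \<le> norm f * N (y - Y k) * norm f" by (rule N_sandwich[OF B_F[OF f]])
      also have "\<dots> \<le> norm f * (r/3) * norm f"
        using k N_le_norm[of "y - Y k"] by (intro mult_right_mono mult_left_mono) auto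
      finally show ?thesis by (simp add: power2_eq_square mult_ac)
    qed
    have "flat (e n) y r" unfolding flat_def
    proof (intro ballI impI)
      fix d assume d: "d \<in> loc (e n)" "pos d"
      have 1: "(N (e n * Y k * e n) - 1 / real (Suc j)) * (norm d)\<^sup>2 \<le> N (d * Y k * d)"
        using fl d by (simp add: flat_def)
      have 2: "N (e n * y * e n) - r/3 \<le> N (e n * Y k * e n)"
      proof -
      have "e n \<in> B" "norm (e n) = 1" using e(1)[of n] by (auto simp: valid_def)
      then show ?thesis using close[of "e n"] unfolding abs_le_iff by simp
    qed
      have "(N (e n * y * e n) - r) * (norm d)\<^sup>2 \<le> (N (e n * Y k * e n) - 1 / real (Suc j) - r/3) * (norm d)\<^sup>2"
        using 2 j by (intro mult_right_mono) auto
      also have "\<dots> \<le> N (d * Y k * d) - r/3 * (norm d)\<^sup>2" using 1 by (simp add: algebra_simps)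
      also have "\<dots> \<le> N (d * y * d)" using close[OF locD(1)[OF d(1)]] unfolding abs_le_iff by simp
      finally show "(N (e n * y * e n) - r) * (norm d)\<^sup>2 \<le> N (d * y * d)" .
    qed
    then show ?thesis ..
  qed
  then show ?thesis using e unfolding Q_def by (intro exI[of _ e]) blast
qed

end

locale excising_sequence = simple_action act ch
  for act :: "'g::topological_group_add \<Rightarrow> 'u::unital_cstar \<Rightarrow> 'u" and ch +
  fixes e :: "nat \<Rightarrow> 'u"
  assumes e_valid: "valid (e n)" and e_loc: "e (Suc n) \<in> loc (e n)"
    and e_flat: "y \<in> A \<Longrightarrow> \<delta> > 0 \<Longrightarrow> \<exists>n. flat (e n) y \<delta>"
begin

lemma e_B: "e n \<in> B" and e_pos: "pos (e n)" and e_norm [simp]: "norm (e n) = 1"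
  using e_valid[of n] by (auto simp: valid_def)

lemma e_F: "e n \<in> F" by (rule B_F[OF e_B])
lemma e_sa: "sa (e n)" by (rule pos_sa[OF e_pos])
lemma e_star [simp]: "star (e n) = e n" by (rule pos_star[OF e_pos])
lemma e2_norm [simp]: "norm (e n * e n) = 1" using sa_norm_square[OF e_sa, of n] by simp

lemma e_loc_less: "m < n \<Longrightarrow> e n \<in> loc (e m)"
proof (induction n)
  case (Suc n)
  then show ?case by (cases "m = n") (auto intro: e_loc loc_trans)
qed simp

lemma e_mult: "m < n \<Longrightarrow> e m * e n = e n" "m < n \<Longrightarrow> e n * e m = e n"
  using e_loc_less locD by blast+

lemma e_mult': "m < n \<Longrightarrow> e m * (e n * z) = e n * z" "m < n \<Longrightarrow> e n * (e m * z) = e n * z"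
  by (metis e_mult mult.assoc)+

section \<open>Excision and the functional \<open>\<phi>\<close>\<close>

abbreviation dev :: "nat \<Rightarrow> 'u \<Rightarrow> complex \<Rightarrow> 'u" where
  "dev j z c \<equiv> e j * z * e j - c *\<^sub>C (e j * e j)"

definition ex :: "'u \<Rightarrow> complex \<Rightarrow> bool" where
  "ex z l \<longleftrightarrow> (\<lambda>j. dev j z l) \<longlonglongrightarrow> 0"

lemma ex_unique: "ex z l \<Longrightarrow> ex z l' \<Longrightarrow> l = l'"
proof -
  assume "ex z l" "ex z l'"
  then have "(\<lambda>j. (dev j z l) - (dev j z l')) \<longlonglongrightarrow> 0 - 0"
    unfolding ex_def by (intro tendsto_diff)
  then have "(\<lambda>j. (l' - l) *\<^sub>C (e j * e j)) \<longlonglongrightarrow> 0" by (simp add: scaleC_diff_left)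
  then have "(\<lambda>j. norm ((l' - l) *\<^sub>C (e j * e j))) \<longlonglongrightarrow> 0" by (rule tendsto_norm_zero)
  then have "cmod (l' - l) = 0" by (simp add: norm_scaleC LIMSEQ_const_iff)
  then show ?thesis by simp
qed

lemma ex_add: "ex z l \<Longrightarrow> ex z' l' \<Longrightarrow> ex (z + z') (l + l')"
  unfolding ex_def
  using tendsto_add[of "\<lambda>j. dev j z l" 0 sequentially "\<lambda>j. dev j z' l'" 0]
  by (simp add: algebra_simps scaleC_add_left)

lemma ex_scaleC: "ex z l \<Longrightarrow> ex (c *\<^sub>C z) (c * l)"
  unfolding ex_def
  using tendsto_scaleC[OF tendsto_const, of "\<lambda>j. dev j z l" 0 sequentially c]
  by (simp add: scaleC_diff_right mult_scaleC scaleC_scaleC)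

lemma ex_star: "ex z l \<Longrightarrow> ex (star z) (cnj l)"
  unfolding ex_def
  using tendsto_star[of "\<lambda>j. dev j z l" 0 sequentially]
  by (simp add: star_diff star_mult star_scaleC mult.assoc)

lemma ex_act: "ex z l \<Longrightarrow> ex (act g z) l"
  unfolding ex_def
  using bounded_linear.tendsto[OF bounded_linear_act, of "\<lambda>j. dev j z l" 0 sequentially g]
  by (simp add: act_diff act_mult act_scaleC F_D[OF e_F])

lemma ex_E: "ex z l \<Longrightarrow> ex (E z) l"
  unfolding ex_def
  using bounded_linear.tendsto[OF bounded_linear_E, of "\<lambda>j. dev j z l" 0 sequentially]
  by (simp add: E_diff E_scaleC E_fixed F_closed_ops e_F E_left E_right)

lemma ex_one: "ex 1 1" by (simp add: ex_def)
lemma ex_zero: "ex 0 0" by (simp add: ex_def)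

lemma ex_approx:
  assumes "\<And>eps. eps > 0 \<Longrightarrow> \<exists>l. \<forall>\<^sub>s j. norm (dev j z l) \<le> eps"
  shows "\<exists>l. ex z l"
proof -
  have "\<forall>n. \<exists>l. \<forall>\<^sub>s j. norm (dev j z l) \<le> 1 / real (Suc n)"
    using assms by simp
  then obtain l where l: "\<And>n. \<forall>\<^sub>s j. norm (dev j z (l n)) \<le> 1 / real (Suc n)" by metis
  have diff: "cmod (l n - l m) \<le> 1 / real (Suc n) + 1 / real (Suc m)" for n m
  proof -
    obtain j where j: "norm (dev j z (l n)) \<le> 1 / real (Suc n)" "norm (dev j z (l m)) \<le> 1 / real (Suc m)"
      using eventually_happens[OF eventually_conj[OF l[of n] l[of m]]] by auto
    have "norm ((l n - l m) *\<^sub>C (e j * e j)) \<le> norm (dev j z (l m)) + norm (dev j z (l n))"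
      using norm_triangle_ineq4[of "dev j z (l m)" "dev j z (l n)"]
      by (simp add: scaleC_diff_left)
    then show ?thesis using j by (simp add: norm_scaleC)
  qed
  have lim0: "(\<lambda>n. 1 / real (Suc n)) \<longlonglongrightarrow> 0" by (rule LIMSEQ_Suc[OF lim_1_over_n])
  have "Cauchy l"
  proof (rule metric_CauchyI)
    fix eps :: real assume "eps > 0"
    then obtain M where M: "\<And>n. n \<ge> M \<Longrightarrow> 1 / real (Suc n) < eps/2"
      using order_tendstoD(2)[OF lim0, of "eps/2"] by (auto simp: eventually_sequentially)
    have "dist (l m) (l n) < eps" if "m \<ge> M" "n \<ge> M" for m n
      using diff[of m n] M[OF that(1)] M[OF that(2)] by (simp add: dist_norm)
    then show "\<exists>M. \<forall>m\<ge>M. \<forall>n\<ge>M. dist (l m) (l n) < eps" by blast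
  qed
  then obtain L where L: "l \<longlonglongrightarrow> L" by (auto simp: Cauchy_convergent_iff convergent_def)
  have "ex z L" unfolding ex_def
  proof (rule tendstoI)
    fix eps :: real assume "eps > 0"
    have "\<forall>\<^sub>s n. 1 / real (Suc n) < eps/2 \<and> dist (l n) L < eps/2"
      using \<open>eps > 0\<close> by (intro eventually_conj order_tendstoD(2)[OF lim0] tendstoD[OF L]) auto
    then obtain n where n: "1 / real (Suc n) < eps/2" "dist (l n) L < eps/2" by (auto simp: eventually_sequentially)
    show "\<forall>\<^sub>s j. dist (dev j z L) 0 < eps"
      using l[of n]
    proof eventually_elim
      case (elim j)
      have "norm (dev j z L) \<le> norm (dev j z (l n)) + norm ((l n - L) *\<^sub>C (e j * e j))"
        by (rule order_trans[OF _ norm_triangle_ineq]) (simp add: scaleC_diff_left)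
      then show ?case using elim n by (simp add: norm_scaleC dist_norm)
    qed
  qed
  then show ?thesis ..
qed

text \<open>On \<open>loc (e n)\<close> a flat element is close to a scalar. If not, the positive part \<open>g\<close> of
  \<open>(m - 2r) d\<^sup>2 - d b d\<close> is nonzero, and \<open>d g\<^sup>2 d\<close> contradicts flatness.\<close>

lemma flat_excise:
  assumes b: "b \<in> B" "pos b" and fl: "flat (e n) b r" "r > 0" and d: "d \<in> loc (e n)" "pos d"
  defines "m \<equiv> norm (e n * b * e n)"
  shows "norm (d * b * d - m *\<^sub>R (d * d)) \<le> 2 * r * (norm d)\<^sup>2"
proof -
  have dB: "d \<in> B" and sad: "sa d" using d locD pos_sa by auto
  have Nm: "N (k * b * k) = norm (k * b * k)" if "k \<in> B" for k
    using that b by (intro N_fixed F_closed_ops B_F)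
  have dn: "e n * d = d" "d * e n = d" using d locD by auto
  have "d * b * d = d * (e n * b * e n) * d" by (simp add: mult.assoc dn) (simp add: dn flip: mult.assoc)
  also have "\<dots> \<preceq> m *\<^sub>R (d * d)"
    using conj_ple_norm[of "e n * b * e n" m d] b sad by (simp add: m_def sa_def pos_star star_mult mult.assoc)
  finally have up: "d * b * d \<preceq> m *\<^sub>R (d * d)" .
  define h where "h = (m - 2 * r) *\<^sub>R (d * d) - d * b * d"
  have hB: "h \<in> B" unfolding h_def using dB b by (intro B_closed_ops B_F)
  have sah: "sa h" unfolding h_def by (intro sa_diff sa_scaleR sa_mult pos_sa pos_conj_sa b sad) auto
  have low: "pos (- h)"
  proof (cases "m - 2 * r \<le> 0")
    case True
    have "- h = d * b * d + (2 * r - m) *\<^sub>R (d * d)" by (simp add: h_def algebra_simps)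
    then show ?thesis using True by (simp add: pos_add pos_conj_sa b sad pos_scaleR sa_square_pos)
  next
    case False
    define c where "c = m - 2 * r"
    have c: "c > 0" using False by (simp add: c_def)
    define g where "g = ppart h"
    note pp = ppart[OF sah, folded g_def]
    define t where "t = d * g"
    have st: "star t = g * d" using pos_star[OF pp(1)] pos_star[OF d(2)] by (simp add: t_def star_mult)
    have "star t * b * t - c *\<^sub>R (star t * t) = - (g * h * g)"
      unfolding st by (simp add: t_def h_def c_def algebra_simps)
    also have "g * h * g = g * g * g" using pp by simp
    finally have tt: "c *\<^sub>R (star t * t) - star t * b * t = g * g * g" by (simp add: algebra_simps)
    have g3: "pos (g * g * g)" using pp by (intro pos_mult sa_square_pos pos_sa) (simp_all add: mult.assoc)
    define k where "k = t * star t"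
    have gB: "g \<in> B" unfolding g_def by (rule B_ppart0[OF sah hB])
    have kB: "k \<in> B" unfolding k_def st unfolding t_def using dB gB by (intro B_mult)
    have k: "k = d * g * g * d" by (simp only: k_def st) (simp only: t_def mult.assoc)
    have "e n * k = k" unfolding k by (simp add: dn flip: mult.assoc)
    moreover have "k * e n = k" unfolding k by (simp add: dn mult.assoc)
    ultimately have kl: "k \<in> loc (e n)" using kB by (simp add: loc_def)
    have pk: "pos k" by (simp add: k_def)
    have "t * (star t * b * t) * star t \<preceq> t * (c *\<^sub>R (star t * t)) * star t"
    proof -
      have "pos (t * (c *\<^sub>R (star t * t) - star t * b * t) * star t)" unfolding tt by (rule pos_conj'[OF g3])
      then show ?thesis by (simp only: right_diff_distrib left_diff_distrib)
    qed
    then have "k * b * k \<preceq> c *\<^sub>R (k * k)" by (simp add: k_def mult.assoc)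
    then have "norm (k * b * k) \<le> norm (c *\<^sub>R (k * k))" by (intro norm_mono pos_conj_sa b pos_sa pk)
    then have "norm (k * b * k) \<le> c * (norm k)\<^sup>2" using c sa_norm_square[OF pos_sa[OF pk]] by simp
    moreover have "(m - r) * (norm k)\<^sup>2 \<le> norm (k * b * k)"
      using fl(1) kl pk Nm[OF kB] Nm[OF e_B] by (auto simp: flat_def m_def)
    ultimately have "r * (norm k)\<^sup>2 \<le> 0" by (simp add: c_def algebra_simps)
    then have "k = 0" using fl(2) by (simp add: mult_le_0_iff)
    then have "star t = 0" using star_mult_zero[of "star t"] by (simp add: k_def star_star)
    then have "t = 0" by (metis star_star star_zero)
    then have "(g * g) * (g * g) = 0" using tt by (metis diff_0_right mult.assoc mult_zero_left mult_zero_right scaleR_zero_right)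
    then have "g = 0" using pp(1) sa_square_zero sa_square_pos pos_sa by metis
    then show ?thesis using pp(2) by simp
  qed
  have dd: "d * d \<preceq> of_real ((norm d)\<^sup>2)"
    using sa_norm_square[OF sad] by (intro ple_norm sa_mult sad) auto
  show ?thesis
  proof (rule sa_norm_le)
    have "pos ((m *\<^sub>R (d * d) - d * b * d) + of_real (2 * r * (norm d)\<^sup>2))"
      using fl(2) by (intro pos_add up pos_of_real) auto
    then show "pos (of_real (2 * r * (norm d)\<^sup>2) - (d * b * d - m *\<^sub>R (d * d)))" by (simp add: algebra_simps)
    have "pos (- h + (2 * r) *\<^sub>R (of_real ((norm d)\<^sup>2) - d * d))"
      using fl(2) by (intro pos_add low pos_scaleR dd) auto
    then show "pos (of_real (2 * r * (norm d)\<^sup>2) + (d * b * d - m *\<^sub>R (d * d)))"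
      by (simp add: h_def of_real_def algebra_simps)
  qed
qed

lemma ex_B_pos: 
  assumes b: "b \<in> B" "pos b"
  shows "\<exists>l. ex b l"
proof (rule ex_approx)
  fix eps :: real assume eps: "eps > 0"
  obtain n where n: "flat (e n) b (eps/2)" using e_flat[OF B_A[OF b(1)], of "eps/2"] eps by auto
  have "\<forall>\<^sub>s j. norm (dev j b (of_real (norm (e n * b * e n)))) \<le> eps"
    using eventually_gt_at_top[of n]
  proof eventually_elim
    case (elim j)
    then show ?case using flat_excise[OF b n _ e_loc_less[OF elim] e_pos] eps by (simp add: scaleC_of_real)
  qed
  then show "\<exists>l. \<forall>\<^sub>s j. norm (dev j b l) \<le> eps" ..
qed

lemma ex_B: 
  assumes b: "b \<in> B"
  shows "\<exists>l. ex b l"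
proof -
  have sa: "\<exists>l. ex h l" if h: "h \<in> B" "sa h" for h
  proof -
    define g where "g = ppart h"
    have g: "g \<in> B" unfolding g_def by (rule B_ppart0[OF h(2,1)])
    obtain l l' where "ex g l" "ex (g - h) l'"
      using ex_B_pos[OF g] ex_B_pos[of "g - h"] ppart[OF h(2), folded g_def] B_closed_ops g h by metis
    then have "ex (g + (-1) *\<^sub>C (g - h)) (l + (-1) * l')" by (intro ex_add ex_scaleC)
    moreover have "g + (-1) *\<^sub>C (g - h) = h" by (simp add: scaleC_minus_left)
    ultimately show ?thesis by metis
  qed
  define x y where "x = b + star b" and "y = \<i> *\<^sub>C (b - star b)"
  have "sa x" "sa y" by (auto simp: x_def y_def sa_def star_add star_diff star_scaleC star_star
     scaleC_diff_right scaleC_minus_left)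
  moreover have "x \<in> B" "y \<in> B" unfolding x_def y_def using b by (auto intro: B_closed_ops)
  ultimately obtain l l' where "ex x l" "ex y l'" using sa by metis
  then have "ex ((1/2) *\<^sub>C (x + (-\<i>) *\<^sub>C y)) ((1/2) * (l + (-\<i>) * l'))" by (intro ex_add ex_scaleC)
  moreover have "(1/2) *\<^sub>C (x + (-\<i>) *\<^sub>C y) = b"
  proof -
    have "(-\<i>) *\<^sub>C y = b - star b" by (simp add: y_def scaleC_scaleC)
    then have "x + (-\<i>) *\<^sub>C y = 2 *\<^sub>C b" using scaleC_add_left[of 1 1 b] by (simp add: x_def)
    then show ?thesis by (simp add: scaleC_scaleC)
  qed
  ultimately show ?thesis by metis
qed

definition \<phi> :: "'u \<Rightarrow> complex" where "\<phi> z = (THE l. ex z l)"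

lemma \<phi>_eqI: "ex z l \<Longrightarrow> \<phi> z = l"
  unfolding \<phi>_def using ex_unique by blast

definition X :: "'u set" where "X = {z. \<exists>l. ex z l}"

lemma X_D: "z \<in> X \<Longrightarrow> ex z (\<phi> z)"
  unfolding X_def using \<phi>_eqI by auto

lemma B_X: "b \<in> B \<Longrightarrow> b \<in> X" using ex_B by (simp add: X_def)

lemma X_closed_ops: "0 \<in> X" "1 \<in> X" "z \<in> X \<Longrightarrow> w \<in> X \<Longrightarrow> z + w \<in> X" "z \<in> X \<Longrightarrow> c *\<^sub>C z \<in> X" "z \<in> X \<Longrightarrow> star z \<in> X"
  "z \<in> X \<Longrightarrow> act g z \<in> X" "z \<in> X \<Longrightarrow> E z \<in> X"
  by (auto simp: X_def intro: ex_add ex_scaleC ex_star ex_one ex_zero ex_act ex_E)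

lemma \<phi>_0 [simp]: "\<phi> 0 = 0" by (rule \<phi>_eqI[OF ex_zero])
lemma \<phi>_1: "\<phi> 1 = 1" by (rule \<phi>_eqI[OF ex_one])
lemma \<phi>_add: "z \<in> X \<Longrightarrow> w \<in> X \<Longrightarrow> \<phi> (z + w) = \<phi> z + \<phi> w" by (intro \<phi>_eqI ex_add X_D)
lemma \<phi>_scaleC: "z \<in> X \<Longrightarrow> \<phi> (c *\<^sub>C z) = c * \<phi> z" by (intro \<phi>_eqI ex_scaleC X_D)
lemma \<phi>_star: "z \<in> X \<Longrightarrow> \<phi> (star z) = cnj (\<phi> z)" by (intro \<phi>_eqI ex_star X_D)
lemma \<phi>_act: "z \<in> X \<Longrightarrow> \<phi> (act g z) = \<phi> z" by (intro \<phi>_eqI ex_act X_D)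
lemma \<phi>_E: "z \<in> X \<Longrightarrow> \<phi> (E z) = \<phi> z" by (intro \<phi>_eqI ex_E X_D)

lemma \<phi>_minus: "z \<in> X \<Longrightarrow> \<phi> (- z) = - \<phi> z" 
  using \<phi>_scaleC[of z "-1"] by (simp add: scaleC_minus_left)

lemma X_minus: "z \<in> X \<Longrightarrow> - z \<in> X"
  using X_closed_ops(4)[of z "-1"] by (simp add: scaleC_minus_left)

lemma X_diff: "z \<in> X \<Longrightarrow> w \<in> X \<Longrightarrow> z - w \<in> X"
  using X_closed_ops(3)[of z "-w"] X_minus by simp

lemma \<phi>_diff: "z \<in> X \<Longrightarrow> w \<in> X \<Longrightarrow> \<phi> (z - w) = \<phi> z - \<phi> w"
  using \<phi>_add[of z "-w"] X_minus by (simp add: \<phi>_minus)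

lemma \<phi>_scaleR: "z \<in> X \<Longrightarrow> \<phi> (r *\<^sub>R z) = of_real r * \<phi> z"
  by (simp add: scaleR_scaleC \<phi>_scaleC)

lemma X_scaleR: "z \<in> X \<Longrightarrow> r *\<^sub>R z \<in> X" by (simp add: scaleR_scaleC X_closed_ops)

lemma X_sum: "(\<And>i. i \<in> I \<Longrightarrow> f i \<in> X) \<Longrightarrow> (\<Sum>i\<in>I. f i) \<in> X"
  by (induction I rule: infinite_finite_induct) (auto intro: X_closed_ops)

lemma \<phi>_sum: "(\<And>i. i \<in> I \<Longrightarrow> f i \<in> X) \<Longrightarrow> \<phi> (\<Sum>i\<in>I. f i) = (\<Sum>i\<in>I. \<phi> (f i))"
  by (induction I rule: infinite_finite_induct) (auto simp: \<phi>_add X_sum)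

lemma \<phi>_lim: "z \<in> X \<Longrightarrow> (\<lambda>j. norm (e j * z * e j)) \<longlonglongrightarrow> cmod (\<phi> z)"
proof -
  assume "z \<in> X"
  then have lim: "(\<lambda>j. norm (dev j z (\<phi> z))) \<longlonglongrightarrow> 0"
    using X_D tendsto_norm_zero unfolding ex_def by blast
  show ?thesis
  proof (rule LIM_zero_cancel, rule tendsto_rabs_zero_cancel, rule tendsto_sandwich[OF _ _ tendsto_const lim])
    show "\<forall>\<^sub>s j. \<bar>norm (e j * z * e j) - cmod (\<phi> z)\<bar> \<le> norm (dev j z (\<phi> z))"
    proof (intro always_eventually allI)
      fix j show "\<bar>norm (e j * z * e j) - cmod (\<phi> z)\<bar> \<le> norm (dev j z (\<phi> z))"
        using norm_triangle_ineq3[of "e j * z * e j" "\<phi> z *\<^sub>C (e j * e j)"] by (simp add: norm_scaleC)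
    qed
  qed simp
qed

lemma \<phi>_norm: "z \<in> X \<Longrightarrow> cmod (\<phi> z) \<le> norm z"
  using Lim_bounded[OF \<phi>_lim, of z 0 "norm z"] norm_mult3[of "e _" z "e _"] by simp

lemma \<phi>_pos: 
  assumes "z \<in> X" "pos z"
  shows "Im (\<phi> z) = 0" "Re (\<phi> z) \<ge> 0" "\<phi> z = of_real (cmod (\<phi> z))"
proof -
  define c where "c = norm z"
  have "\<phi> (star z) = \<phi> z" using pos_star[OF assms(2)] by simp
  then show im: "Im (\<phi> z) = 0" using \<phi>_star[OF assms(1)] by (simp add: complex_eq_iff)
  have "of_real c - z = c *\<^sub>R 1 - z" by (simp add: of_real_def)
  moreover have "norm (of_real c - z) \<le> c" unfolding c_def by (rule pos_norm_bound[OF assms(2)]) simp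
  ultimately have "cmod (\<phi> (c *\<^sub>R 1 - z)) \<le> c"
    using order_trans[OF \<phi>_norm[OF X_diff[OF X_scaleR[OF X_closed_ops(2)] assms(1)], of c]] by simp
  moreover have "\<phi> (c *\<^sub>R 1 - z) = of_real c - \<phi> z"
    using assms by (simp add: \<phi>_diff \<phi>_scaleR X_scaleR X_closed_ops \<phi>_1)
  ultimately have "\<bar>c - Re (\<phi> z)\<bar> \<le> c" using abs_Re_le_cmod[of "of_real c - \<phi> z"] by simp
  then show re: "Re (\<phi> z) \<ge> 0" by simp
  then show "\<phi> z = of_real (cmod (\<phi> z))" using im by (simp add: complex_eq_iff cmod_eq_Re)
qed

lemma \<phi>_mono: "z \<in> X \<Longrightarrow> w \<in> X \<Longrightarrow> pos z \<Longrightarrow> z \<preceq> w \<Longrightarrow> cmod (\<phi> z) \<le> cmod (\<phi> w)"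
proof -
  assume a: "z \<in> X" "w \<in> X" "pos z" "z \<preceq> w"
  have "Re (\<phi> (w - z)) \<ge> 0" using \<phi>_pos(2)[OF X_diff] a by blast
  then have "Re (\<phi> z) \<le> Re (\<phi> w)" using a by (simp add: \<phi>_diff)
  then show ?thesis using \<phi>_pos[of z] \<phi>_pos[of w] a ple_pos[of z w] by (metis Re_complex_of_real)
qed

lemma ex_tail:
  assumes "z \<in> X" "eps > 0"
  shows "\<forall>\<^sub>s i. \<forall>j>i. norm (e i * z * e j - \<phi> z *\<^sub>C e j) \<le> eps"
proof -
  have "\<forall>\<^sub>s i. dist (dev i z (\<phi> z)) 0 < eps"
    using tendstoD[OF X_D[OF assms(1), unfolded ex_def] assms(2)] .
  then show ?thesis
  proof eventually_elim
    case (elim i)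
    show ?case
    proof (intro allI impI)
      fix j assume j: "i < j"
      have "e i * z * e j - \<phi> z *\<^sub>C e j = (dev i z (\<phi> z)) * e j"
        using j by (simp add: left_diff_distrib mult_scaleC_left mult.assoc e_mult)
      also have "norm \<dots> \<le> norm (dev i z (\<phi> z)) * norm (e j)" by (rule norm_mult_ineq)
      finally show "norm (e i * z * e j - \<phi> z *\<^sub>C e j) \<le> eps" using elim by simp
    qed
  qed
qed

definition nph :: "'u \<Rightarrow> real" where "nph w = sqrt (cmod (\<phi> (star w * w)))"

lemma nph_nonneg [simp]: "nph w \<ge> 0" by (simp add: nph_def)
lemma nph_sq: "(nph w)\<^sup>2 = cmod (\<phi> (star w * w))" by (simp add: nph_def)

lemma nph_of_real: "star w * w \<in> X \<Longrightarrow> \<phi> (star w * w) = of_real ((nph w)\<^sup>2)"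
  using \<phi>_pos(3)[of "star w * w"] by (simp add: nph_sq)

text \<open>\<open>nph\<close> is the GNS seminorm of \<open>\<phi>\<close>. As a limit of norms it
  inherits the triangle inequality and the bound for left multiplication.\<close>

lemma norm_lim: "star w * w \<in> X \<Longrightarrow> (\<lambda>j. norm (w * e j)) \<longlonglongrightarrow> nph w"
proof -
  assume a: "star w * w \<in> X"
  have eq: "norm (w * e j) = sqrt (norm (e j * (star w * w) * e j))" for j
    using cstar_identity[of "w * e j"] by (simp add: star_mult mult.assoc)
  show ?thesis unfolding eq nph_def by (intro tendsto_real_sqrt \<phi>_lim a)
qed

lemma N_lim: "E (star w * w) \<in> X \<Longrightarrow> (\<lambda>j. N (w * e j)) \<longlonglongrightarrow> sqrt (cmod (\<phi> (E (star w * w))))"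
proof -
  assume a: "E (star w * w) \<in> X"
  have eq: "N (w * e j) = sqrt (norm (e j * E (star w * w) * e j))" for j
    using N_conj[OF e_F e_sa, of w j] by (metis N_nonneg abs_of_nonneg real_sqrt_abs)
  show ?thesis unfolding eq by (intro tendsto_real_sqrt \<phi>_lim a)
qed

end

section \<open>Flat elements are approximately central\<close>

context excising_sequence
begin

section \<open>The GNS representation of \<open>\<phi>\<close> on \<open>B\<close>\<close>

lemma B_star_mult: "a \<in> B \<Longrightarrow> b \<in> B \<Longrightarrow> star a * b \<in> B" by (intro B_mult B_closed_ops(4))
lemma B_conj: "r \<in> B \<Longrightarrow> b \<in> B \<Longrightarrow> star r * b * r \<in> B" by (intro B_mult B_closed_ops(4))

lemma norm_lim_B: "t \<in> B \<Longrightarrow> (\<lambda>j. norm (t * e j)) \<longlonglongrightarrow> nph t"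
  by (intro norm_lim B_X B_mult B_closed_ops)

lemma nph_triangle: "s \<in> B \<Longrightarrow> t \<in> B \<Longrightarrow> nph (s + t) \<le> nph s + nph t"
  by (rule LIMSEQ_le[OF norm_lim_B tendsto_add[OF norm_lim_B norm_lim_B]])
     (auto intro: B_closed_ops norm_triangle_ineq simp: distrib_right)

lemma nph_left: "t \<in> B \<Longrightarrow> a \<in> F \<Longrightarrow> nph (a * t) \<le> norm a * nph t"
  by (rule LIMSEQ_le[OF norm_lim_B tendsto_mult[OF tendsto_const norm_lim_B]])
     (auto intro: B_closed_ops norm_mult_ineq simp: mult.assoc)

lemma nph_le_norm: "t \<in> B \<Longrightarrow> nph t \<le> norm t"
  using Lim_bounded[OF norm_lim_B, of t 0 "norm t"] norm_mult_ineq[of t "e _"] by simp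

lemma nph_scaleC: "t \<in> B \<Longrightarrow> nph (c *\<^sub>C t) = cmod c * nph t"
  by (rule LIMSEQ_unique[OF norm_lim_B], rule B_closed_ops, assumption)
     (simp add: mult_scaleC_left norm_scaleC tendsto_mult_left norm_lim_B)

lemma \<phi>_unit: "\<phi> (e n * e n) = 1"
proof (rule \<phi>_eqI)
  have "\<forall>\<^sub>s j. 0 = dev j (e n * e n) 1"
    using eventually_gt_at_top[of n] by eventually_elim (simp add: mult.assoc e_mult e_mult')
  then show "ex (e n * e n) 1" unfolding ex_def by (rule Lim_transform_eventually[OF tendsto_const])
qed

lemma nph_e: "nph (e n) = 1" by (simp add: nph_def \<phi>_unit)

text \<open>The elements \<open>b\<close> in question form the kernel of the GNS representation. It
  is a closed ideal of the simple algebra \<open>B\<close> and does not contain \<open>e 0\<close>,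
  since \<open>e 0 * e 1 = e 1\<close> has length 1.\<close>

lemma nph_faithful:
  assumes b: "b \<in> B" and z: "\<And>r. r \<in> B \<Longrightarrow> nph (b * r) = 0"
  shows "b = 0"
proof -
  define I where "I = {b \<in> B. \<forall>r\<in>B. nph (b * r) = 0}"
  have "I = {0} \<or> I = B"
  proof (rule simple_B)
    show "I \<subseteq> B" by (auto simp: I_def)
    show "0 \<in> I" by (auto simp: I_def B_closed_ops nph_def)
    show "x + y \<in> I" if "x \<in> I" "y \<in> I" for x y
    proof -
      have "nph ((x + y) * r) \<le> 0" if "r \<in> B" for r
        using nph_triangle[of "x * r" "y * r"] \<open>x \<in> I\<close> \<open>y \<in> I\<close> that by (auto simp: I_def distrib_right B_mult)
      then show ?thesis using that by (auto simp: I_def B_closed_ops intro: antisym)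
    qed
    show "c *\<^sub>C x \<in> I" if "x \<in> I" for c x
      using that by (auto simp: I_def B_closed_ops mult_scaleC_left nph_scaleC B_mult)
    show "a * x \<in> I" if "a \<in> B" "x \<in> I" for a x
    proof -
      have "nph ((a * x) * r) \<le> 0" if "r \<in> B" for r
        using nph_left[of "x * r" a] \<open>x \<in> I\<close> \<open>a \<in> B\<close> that by (auto simp: I_def mult.assoc B_mult B_F)
      then show ?thesis using that by (auto simp: I_def B_mult intro: antisym)
    qed
    show "x * a \<in> I" if "a \<in> B" "x \<in> I" for a x
      using that by (auto simp: I_def B_mult mult.assoc)
    show "closed I" unfolding closed_sequential_limits
    proof (intro allI impI, elim conjE)
      fix x l assume x: "\<forall>n. x n \<in> I" and lim: "x \<longlonglongrightarrow> l"
      have lB: "l \<in> B" using closed_sequentially[OF closed_B _ lim] x by (auto simp: I_def)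
      have "nph (l * r) = 0" if r: "r \<in> B" for r
      proof -
        have "nph (l * r) \<le> norm (l - x n) * norm r" for n
        proof -
          have "nph ((l - x n) * r + x n * r) \<le> nph ((l - x n) * r) + nph (x n * r)"
            using x lB r by (intro nph_triangle B_mult B_closed_ops) (auto simp: I_def)
          also have "nph (x n * r) = 0" using x r by (auto simp: I_def)
          also have "nph ((l - x n) * r) \<le> norm ((l - x n) * r)"
            using x lB r by (intro nph_le_norm B_mult B_closed_ops) (auto simp: I_def)
          also have "\<dots> \<le> norm (l - x n) * norm r" by (rule norm_mult_ineq)
          finally show ?thesis by (simp add: algebra_simps)
        qed
        moreover have "(\<lambda>n. norm (l - x n) * norm r) \<longlonglongrightarrow> norm (l - l) * norm r" by (intro tendsto_intros lim)
        ultimately have "nph (l * r) \<le> 0" using Lim_bounded2[of "\<lambda>n. norm (l - x n) * norm r" 0 0] by simp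
        then show ?thesis by (intro antisym) simp_all
      qed
      then show "l \<in> I" using lB by (simp add: I_def)
    qed
  qed
  moreover have "nph (e 0 * e 1) \<noteq> 0" using nph_e[of 1] e_mult(1)[of 0 1] by simp
  then have "e 0 \<notin> I" using e_B[of 1] by (auto simp: I_def)
  ultimately show ?thesis using b z e_B[of 0] by (auto simp: I_def)
qed

text \<open>A faithful representation is isometric. Concretely, the hypothesis is tested on the
  vectors \<open>p * r\<close>, with \<open>p\<close> the part of \<open>h\<close> above
  \<open>c\<close>: the excess over \<open>c\<close> is
  \<open>\<phi> (star r * (p * p * p) * r)\<close>, which must vanish.\<close>

lemma norm_le_from_\<phi>:
  assumes h: "h \<in> B" "pos h" and c: "c \<ge> 0"
    and le: "\<And>r. r \<in> B \<Longrightarrow> cmod (\<phi> (star r * h * r)) \<le> c * (nph r)\<^sup>2"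
  shows "norm h \<le> c"
proof -
  define p where "p = ppart (h - of_real c)"
  have sau: "sa (h - of_real c)" by (intro sa_diff pos_sa h sa_of_real)
  note pp = ppart[OF sau, folded p_def]
  have pB: "p \<in> B" unfolding p_def using B_ppart[OF pos_sa[OF h(2)] h(1) c] .
  have p3: "p * h * p = p * p * p + c *\<^sub>R (p * p)"
    using arg_cong[OF pp(6), of "\<lambda>z. z * p"] by (simp add: algebra_simps of_real_def)
  have p3pos: "pos (p * p * p)" using pp by (intro pos_mult sa_square_pos pos_sa) (simp_all add: mult.assoc)
  have z: "\<phi> (star r * (p * p * p) * r) = 0" if r: "r \<in> B" for r
  proof -
    have pr: "p * r \<in> B" using pB r by (rule B_mult)
    have eq: "star (p * r) * h * (p * r) = star r * (p * p * p) * r + c *\<^sub>R (star (p * r) * (p * r))"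
    proof -
      have "star (p * r) * h * (p * r) = star r * (p * h * p) * r" by (simp add: star_mult pos_star[OF pp(1)] mult.assoc)
      then show ?thesis unfolding p3 by (simp add: star_mult pos_star[OF pp(1)] algebra_simps)
    qed
    have X1: "star r * (p * p * p) * r \<in> X" using r pB by (intro B_X B_conj B_mult)
    have X2: "star (p * r) * (p * r) \<in> X" using pr by (intro B_X B_star_mult)
    have "\<phi> (star (p * r) * h * (p * r)) = \<phi> (star r * (p * p * p) * r) + of_real (c * (nph (p * r))\<^sup>2)"
      unfolding eq using X1 X2 by (simp add: \<phi>_add X_scaleR \<phi>_scaleR nph_of_real)
    also have "\<phi> (star r * (p * p * p) * r) = of_real (cmod (\<phi> (star r * (p * p * p) * r)))"
      by (rule \<phi>_pos(3)[OF X1 pos_conj[OF p3pos]])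
    finally have "cmod (\<phi> (star (p * r) * h * (p * r))) = cmod (\<phi> (star r * (p * p * p) * r)) + c * (nph (p * r))\<^sup>2"
      using c by (simp only: of_real_add[symmetric] norm_of_real) simp
    then show ?thesis using le[OF pr] by simp
  qed
  have "p * p = 0"
  proof (rule nph_faithful)
    show "p * p \<in> B" using pB by (simp add: B_mult)
    fix r assume r: "r \<in> B"
    \<comment> \<open>\<open>p * p * p * p = k * p * k\<close> is at most \<open>norm p\<close>
      times \<open>k * k\<close>, so the vanishing for the third power of \<open>p\<close> yields it
      for the fourth, which is what \<open>nph (p * p * r)\<close> measures.\<close>
    define k where "k = psqrt (p * p * p)"
    have k: "star k = k" "k * k = p * p * p" unfolding k_def using psqrt(1,2)[OF p3pos] by (auto simp: pos_star)
    have pk: "p * k = k * p" unfolding k_def by (rule psqrt(3)[OF p3pos]) (simp add: mult.assoc)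
    have "k * p * k = p * (k * k)" by (simp only: mult.assoc[symmetric] pk)
    then have "star r * (k * p * k) * r = star r * (p * (p * p * p)) * r" using k by simp
    then have eq: "star (p * p * r) * (p * p * r) = star (k * r) * p * (k * r)"
      by (simp add: star_mult pos_star[OF pp(1)] k(1) mult.assoc)
    have "star r * (k * k) * r = star r * (p * p * p) * r" using k by simp
    then have eq2: "star (k * r) * (k * r) = star r * (p * p * p) * r"
      by (simp add: star_mult k(1) mult.assoc)
    have "star (p * p * r) * (p * p * r) \<preceq> norm p *\<^sub>R (star (k * r) * (k * r))"
      unfolding eq by (rule conj_ple_norm[OF pos_sa[OF pp(1)]]) simp
    then have "star (p * p * r) * (p * p * r) \<preceq> norm p *\<^sub>R (star r * (p * p * p) * r)" unfolding eq2 .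
    moreover have "star r * (p * p * p) * r \<in> X" "star (p * p * r) * (p * p * r) \<in> X"
      by (intro B_X B_conj B_star_mult B_mult r pB)+
    ultimately have "cmod (\<phi> (star (p * p * r) * (p * p * r))) \<le> cmod (\<phi> (norm p *\<^sub>R (star r * (p * p * p) * r)))"
      by (intro \<phi>_mono X_scaleR) auto
    also have "\<dots> = 0" using z[OF r] \<open>star r * (p * p * p) * r \<in> X\<close> by (simp add: \<phi>_scaleR)
    finally show "nph (p * p * r) = 0" by (simp add: nph_def)
  qed
  then have "p = 0" using sa_square_zero[OF pos_sa[OF pp(1)]] by simp
  then have "pos (of_real c - h)" using pp(2) by simp
  then show ?thesis using pos_le_norm(1)[OF h(2)] by blast
qed

text \<open>The iterated upper limit of \<open>N (f i j)\<close>, first in \<open>j\<close> and then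
  in \<open>i\<close>, is at most \<open>c\<close>. The order matters: with \<open>i\<close> fixed,
  \<open>e j\<close> is eventually absorbed by \<open>e i\<close>, and only then does
  \<open>e i\<close> excise.\<close>

definition Sm :: "real \<Rightarrow> (nat \<Rightarrow> nat \<Rightarrow> 'u) \<Rightarrow> bool" where
  "Sm c f \<longleftrightarrow> (\<forall>eps>0. \<forall>\<^sub>s i. \<forall>\<^sub>s j. N (f i j) \<le> c + eps)"

lemma SmD: "Sm c f \<Longrightarrow> eps > 0 \<Longrightarrow> \<forall>\<^sub>s i. \<forall>\<^sub>s j. N (f i j) \<le> c + eps"
  by (simp add: Sm_def)

lemma Sm_mono: "Sm c f \<Longrightarrow> c \<le> d \<Longrightarrow> Sm d f"
  unfolding Sm_def
proof (intro allI impI)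
  fix eps :: real assume a: "\<forall>eps>0. \<forall>\<^sub>s i. \<forall>\<^sub>s j. N (f i j) \<le> c + eps" "c \<le> d" "eps > 0"
  then have "\<forall>\<^sub>s i. \<forall>\<^sub>s j. N (f i j) \<le> c + eps" by blast
  then show "\<forall>\<^sub>s i. \<forall>\<^sub>s j. N (f i j) \<le> d + eps"
    by (rule eventually_mono) (rule eventually_mono, assumption, use a(2) in linarith)
qed

lemma Sm_cong:
  assumes "Sm c f" "\<forall>\<^sub>s i. \<forall>\<^sub>s j. f i j = g i j"
  shows "Sm c g"
  unfolding Sm_def
proof (intro allI impI)
  fix eps :: real assume "eps > 0"
  then have "\<forall>\<^sub>s i. \<forall>\<^sub>s j. N (f i j) \<le> c + eps" using assms(1) by (simp add: Sm_def)
  with assms(2) show "\<forall>\<^sub>s i. \<forall>\<^sub>s j. N (g i j) \<le> c + eps"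
    by eventually_elim (erule (1) eventually_elim2, simp)
qed

lemma Sm_cong_gt:
  assumes "Sm c f" "\<And>i j. i > n \<Longrightarrow> j > Suc i \<Longrightarrow> f i j = g i j"
  shows "Sm c g"
proof (rule Sm_cong[OF assms(1)])
  show "\<forall>\<^sub>s i. \<forall>\<^sub>s j. f i j = g i j"
    using eventually_gt_at_top[of n]
  proof eventually_elim
    case (elim i)
    show ?case using eventually_gt_at_top[of "Suc i"] by eventually_elim (use assms(2) elim in blast)
  qed
qed

lemma Sm_add:
  assumes "Sm a f" "Sm b g"
  shows "Sm (a + b) (\<lambda>i j. f i j + g i j)"
  unfolding Sm_def
proof (intro allI impI)
  fix eps :: real assume "eps > 0"
  then have "eps/2 > 0" by simp
  from SmD[OF assms(1) this] SmD[OF assms(2) this]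
  show "\<forall>\<^sub>s i. \<forall>\<^sub>s j. N (f i j + g i j) \<le> a + b + eps"
  proof eventually_elim
    case (elim i)
    then show ?case
    proof eventually_elim
      case (elim j)
      then show ?case using N_triangle[of "f i j" "g i j"] by (simp add: field_simps)
    qed
  qed
qed

lemma Sm_scaleC: "Sm a f \<Longrightarrow> Sm (cmod c * a) (\<lambda>i j. c *\<^sub>C f i j)"
proof (cases "c = 0")
  case True then show ?thesis by (simp add: Sm_def)
next
  case False
  assume a: "Sm a f"
  show ?thesis unfolding Sm_def
  proof (intro allI impI)
    fix eps :: real assume "eps > 0"
    then have "eps / cmod c > 0" using False by simp
    from SmD[OF a this] show "\<forall>\<^sub>s i. \<forall>\<^sub>s j. N (c *\<^sub>C f i j) \<le> cmod c * a + eps"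
    proof eventually_elim
      case (elim i)
      then show ?case
      proof eventually_elim
        case (elim j)
        then have "cmod c * N (f i j) \<le> cmod c * (a + eps / cmod c)" by (intro mult_left_mono) auto
        then show ?case using False by (simp add: N_scaleC distrib_left)
      qed
    qed
  qed
qed

lemma Sm_minus: "Sm a f \<Longrightarrow> Sm a (\<lambda>i j. - f i j)"
  by (simp add: Sm_def N_minus)

lemma Sm_diff: "Sm a f \<Longrightarrow> Sm b g \<Longrightarrow> Sm (a + b) (\<lambda>i j. f i j - g i j)"
  using Sm_add[of a f b "\<lambda>i j. - g i j"] Sm_minus by simp

lemma Sm_shift: "Sm a f \<Longrightarrow> Sm a (\<lambda>i. f (Suc i))"
  unfolding Sm_def using eventually_sequentially_Suc by meson

lemma Sm_left:
  assumes "Sm a f" "a \<ge> 0" "(\<lambda>i. norm (s i)) \<longlonglongrightarrow> \<sigma>"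
  shows "Sm (\<sigma> * a) (\<lambda>i j. s i * f i j)"
  unfolding Sm_def
proof (intro allI impI)
  fix eps :: real assume eps: "eps > 0"
  have \<sigma>: "\<sigma> \<ge> 0" by (rule Lim_bounded2[OF assms(3), of 0]) simp
  define h where "h = min 1 (eps / (\<sigma> + a + 1))"
  have h: "h > 0" "h \<le> 1" using eps \<sigma> assms(2) by (auto simp: h_def)
  have "h * (\<sigma> + a + 1) \<le> eps / (\<sigma> + a + 1) * (\<sigma> + a + 1)"
    using \<sigma> assms(2) by (intro mult_right_mono) (auto simp: h_def)
  then have *: "h * (\<sigma> + a + 1) \<le> eps" using \<sigma> assms(2) by simp
  have "(\<sigma> + h) * (a + h) = \<sigma> * a + h * (\<sigma> + a + h)" by (simp add: algebra_simps)
  also have "\<dots> \<le> \<sigma> * a + h * (\<sigma> + a + 1)" using h by (intro add_left_mono mult_left_mono) auto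
  finally have fin: "(\<sigma> + h) * (a + h) \<le> \<sigma> * a + eps" using * by linarith
  have "\<forall>\<^sub>s i. norm (s i) < \<sigma> + h" using order_tendstoD(2)[OF assms(3)] h by simp
  with SmD[OF assms(1) h(1)]
  show "\<forall>\<^sub>s i. \<forall>\<^sub>s j. N (s i * f i j) \<le> \<sigma> * a + eps"
  proof eventually_elim
    case (elim i)
    from elim(1) show ?case
    proof eventually_elim
      case (elim j)
      have "N (s i * f i j) \<le> norm (s i) * N (f i j)" by (rule N_left)
      also have "\<dots> \<le> (\<sigma> + h) * (a + h)"
        using elim \<open>norm (s i) < \<sigma> + h\<close> \<sigma> h by (intro mult_mono) auto
      finally show ?case using fin by linarith
    qed
  qed
qed

lemma Sm_left_const: "Sm a f \<Longrightarrow> a \<ge> 0 \<Longrightarrow> Sm (norm s * a) (\<lambda>i j. s * f i j)"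
  using Sm_left[of a f "\<lambda>_. s"] by simp

lemma Sm_bounded: "(\<And>i j. N (f i j) \<le> a) \<Longrightarrow> Sm a f"
  by (auto simp: Sm_def intro!: always_eventually) (smt (verit, best))

lemma Sm_j_le: "Sm c (\<lambda>i j. f j) \<Longrightarrow> (\<lambda>j. N (f j)) \<longlonglongrightarrow> a \<Longrightarrow> a \<le> c"
proof (rule field_le_epsilon)
  fix eps :: real assume a: "Sm c (\<lambda>i j. f j)" "(\<lambda>j. N (f j)) \<longlonglongrightarrow> a" "eps > 0"
  then have "\<forall>\<^sub>s j. N (f j) \<le> c + eps" using SmD[OF a(1,3)] by simp
  then show "a \<le> c + eps" by (rule tendsto_upperbound[OF a(2)]) simp
qed

text \<open>The squares of \<open>N (z * r * e j)\<close> tend to the value at \<open>r\<close> of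
  the quadratic form of \<open>E (star z * z)\<close> in the GNS representation. A bound by
  \<open>\<eta>\<^sup>2 (nph r)\<^sup>2\<close> for all \<open>r\<close> therefore bounds the norm
  of that element by \<open>\<eta>\<^sup>2\<close>.\<close>

lemma N_le_from_Sm:
  assumes z: "z \<in> A" and \<eta>: "\<eta> \<ge> 0" and sm: "\<And>r. r \<in> B \<Longrightarrow> Sm (\<eta> * nph r) (\<lambda>i j. z * r * e j)"
  shows "N z \<le> \<eta>"
proof -
  define h where "h = E (star z * z)"
  have h: "h \<in> B" "pos h" unfolding h_def using z by (auto intro!: E_in_B E_pos A_closed_ops)
  have "norm h \<le> \<eta>\<^sup>2"
  proof (rule norm_le_from_\<phi>[OF h])
    fix r assume r: "r \<in> B"
    have eq: "E (star (z * r) * (z * r)) = star r * h * r"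
      using E_conj[OF B_F[OF r], of "star z * z"] by (simp add: h_def star_mult mult.assoc)
    have X: "star r * h * r \<in> X" using r h by (intro B_X B_mult B_closed_ops(4))
    have "(\<lambda>j. N (z * r * e j)) \<longlonglongrightarrow> sqrt (cmod (\<phi> (star r * h * r)))"
      using N_lim[of "z * r"] X by (simp add: eq)
    then have "sqrt (cmod (\<phi> (star r * h * r))) \<le> \<eta> * nph r" by (rule Sm_j_le[OF sm[OF r]])
    then have "cmod (\<phi> (star r * h * r)) \<le> (\<eta> * nph r)\<^sup>2"
      using power_mono[of "sqrt (cmod (\<phi> (star r * h * r)))" _ 2] by simp
    then show "cmod (\<phi> (star r * h * r)) \<le> \<eta>\<^sup>2 * (nph r)\<^sup>2" by (simp add: power_mult_distrib)
  qed simp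
  then show ?thesis using \<eta> by (intro N_leI) (auto simp: h_def)
qed

end

locale flat_element = excising_sequence act ch e
  for act :: "'g::topological_group_add \<Rightarrow> 'u::unital_cstar \<Rightarrow> 'u" and ch e +
  fixes y :: 'u and n :: nat and \<delta> :: real
  assumes y: "y \<in> A" and fl: "flat (e n) y \<delta>" and \<delta>: "\<delta> > 0"
begin

abbreviation (input) "m \<equiv> N (e n * y * e n)"
definition T :: "'u set" where "T = {t \<in> B. e n * t = t}"
text \<open>The error rate of one flat element. A vector of squared length at most
  \<open>m^2\<close> whose component in one direction has squared length at least
  \<open>(m - \<delta>)^2\<close> leaves at most \<open>2 m \<delta>\<close> for the orthogonal
  part.\<close>

definition \<kappa> :: real where "\<kappa> = sqrt (2 * m * \<delta>)"

lemma \<kappa>: "\<kappa> \<ge> 0" "\<kappa>\<^sup>2 = 2 * m * \<delta>" using \<delta> by (simp_all add: \<kappa>_def)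

lemma T_D: "t \<in> T \<Longrightarrow> t \<in> B" "t \<in> T \<Longrightarrow> e n * t = t" "t \<in> T \<Longrightarrow> star t * e n = star t"
  by (auto simp: T_def) (metis e_star star_mult)

lemma T_closed: "t \<in> T \<Longrightarrow> s \<in> T \<Longrightarrow> t + s \<in> T" "t \<in> T \<Longrightarrow> s \<in> T \<Longrightarrow> t - s \<in> T" "t \<in> T \<Longrightarrow> c *\<^sub>C t \<in> T"
  "e (Suc n) \<in> T"
  by (auto simp: T_def B_closed_ops distrib_left right_diff_distrib mult_scaleC_right e_B e_mult)

text \<open>Flatness speaks of positive elements of \<open>loc (e n)\<close>, and
  \<open>v = t * e j\<close> is not one, but \<open>v * star v\<close> is. The outer factors
  \<open>v\<close> and \<open>star v\<close> are then removed at the cost of the square of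
  \<open>norm v\<close>.\<close>

lemma flat_lower:
  assumes t: "t \<in> T" and v: "t * e j \<noteq> 0"
  shows "N (e j * star t * y * t * e j) \<ge> (m - \<delta>) * (norm (t * e j))\<^sup>2"
proof -
  define v where "v = t * e j"
  have v0: "norm v > 0" using assms(2) by (simp add: v_def)
  have vB: "v \<in> B" unfolding v_def by (intro B_mult T_D t e_B)
  have ev: "e n * v = v" "star v * e n = star v"
    using T_D[OF t] by (simp_all add: v_def star_mult mult.assoc) (simp add: T_D(2)[OF t] flip: mult.assoc)
  have "e n * (v * star v) = v * star v" by (simp add: ev flip: mult.assoc)
  moreover have "v * star v * e n = v * star v" by (simp add: ev mult.assoc)
  ultimately have "v * star v \<in> loc (e n)" unfolding loc_def using vB by (simp add: B_mult B_closed_ops(4))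
  then have "(m - \<delta>) * (norm (v * star v))\<^sup>2 \<le> N (v * star v * y * (v * star v))"
    using fl by (simp add: flat_def)
  also have "\<dots> = N (v * (star v * y * v) * star v)" by (simp add: mult.assoc)
  also have "\<dots> \<le> norm v * N (star v * y * v) * norm (star v)"
    by (intro N_sandwich F_closed_ops B_F vB)
  finally have "(m - \<delta>) * (norm v)\<^sup>2 * (norm v)\<^sup>2 \<le> N (star v * y * v) * (norm v)\<^sup>2"
    by (simp add: cstar_identity' power2_eq_square mult_ac)
  then have "(m - \<delta>) * (norm v)\<^sup>2 \<le> N (star v * y * v)" using v0 by simp
  then show ?thesis by (simp add: v_def star_mult mult.assoc)
qed

text \<open>By flatness the component of \<open>y t e\<^sub>j\<close> along \<open>t e\<^sub>i\<close> has almost full length.\<close>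

lemma eigenvector:
  assumes t: "t \<in> T" and \<tau>: "nph t > 0"
  shows "Sm (\<kappa> * nph t) (\<lambda>i j. e n * y * e n * t * e j - (1 / (nph t)\<^sup>2) *\<^sub>R (t * e i * e i * star t * y * t * e j))"
  unfolding Sm_def
proof (intro allI impI)
  fix eps :: real assume eps: "eps > 0"
  define \<tau> where "\<tau> = (nph t)\<^sup>2"
  have \<tau>0: "\<tau> > 0" using \<tau> by (simp add: \<tau>_def)
  note tT = T_D[OF t]
  define yn where "yn = e n * y * e n"
  have ynA: "yn \<in> A" unfolding yn_def by (intro A_closed_ops y)
  define U where "U = star t * E (star yn * yn) * t"
  define q where "q i = e i * star t * y * t" for i
  define V where "V i = E (star (q i) * q i)" for i
  \<comment> \<open>Expanding the square of \<open>a - (1/\<tau>) w p\<close>, with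
    \<open>p = star w * a\<close>, gives \<open>- 2/\<tau>\<close> from the mixed terms and at most
    \<open>norm w\<close> squared over \<open>\<tau>\<close> squared from the last one. The
    coefficient of \<open>star p * p\<close> is then \<open>- s i\<close>, and \<open>s i\<close>
    tends to \<open>1 / \<tau>\<close>.\<close>
  define s where "s i = 2 / \<tau> - (norm (t * e i))\<^sup>2 / \<tau>\<^sup>2" for i
  have UB: "U \<in> B" unfolding U_def by (intro B_mult B_closed_ops(4) tT E_in_B A_closed_ops ynA)
  have qA: "q i \<in> A" for i unfolding q_def by (intro A_closed_ops y)
  have VB: "V i \<in> B" for i unfolding V_def by (intro E_in_B A_closed_ops qA)
  have Up: "pos U" unfolding U_def by (intro pos_conj E_pos star_mult_pos)
  have Vp: "pos (V i)" for i unfolding V_def by (intro E_pos star_mult_pos)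
  have Ule: "cmod (\<phi> U) \<le> m\<^sup>2 * \<tau>"
  proof -
    have "U \<preceq> m\<^sup>2 *\<^sub>R (star t * t)" unfolding U_def
      by (rule conj_ple_norm) (auto intro!: pos_sa E_pos simp: N_sq yn_def)
    then have "cmod (\<phi> U) \<le> cmod (\<phi> (m\<^sup>2 *\<^sub>R (star t * t)))"
      using tT by (intro \<phi>_mono B_X UB Up B_closed_ops(8) B_star_mult)
    also have "\<dots> = m\<^sup>2 * \<tau>"
      using tT by (subst \<phi>_scaleR) (auto intro!: B_X B_star_mult simp: norm_mult norm_power nph_sq \<tau>_def)
    finally show ?thesis .
  qed
  have Vge: "cmod (\<phi> (V i)) \<ge> (m\<^sup>2 - 2 * m * \<delta>) * \<tau>\<^sup>2" for i
  proof -
    have "(m - \<delta>) * \<tau> \<le> sqrt (cmod (\<phi> (V i)))"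
    proof (rule tendsto_le[OF _ N_lim[of "q i", folded V_def, OF B_X[OF VB]]])
      show "(\<lambda>j. (m - \<delta>) * (norm (t * e j))\<^sup>2) \<longlonglongrightarrow> (m - \<delta>) * \<tau>"
        unfolding \<tau>_def by (intro tendsto_intros norm_lim_B tT)
      have "\<forall>\<^sub>s j. norm (t * e j) > 0" using order_tendstoD(1)[OF norm_lim_B[OF tT(1)] \<tau>] .
      with eventually_gt_at_top[of i]
      show "\<forall>\<^sub>s j. (m - \<delta>) * (norm (t * e j))\<^sup>2 \<le> N (q i * e j)"
      proof eventually_elim
        case (elim j)
        have "(m - \<delta>) * (norm (t * e j))\<^sup>2 \<le> N (e j * star t * y * t * e j)"
          using flat_lower[OF t, of j] elim by simp
        also have "e j * star t * y * t * e j = e j * (q i * e j)"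
          using elim by (simp add: q_def mult.assoc e_mult')
        also have "N \<dots> \<le> N (q i * e j)" using N_left[of "e j"] by simp
        finally show ?case .
      qed
    qed simp
    then have a: "(m - \<delta>) * \<tau> \<le> sqrt (cmod (\<phi> (V i)))" .
    show ?thesis
    proof (cases "m \<ge> \<delta>")
      case True
      then have "((m - \<delta>) * \<tau>)\<^sup>2 \<le> (sqrt (cmod (\<phi> (V i))))\<^sup>2" using a \<tau>0 by (intro power_mono) auto
      then have "(m - \<delta>)\<^sup>2 * \<tau>\<^sup>2 \<le> cmod (\<phi> (V i))" by (simp add: power_mult_distrib)
      moreover have "(m\<^sup>2 - 2 * m * \<delta>) * \<tau>\<^sup>2 \<le> (m - \<delta>)\<^sup>2 * \<tau>\<^sup>2"
        by (intro mult_right_mono) (auto simp: power2_eq_square algebra_simps)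
      ultimately show ?thesis by linarith
    next
      case False
      then have "m * (m - 2 * \<delta>) \<le> 0" using \<delta> by (intro mult_nonneg_nonpos) auto
      then have "m\<^sup>2 - 2 * m * \<delta> \<le> 0" by (simp add: power2_eq_square algebra_simps)
      then have "(m\<^sup>2 - 2 * m * \<delta>) * \<tau>\<^sup>2 \<le> 0" by (intro mult_nonpos_nonneg) auto
      then show ?thesis using norm_ge_zero order_trans by blast
    qed
  qed
  define \<rho> where "\<rho> = (\<kappa> * nph t + eps)\<^sup>2"
  have "(\<kappa> * nph t)\<^sup>2 < \<rho>" unfolding \<rho>_def using \<kappa>(1) eps by (intro power_strict_mono) auto
  then have \<rho>: "2 * m * \<delta> * \<tau> < \<rho>" by (simp add: power_mult_distrib \<kappa>(2) \<tau>_def)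
  \<comment> \<open>The bound that remains after inserting the estimates for \<open>U\<close> and
    \<open>V i\<close>. It tends to \<open>2 m \<delta> \<tau> = (\<kappa> * nph t)\<^sup>2\<close>,
    hence is eventually below \<open>\<rho>\<close>.\<close>
  define g where "g i = m\<^sup>2 * \<tau> - s i * ((m\<^sup>2 - 2 * m * \<delta>) * \<tau>\<^sup>2)" for i
  have "s \<longlonglongrightarrow> 2 / \<tau> - \<tau> / \<tau>\<^sup>2" unfolding s_def
    by (intro tendsto_intros) (use norm_lim_B[OF tT(1)] \<tau> in \<open>auto simp: \<tau>_def intro!: tendsto_power\<close>)
  then have slim: "s \<longlonglongrightarrow> 1 / \<tau>" using \<tau>0 by (simp add: power2_eq_square diff_divide_distrib[symmetric])
  then have "g \<longlonglongrightarrow> m\<^sup>2 * \<tau> - (1 / \<tau>) * ((m\<^sup>2 - 2 * m * \<delta>) * \<tau>\<^sup>2)" unfolding g_def by (intro tendsto_intros)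
  moreover have "m\<^sup>2 * \<tau> - (1 / \<tau>) * ((m\<^sup>2 - 2 * m * \<delta>) * \<tau>\<^sup>2) = 2 * m * \<delta> * \<tau>"
    using \<tau>0 by (simp add: power2_eq_square field_simps)
  ultimately have "\<forall>\<^sub>s i. g i < \<rho>" using order_tendstoD(2) \<rho> by metis
  moreover have "\<forall>\<^sub>s i. 0 < s i" using order_tendstoD(1)[OF slim, of 0] \<tau>0 by simp
  ultimately show "\<forall>\<^sub>s i. \<forall>\<^sub>s j.
      N (e n * y * e n * t * e j - (1 / (nph t)\<^sup>2) *\<^sub>R (t * e i * e i * star t * y * t * e j)) \<le> \<kappa> * nph t + eps"
    using eventually_gt_at_top[of n]
  proof eventually_elim
    case (elim i)
    \<comment> \<open>The gap between \<open>\<rho>\<close> and \<open>g i\<close> is shared by the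
      two excision errors, which enter with weights 1 and \<open>s i\<close>.\<close>
    define h where "h = (\<rho> - max 0 (g i)) / (1 + s i)"
    have "\<kappa> * nph t + eps > 0" using eps \<kappa>(1) by (intro add_nonneg_pos) auto
    then have "\<rho> > 0" by (simp add: \<rho>_def)
    then have h: "h > 0" using elim by (simp add: h_def)
    have "(\<lambda>j. dev j U (\<phi> U)) \<longlonglongrightarrow> 0" using X_D[OF B_X[OF UB]] by (simp add: ex_def)
    then have ev1: "\<forall>\<^sub>s j. norm (dev j U (\<phi> U)) < h" using tendstoD[OF _ h] by (fastforce simp: dist_norm)
    have "(\<lambda>j. dev j (V i) (\<phi> (V i))) \<longlonglongrightarrow> 0" using X_D[OF B_X[OF VB]] by (simp add: ex_def)
    then have ev2: "\<forall>\<^sub>s j. norm (dev j (V i) (\<phi> (V i))) < h" using tendstoD[OF _ h] by (fastforce simp: dist_norm)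
    show ?case using ev1 ev2
    proof eventually_elim
      case (elim j)
      let ?U = "e j * U * e j - cmod (\<phi> U) *\<^sub>R (e j * e j)" and ?V = "e j * V i * e j - cmod (\<phi> (V i)) *\<^sub>R (e j * e j)"
        and ?c = "cmod (\<phi> U) - s i * cmod (\<phi> (V i))"
      define a where "a = yn * t * e j"
      define w where "w = t * e i"
      define p where "p = q i * e j"
      have wa: "star w * a = p"
        by (simp add: w_def a_def p_def q_def yn_def star_mult mult.assoc tT) (simp add: tT(2,3) flip: mult.assoc)
      define Xij where "Xij = a - (1 / \<tau>) *\<^sub>R (w * p)"
      have "star Xij * Xij = star a * a - (2 / \<tau>) *\<^sub>R (star p * p) + (1 / \<tau>\<^sup>2) *\<^sub>R (star p * (star w * w) * p)"
      proof -
        have "star a * w = star p" using wa by (metis star_mult star_star)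
        then have "star a * (w * p) = star p * p" by (simp flip: mult.assoc)
        moreover have "star (w * p) * a = star p * p" using wa by (simp add: star_mult mult.assoc)
        moreover have "star (w * p) * (w * p) = star p * (star w * w) * p" by (simp add: star_mult mult.assoc)
        ultimately show ?thesis
          by (simp add: Xij_def star_diff star_scaleR left_diff_distrib right_diff_distrib power2_eq_square)
             (simp add: algebra_simps flip: scaleR_add_left)
      qed
      moreover have "star p * (star w * w) * p \<preceq> (norm w)\<^sup>2 *\<^sub>R (star p * p)"
        by (rule conj_ple_norm) (auto simp: sa_simps cstar_identity)
      then have "(1 / \<tau>\<^sup>2) *\<^sub>R (star p * (star w * w) * p) \<preceq> (1 / \<tau>\<^sup>2) *\<^sub>R ((norm w)\<^sup>2 *\<^sub>R (star p * p))"
        by (intro ple_scaleR) auto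
      ultimately have "star Xij * Xij \<preceq> star a * a - s i *\<^sub>R (star p * p)"
        by (simp add: s_def w_def scaleR_diff_left algebra_simps)
      then have "E (star Xij * Xij) \<preceq> E (star a * a) - s i *\<^sub>R E (star p * p)"
        using E_mono by (metis E_diff E_scaleR)
      moreover have "E (star a * a) = e j * U * e j"
        using E_conj[OF B_F[OF B_mult[OF tT(1) e_B[of j]]], of "star yn * yn"] by (simp add: a_def U_def star_mult mult.assoc)
      moreover have "E (star p * p) = e j * V i * e j"
        using E_conj[OF e_F[of j], of "star (q i) * q i"] by (simp add: p_def V_def star_mult mult.assoc)
      ultimately have Xle: "E (star Xij * Xij) \<preceq> e j * U * e j - s i *\<^sub>R (e j * V i * e j)" by simp
      have bnd: "\<phi> Z *\<^sub>C (e j * e j) = cmod (\<phi> Z) *\<^sub>R (e j * e j)" if "Z \<in> B" "pos Z" for Z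
        using \<phi>_pos(3)[OF B_X[OF that(1)] that(2)] by (metis scaleC_of_real)
      have saj: "sa (e j * Z * e j - r *\<^sub>R (e j * e j))" if "pos Z" for Z r
        by (intro sa_diff sa_scaleR pos_sa[OF pos_conj_sa] that e_sa sa_mult) auto
      have 1: "?U \<preceq> of_real h"
        using elim(1) unfolding bnd[OF UB Up] by (intro ple_norm saj Up) auto
      have 2: "- (?V) \<preceq> of_real h"
        using elim(2) unfolding bnd[OF VB Vp] by (intro ple_norm sa_minus saj Vp) (simp only: norm_minus_cancel less_imp_le)
      have th: "?c \<le> g i"
        unfolding g_def using Ule Vge[of i] \<open>0 < s i\<close> by (intro diff_mono mult_left_mono) auto
      have 3: "?c *\<^sub>R (e j * e j) \<preceq> of_real (max 0 (g i))"
      proof (rule ple_trans)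
        show "?c *\<^sub>R (e j * e j) \<preceq> max 0 (g i) *\<^sub>R (e j * e j)"
          unfolding scaleR_diff_left[symmetric] by (intro pos_scaleR sa_square_pos e_sa) (use th in auto)
        show "max 0 (g i) *\<^sub>R (e j * e j) \<preceq> of_real (max 0 (g i))"
          by (intro ple_norm sa_scaleR sa_mult e_sa) auto
      qed
      have "pos ((of_real h - (?U))
          + (s i *\<^sub>R (of_real h - (- (?V)))
          + (of_real (max 0 (g i)) - ?c *\<^sub>R (e j * e j))))"
        using \<open>0 < s i\<close> by (intro pos_add pos_scaleR 1 2 3) auto
      also have "(of_real h - (?U))
          + (s i *\<^sub>R (of_real h - (- (?V)))
          + (of_real (max 0 (g i)) - ?c *\<^sub>R (e j * e j)))
        = of_real (max 0 (g i) + (1 + s i) * h) - (e j * U * e j - s i *\<^sub>R (e j * V i * e j))"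
        by (simp add: algebra_simps of_real_def)
      also have "max 0 (g i) + (1 + s i) * h = \<rho>" using \<open>0 < s i\<close> by (simp add: h_def)
      finally have "e j * U * e j - s i *\<^sub>R (e j * V i * e j) \<preceq> of_real \<rho>" .
      then have "E (star Xij * Xij) \<preceq> of_real \<rho>" using ple_trans Xle by blast
      then have "norm (E (star Xij * Xij)) \<le> \<rho>" using pos_le_norm(1) E_pos star_mult_pos by blast
      then have "N Xij \<le> \<kappa> * nph t + eps" using \<kappa>(1) eps by (intro N_leI) (auto simp: \<rho>_def)
      moreover have "Xij = e n * y * e n * t * e j - (1 / (nph t)\<^sup>2) *\<^sub>R (t * e i * e i * star t * y * t * e j)"
        by (simp add: Xij_def a_def w_def p_def q_def yn_def \<tau>_def mult.assoc)
      ultimately show ?case by simp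
    qed
  qed
qed

end

section \<open>Matrix coefficients of a flat element\<close>

context flat_element
begin

text \<open>The compressed matrix coefficient of \<open>y\<close> between the vectors
  \<open>t\<close> and \<open>s\<close>. The index \<open>Suc i\<close> leaves room for
  \<open>e i\<close>: the element \<open>e (Suc i) * star s * t * e i\<close> is close to
  \<open>\<phi> (star s * t) *\<^sub>C e (Suc i)\<close>.\<close>

definition Q :: "'u \<Rightarrow> 'u \<Rightarrow> nat \<Rightarrow> nat \<Rightarrow> 'u" where
  "Q s t i j = e (Suc i) * star s * y * t * e j"

lemma Q_add: "Q (s + s') t i j = Q s t i j + Q s' t i j" "Q s (t + t') i j = Q s t i j + Q s t' i j"
  by (simp_all add: Q_def star_add distrib_left distrib_right)

lemma Q_diff: "Q (s - s') t i j = Q s t i j - Q s' t i j" "Q s (t - t') i j = Q s t i j - Q s t' i j"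
  by (simp_all add: Q_def star_diff right_diff_distrib left_diff_distrib)

lemma Q_scaleC: "Q (c *\<^sub>C s) t i j = cnj c *\<^sub>C Q s t i j" "Q s (c *\<^sub>C t) i j = c *\<^sub>C Q s t i j"
  by (simp_all add: Q_def star_scaleC mult_scaleC)

lemma norm_lim_left: "s \<in> B \<Longrightarrow> (\<lambda>i. norm (e (Suc i) * star s)) \<longlonglongrightarrow> nph s"
proof -
  assume s: "s \<in> B"
  have "norm (e i * star s) = norm (s * e i)" for i
    using norm_star[of "s * e i"] by (simp add: star_mult)
  then show ?thesis using LIMSEQ_Suc[OF norm_lim_B[OF s]] by simp
qed

lemma N_y_tail: "t \<in> B \<Longrightarrow> Sm (norm a * N y * nph t) (\<lambda>i j. a * y * t * e j)"
proof -
  assume t: "t \<in> B"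
  have N: "N (a * y * t * e j) \<le> norm a * N y * norm (t * e j)" for j
    using N_sandwich[of "t * e j" a y] by (simp add: mult.assoc B_F B_mult t e_B)
  have lim: "(\<lambda>j. norm a * N y * norm (t * e j)) \<longlonglongrightarrow> norm a * N y * nph t"
    by (intro tendsto_intros norm_lim_B t)
  show ?thesis unfolding Sm_def
  proof (intro allI impI, rule always_eventually, rule allI)
    fix eps :: real assume "eps > 0"
    then have "\<forall>\<^sub>s j. norm a * N y * norm (t * e j) < norm a * N y * nph t + eps"
      by (intro order_tendstoD(2)[OF lim]) simp
    then show "\<forall>\<^sub>s j. N (a * y * t * e j) \<le> norm a * N y * nph t + eps"
      by eventually_elim (use N in \<open>meson less_imp_le order_trans\<close>)
  qed
qed

lemma Q_bound: "s \<in> B \<Longrightarrow> t \<in> B \<Longrightarrow> Sm (nph s * (N y * nph t)) (Q s t)"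
  using Sm_left[OF N_y_tail[of t 1] _ norm_lim_left[of s]] by (simp add: Q_def[abs_def] mult.assoc)

text \<open>Multiplying \<open>eigenvector\<close> from the left by
  \<open>e (Suc i) * star s\<close> turns the vector \<open>t\<close> in its second term into the
  inner product of \<open>s\<close> and \<open>t\<close>; \<open>D i\<close> is the error of this
  replacement. If \<open>s\<close> and \<open>t\<close> are orthogonal, \<open>Q s t\<close> itself
  is small.\<close>

lemma Q_proportional:
  assumes s: "s \<in> T" and t: "t \<in> T" and \<tau>: "nph t > 0"
  shows "Sm (\<kappa> * nph s * nph t) (\<lambda>i j. Q s t i j - (\<phi> (star s * t) / (nph t)\<^sup>2) *\<^sub>C Q t t i j)"
proof -
  define \<tau>2 where "\<tau>2 = (nph t)\<^sup>2"
  have \<tau>2: "\<tau>2 > 0" using \<tau> by (simp add: \<tau>2_def)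
  note sT = T_D[OF s] and tT = T_D[OF t]
  define X0 where "X0 i j = e n * y * e n * t * e j - (1 / \<tau>2) *\<^sub>R (t * e i * e i * star t * y * t * e j)" for i j
  have 1: "Sm (nph s * (\<kappa> * nph t)) (\<lambda>i j. (e (Suc i) * star s) * X0 i j)"
    using Sm_left[OF eigenvector[OF t \<tau>] _ norm_lim_left[OF sT(1)]] \<kappa>(1) by (simp add: X0_def \<tau>2_def)
  define D where "D i = (1 / \<tau>2) *\<^sub>R (e (Suc i) * star s * t * e i - \<phi> (star s * t) *\<^sub>C e (Suc i))" for i
  have "(\<lambda>i. norm (D i)) \<longlonglongrightarrow> 0"
  proof (rule tendstoI)
    fix eps :: real assume eps: "eps > 0"
    have X: "star t * s \<in> X" using sT tT by (intro B_X B_star_mult)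
    have "eps * \<tau>2 / 2 > 0" using eps \<tau>2 by simp
    from ex_tail[OF X this] show "\<forall>\<^sub>s i. dist (norm (D i)) 0 < eps"
    proof eventually_elim
      case (elim i)
      have st: "\<phi> (star s * t) = cnj (\<phi> (star t * s))" using \<phi>_star[OF X] by (simp add: star_mult star_star)
      have "star (e i * (star t * s) * e (Suc i) - \<phi> (star t * s) *\<^sub>C e (Suc i)) = e (Suc i) * star s * t * e i - \<phi> (star s * t) *\<^sub>C e (Suc i)"
        by (simp add: st star_diff star_mult star_star star_scaleC mult.assoc)
      then have "norm (e (Suc i) * star s * t * e i - \<phi> (star s * t) *\<^sub>C e (Suc i)) \<le> eps * \<tau>2 / 2"
        using elim norm_star by (metis lessI)
      then have "norm (D i) \<le> (1 / \<tau>2) * (eps * \<tau>2 / 2)" using \<tau>2 unfolding D_def norm_scaleR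
        by (intro mult_mono) auto
      then show ?case using eps \<tau>2 by simp
    qed
  qed
  moreover have "Sm (norm (star t) * N y * nph t) (\<lambda>i j. star t * y * t * e j)" by (rule N_y_tail[OF tT(1)])
  then have "Sm (norm (star t) * N y * nph t) (\<lambda>i j. e i * (star t * y * t * e j))"
    using Sm_left[where s="\<lambda>i. e i" and \<sigma>=1] by fastforce
  ultimately have 2: "Sm (0 * (norm (star t) * N y * nph t)) (\<lambda>i j. D i * (e i * (star t * y * t * e j)))"
    by (intro Sm_left[where s=D]) auto
  have "Sm (\<kappa> * nph s * nph t) (\<lambda>i j. (e (Suc i) * star s) * X0 i j + D i * (e i * (star t * y * t * e j)))"
    using Sm_add[OF 1 2] by (simp add: mult_ac)
  then show ?thesis
  proof (rule Sm_cong_gt[of _ _ n])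
    fix i j assume ij: "i > n" "j > Suc i"
    have "(e (Suc i) * star s) * X0 i j = Q s t i j - (1 / \<tau>2) *\<^sub>R (e (Suc i) * star s * t * e i * e i * star t * y * t * e j)"
    proof -
      have "star s * (e n * y * e n * t * e j) = star s * y * t * e j"
        by (simp add: mult.assoc sT tT) (simp add: sT(3) tT(2) flip: mult.assoc)
      then show ?thesis by (simp add: X0_def Q_def right_diff_distrib mult.assoc)
    qed
    moreover have "D i * (e i * (star t * y * t * e j)) = (1 / \<tau>2) *\<^sub>R (e (Suc i) * star s * t * e i * e i * star t * y * t * e j)
       - (\<phi> (star s * t) / of_real \<tau>2) *\<^sub>C Q t t i j"
      by (simp add: D_def left_diff_distrib scaleC_diff_right mult_scaleC_left scaleR_scaleC scaleC_scaleC mult.assoc Q_def e_mult')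
    ultimately show "(e (Suc i) * star s) * X0 i j + D i * (e i * (star t * y * t * e j)) =
        Q s t i j - (\<phi> (star s * t) / (nph t)\<^sup>2) *\<^sub>C Q t t i j"
      by (simp add: \<tau>2_def)
  qed
qed

lemma \<phi>_inner_add: "s \<in> B \<Longrightarrow> s' \<in> B \<Longrightarrow> t \<in> B \<Longrightarrow> \<phi> (star (s + s') * t) = \<phi> (star s * t) + \<phi> (star s' * t)"
  "s \<in> B \<Longrightarrow> s' \<in> B \<Longrightarrow> t \<in> B \<Longrightarrow> \<phi> (star t * (s + s')) = \<phi> (star t * s) + \<phi> (star t * s')"
  "s \<in> B \<Longrightarrow> s' \<in> B \<Longrightarrow> t \<in> B \<Longrightarrow> \<phi> (star (s - s') * t) = \<phi> (star s * t) - \<phi> (star s' * t)"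
  "s \<in> B \<Longrightarrow> s' \<in> B \<Longrightarrow> t \<in> B \<Longrightarrow> \<phi> (star t * (s - s')) = \<phi> (star t * s) - \<phi> (star t * s')"
  "s \<in> B \<Longrightarrow> t \<in> B \<Longrightarrow> \<phi> (star (c *\<^sub>C s) * t) = cnj c * \<phi> (star s * t)"
  "s \<in> B \<Longrightarrow> t \<in> B \<Longrightarrow> \<phi> (star t * (c *\<^sub>C s)) = c * \<phi> (star t * s)"
  "s \<in> B \<Longrightarrow> t \<in> B \<Longrightarrow> \<phi> (star t * s) = cnj (\<phi> (star s * t))"
  by (auto simp: star_add star_diff star_scaleC distrib_left distrib_right right_diff_distrib left_diff_distrib
      mult_scaleC \<phi>_add \<phi>_diff \<phi>_scaleC B_X B_star_mult)
     (metis B_X B_star_mult \<phi>_star star_mult star_star)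

lemmas \<phi>_inner = \<phi>_inner_add(1-6)

lemma nph_inner: "s \<in> B \<Longrightarrow> \<phi> (star s * s) = of_real ((nph s)\<^sup>2)"
  by (intro nph_of_real B_X B_star_mult)

text \<open>Polarization: orthogonal vectors have small mixed terms, so \<open>Q t t\<close> is proportional to \<open>(nph t)\<^sup>2\<close>.\<close>

lemma Q_scalar:
  assumes t: "t \<in> T"
  defines "u \<equiv> e (Suc n)"
  shows "Sm (5 * \<kappa> * (nph t)\<^sup>2) (\<lambda>i j. Q t t i j - (nph t)\<^sup>2 *\<^sub>R Q u u i j)"
proof -
  have u: "u \<in> T" unfolding u_def by (rule T_closed(4))
  note uB = T_D(1)[OF u] and tB = T_D(1)[OF t]
  have uu: "\<phi> (star u * u) = 1" unfolding u_def by (simp add: \<phi>_unit)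
  have nu: "nph u = 1" unfolding u_def by (rule nph_e)
  define a where "a = \<phi> (star u * t)"
  define t' where "t' = t - a *\<^sub>C u"
  have t': "t' \<in> T" unfolding t'_def by (intro T_closed t u)
  note t'B = T_D(1)[OF t']
  have ut': "\<phi> (star u * t') = 0" unfolding t'_def
    using uB tB by (simp add: \<phi>_inner B_closed_ops uu a_def)
  have t'u: "\<phi> (star t' * u) = 0" using \<phi>_inner_add(7)[OF uB t'B] ut' by simp
  have tt': "t = t' + a *\<^sub>C u" by (simp add: t'_def)
  have pyth: "(nph t)\<^sup>2 = (nph t')\<^sup>2 + (cmod a)\<^sup>2"
  proof -
    have "of_real ((nph t)\<^sup>2) = \<phi> (star (t' + a *\<^sub>C u) * (t' + a *\<^sub>C u))"
      using nph_inner[OF tB] tt' by simp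
    also have "\<dots> = (\<phi> (star t' * t') + a * \<phi> (star t' * u)) + (cnj a * \<phi> (star u * t') + cnj a * (a * \<phi> (star u * u)))"
      using uB t'B by (simp add: \<phi>_inner B_closed_ops) (simp add: algebra_simps)
    also have "\<dots> = of_real ((nph t')\<^sup>2) + a * cnj a"
      unfolding uu ut' t'u nph_inner[OF t'B] by simp
    also have "a * cnj a = of_real ((cmod a)\<^sup>2)" by (rule complex_norm_square[symmetric])
    finally have "complex_of_real ((nph t)\<^sup>2) = of_real ((nph t')\<^sup>2 + (cmod a)\<^sup>2)" by simp
    then show ?thesis by (simp only: of_real_eq_iff)
  qed
  have Qtt: "Q t t i j = Q t' t' i j + (cnj a *\<^sub>C Q u t' i j + a *\<^sub>C Q t' u i j) + (cmod a)\<^sup>2 *\<^sub>R Q u u i j" for i j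
  proof -
    have "a *\<^sub>C cnj a *\<^sub>C Q u u i j = (cmod a)\<^sup>2 *\<^sub>R Q u u i j"
      unfolding scaleC_scaleC by (subst complex_norm_square[symmetric]) (rule scaleC_of_real)
    then show ?thesis by (subst (1 2) tt') (simp only: Q_add Q_scaleC scaleC_add_right, simp add: algebra_simps)
  qed
  define l where "l = nph t'"
  have main: "Sm (\<kappa> * l) (Q u t') \<and> Sm (\<kappa> * l) (Q t' u) \<and> Sm (4 * \<kappa> * l\<^sup>2) (\<lambda>i j. Q t' t' i j - l\<^sup>2 *\<^sub>R Q u u i j)"
  proof (cases "l = 0")
    case True
    then show ?thesis
      using Q_bound[OF uB t'B] Q_bound[OF t'B uB] Q_bound[OF t'B t'B] by (simp add: l_def)
  next
    case False
    then have l: "l > 0" using nph_nonneg[of t'] by (simp add: l_def order.strict_iff_order del: nph_nonneg)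
    define w where "w = of_real (1 / l) *\<^sub>C t'"
    have w: "w \<in> T" unfolding w_def by (rule T_closed(3)[OF t'])
    note wB = T_D(1)[OF w]
    have uw: "\<phi> (star u * w) = 0" "\<phi> (star w * u) = 0"
      unfolding w_def using uB t'B by (simp_all add: \<phi>_inner ut' t'u)
    have nw: "nph w = 1" using l t'B by (simp add: w_def nph_scaleC l_def[symmetric] norm_divide)
    have ww: "\<phi> (star w * w) = 1" using nph_inner[OF wB] nw by simp
    have t'w: "t' = of_real l *\<^sub>C w" using l by (simp add: w_def scaleC_scaleC)
    have a1: "Sm \<kappa> (Q u w)" using Q_proportional[OF u w] by (simp add: nw nu uw)
    have a2: "Sm \<kappa> (Q w u)" using Q_proportional[OF w u] by (simp add: nw nu uw)
    \<comment> \<open>\<open>u + w\<close> and \<open>u - w\<close> are again orthogonal. Since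
      \<open>Q (u - w) (u + w)\<close> is \<open>Q u u - Q w w + Q u w - Q w u\<close>, three small
      coefficients with errors \<open>\<kappa>\<close>, \<open>\<kappa>\<close> and
      \<open>2 \<kappa>\<close> control the difference of the diagonal ones.\<close>
    have np: "nph (u + w) = sqrt 2" "nph (u - w) = sqrt 2"
      unfolding nph_def using uB wB by (simp_all add: \<phi>_inner B_closed_ops uw uu ww)
    have "\<phi> (star (u - w) * (u + w)) = 0"
      using uB wB by (simp add: \<phi>_inner B_closed_ops uw uu ww)
    then have a3: "Sm (\<kappa> * 2) (Q (u - w) (u + w))"
      using Q_proportional[OF T_closed(2)[OF u w] T_closed(1)[OF u w]] by (simp add: np mult.assoc)
    have "Sm ((\<kappa> + \<kappa>) + \<kappa> * 2) (\<lambda>i j. (Q u w i j - Q w u i j) - Q (u - w) (u + w) i j)"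
      by (intro Sm_diff a1 a2 a3)
    then have a4: "Sm (4 * \<kappa>) (\<lambda>i j. Q w w i j - Q u u i j)"
      by (simp add: Q_add Q_diff algebra_simps)
    show ?thesis
    proof (intro conjI)
      show "Sm (\<kappa> * l) (Q u t')" unfolding t'w Q_scaleC
        using Sm_scaleC[OF a1, of "of_real l"] l by (simp add: mult.commute Q_scaleC[abs_def])
      show "Sm (\<kappa> * l) (Q t' u)" unfolding t'w
        using Sm_scaleC[OF a2, of "of_real l"] l by (simp add: mult.commute Q_scaleC[abs_def])
      have "Q t' t' i j - l\<^sup>2 *\<^sub>R Q u u i j = of_real (l\<^sup>2) *\<^sub>C (Q w w i j - Q u u i j)" for i j
        unfolding t'w Q_scaleC scaleC_scaleC scaleC_diff_right by (simp add: power2_eq_square scaleR_scaleC)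
      then show "Sm (4 * \<kappa> * l\<^sup>2) (\<lambda>i j. Q t' t' i j - l\<^sup>2 *\<^sub>R Q u u i j)"
        using Sm_scaleC[OF a4, of "of_real (l\<^sup>2)"] by (simp add: mult_ac norm_power)
    qed
  qed
  have "Sm (4 * \<kappa> * l\<^sup>2 + (cmod (cnj a) * (\<kappa> * l) + cmod a * (\<kappa> * l)))
      (\<lambda>i j. (Q t' t' i j - l\<^sup>2 *\<^sub>R Q u u i j) + (cnj a *\<^sub>C Q u t' i j + a *\<^sub>C Q t' u i j))"
    using main by (intro Sm_add Sm_scaleC) auto
  moreover have "Q t t i j - (nph t)\<^sup>2 *\<^sub>R Q u u i j =
     (Q t' t' i j - l\<^sup>2 *\<^sub>R Q u u i j) + (cnj a *\<^sub>C Q u t' i j + a *\<^sub>C Q t' u i j)" for i j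
    unfolding Qtt pyth l_def by (simp add: algebra_simps)
  \<comment> \<open>The mixed terms of \<open>t = t' + a u\<close> cost \<open>2 \<kappa> l\<close>
    times the modulus of \<open>a\<close>, at most \<open>\<kappa>\<close> times the sum of the two
    squares, that is, \<open>\<kappa> (nph t)\<^sup>2\<close>. This raises 4 to 5.\<close>
  moreover have "4 * \<kappa> * l\<^sup>2 + (cmod (cnj a) * (\<kappa> * l) + cmod a * (\<kappa> * l)) \<le> 5 * \<kappa> * (nph t)\<^sup>2"
  proof -
    have "2 * (cmod a * l) \<le> (cmod a)\<^sup>2 + l\<^sup>2" using zero_le_power2[of "cmod a - l"] by (simp add: power2_eq_square algebra_simps)
    then have "\<kappa> * (2 * (cmod a * l)) \<le> \<kappa> * ((cmod a)\<^sup>2 + l\<^sup>2)" using \<kappa>(1) by (rule mult_left_mono)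
    moreover have "0 \<le> \<kappa> * (cmod a)\<^sup>2" using \<kappa>(1) by simp
    ultimately show ?thesis unfolding pyth l_def[symmetric] by (simp add: algebra_simps)
  qed
  ultimately show ?thesis using Sm_mono by simp
qed

text \<open>\<open>eigenvector\<close> makes \<open>y\<close> act on \<open>t\<close> as
  multiplication by a coefficient, and \<open>Q_scalar\<close> says that this coefficient does not
  depend on \<open>t\<close>; together, \<open>t\<close> can be moved to the left of
  \<open>y\<close>. The constant is 1 from the former plus 5 from the latter. If
  \<open>nph t = 0\<close>, both terms are small separately.\<close>

lemma approx_central:
  assumes t: "t \<in> T"
  shows "Sm (6 * \<kappa> * nph t) (\<lambda>i j. e n * y * e n * t * e j - t * e (Suc i) * e (Suc i) * y * e j)"
proof (cases "nph t = 0")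
  case True
  note tT = T_D[OF t]
  let ?f = "\<lambda>i j. e n * y * t * e j - (t * e (Suc i)) * (e (Suc i) * (1 * y * e 0 * e j))"
  have "Sm (norm (e n) * N y * nph t) (\<lambda>i j. e n * y * t * e j)" by (rule N_y_tail[OF tT(1)])
  moreover have "Sm (1 * (N y * nph (e 0))) (\<lambda>i j. e (Suc i) * (1 * y * e 0 * e j))"
    using N_y_tail[OF e_B, of 1 0]
    by (intro Sm_left[where s="\<lambda>i. e (Suc i)" and f="\<lambda>i j. 1 * y * e 0 * e j"]) auto
  then have "Sm (nph t * (1 * (N y * nph (e 0)))) (\<lambda>i j. (t * e (Suc i)) * (e (Suc i) * (1 * y * e 0 * e j)))"
    using LIMSEQ_Suc[OF norm_lim_B[OF tT(1)]]
    by (intro Sm_left[where s="\<lambda>i. t * e (Suc i)"]) auto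
  ultimately have "Sm (norm (e n) * N y * nph t + nph t * (1 * (N y * nph (e 0))))
     ?f" by (rule Sm_diff)
  then have "Sm 0 ?f"
    using True by simp
  then have "Sm 0 (\<lambda>i j. e n * y * e n * t * e j - t * e (Suc i) * e (Suc i) * y * e j)"
  proof (rule Sm_cong_gt[of _ _ 0])
    fix i j :: nat assume "0 < i" "Suc i < j"
    then have "e 0 * e j = e j" by (intro e_mult) simp
    then show "?f i j =
        e n * y * e n * t * e j - t * e (Suc i) * e (Suc i) * y * e j"
      by (simp add: mult.assoc) (simp add: tT(2) flip: mult.assoc)
  qed
  then show ?thesis using True by simp
next
  case False
  then have \<tau>: "nph t > 0" using nph_nonneg[of t] by linarith
  note tT = T_D[OF t]
  let ?u = "e (Suc n)"
  let ?P = "\<lambda>i j. e n * y * e n * t * e j - (1 / (nph t)\<^sup>2) *\<^sub>R (t * e (Suc i) * e (Suc i) * star t * y * t * e j)"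
    and ?Q = "\<lambda>i j. (t * e (Suc i)) * (of_real (1 / (nph t)\<^sup>2) *\<^sub>C (Q t t i j - (nph t)\<^sup>2 *\<^sub>R Q ?u ?u i j))"
  have S1: "Sm (\<kappa> * nph t) ?P" by (rule Sm_shift[OF eigenvector[OF t \<tau>]])
  have S2: "Sm (nph t * (cmod (of_real (1 / (nph t)\<^sup>2)) * (5 * \<kappa> * (nph t)\<^sup>2))) ?Q"
    using LIMSEQ_Suc[OF norm_lim_B[OF tT(1)]] \<kappa>(1)
    by (intro Sm_left[where s="\<lambda>i. t * e (Suc i)"] Sm_scaleC Q_scalar t) auto
  have S3: "nph t * (cmod (of_real (1 / (nph t)\<^sup>2)) * (5 * \<kappa> * (nph t)\<^sup>2)) = 5 * \<kappa> * nph t"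
    using \<tau> by (simp add: norm_divide norm_power)
  have "Sm (6 * \<kappa> * nph t) (\<lambda>i j. ?P i j + ?Q i j)"
    by (rule Sm_mono[OF Sm_add[OF S1 S2[unfolded S3]]]) simp
  then show ?thesis
  proof (rule Sm_cong_gt[of _ _ "Suc n"])
    fix i j assume ij: "i > Suc n" "j > Suc i"
    have Qu: "Q ?u ?u i j = e (Suc i) * y * e j"
      using ij by (simp add: Q_def mult.assoc e_mult e_mult')
    show "?P i j + ?Q i j = e n * y * e n * t * e j - t * e (Suc i) * e (Suc i) * y * e j"
      using \<tau> unfolding Qu scaleC_of_real by (simp add: Q_def scaleR_diff_right right_diff_distrib mult.assoc)
  qed
qed

text \<open>The bound does not depend on the number \<open>L\<close> of summands. The row with
  entries \<open>star (z l) * e (Suc n)\<close> is a contraction because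
  \<open>s \<preceq> 1\<close>, and the errors for the vectors \<open>t l\<close> are square
  summable, their squared lengths adding up to \<open>\<phi> (star r * s * r)\<close>.\<close>

lemma approx_central_row:
  fixes z :: "nat \<Rightarrow> 'u"
  assumes z: "\<And>l. l < L \<Longrightarrow> z l \<in> B"
  defines "s \<equiv> (\<Sum>l<L. star (z l) * (e (Suc n) * e (Suc n)) * z l)"
    and "S \<equiv> (\<Sum>l<L. star (z l) * (e (Suc n) * y * e (Suc n)) * z l)"
  assumes s: "s \<preceq> 1" and r: "r \<in> B"
  shows "Sm (6 * \<kappa> * nph r) (\<lambda>i j. S * r * e j - s * r * e (Suc i) * e (Suc i) * y * e j)"
proof -
  let ?u = "e (Suc n)"
  define t where "t l = ?u * z l * r" for l
  have tT: "t l \<in> T" if "l < L" for l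
    unfolding T_def t_def using z[OF that] r by (auto simp: B_mult e_B e_mult mult.assoc e_mult')
  define Y where "Y l i j = e n * y * e n * t l * e j - t l * e (Suc i) * e (Suc i) * y * e j" for l i j
  define a where "a l = 6 * \<kappa> * nph (t l)" for l
  have SmY: "Sm (a l) (Y l)" if "l < L" for l
    using approx_central[OF tT[OF that]] by (simp add: a_def Y_def[abs_def])
  have sB: "s \<in> B" unfolding s_def using z by (intro B_sum B_conj B_mult e_B) auto
  have ps: "pos s" unfolding s_def by (intro pos_sum pos_conj sa_square_pos e_sa)
  have ns: "norm s \<le> 1" using pos_le_norm(1)[OF ps, of 1] s by simp
  have suma: "(\<Sum>l<L. (a l)\<^sup>2) \<le> (6 * \<kappa> * nph r)\<^sup>2"
  proof -
    have "of_real (\<Sum>l<L. (nph (t l))\<^sup>2) = (\<Sum>l<L. \<phi> (star (t l) * t l))"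
      using tT T_D by (simp add: nph_inner)
    also have "\<dots> = \<phi> (\<Sum>l<L. star (t l) * t l)"
      using tT T_D by (intro \<phi>_sum[symmetric]) (auto intro!: B_X B_star_mult)
    also have "(\<Sum>l<L. star (t l) * t l) = star r * s * r"
      unfolding s_def t_def sum_distrib_left sum_distrib_right by (simp add: star_mult mult.assoc)
    finally have eq: "complex_of_real (\<Sum>l<L. (nph (t l))\<^sup>2) = \<phi> (star r * s * r)" .
    have "star r * s * r \<preceq> 1 *\<^sub>R (star r * r)" by (rule conj_ple_norm[OF pos_sa[OF ps] ns])
    then have "cmod (\<phi> (star r * s * r)) \<le> (nph r)\<^sup>2"
      unfolding nph_sq using ps r sB by (intro \<phi>_mono B_X B_conj B_star_mult pos_conj) auto
    then have "(\<Sum>l<L. (nph (t l))\<^sup>2) \<le> (nph r)\<^sup>2" unfolding eq[symmetric] norm_of_real by simp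
    then have "(6 * \<kappa>)\<^sup>2 * (\<Sum>l<L. (nph (t l))\<^sup>2) \<le> (6 * \<kappa>)\<^sup>2 * (nph r)\<^sup>2" by (intro mult_left_mono) auto
    then show ?thesis by (simp add: a_def power_mult_distrib sum_distrib_left)
  qed
  have eq: "S * r * e j - s * r * e (Suc i) * e (Suc i) * y * e j = (\<Sum>l<L. (star (z l) * ?u) * Y l i j)" for i j
  proof -
    have "?u * (e n * y * e n * t l * e j) = ?u * y * ?u * z l * r * e j" for l
      by (simp add: t_def mult.assoc e_mult e_mult')
    then have "(star (z l) * ?u) * Y l i j = star (z l) * (?u * y * ?u) * z l * r * e j
        - star (z l) * (?u * ?u) * z l * r * e (Suc i) * e (Suc i) * y * e j" for l
      by (simp add: Y_def right_diff_distrib mult.assoc t_def)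
    then show ?thesis by (simp add: S_def s_def sum_subtractf sum_distrib_right)
  qed
  show ?thesis unfolding Sm_def eq
  proof (intro allI impI)
    fix eps :: real assume eps: "eps > 0"
    \<comment> \<open>A slack \<open>h\<close> in each of \<open>L\<close> entries contributes
      \<open>h sqrt L\<close> to the Euclidean norm.\<close>
    define h where "h = eps / (sqrt (real L) + 1)"
    have "sqrt (real L) + 1 > 0" by (simp add: add_nonneg_pos)
    then have h: "h > 0" "h * sqrt (real L) \<le> eps" using eps by (auto simp: h_def field_simps)
    have "\<forall>\<^sub>s i. \<forall>l\<in>{..<L}. \<forall>\<^sub>s j. N (Y l i j) \<le> a l + h"
      by (intro eventually_ball_finite ballI SmD[OF SmY] h) auto
    then show "\<forall>\<^sub>s i. \<forall>\<^sub>s j. N (\<Sum>l<L. star (z l) * e (Suc n) * Y l i j) \<le> 6 * \<kappa> * nph r + eps"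
    proof eventually_elim
      case (elim i)
      then have "\<forall>\<^sub>s j. \<forall>l\<in>{..<L}. N (Y l i j) \<le> a l + h"
        by (intro eventually_ball_finite) auto
      then show ?case
      proof eventually_elim
        case (elim j)
        have "(N (\<Sum>l<L. (star (z l) * ?u) * Y l i j))\<^sup>2 \<le> 1 * (\<Sum>l<L. (N (Y l i j))\<^sup>2)"
        proof (rule N_row)
          have "(\<Sum>l<L. star (z l) * ?u * star (star (z l) * ?u)) = s"
            by (simp add: s_def star_mult star_star mult.assoc)
          then show "norm (\<Sum>l<L. star (z l) * ?u * star (star (z l) * ?u)) \<le> 1" using ns by simp
        qed
        also have "\<dots> \<le> (\<Sum>l<L. (a l + h)\<^sup>2)" using elim by (auto intro!: sum_mono power_mono)
        finally have "N (\<Sum>l<L. (star (z l) * ?u) * Y l i j) \<le> L2_set (\<lambda>l. a l + h) {..<L}"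
          unfolding L2_set_def by (simp add: real_le_rsqrt)
        also have "\<dots> \<le> L2_set a {..<L} + L2_set (\<lambda>l. h) {..<L}" by (rule L2_set_triangle_ineq)
        also have "L2_set a {..<L} \<le> 6 * \<kappa> * nph r"
          unfolding L2_set_def using suma \<kappa>(1) by (intro real_le_lsqrt) (auto intro: sum_nonneg)
        also have "L2_set (\<lambda>l. h) {..<L} \<le> eps" unfolding L2_set_def using h by (simp add: real_sqrt_mult mult.commute)
        finally show ?case by simp
      qed
    qed
  qed
qed

end

section \<open>From approximately central elements to multipliers\<close>

context excising_sequence
begin

text \<open>By simplicity these finite sums are dense in \<open>B\<close>. A sum, rather than a
  general element of the ideal, is what \<open>row_inequality\<close> can be applied to.\<close>

definition span_e :: "nat \<Rightarrow> 'u set" where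
  "span_e n = {x. \<exists>L a c. (\<forall>l<L. a l \<in> B \<and> c l \<in> B) \<and> x = (\<Sum>l<L::nat. a l * e n * c l)}"

lemma span_e_add: "x \<in> span_e n \<Longrightarrow> y \<in> span_e n \<Longrightarrow> x + y \<in> span_e n"
proof -
  assume "x \<in> span_e n" "y \<in> span_e n"
  then obtain L a c M b d where x: "\<forall>l<L. a l \<in> B \<and> c l \<in> B" "x = (\<Sum>l<L::nat. a l * e n * c l)"
    and y: "\<forall>l<M. b l \<in> B \<and> d l \<in> B" "y = (\<Sum>l<M::nat. b l * e n * d l)"
    unfolding span_e_def by blast
  define a' where "a' l = (if l < L then a l else b (l - L))" for l
  define c' where "c' l = (if l < L then c l else d (l - L))" for l
  have split: "(\<Sum>l<L + M. g l) = (\<Sum>l<L. g l) + (\<Sum>l<M. g (L + l))" for g :: "nat \<Rightarrow> 'u"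
    by (induction M) (auto simp: add.assoc)
  have "(\<Sum>l<L + M. a' l * e n * c' l) = (\<Sum>l<L. a' l * e n * c' l) + (\<Sum>l<M. a' (L + l) * e n * c' (L + l))"
    by (rule split)
  also have "\<dots> = x + y" by (simp add: x y a'_def c'_def)
  finally have "x + y = (\<Sum>l<L + M. a' l * e n * c' l)" ..
  moreover have "\<forall>l<L + M. a' l \<in> B \<and> c' l \<in> B" using x(1) y(1) by (auto simp: a'_def c'_def)
  ultimately show ?thesis unfolding span_e_def by blast
qed

lemma span_e_map:
  assumes "x \<in> span_e n" "\<And>a. a \<in> B \<Longrightarrow> p a \<in> B" "\<And>a. a \<in> B \<Longrightarrow> q a \<in> B"
    "\<And>a c. f (a * e n * c) = p a * e n * q c" "\<And>(g::nat \<Rightarrow> 'u) L. f (\<Sum>l<L. g l) = (\<Sum>l<L. f (g l))"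
  shows "f x \<in> span_e n"
proof -
  obtain L a c where x: "\<forall>l<L. a l \<in> B \<and> c l \<in> B" "x = (\<Sum>l<L::nat. a l * e n * c l)"
    using assms(1) unfolding span_e_def by blast
  have "f x = (\<Sum>l<L. p (a l) * e n * q (c l))" by (simp add: x(2) assms(4,5))
  then show ?thesis unfolding span_e_def using x(1) assms(2,3)
    by (intro CollectI exI[of _ L] exI[of _ "\<lambda>l. p (a l)"] exI[of _ "\<lambda>l. q (c l)"]) auto
qed

lemma span_e_B: "span_e n \<subseteq> B"
  unfolding span_e_def by (auto intro!: B_sum B_mult e_B)

lemma closure_image_subset:
  assumes "bounded_linear f" "\<And>x. x \<in> S \<Longrightarrow> f x \<in> S" "x \<in> closure S"
  shows "f x \<in> closure S"
proof -
  obtain u where u: "\<And>n. u n \<in> S" "u \<longlonglongrightarrow> x" using assms(3) unfolding closure_sequential by blast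
  then have "(\<lambda>n. f (u n)) \<longlonglongrightarrow> f x" using bounded_linear.tendsto[OF assms(1)] by blast
  then show ?thesis using assms(2) u(1) unfolding closure_sequential by (intro exI[of _ "\<lambda>n. f (u n)"]) auto
qed

lemma closure_span_e: "closure (span_e n) = B"
proof -
  have "closure (span_e n) = {0} \<or> closure (span_e n) = B"
  proof (rule simple_B)
    show "closure (span_e n) \<subseteq> B" by (rule closure_minimal[OF span_e_B closed_B])
    have "0 \<in> span_e n" unfolding span_e_def by (intro CollectI exI[of _ 0]) auto
    then show "0 \<in> closure (span_e n)" using closure_subset by blast
    show "x + y \<in> closure (span_e n)" if xy: "x \<in> closure (span_e n)" "y \<in> closure (span_e n)" for x y
    proof -
      obtain u where u: "\<And>k. u k \<in> span_e n" "u \<longlonglongrightarrow> x"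
        using xy(1) unfolding closure_sequential by blast
      obtain v where v: "\<And>k. v k \<in> span_e n" "v \<longlonglongrightarrow> y"
        using xy(2) unfolding closure_sequential by blast
      have "(\<lambda>k. u k + v k) \<longlonglongrightarrow> x + y" by (intro tendsto_add u v)
      then show ?thesis using span_e_add u v unfolding closure_sequential by (intro exI[of _ "\<lambda>k. u k + v k"]) auto
    qed
    show "c *\<^sub>C x \<in> closure (span_e n)" if "x \<in> closure (span_e n)" for c x
    proof (rule closure_image_subset[OF bounded_linear_scaleC _ that])
      fix x assume "x \<in> span_e n"
      then show "c *\<^sub>C x \<in> span_e n"
        by (rule span_e_map[where p="\<lambda>a. c *\<^sub>C a" and q="\<lambda>a. a"]) (auto simp: B_closed_ops mult_scaleC_left scaleC_sum_right)
    qed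
    show "b * x \<in> closure (span_e n)" if "b \<in> B" "x \<in> closure (span_e n)" for b x
    proof (rule closure_image_subset[OF bounded_linear_mult_right _ that(2)])
      fix x assume "x \<in> span_e n"
      then show "b * x \<in> span_e n"
        by (rule span_e_map[where p="\<lambda>a. b * a" and q="\<lambda>a. a"]) (use that in \<open>auto simp: B_mult mult.assoc sum_distrib_left\<close>)
    qed
    show "x * b \<in> closure (span_e n)" if "b \<in> B" "x \<in> closure (span_e n)" for b x
    proof (rule closure_image_subset[OF bounded_linear_mult_left _ that(2)])
      fix x assume "x \<in> span_e n"
      then show "x * b \<in> span_e n"
        by (rule span_e_map[where p="\<lambda>a. a" and q="\<lambda>a. a * b"]) (use that in \<open>auto simp: B_mult mult.assoc sum_distrib_right\<close>)
    qed
  qed simp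
  moreover have "e (Suc (Suc n)) \<in> span_e n" unfolding span_e_def
    by (intro CollectI exI[of _ 1] exI[of _ "\<lambda>_. e (Suc n)"] exI[of _ "\<lambda>_. e (Suc (Suc n))"])
       (simp add: e_B e_mult)
  then have "e (Suc (Suc n)) \<in> closure (span_e n)" using closure_subset by blast
  then have "closure (span_e n) \<noteq> {0}" using e_norm[of "Suc (Suc n)"] by (metis norm_zero singletonD zero_neq_one)
  ultimately show ?thesis by blast
qed

text \<open>Approximate units of the form \<open>1 - (1 - P)\<^sup>k\<close>, where \<open>P\<close> is a multiple of \<open>\<Sum> a\<^sub>l e\<^sub>n\<^sup>2 a\<^sub>l\<^sup>*\<close>.\<close>

lemma approximate_unit:
  assumes h: "h \<in> B" and eps: "eps > 0"
  shows "\<exists>L z. (\<forall>l<L. z l \<in> B) \<and> (\<Sum>l<L::nat. star (z l) * (e n * e n) * z l) \<preceq> 1 \<and>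
     norm ((1 - (\<Sum>l<L. star (z l) * (e n * e n) * z l)) * h) \<le> eps"
proof -
  obtain x where "x \<in> span_e n" and hx: "norm (h - x) < eps/2"
    using h eps closure_approachable[of h "span_e n"] unfolding closure_span_e by (metis dist_norm half_gt_zero norm_minus_commute)
  then obtain L a c where x: "\<forall>l<L. a l \<in> B \<and> c l \<in> B" "x = (\<Sum>l<L::nat. a l * e n * c l)"
    unfolding span_e_def by blast
  define p where "p = (\<Sum>l<L. a l * (e n * e n) * star (a l))"
  define C where "C = norm (\<Sum>l<L. star (c l) * star (star (c l))) + 1"
  define M where "M = norm p + 1"
  have C: "C > 0" and M: "M > 0" by (auto simp: C_def M_def add_nonneg_pos)
  have pp: "pos p" unfolding p_def by (intro pos_sum pos_conj' sa_square_pos e_sa)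
  have pB: "p \<in> B" unfolding p_def using x(1) by (intro B_sum B_mult B_closed_ops(4) e_B) auto
  \<comment> \<open>The factors \<open>c l\<close> are absorbed into the constant \<open>C\<close>,
    leaving an element \<open>p\<close> that depends only on the left factors
    \<open>a l\<close>.\<close>
  have xx: "x * star x \<preceq> C *\<^sub>R p"
  proof -
    have sx: "star x = (\<Sum>l<L. star (c l) * (e n * star (a l)))" by (simp add: x(2) star_sum star_mult mult.assoc)
    have "star (\<Sum>l<L. star (c l) * (e n * star (a l))) * (\<Sum>l<L. star (c l) * (e n * star (a l)))
       \<preceq> C *\<^sub>R (\<Sum>l<L. star (e n * star (a l)) * (e n * star (a l)))"
      by (rule row_inequality[OF _ C]) (simp add: C_def)
    then show ?thesis unfolding sx[symmetric] by (simp add: star_star star_mult p_def mult.assoc)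
  qed
  define P where "P = (1/M) *\<^sub>R p"
  have P: "pos P" unfolding P_def using M by (intro pos_scaleR pp) auto
  have "norm P \<le> 1" using M by (simp add: P_def M_def)
  then have P1: "P \<preceq> 1" using ple_norm[OF pos_sa[OF P], of 1] by simp
  have PB: "P \<in> B" unfolding P_def by (intro B_closed_ops pB)
  have Q: "pos (1 - P)" "1 - P \<in> F" using P1 PB by (auto intro: F_closed_ops B_F)
  obtain k :: nat where k: "C * M / (eps/2)\<^sup>2 < real k" using reals_Archimedean2 by blast
  define q where "q = (1 - P) ^ k"
  have qF: "q \<in> F" unfolding q_def by (intro F_power Q)
  have posq: "pos q" unfolding q_def by (intro pos_power Q)
  have sq: "star q = q" by (rule pos_star[OF posq])
  have qx: "norm (q * x) \<le> eps/2"
  proof -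
    have "(norm (q * x))\<^sup>2 = norm (q * (x * star x) * q)"
      by (simp add: cstar_identity'[symmetric] star_mult sq mult.assoc)
    also have "\<dots> \<le> norm (q * (C *\<^sub>R p) * q)"
      by (intro norm_mono pos_conj_sa ple_conj_sa xx pos_sa[OF posq]) simp
    also have "q * (C *\<^sub>R p) * q = (C * M) *\<^sub>R (P * (1 - P) ^ (k + k))"
    proof -
      have "P * q = q * P" unfolding q_def by (rule power_commuting_commutes[symmetric]) (simp add: algebra_simps)
      then have "q * P * q = (P * q) * q" by simp
      then have "q * P * q = P * (q * q)" by (simp only: mult.assoc)
      then have "q * P * q = P * (1 - P) ^ (k + k)" by (simp add: power_add q_def)
      moreover have "C *\<^sub>R p = (C * M) *\<^sub>R P" using M by (simp add: P_def)
      ultimately show ?thesis by simp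
    qed
    also have "norm \<dots> = C * M * norm (P * (1 - P) ^ (k + k))" using C M by simp
    also have "\<dots> \<le> C * M * (1 / real (Suc (k + k)))"
      using power_decay[OF P P1, of "k + k"] C M by (intro mult_left_mono) (auto simp: field_simps)
    also have "\<dots> \<le> (eps/2)\<^sup>2"
    proof -
      have "C * M < (eps/2)\<^sup>2 * real k" using k eps by (simp add: field_simps)
      also have "\<dots> \<le> (eps/2)\<^sup>2 * real (Suc (k + k))" by (intro mult_left_mono) auto
      finally show ?thesis by (simp add: field_simps)
    qed
    finally show ?thesis using eps by (simp add: power2_le_iff_abs_le)
  qed
  \<comment> \<open>\<open>w\<close> is the truncated geometric series for the inverse of
    \<open>p\<close>, so that \<open>p * w = 1 - q\<close>. Its square root \<open>r\<close>
    commutes with \<open>p\<close>, and \<open>z l = star (a l) * r\<close> turns \<open>p\<close>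
    into \<open>r * p * r\<close>.\<close>
  define w where "w = (1/M) *\<^sub>R (\<Sum>i<k. (1 - P) ^ i)"
  have wF: "w \<in> F" unfolding w_def by (intro F_closed_ops F_sum F_power Q)
  have pw: "pos w" unfolding w_def using M by (intro pos_scaleR pos_sum pos_power Q) auto
  define r where "r = psqrt w"
  have r: "star r = r" "r * r = w" "r \<in> F" unfolding r_def using psqrt(1,2)[OF pw] F_psqrt[OF pw wF] by (auto simp: pos_star)
  have "p * (1 - P) ^ i = (1 - P) ^ i * p" for i
    by (rule power_commuting_commutes[symmetric]) (simp add: P_def algebra_simps)
  then have "p * w = w * p" by (simp add: w_def sum_distrib_left sum_distrib_right)
  then have pr: "p * r = r * p" unfolding r_def by (rule psqrt(3)[OF pw])
  have "r * p * r = w * p" using pr r(2) by (metis mult.assoc)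
  also have "\<dots> = (\<Sum>i<k. (1 - P) ^ i * P)" using M by (simp add: w_def P_def sum_distrib_right scaleR_sum_right)
  also have "\<dots> = 1 - q"
  proof -
    have "(1 - P) ^ i * P = P * (1 - P) ^ i" for i
      by (rule power_commuting_commutes) (simp add: algebra_simps)
    then show ?thesis unfolding q_def by (induction k) (auto simp: algebra_simps)
  qed
  finally have rpr: "r * p * r = 1 - q" .
  define z where "z l = star (a l) * r" for l
  have zs: "(\<Sum>l<L. star (z l) * (e n * e n) * z l) = 1 - q"
    unfolding rpr[symmetric] by (simp add: z_def p_def star_mult star_star r(1) sum_distrib_left sum_distrib_right mult.assoc)
  have "norm q \<le> 1"
  proof -
    have "norm (1 - P) \<le> 1" using pos_le_norm(1)[OF Q(1), of 1] P by simp
    then show ?thesis unfolding q_def by (meson norm_ge_zero norm_power_ineq order_trans power_le_one)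
  qed
  have "norm (q * h) \<le> norm (q * x) + norm (q * (h - x))"
    by (rule order_trans[OF _ norm_triangle_ineq]) (simp add: algebra_simps)
  also have "norm (q * (h - x)) \<le> norm q * norm (h - x)" by (rule norm_mult_ineq)
  also have "\<dots> \<le> 1 * norm (h - x)" using \<open>norm q \<le> 1\<close> by (intro mult_right_mono) auto
  finally have "norm (q * h) \<le> eps" using qx hx by simp
  moreover have "\<forall>l<L. z l \<in> B" using x(1) r(3) by (auto simp: z_def intro: B_closed_ops)
  ultimately show ?thesis using posq by (intro exI[of _ L] exI[of _ z]) (simp add: zs)
qed

text \<open>\<open>S\<close> acts on GNS vectors like \<open>s\<close> followed by
  \<open>e (Suc i) * e (Suc i) * y * e j\<close>, a factor that does not involve \<open>S\<close> or
  \<open>s\<close>. It will turn out to be the scalar \<open>\<phi> y\<close>; before that is known,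
  it can still be cancelled between two such pairs.\<close>

definition AP :: "'u \<Rightarrow> real \<Rightarrow> 'u \<Rightarrow> 'u \<Rightarrow> bool" where
  "AP y \<eta> S s \<longleftrightarrow> S \<in> A \<and> s \<in> B \<and>
     (\<forall>r\<in>B. Sm (\<eta> * nph r) (\<lambda>i j. S * r * e j - s * r * e (Suc i) * e (Suc i) * y * e j))"

lemma AP_diff:
  assumes "AP y h S s" "AP y h' S' s'"
  shows "AP y (h + h') (S - S') (s - s')"
  unfolding AP_def
proof (intro conjI ballI)
  fix r assume r: "r \<in> B"
  have "Sm (h * nph r + h' * nph r) (\<lambda>i j. (S * r * e j - s * r * e (Suc i) * e (Suc i) * y * e j) -
      (S' * r * e j - s' * r * e (Suc i) * e (Suc i) * y * e j))"
    using assms r by (intro Sm_diff) (auto simp: AP_def)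
  then show "Sm ((h + h') * nph r) (\<lambda>i j. (S - S') * r * e j - (s - s') * r * e (Suc i) * e (Suc i) * y * e j)"
    by (simp add: algebra_simps)
qed (use assms in \<open>auto simp: AP_def intro: A_closed_ops B_closed_ops\<close>)

lemma AP_right:
  assumes "AP y h S s" "h \<ge> 0" "b \<in> B"
  shows "AP y (h * norm b) (S * b) (s * b)"
  unfolding AP_def
proof (intro conjI ballI)
  fix r assume r: "r \<in> B"
  have "Sm (h * nph (b * r)) (\<lambda>i j. S * (b * r) * e j - s * (b * r) * e (Suc i) * e (Suc i) * y * e j)"
    using assms r B_mult[OF assms(3) r] by (auto simp: AP_def)
  moreover have "h * nph (b * r) \<le> h * norm b * nph r"
    using mult_left_mono[OF nph_left[OF r B_F[OF assms(3)]] assms(2)] by (simp add: mult.assoc)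
  ultimately show "Sm (h * norm b * nph r) (\<lambda>i j. (S * b) * r * e j - (s * b) * r * e (Suc i) * e (Suc i) * y * e j)"
    by (simp add: mult.assoc Sm_mono)
qed (use assms in \<open>auto simp: AP_def intro: A_closed_ops B_mult\<close>)

lemma AP_left:
  assumes "AP y h S s" "h \<ge> 0" "b \<in> B"
  shows "AP y (h * norm b) (b * S) (b * s)"
  unfolding AP_def
proof (intro conjI ballI)
  fix r assume r: "r \<in> B"
  have "Sm (norm b * (h * nph r)) (\<lambda>i j. b * (S * r * e j - s * r * e (Suc i) * e (Suc i) * y * e j))"
    using assms r by (intro Sm_left_const) (auto simp: AP_def)
  then show "Sm (h * norm b * nph r) (\<lambda>i j. (b * S) * r * e j - (b * s) * r * e (Suc i) * e (Suc i) * y * e j)"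
    by (simp add: right_diff_distrib mult_ac)
qed (use assms in \<open>auto simp: AP_def intro: A_closed_ops B_mult\<close>)

lemma Sm_tail: 
  assumes s: "s \<in> B" and r: "r \<in> B"
  shows "Sm (norm s * N y * nph r) (\<lambda>i j. s * r * e (Suc i) * e (Suc i) * y * e j)"
proof -
  have "Sm (N y) (\<lambda>i j. e (Suc i) * y * e j)"
    by (rule Sm_bounded) (use N_sandwich[OF e_F, of "e _" y] in simp)
  then have "Sm (nph (s * r) * N y) (\<lambda>i j. (s * r * e (Suc i)) * (e (Suc i) * y * e j))"
    using LIMSEQ_Suc[OF norm_lim_B[OF B_mult[OF s r]]]
    by (intro Sm_left[where s="\<lambda>i. s * r * e (Suc i)"]) auto
  moreover have "nph (s * r) * N y \<le> norm s * N y * nph r"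
    using mult_right_mono[OF nph_left[OF r B_F[OF s]] N_nonneg[of y]] by (simp add: mult_ac)
  ultimately show ?thesis by (simp add: mult.assoc Sm_mono)
qed

text \<open>Combined with \<open>AP_diff\<close>, \<open>AP_left\<close> and
  \<open>AP_right\<close>, this bounds differences and commutators of the elements \<open>S\<close>
  by those of the elements \<open>s\<close> in \<open>B\<close>, which converge.\<close>

lemma AP_N:
  assumes "AP y h S s" "h \<ge> 0"
  shows "N S \<le> h + norm s * N y"
proof (rule N_le_from_Sm)
  show "S \<in> A" using assms by (simp add: AP_def)
  show "0 \<le> h + norm s * N y" using assms by simp
  fix r assume r: "r \<in> B"
  have s: "s \<in> B" using assms by (simp add: AP_def)
  have "Sm (h * nph r + norm s * N y * nph r)
    (\<lambda>i j. (S * r * e j - s * r * e (Suc i) * e (Suc i) * y * e j) + s * r * e (Suc i) * e (Suc i) * y * e j)"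
    using assms r by (intro Sm_add Sm_tail[OF s r]) (auto simp: AP_def)
  then show "Sm ((h + norm s * N y) * nph r) (\<lambda>i j. S * r * e j)" by (simp add: algebra_simps)
qed

lemma AP_exists:
  assumes y: "y \<in> A" and \<eta>: "\<eta> > 0" and h: "h \<in> B" and eps: "eps > 0"
  shows "\<exists>S s. AP y \<eta> S s \<and> pos s \<and> s \<preceq> 1 \<and> norm ((1 - s) * h) \<le> eps"
proof -
  \<comment> \<open>Chosen so that \<open>\<kappa>\<^sup>2 = 2 m d\<close> is at most
    \<open>(\<eta> / 6)\<^sup>2\<close>, where 6 is the constant of
    \<open>approx_central_row\<close> and \<open>m \<le> N y\<close>.\<close>
  define d where "d = (\<eta> / 6)\<^sup>2 / (2 * (N y + 1))"
  have Ny: "N y + 1 > 0" using N_nonneg[of y] by linarith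
  have d: "d > 0" using \<eta> Ny by (simp add: d_def)
  obtain n where n: "flat (e n) y d" using e_flat[OF y d] by blast
  interpret f: flat_element act ch e y n d by unfold_locales (use y n d in auto)
  have "6 * f.\<kappa> \<le> \<eta>"
  proof -
    have "N (e n * y * e n) \<le> N y + 1" using N_sandwich[OF e_F, of "e n" y n] by simp
    then have "2 * N (e n * y * e n) * d \<le> 2 * (N y + 1) * d" using d by (intro mult_right_mono mult_left_mono) auto
    also have "\<dots> = (\<eta> / 6)\<^sup>2" using Ny by (simp add: d_def)
    finally have "f.\<kappa> \<le> sqrt ((\<eta> / 6)\<^sup>2)" unfolding f.\<kappa>_def by (rule real_sqrt_le_mono)
    then show ?thesis using \<eta> by simp
  qed
  obtain L z where z: "\<forall>l<L. z l \<in> B" and s1: "(\<Sum>l<L::nat. star (z l) * (e (Suc n) * e (Suc n)) * z l) \<preceq> 1"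
    and sh: "norm ((1 - (\<Sum>l<L. star (z l) * (e (Suc n) * e (Suc n)) * z l)) * h) \<le> eps"
    using approximate_unit[OF h eps, of "Suc n"] by blast
  define s where "s = (\<Sum>l<L. star (z l) * (e (Suc n) * e (Suc n)) * z l)"
  define S where "S = (\<Sum>l<L. star (z l) * (e (Suc n) * y * e (Suc n)) * z l)"
  have "AP y \<eta> S s" unfolding AP_def
  proof (intro conjI ballI)
    show "S \<in> A" unfolding S_def by (intro A_sum A_closed_ops y)
    show "s \<in> B" unfolding s_def using z by (intro B_sum B_conj B_mult e_B) auto
    fix r assume r: "r \<in> B"
    have "Sm (6 * f.\<kappa> * nph r) (\<lambda>i j. S * r * e j - s * r * e (Suc i) * e (Suc i) * y * e j)"
      unfolding S_def s_def using z s1 r by (intro f.approx_central_row) auto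
    then show "Sm (\<eta> * nph r) (\<lambda>i j. S * r * e j - s * r * e (Suc i) * e (Suc i) * y * e j)"
      by (rule Sm_mono) (use \<open>6 * f.\<kappa> \<le> \<eta>\<close> in \<open>auto intro: mult_right_mono\<close>)
  qed
  moreover have "pos s" unfolding s_def by (intro pos_sum pos_conj sa_square_pos e_sa)
  ultimately show ?thesis using s1 sh unfolding s_def by blast
qed

definition approx_unit :: "(nat \<Rightarrow> 'u) \<Rightarrow> bool" where
  "approx_unit s \<longleftrightarrow> (\<forall>k. s k \<in> B \<and> pos (s k) \<and> s k \<preceq> 1) \<and>
     (\<forall>b\<in>B. (\<lambda>k. s k * b) \<longlonglongrightarrow> b) \<and> (\<forall>b\<in>B. (\<lambda>k. b * s k) \<longlonglongrightarrow> b)"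

lemma approx_unit_norm: "approx_unit s \<Longrightarrow> norm (s k) \<le> 1" "approx_unit s \<Longrightarrow> norm (1 - s k) \<le> 1"
  using pos_le_norm(1)[of "s k" 1] pos_le_norm(1)[of "1 - s k" 1] by (auto simp: approx_unit_def)

text \<open>In the module norm, \<open>x * (1 - s k)\<close> is governed by
  \<open>E (star x * x)\<close>, an element of \<open>B\<close>. Convolution with a fixed
  \<open>f\<close> passes to the norm, and \<open>cv f x\<close> is close to
  \<open>x\<close>.\<close>

lemma approx_unit_A:
  assumes s: "approx_unit s" and x: "x \<in> A"
  shows "(\<lambda>k. x * s k) \<longlonglongrightarrow> x" "(\<lambda>k. s k * x) \<longlonglongrightarrow> x"
proof -
  have right: "(\<lambda>k. x * s k) \<longlonglongrightarrow> x" if x: "x \<in> A" for x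
  proof (rule LIM_zero_cancel, rule tendstoI)
    fix eps :: real assume eps: "eps > 0"
    obtain f where f: "continuous_on UNIV f" "norm (cv f x - x) \<le> eps/3" using cv_approx[of "eps/3" x] eps by auto
    obtain K where K: "K > 0" "\<And>x. norm (cv f x) \<le> K * N x" using cv_norm_le[OF f(1)] by blast
    define h where "h = E (star x * x)"
    have h: "h \<in> B" unfolding h_def by (intro E_in_B A_closed_ops x)
    have oF: "1 - s k \<in> F" "sa (1 - s k)" for k
    proof -
      have "s k \<in> F" "pos (s k)" using s B_F by (auto simp: approx_unit_def)
      then show "1 - s k \<in> F" "sa (1 - s k)" by (simp_all add: F_closed_ops(2,5) sa_diff sa_one pos_sa)
    qed
    have Nb: "N (x * (1 - s k)) \<le> sqrt (norm (h - h * s k))" for k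
    proof -
      have "(N (x * (1 - s k)))\<^sup>2 = norm ((1 - s k) * (h * (1 - s k)))"
        using N_conj[OF oF, of x] by (simp add: h_def mult.assoc)
      also have "\<dots> \<le> norm (1 - s k) * norm (h * (1 - s k))" by (rule norm_mult_ineq)
      also have "\<dots> \<le> 1 * norm (h * (1 - s k))" by (intro mult_right_mono approx_unit_norm s) simp
      finally show ?thesis by (simp add: real_le_rsqrt algebra_simps)
    qed
    have "(\<lambda>k. K * sqrt (norm (h - h * s k))) \<longlonglongrightarrow> K * sqrt (norm (h - h))"
      using s h by (intro tendsto_intros) (auto simp: approx_unit_def)
    then have "\<forall>\<^sub>s k. K * sqrt (norm (h - h * s k)) < eps/3"
      using eps by (intro order_tendstoD(2)) auto
    then show "\<forall>\<^sub>s k. dist (x * s k - x) 0 < eps"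
    proof eventually_elim
      case (elim k)
      have "norm (cv f (x * (1 - s k))) \<le> K * N (x * (1 - s k))" by (rule K)
      also have "\<dots> \<le> K * sqrt (norm (h - h * s k))" using K(1) Nb by (intro mult_left_mono) auto
      finally have 1: "norm (cv f x * (1 - s k)) < eps/3" using elim cv_right[OF f(1) oF(1)] by simp
      have "norm ((cv f x - x) * (1 - s k)) \<le> norm (cv f x - x) * norm (1 - s k)" by (rule norm_mult_ineq)
      also have "\<dots> \<le> eps/3 * 1" using f(2) approx_unit_norm(2)[OF s] eps by (intro mult_mono) auto
      finally have 2: "norm ((cv f x - x) * (1 - s k)) \<le> eps/3" by simp
      have "x * s k - x = (cv f x - x) * (1 - s k) - cv f x * (1 - s k)" by (simp add: algebra_simps)
      then have "norm (x * s k - x) \<le> norm ((cv f x - x) * (1 - s k)) + norm (cv f x * (1 - s k))"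
        by (metis norm_triangle_ineq4)
      then show ?case using 1 2 eps by simp
    qed
  qed
  show "(\<lambda>k. x * s k) \<longlonglongrightarrow> x" by (rule right[OF x])
  have ss: "star (s k) = s k" for k using s by (auto simp: approx_unit_def pos_star)
  show "(\<lambda>k. s k * x) \<longlonglongrightarrow> x"
    using tendsto_star[OF right[OF A_closed_ops(4)[OF x]]] by (simp add: star_mult star_star ss)
qed

lemma B_dense_sequence: "\<exists>b::nat \<Rightarrow> 'u. (\<forall>n. b n \<in> B) \<and> (\<forall>x\<in>B. \<forall>eps>0. \<exists>n. norm (x - b n) < eps)"
proof -
  obtain D :: "nat \<Rightarrow> 'u" where D: "\<And>n. D n \<in> A" "\<And>x e. x \<in> A \<Longrightarrow> e > 0 \<Longrightarrow> \<exists>n. norm (x - D n) < e"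
    using separable by blast
  have "\<exists>n. norm (x - E (D n)) < eps" if x: "x \<in> B" "eps > 0" for x eps
  proof -
    obtain n where "norm (x - D n) < eps" using D(2)[OF B_A[OF x(1)] x(2)] by blast
    moreover have "norm (x - E (D n)) \<le> norm (x - D n)"
      using E_norm[of "x - D n"] by (simp add: E_diff E_fixed B_F x)
    ultimately show ?thesis by (intro exI[of _ n]) simp
  qed
  then show ?thesis using D(1) E_in_B by (intro exI[of _ "\<lambda>n. E (D n)"]) auto
qed

lemma AP_sequence:
  assumes y: "y \<in> A"
  shows "\<exists>S s. approx_unit s \<and> (\<forall>k. AP y (1 / real (Suc k)) (S k) (s k))"
proof -
  obtain b :: "nat \<Rightarrow> 'u" where b: "\<And>n. b n \<in> B" "\<And>x eps. x \<in> B \<Longrightarrow> eps > 0 \<Longrightarrow> \<exists>n. norm (x - b n) < eps"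
    using B_dense_sequence by blast
  \<comment> \<open>One positive element dominates \<open>b i * star (b i)\<close> and
    \<open>star (b i) * b i\<close> for all \<open>i \<le> k\<close>; if \<open>1 - s k\<close> is
    small on it, it is small on all these elements and their adjoints.\<close>
  define h where "h k = (\<Sum>i\<le>k. b i * star (b i) + star (b i) * b i)" for k
  have hB: "h k \<in> B" for k unfolding h_def using b(1) by (intro B_sum B_closed_ops(2) B_mult B_closed_ops(4)) auto
  have "\<exists>S s. AP y (1 / real (Suc k)) S s \<and> pos s \<and> s \<preceq> 1 \<and> norm ((1 - s) * h k) \<le> (1 / real (Suc k))\<^sup>2" for k
    using AP_exists[OF y _ hB] by simp
  then obtain S s where S: "\<And>k. AP y (1 / real (Suc k)) (S k) (s k)" and s: "\<And>k. pos (s k)" "\<And>k. s k \<preceq> 1"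
    "\<And>k. norm ((1 - s k) * h k) \<le> (1 / real (Suc k))\<^sup>2" by metis
  have ns: "norm (1 - s k) \<le> 1" for k using pos_le_norm(1)[of "1 - s k" 1] s by simp
  have so: "star (1 - s k) = 1 - s k" for k using s(1)[of k] by (simp add: star_diff pos_star)
  have bound: "norm ((1 - s k) * x) \<le> 1 / real (Suc k)" if x: "pos (h k - x * star x)" for k x
  proof -
    have "(norm ((1 - s k) * x))\<^sup>2 = norm ((1 - s k) * (x * star x) * (1 - s k))"
      by (simp add: cstar_identity'[symmetric] star_mult so mult.assoc)
    also have "\<dots> \<le> norm ((1 - s k) * h k * (1 - s k))"
      by (intro norm_mono pos_conj_sa ple_conj_sa x) (auto simp: sa_def so)
    also have "\<dots> \<le> norm ((1 - s k) * h k) * norm (1 - s k)" by (rule norm_mult_ineq)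
    also have "\<dots> \<le> (1 / real (Suc k))\<^sup>2 * 1" using s(3) ns by (intro mult_mono) auto
    finally show ?thesis by (simp add: power2_le_iff_abs_le)
  qed
  have hb: "b i * star (b i) \<preceq> h k" "star (b i) * b i \<preceq> h k" if "i \<le> k" for i k
  proof -
    have eq: "h k = (b i * star (b i) + star (b i) * b i) + (\<Sum>i\<in>{..k} - {i}. b i * star (b i) + star (b i) * b i)"
      unfolding h_def using that by (subst sum.remove[of _ i]) auto
    have p: "pos (\<Sum>i\<in>{..k} - {i}. b i * star (b i) + star (b i) * b i)" by (intro pos_sum pos_add) auto
    have "h k - b i * star (b i) = star (b i) * b i + (\<Sum>i\<in>{..k} - {i}. b i * star (b i) + star (b i) * b i)" by (simp add: eq)
    then show "b i * star (b i) \<preceq> h k" using p by (simp add: pos_add)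
    have "h k - star (b i) * b i = b i * star (b i) + (\<Sum>i\<in>{..k} - {i}. b i * star (b i) + star (b i) * b i)" by (simp add: eq)
    then show "star (b i) * b i \<preceq> h k" using p by (simp add: pos_add)
  qed
  have lim0: "(\<lambda>n. 1 / real (Suc n)) \<longlonglongrightarrow> 0" by (rule LIMSEQ_Suc[OF lim_1_over_n])
  have lim: "(\<lambda>k. s k * x) \<longlonglongrightarrow> x \<and> (\<lambda>k. s k * star x) \<longlonglongrightarrow> star x" if x: "x \<in> B" for x
  proof -
    have "(\<lambda>k. s k * z) \<longlonglongrightarrow> z" if z: "z = x \<or> z = star x" for z
    proof (rule LIM_zero_cancel, rule tendstoI)
      fix eps :: real assume eps: "eps > 0"
      obtain i where i: "norm (x - b i) < eps/2" using b(2)[OF x, of "eps/2"] eps by auto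
      define c where "c = (if z = x then b i else star (b i))"
      have c: "norm (z - c) < eps/2" "c = b i \<or> c = star (b i)"
        using z i norm_star[of "x - b i"] by (auto simp: c_def star_diff)
      have "\<forall>\<^sub>s k. 1 / real (Suc k) < eps/2" using order_tendstoD(2)[OF lim0, of "eps/2"] eps by simp
      with eventually_ge_at_top[of i] show "\<forall>\<^sub>s k. dist (s k * z - z) 0 < eps"
      proof eventually_elim
        case (elim k)
        have "norm ((1 - s k) * c) \<le> 1 / real (Suc k)"
          using c(2) hb[OF elim(1)] by (intro bound) (auto simp: star_star)
        moreover have "norm ((1 - s k) * (z - c)) \<le> norm (1 - s k) * norm (z - c)" by (rule norm_mult_ineq)
        moreover have "\<dots> \<le> 1 * norm (z - c)" by (intro mult_right_mono ns) simp
        moreover have "norm ((1 - s k) * z) \<le> norm ((1 - s k) * (z - c)) + norm ((1 - s k) * c)"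
          by (rule order_trans[OF _ norm_triangle_ineq]) (simp add: algebra_simps)
        ultimately have "norm ((1 - s k) * z) < eps" using elim c(1) by simp
        then show ?case by (simp add: algebra_simps norm_minus_commute)
      qed
    qed
    then show ?thesis by blast
  qed
  have "approx_unit s" unfolding approx_unit_def
  proof (intro conjI allI ballI)
    show "s k \<in> B" for k using S[of k] by (simp add: AP_def)
    fix x assume x: "x \<in> B"
    show "(\<lambda>k. s k * x) \<longlonglongrightarrow> x" using lim[OF x] by blast
    have "(\<lambda>k. s k * star x) \<longlonglongrightarrow> star x" using lim[OF x] by blast
    from tendsto_star[OF this] show "(\<lambda>k. x * s k) \<longlonglongrightarrow> x" using s(1) by (simp add: star_mult star_star pos_star)
  qed (use s in auto)
  then show ?thesis using S by blast
qed

end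

section \<open>Strict limits and excision on all of \<open>A\<close>\<close>

context excising_sequence
begin

lemma convergent_on_A:
  assumes "bounded (range S)" "\<And>b. b \<in> B \<Longrightarrow> convergent (\<lambda>k. S k * b)" and s: "approx_unit s" and x: "x \<in> A"
  shows "convergent (\<lambda>k. S k * (x::'u))"
proof -
  obtain C where C: "\<And>k. norm (S k) \<le> C" "C > 0" using assms(1) unfolding bounded_pos by auto
  have "Cauchy (\<lambda>k. S k * x)"
  proof (rule metric_CauchyI)
    fix eps :: real assume eps: "eps > 0"
    obtain l where l: "norm (s l * x - x) < eps / (4 * C)"
      using tendstoD[OF approx_unit_A(2)[OF s x], of "eps / (4 * C)"] eps C(2) by (auto simp: dist_norm eventually_sequentially)
    have near: "norm (S k * x - S k * s l * x) \<le> eps/4" for k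
    proof -
      have "S k * x - S k * s l * x = S k * (x - s l * x)" by (simp add: algebra_simps)
      then have "norm (S k * x - S k * s l * x) \<le> norm (S k) * norm (x - s l * x)" by (metis norm_mult_ineq)
      also have "\<dots> \<le> C * (eps / (4 * C))"
        using l C by (intro mult_mono) (auto simp: norm_minus_commute)
      finally show ?thesis using C(2) by simp
    qed
    have "s l \<in> B" using s by (simp add: approx_unit_def)
    then have "convergent (\<lambda>k. S k * s l)" by (rule assms(2))
    then have "convergent (\<lambda>k. S k * s l * x)" by (rule convergent_mult[OF _ convergent_const])
    then have "Cauchy (\<lambda>k. S k * s l * x)" by (rule convergent_Cauchy)
    then obtain M where M: "\<And>m n. m \<ge> M \<Longrightarrow> n \<ge> M \<Longrightarrow> dist (S m * s l * x) (S n * s l * x) < eps/4"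
      using metric_CauchyD[of _ "eps/4"] eps by (metis divide_pos_pos zero_less_numeral)
    have "dist (S m * x) (S n * x) < eps" if "m \<ge> M" "n \<ge> M" for m n
    proof -
      have "norm (S m * x - S n * x) \<le> norm (S m * x - S m * s l * x) + norm (S m * s l * x - S n * s l * x) + norm (S n * x - S n * s l * x)"
        using norm_triangle_ineq[of "S m * x - S m * s l * x" "S m * s l * x - S n * s l * x"]
          norm_triangle_ineq4[of "(S m * x - S m * s l * x) + (S m * s l * x - S n * s l * x)" "S n * x - S n * s l * x"] by simp
      then show ?thesis using near[of m] near[of n] M[OF that] eps by (simp add: dist_norm)
    qed
    then show "\<exists>M. \<forall>m\<ge>M. \<forall>n\<ge>M. dist (S m * x) (S n * x) < eps" by blast
  qed
  then show ?thesis by (simp add: Cauchy_convergent_iff)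
qed

lemma Cauchy_small:
  fixes S :: "nat \<Rightarrow> 'u"
  assumes "\<And>k l. norm (S k - S l) \<le> r k + r l" "r \<longlonglongrightarrow> (0::real)"
  shows "convergent S"
proof -
  have "Cauchy S"
  proof (rule metric_CauchyI)
    fix eps :: real assume "eps > 0"
    then obtain M where M: "\<And>n. n \<ge> M \<Longrightarrow> r n < eps/2"
      using order_tendstoD(2)[OF assms(2), of "eps/2"] by (auto simp: eventually_sequentially)
    have "dist (S m) (S n) < eps" if "m \<ge> M" "n \<ge> M" for m n
      using assms(1)[of m n] M[OF that(1)] M[OF that(2)] by (simp add: dist_norm)
    then show "\<exists>M. \<forall>m\<ge>M. \<forall>n\<ge>M. dist (S m) (S n) < eps" by blast
  qed
  then show ?thesis by (simp add: Cauchy_convergent_iff)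
qed

text \<open>For \<open>S k\<close> only estimates in \<open>N\<close> are available, which do not
  give strict convergence. Convolution with \<open>f\<close> turns them into norm estimates and
  commutes with multiplication by \<open>B\<close>; so \<open>cv f (S k)\<close> converges strictly
  and asymptotically commutes with \<open>B\<close>, because \<open>s k\<close> does.\<close>

lemma convolution_scalar:
  assumes f: "continuous_on UNIV f" and s: "approx_unit s" and S: "\<And>k. AP y (1 / real (Suc k)) (S k) (s k)"
  shows "\<exists>c. \<forall>x\<in>A. (\<lambda>k. cv f (S k) * x) \<longlonglongrightarrow> c *\<^sub>C x"
proof -
  obtain K where K: "K > 0" "\<And>x. norm (cv f x) \<le> K * N x" using cv_norm_le[OF f] by blast
  define h where "h k = 1 / real (Suc k)" for k
  have h: "h k \<ge> 0" "h k \<le> 1" for k by (auto simp: h_def)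
  have lim0: "h \<longlonglongrightarrow> 0" unfolding h_def by (rule LIMSEQ_Suc[OF lim_1_over_n])
  have SA: "S k \<in> A" for k using S[of k] by (simp add: AP_def)
  have S': "AP y (h k) (S k) (s k)" for k using S by (simp add: h_def)
  have conv: "convergent u" if w: "w \<longlonglongrightarrow> b"
    and u: "\<And>k l. norm (u k - u l) \<le> K * N (z k l)" "\<And>k l. N (z k l) \<le> (h k + h l) * norm b + norm (w k - w l) * N y"
    for b :: 'u and u w :: "nat \<Rightarrow> 'u" and z :: "nat \<Rightarrow> nat \<Rightarrow> 'u"
  proof (rule Cauchy_small)
    fix k l
    have "norm (u k - u l) \<le> K * ((h k + h l) * norm b + norm (w k - w l) * N y)"
      by (rule order_trans[OF u(1) mult_left_mono[OF u(2)]]) (use K(1) in simp)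
    also have "norm (w k - w l) \<le> norm (w k - b) + norm (w l - b)" using norm_triangle_ineq4[of "w k - b" "w l - b"] by simp
    finally show "norm (u k - u l) \<le> K * (h k * norm b + norm (w k - b) * N y) + K * (h l * norm b + norm (w l - b) * N y)"
      using K(1) by (simp add: algebra_simps mult_left_mono mult_right_mono)
  next
    have "(\<lambda>k. K * (h k * norm b + norm (w k - b) * N y)) \<longlonglongrightarrow> K * (0 * norm b + norm (b - b) * N y)"
      by (intro tendsto_intros lim0 w)
    then show "(\<lambda>k. K * (h k * norm b + norm (w k - b) * N y)) \<longlonglongrightarrow> 0" by simp
  qed
  have conv_right: "convergent (\<lambda>k. cv f (S k) * b)" if b: "b \<in> B" for b
  proof (rule conv[where w="\<lambda>k. s k * b" and z="\<lambda>k l. (S k - S l) * b"])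
    show "norm (cv f (S k) * b - cv f (S l) * b) \<le> K * N ((S k - S l) * b)" for k l
      using K(2)[of "(S k - S l) * b"] cv_right[OF f B_F[OF b]] cv_diff[OF f] by (simp add: left_diff_distrib)
    show "N ((S k - S l) * b) \<le> (h k + h l) * norm b + norm (s k * b - s l * b) * N y" for k l
      unfolding left_diff_distrib[symmetric] using h by (intro AP_N[OF AP_right[OF AP_diff[OF S' S']]] b) auto
  qed (use s b in \<open>simp add: approx_unit_def\<close>)
  have conv_left: "convergent (\<lambda>k. b * cv f (S k))" if b: "b \<in> B" for b
  proof (rule conv[where w="\<lambda>k. b * s k" and z="\<lambda>k l. b * (S k - S l)"])
    show "norm (b * cv f (S k) - b * cv f (S l)) \<le> K * N (b * (S k - S l))" for k l
      using K(2)[of "b * (S k - S l)"] cv_left[OF f B_F[OF b]] cv_diff[OF f] by (simp add: right_diff_distrib)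
    show "N (b * (S k - S l)) \<le> (h k + h l) * norm b + norm (b * s k - b * s l) * N y" for k l
      unfolding right_diff_distrib[symmetric] using h by (intro AP_N[OF AP_left[OF AP_diff[OF S' S']]] b) auto
  qed (use s b in \<open>simp add: approx_unit_def\<close>)
  have bounded: "bounded (range (\<lambda>k. cv f (S k)))"
  proof (rule boundedI)
    fix x assume "x \<in> range (\<lambda>k. cv f (S k))"
    then obtain k where "x = cv f (S k)" by blast
    then have "norm x \<le> K * N (S k)" using K by simp
    also have "\<dots> \<le> K * (h k + norm (s k) * N y)" using K(1) h by (intro mult_left_mono AP_N[OF S']) auto
    also have "\<dots> \<le> K * (1 + 1 * N y)" using K(1) h approx_unit_norm[OF s] by (intro mult_left_mono add_mono mult_right_mono) auto
    finally show "norm x \<le> K * (1 + 1 * N y)" .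
  qed
  show ?thesis
  proof (rule minimal)
    show "cv f (S k) \<in> A" for k by (rule cv_A[OF f SA])
    show "bounded (range (\<lambda>k. cv f (S k)))" by (rule bounded)
    show "convergent (\<lambda>k. cv f (S k) * x)" if "x \<in> A" for x
      by (rule convergent_on_A[OF bounded conv_right s that])
    show "convergent (\<lambda>k. x * cv f (S k))" if x: "x \<in> A" for x
    proof -
      have b': "bounded (range (\<lambda>k. star (cv f (S k))))" using bounded by (auto simp: bounded_iff)
      have c': "convergent (\<lambda>k. star (cv f (S k)) * b)" if bB: "b \<in> B" for b
      proof -
        obtain L where "(\<lambda>k. star b * cv f (S k)) \<longlonglongrightarrow> L" using conv_left[OF B_closed_ops(4)[OF bB]] by (auto simp: convergent_def)
        then have "(\<lambda>k. star (star b * cv f (S k))) \<longlonglongrightarrow> star L" by (rule tendsto_star)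
        then show ?thesis by (auto simp: convergent_def star_mult star_star)
      qed
      obtain L where "(\<lambda>k. star (cv f (S k)) * star x) \<longlonglongrightarrow> L"
        using convergent_on_A[OF b' c' s A_closed_ops(4)[OF x]] by (auto simp: convergent_def)
      then have "(\<lambda>k. star (star (cv f (S k)) * star x)) \<longlonglongrightarrow> star L" by (rule tendsto_star)
      then show ?thesis by (auto simp: convergent_def star_mult star_star)
    qed
    show "(\<lambda>k. cv f (S k) * b - b * cv f (S k)) \<longlonglongrightarrow> 0" if b: "b \<in> B" for b
    proof (rule Lim_null_comparison[OF always_eventually[OF allI]])
      let ?r = "\<lambda>k. K * ((h k * norm b + h k * norm b) + norm (s k * b - b * s k) * N y)"
      fix k
      have "norm (cv f (S k) * b - b * cv f (S k)) = norm (cv f (S k * b - b * S k))"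
        using cv_right[OF f B_F[OF b]] cv_left[OF f B_F[OF b]] cv_diff[OF f] by simp
      also have "\<dots> \<le> K * N (S k * b - b * S k)" by (rule K)
      also have "\<dots> \<le> ?r k"
        using K(1) h by (intro mult_left_mono AP_N[OF AP_diff[OF AP_right[OF S'] AP_left[OF S']]] b) auto
      finally show "norm (cv f (S k) * b - b * cv f (S k)) \<le> ?r k" .
      have "?r \<longlonglongrightarrow> K * ((0 * norm b + 0 * norm b) + norm (b - b) * N y)"
        using s b by (intro tendsto_intros lim0) (auto simp: approx_unit_def)
      then show "?r \<longlonglongrightarrow> 0" by simp
    qed
  qed
qed

text \<open>Two descriptions of \<open>S k * b\<close> with \<open>b = e 1\<close> are compared: it
  is near \<open>c *\<^sub>C b\<close> by minimality, and after multiplication by \<open>e j\<close>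
  it is near \<open>e (Suc i) * e (Suc i) * y * e j\<close> by \<open>AP\<close>, since
  \<open>s k * b\<close> is near \<open>b\<close>.\<close>

lemma N_excise:
  assumes y: "y \<in> A" and eps: "eps > 0"
  shows "\<exists>c. \<forall>\<^sub>s j. N (dev j y c) \<le> eps"
proof -
  obtain S s where s: "approx_unit s" and S: "\<And>k. AP y (1 / real (Suc k)) (S k) (s k)"
    using AP_sequence[OF y] by blast
  define h where "h k = 1 / real (Suc k)" for k
  have h: "h k \<ge> 0" for k by (auto simp: h_def)
  have lim0: "h \<longlonglongrightarrow> 0" unfolding h_def by (rule LIMSEQ_Suc[OF lim_1_over_n])
  have S': "AP y (h k) (S k) (s k)" for k using S by (simp add: h_def)
  define b where "b = e 1"
  have b: "b \<in> B" "norm b = 1" "nph b = 1" by (auto simp: b_def e_B nph_e)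
  \<comment> \<open>The final error is \<open>6 \<beta> + \<beta> N y\<close>:
    \<open>4 \<beta>\<close> for the comparison with the scalar, \<open>2 \<beta>\<close> from
    \<open>AP\<close>, and \<open>\<beta> N y\<close> for replacing \<open>s k * b\<close> by
    \<open>b\<close>.\<close>
  define \<beta> where "\<beta> = eps / (7 + N y)"
  have Ny: "7 + N y > 0" using N_nonneg[of y] by linarith
  have \<beta>: "\<beta> > 0" "(7 + N y) * \<beta> = eps" using eps Ny by (auto simp: \<beta>_def)
  define r where "r k = h k + norm (s k * b - b) * N y" for k
  have "r \<longlonglongrightarrow> 0 + norm (b - b) * N y" unfolding r_def
    using s b by (intro tendsto_intros lim0) (auto simp: approx_unit_def)
  then have "\<forall>\<^sub>s k. r k < \<beta>/2" using \<beta> by (intro order_tendstoD(2)) auto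
  then obtain k0 where k0: "\<And>k. k \<ge> k0 \<Longrightarrow> r k < \<beta>/2" by (auto simp: eventually_sequentially)
  have close: "N (S k * b - S l * b) \<le> r k + r l" for k l
  proof -
    have "N (S k * b - S l * b) \<le> (h k * norm b + h l * norm b) + norm (s k * b - s l * b) * N y"
      by (rule AP_N[OF AP_diff[OF AP_right[OF S'] AP_right[OF S']]]) (auto simp: h b)
    also have "norm (s k * b - s l * b) \<le> norm (s k * b - b) + norm (s l * b - b)"
      using norm_triangle_ineq4[of "s k * b - b" "s l * b - b"] by simp
    finally show ?thesis using b N_nonneg[of y] by (simp add: r_def algebra_simps mult_right_mono)
  qed
  \<comment> \<open>\<open>f\<close> has to be fixed before \<open>k\<close>, since the scalar
    \<open>c\<close> depends on \<open>f\<close>. It is fitted to \<open>x\<close>, and the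
    contractivity of \<open>cv f\<close> in \<open>N\<close> transfers the approximation to
    \<open>S k * b\<close> for all \<open>k \<ge> k0\<close>.\<close>
  define x where "x = S k0 * b"
  obtain f where f: "continuous_on UNIV f" "\<And>g. f g \<ge> 0" "hmean f = 1" "norm (cv f x - x) \<le> \<beta>"
    using cv_approx[OF \<beta>(1), of x] by blast
  obtain c where c: "\<And>x. x \<in> A \<Longrightarrow> (\<lambda>k. cv f (S k) * x) \<longlonglongrightarrow> c *\<^sub>C x"
    using convolution_scalar[OF f(1) s S] by blast
  have "\<forall>\<^sub>s k. dist (cv f (S k) * b) (c *\<^sub>C b) < \<beta>" using tendstoD[OF c[OF B_A[OF b(1)]] \<beta>(1)] .
  moreover have "\<forall>\<^sub>s k. dist (s k * b) b < \<beta>"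
    using tendstoD[OF _ \<beta>(1)] s b(1) unfolding approx_unit_def by blast
  moreover have "\<forall>\<^sub>s k. h k < \<beta>" using order_tendstoD(2)[OF lim0] \<beta> by simp
  moreover have "\<forall>\<^sub>s k. k \<ge> k0" by (rule eventually_ge_at_top)
  ultimately have "\<forall>\<^sub>s k. dist (cv f (S k) * b) (c *\<^sub>C b) < \<beta> \<and> dist (s k * b) b < \<beta> \<and> h k < \<beta> \<and> k \<ge> k0"
    by eventually_elim blast
  then obtain k where k: "dist (cv f (S k) * b) (c *\<^sub>C b) < \<beta>" "dist (s k * b) b < \<beta>" "h k < \<beta>" "k \<ge> k0"
    by (auto simp: eventually_sequentially)
  have near: "N (S k * b - c *\<^sub>C b) \<le> 4 * \<beta>"
  proof -
    have 1: "N (S k * b - x) \<le> \<beta>" using close[of k k0] k0[OF k(4)] k0[of k0] by (simp add: x_def)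
    have 2: "N (x - cv f x) \<le> \<beta>" using N_le_norm[of "x - cv f x"] f(4) by (simp add: norm_minus_commute)
    have "cv f x - cv f (S k * b) = cv f (x - S k * b)" by (simp add: cv_diff f(1))
    then have 3: "N (cv f x - cv f (S k * b)) \<le> \<beta>"
      using cv_N_le[OF f(1-3), of "x - S k * b"] 1 by (simp add: N_commute)
    have 4: "N (cv f (S k * b) - c *\<^sub>C b) \<le> \<beta>"
      using k(1) N_le_norm[of "cv f (S k * b) - c *\<^sub>C b"] cv_right[OF f(1) B_F[OF b(1)], of "S k"] by (simp add: dist_norm)
    show ?thesis using 1 2 3 4 N_diff_triangle[of "S k * b" "c *\<^sub>C b" x] N_diff_triangle[of x "c *\<^sub>C b" "cv f x"]
      N_diff_triangle[of "cv f x" "c *\<^sub>C b" "cv f (S k * b)"] by linarith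
  qed
  have "Sm (h k * nph b) (\<lambda>i j. S k * b * e j - s k * b * e (Suc i) * e (Suc i) * y * e j)"
    using S'[of k] b(1) by (simp add: AP_def)
  from SmD[OF this \<beta>(1)]
  have "\<forall>\<^sub>s i. \<forall>\<^sub>s j. N (S k * b * e j - s k * b * e (Suc i) * e (Suc i) * y * e j) \<le> h k + \<beta>"
    using b(3) by simp
  moreover have "\<forall>\<^sub>s i. i > 1" by (rule eventually_gt_at_top)
  ultimately have "\<forall>\<^sub>s i. i > 1 \<and> (\<forall>\<^sub>s j. N (S k * b * e j - s k * b * e (Suc i) * e (Suc i) * y * e j) \<le> h k + \<beta>)"
    by eventually_elim blast
  then obtain i where i: "i > 1" "\<forall>\<^sub>s j. N (S k * b * e j - s k * b * e (Suc i) * e (Suc i) * y * e j) \<le> h k + \<beta>"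
    using eventually_happens'[OF sequentially_bot] by blast
  have "\<forall>\<^sub>s j. N (dev j y c) \<le> eps"
    using i(2) eventually_gt_at_top[of "Suc i"]
  proof eventually_elim
    case (elim j)
    let ?w = "e (Suc i) * e (Suc i) * y * e j"
    have be: "b * e j = e j" "b * e (Suc i) = e (Suc i)" using i(1) elim(2) by (auto simp: b_def e_mult)
    have 1: "N (S k * b * e j - s k * b * ?w) \<le> \<beta> + \<beta>"
      using elim(1) k(3) by (simp add: mult.assoc)
    have 2: "N (S k * b * e j - c *\<^sub>C e j) \<le> 4 * \<beta>"
    proof -
      have "S k * b * e j - c *\<^sub>C e j = (S k * b - c *\<^sub>C b) * e j"
        by (simp add: left_diff_distrib mult_scaleC_left be)
      then have "N (S k * b * e j - c *\<^sub>C e j) \<le> N (S k * b - c *\<^sub>C b) * norm (e j)" using N_right[OF e_F] by metis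
      then show ?thesis using near by simp
    qed
    have 3: "N (s k * b * ?w - ?w) \<le> \<beta> * N y"
    proof -
      have bw: "b * ?w = ?w" using be(2) by (simp flip: mult.assoc)
      have "s k * b * ?w - ?w = (s k * b - b) * ?w" by (simp add: left_diff_distrib bw)
      then have "N (s k * b * ?w - ?w) \<le> norm (s k * b - b) * N ?w" using N_left by metis
      also have "\<dots> \<le> \<beta> * N y"
      proof (rule mult_mono)
        show "norm (s k * b - b) \<le> \<beta>" using k(2) by (simp add: dist_norm)
        have "N ?w \<le> norm (e (Suc i) * e (Suc i)) * N y * norm (e j)" by (rule N_sandwich[OF e_F])
        then show "N ?w \<le> N y" by simp
      qed (use \<beta> in auto)
      finally show ?thesis .
    qed
    have eq: "c *\<^sub>C e j - ?w = (s k * b * ?w - ?w) + ((S k * b * e j - s k * b * ?w) - (S k * b * e j - c *\<^sub>C e j))" by simp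
    have "N (c *\<^sub>C e j - ?w) \<le> N (s k * b * ?w - ?w) + (N (S k * b * e j - s k * b * ?w) + N (S k * b * e j - c *\<^sub>C e j))"
      unfolding eq by (rule order_trans[OF N_triangle add_left_mono[OF N_triangle_diff]])
    also have "\<dots> \<le> \<beta> * N y + ((\<beta> + \<beta>) + 4 * \<beta>)" using 1 2 3 by linarith
    also have "\<dots> \<le> eps" using \<beta> by (simp add: algebra_simps)
    finally have fin: "N (c *\<^sub>C e j - ?w) \<le> eps" .
    have "e j * (c *\<^sub>C e j - ?w) = c *\<^sub>C (e j * e j) - e j * y * e j"
      using elim(2) by (simp add: right_diff_distrib mult_scaleC_right mult.assoc e_mult')
    then have "N (c *\<^sub>C (e j * e j) - e j * y * e j) \<le> norm (e j) * N (c *\<^sub>C e j - ?w)" using N_left by metis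
    then show ?case using fin by (simp add: N_commute)
  qed
  then show ?thesis ..
qed

text \<open>Convolution upgrades the module norm estimate to the C*-norm.\<close>

theorem A_subset_X: "y \<in> A \<Longrightarrow> y \<in> X"
proof -
  assume y: "y \<in> A"
  have "\<exists>l. ex y l"
  proof (rule ex_approx)
    fix eps :: real assume eps: "eps > 0"
    obtain f where f: "continuous_on UNIV f" "hmean f = 1" "norm (cv f y - y) \<le> eps/2"
      using cv_approx[of "eps/2" y] eps by auto
    obtain K where K: "K > 0" "\<And>x. norm (cv f x) \<le> K * N x" using cv_norm_le[OF f(1)] by blast
    have "eps / (2 * K) > 0" using eps K by simp
    then obtain c where c: "\<forall>\<^sub>s j. N (dev j y c) \<le> eps / (2 * K)"
      using N_excise[OF y] by blast
    then have "\<forall>\<^sub>s j. norm (dev j y c) \<le> eps"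
    proof eventually_elim
      case (elim j)
      have eF: "c *\<^sub>C (e j * e j) \<in> F" by (intro F_closed_ops e_F)
      have "cv f (dev j y c) = dev j (cv f y) c"
        by (simp add: cv_diff cv_left cv_right cv_fixed f e_F eF)
      then have 1: "norm (dev j (cv f y) c) \<le> K * N (dev j y c)" using K by metis
      have "K * N (dev j y c) \<le> K * (eps / (2 * K))"
        using elim K(1) by (intro mult_left_mono) auto
      then have 2: "norm (dev j (cv f y) c) \<le> eps/2" using 1 K(1) by simp
      have 3: "norm (e j * (cv f y - y) * e j) \<le> eps/2"
        using norm_mult3[of "e j" "cv f y - y" "e j"] f(3) by simp
      have "dev j y c = (dev j (cv f y) c) - e j * (cv f y - y) * e j"
        by (simp add: algebra_simps)
      then have "norm (dev j y c) \<le> norm (dev j (cv f y) c) + norm (e j * (cv f y - y) * e j)"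
        by (metis norm_triangle_ineq4)
      then show ?case using 2 3 by simp
    qed
    then show "\<exists>l. \<forall>\<^sub>s j. norm (dev j y l) \<le> eps" ..
  qed
  then show ?thesis by (simp add: X_def)
qed

end

section \<open>Finite-dimensional invariant subspaces\<close>

text \<open>A form of Mazur's theorem. Each \<open>H n\<close> is a closed neighbourhood of a
  finite-dimensional polytope that contains \<open>C\<close>; the intersection is totally bounded,
  and every mean of a function with values in \<open>C\<close> lies in each closed convex
  \<open>H n\<close>.\<close>

lemma (in compact_group) compact_hmean_range:
  fixes C :: "'v::banach set"
  assumes "compact C"
  shows "\<exists>K. compact K \<and> (\<forall>F::'g \<Rightarrow> 'v. continuous_on UNIV F \<longrightarrow> range F \<subseteq> C \<longrightarrow> hmean F \<in> K)"
proof -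
  have tb: "\<And>D::'v set. compact D \<Longrightarrow> \<forall>e>0. \<exists>k. finite k \<and> D \<subseteq> (\<Union>x\<in>k. ball x e)"
    by (simp add: compact_eq_totally_bounded)
  have "\<forall>n. \<exists>T. finite T \<and> C \<subseteq> (\<Union>x\<in>T. ball x (1 / real (Suc n)))"
    using tb[OF assms] by simp
  then obtain T where T: "\<And>n. finite (T n)" "\<And>n. C \<subseteq> (\<Union>x\<in>T n. ball x (1 / real (Suc n)))" by metis
  define H where "H n = {x + y | x y. x \<in> convex hull (T n) \<and> y \<in> cball 0 (1 / real (Suc n))}" for n
  have cH: "compact (convex hull (T n))" for n using T(1) finite_imp_compact_convex_hull by blast
  have clH: "closed (H n)" for n unfolding H_def using compact_closed_sums[OF cH closed_cball[of 0 "1 / real (Suc n)"], of n] by (rule back_subst[where P=closed]) blast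
  have cvH: "convex (H n)" for n unfolding H_def
    using convex_sums[OF convex_convex_hull convex_cball[of 0 "1 / real (Suc n)"], of "T n"] by (rule back_subst[where P=convex]) blast
  have CH: "C \<subseteq> H n" for n
  proof
    fix c assume "c \<in> C"
    then obtain t where "t \<in> T n" "dist t c < 1 / real (Suc n)" using T(2) by fastforce
    then show "c \<in> H n" unfolding H_def
      by (intro CollectI exI[of _ t] exI[of _ "c - t"]) (auto simp: hull_inc dist_norm norm_minus_commute)
  qed
  define K where "K = (\<Inter>n. H n)"
  have "closed K" unfolding K_def using clH by auto
  moreover have "\<exists>k. finite k \<and> K \<subseteq> (\<Union>x\<in>k. ball x e)" if e: "e > 0" for e
  proof -
    obtain n where n: "1 / real (Suc n) < e/2" using nat_approx_posE[of "e/2"] e by auto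
    obtain k where k: "finite k" "convex hull (T n) \<subseteq> (\<Union>x\<in>k. ball x (e/2))"
      using tb[OF cH[of n]] e by (meson half_gt_zero)
    have "K \<subseteq> (\<Union>x\<in>k. ball x e)"
    proof
      fix z assume "z \<in> K"
      then have "z \<in> H n" by (simp add: K_def)
      then obtain x y where xy: "z = x + y" "x \<in> convex hull (T n)" "norm y \<le> 1 / real (Suc n)"
        unfolding H_def mem_cball_0 by blast
      then obtain c where c: "c \<in> k" "dist c x < e/2" using k(2) by auto
      have "dist c z \<le> dist c x + norm y" using xy(1) norm_triangle_ineq4[of "c - x" y] by (simp add: dist_norm algebra_simps)
      then have "dist c z < e" using c xy(3) n by simp
      then show "z \<in> (\<Union>x\<in>k. ball x e)" using c(1) by auto
    qed
    then show ?thesis using k(1) by blast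
  qed
  ultimately have "compact K" unfolding compact_eq_totally_bounded by (simp add: complete_eq_closed)
  moreover have "hmean F \<in> K" if F: "continuous_on UNIV F" "range F \<subseteq> C" for F :: "'g \<Rightarrow> 'v"
    unfolding K_def using hmean_closed_convex[OF F(1) clH cvH] F(2) CH by blast
  ultimately show ?thesis by blast
qed

section \<open>The GNS inner product on the whole algebra\<close>

context excising_sequence
begin

lemma X_UNIV [simp]: "z \<in> X"
proof -
  have "z - ch z *\<^sub>C 1 \<in> A" by (simp add: A_def ch_diff ch_scaleC ch_one)
  then have "(z - ch z *\<^sub>C 1) + ch z *\<^sub>C 1 \<in> X" by (intro X_closed_ops A_subset_X)
  then show ?thesis by simp
qed

lemma bounded_linear_\<phi>: "bounded_linear \<phi>"
proof (rule bounded_linear_intro[where K=1])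
  show "\<phi> (r *\<^sub>R x) = r *\<^sub>R \<phi> x" for r x unfolding \<phi>_scaleR[OF X_UNIV] by (simp only: scaleR_conv_of_real)
qed (simp_all add: \<phi>_add \<phi>_norm)

definition ip :: "'u \<Rightarrow> 'u \<Rightarrow> complex" where "ip z w = \<phi> (star z * w)"

lemma ip_simps:
  "ip (z + z') w = ip z w + ip z' w" "ip z (w + w') = ip z w + ip z w'"
  "ip (z - z') w = ip z w - ip z' w" "ip z (w - w') = ip z w - ip z w'"
  "ip (c *\<^sub>C z) w = cnj c * ip z w" "ip z (c *\<^sub>C w) = c * ip z w"
  "ip 0 w = 0" "ip z 0 = 0"
  by (simp_all add: ip_def star_add star_diff star_scaleC distrib_left distrib_right right_diff_distrib left_diff_distrib
      mult_scaleC \<phi>_add \<phi>_diff \<phi>_scaleC)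

lemma ip_sum: "ip z (\<Sum>i\<in>I. f i) = (\<Sum>i\<in>I. ip z (f i))" "ip (\<Sum>i\<in>I. f i) z = (\<Sum>i\<in>I. ip (f i) z)"
  by (induction I rule: infinite_finite_induct) (auto simp: ip_simps)

lemma ip_cnj: "ip w z = cnj (ip z w)"
  unfolding ip_def by (subst \<phi>_star[symmetric]) (simp_all add: star_mult star_star)

lemma ip_self: "ip z z = of_real ((nph z)\<^sup>2)" by (simp add: ip_def nph_of_real)

lemma ip_act: "ip (act g z) (act g w) = ip z w"
  unfolding ip_def by (subst act_star[symmetric], subst act_mult[symmetric]) (simp add: \<phi>_act)

lemma nlim: "(\<lambda>j. norm (w * e j)) \<longlonglongrightarrow> nph w" by (rule norm_lim) simp

lemma nph_tri: "nph (s + t) \<le> nph s + nph t"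
  by (rule LIMSEQ_le[OF nlim tendsto_add[OF nlim nlim]]) (auto intro: norm_triangle_ineq simp: distrib_right)

lemma nph_minus: "nph (- t) = nph t" by (simp add: nph_def star_minus)

lemma nph_tri_diff: "nph (s - t) \<le> nph s + nph t"
  using nph_tri[of s "-t"] by (simp add: nph_minus)

lemma nph_mult: "nph (a * t) \<le> norm a * nph t"
  by (rule LIMSEQ_le[OF nlim tendsto_mult[OF tendsto_const nlim]]) (auto intro: norm_mult_ineq simp: mult.assoc)

lemma nph_norm: "nph t \<le> norm t"
proof (rule Lim_bounded[OF nlim[of t], of 0 "norm t"], intro allI impI)
  fix j show "norm (t * e j) \<le> norm t" using norm_mult_ineq[of t "e j"] by simp
qed

lemma nph_scale: "nph (c *\<^sub>C t) = cmod c * nph t"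
  by (rule LIMSEQ_unique[OF nlim]) (simp add: mult_scaleC_left norm_scaleC tendsto_mult_left nlim)

lemma nph_act: "nph (act g t) = nph t"
  using ip_act[of g t t] unfolding ip_self by (simp only: of_real_eq_iff power2_eq_iff_nonneg nph_nonneg)

lemma ip_CS: "cmod (ip z w) \<le> nph z * nph w"
  unfolding ip_def
proof (rule LIMSEQ_le[OF \<phi>_lim tendsto_mult[OF nlim nlim]])
  show "\<exists>N. \<forall>j\<ge>N. norm (e j * (star z * w) * e j) \<le> norm (z * e j) * norm (w * e j)"
  proof (intro exI allI impI)
    fix j
    have "norm (star (z * e j) * (w * e j)) \<le> norm (star (z * e j)) * norm (w * e j)" by (rule norm_mult_ineq)
    then show "norm (e j * (star z * w) * e j) \<le> norm (z * e j) * norm (w * e j)" by (simp only: norm_star) (simp add: star_mult mult.assoc)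
  qed
qed simp

definition orthonormal :: "'u set \<Rightarrow> bool" where
  "orthonormal S \<longleftrightarrow> finite S \<and> (\<forall>x\<in>S. \<forall>y\<in>S. ip x y = (if x = y then 1 else 0))"

definition pr :: "'u set \<Rightarrow> 'u \<Rightarrow> 'u" where "pr S z = (\<Sum>x\<in>S. ip x z *\<^sub>C x)"

lemma ip_pr: "orthonormal S \<Longrightarrow> x \<in> S \<Longrightarrow> ip x (pr S z) = ip x z"
proof -
  assume S: "orthonormal S" "x \<in> S"
  have "(\<Sum>i\<in>S. ip i z * ip x i) = (\<Sum>i\<in>S. if x = i then ip i z else 0)"
    using S by (intro sum.cong) (auto simp: orthonormal_def)
  also have "\<dots> = ip x z" using S by (simp add: orthonormal_def)
  finally show ?thesis by (simp add: pr_def ip_sum ip_simps)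
qed

lemma ip_residual: "orthonormal S \<Longrightarrow> x \<in> S \<Longrightarrow> ip x (z - pr S z) = 0"
  by (simp add: ip_simps ip_pr)

lemma nph_pythagoras:
  assumes "orthonormal S"
  shows "(nph z)\<^sup>2 = (nph (z - pr S z))\<^sup>2 + (\<Sum>x\<in>S. (cmod (ip x z))\<^sup>2)"
proof -
  have a: "ip (pr S z) w = (\<Sum>x\<in>S. cnj (ip x z) * ip x w)" for w by (simp add: pr_def ip_sum ip_simps)
  have 0: "ip (pr S z) (z - pr S z) = 0" unfolding a using ip_residual[OF assms] by simp
  have 1: "ip (pr S z) z = of_real (\<Sum>x\<in>S. (cmod (ip x z))\<^sup>2)"
    unfolding a of_real_sum complex_norm_square by (simp only: mult.commute)
  have "ip z z = ip (z - pr S z) z + ip (pr S z) z" by (simp add: ip_simps)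
  also have "ip (z - pr S z) z = ip (z - pr S z) (z - pr S z) + ip (z - pr S z) (pr S z)" by (simp add: ip_simps)
  also have "ip (z - pr S z) (pr S z) = 0" using 0 ip_cnj by (metis complex_cnj_zero)
  finally have "complex_of_real ((nph z)\<^sup>2) = of_real ((nph (z - pr S z))\<^sup>2 + (\<Sum>x\<in>S. (cmod (ip x z))\<^sup>2))"
    by (simp only: ip_self 1 of_real_add add_0_right)
  then show ?thesis by (simp only: of_real_eq_iff)
qed

lemma bessel: "orthonormal S \<Longrightarrow> (\<Sum>x\<in>S. (cmod (ip x z))\<^sup>2) \<le> (nph z)\<^sup>2"
  by (simp only: nph_pythagoras[of S z]) simp

lemma orthonormal_insert:
  assumes S: "orthonormal S" and z: "nph z \<noteq> 0" "\<And>x. x \<in> S \<Longrightarrow> ip x z = 0"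
  defines "w \<equiv> of_real (1 / nph z) *\<^sub>C z"
  shows "orthonormal (insert w S)" "w \<notin> S"
proof -
  have "ip w w = cnj (of_real (1 / nph z)) * (of_real (1 / nph z) * of_real ((nph z)\<^sup>2))"
    unfolding w_def ip_simps(5,6) unfolding ip_self by (rule mult.left_commute)
  then have w1: "ip w w = 1" using z(1) by (simp add: power2_eq_square)
  have w0: "ip x w = 0" "ip w x = 0" if "x \<in> S" for x
    using z(2)[OF that] ip_cnj[of z x] by (simp_all add: w_def ip_simps)
  show "w \<notin> S" using w0 w1 by fastforce
  then show "orthonormal (insert w S)" using S w0 w1 unfolding orthonormal_def by auto
qed

lemma ip_cont: "continuous_on UNIV (\<lambda>g. ip (act g a) z)"
  unfolding ip_def by (intro continuous_intros bounded_linear.continuous_on[OF bounded_linear_\<phi>] act_cont)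

text \<open>The average over the group of the rank one operators given by the translates of
  \<open>a\<close>. It is equivariant, positive and compact for the inner product \<open>ip\<close>,
  so its eigenspaces for positive eigenvalues yield finite-dimensional invariant subspaces. The
  formula gives elements of the algebra, not just of a Hilbert space completion.\<close>

definition R1 :: "'u \<Rightarrow> 'u \<Rightarrow> 'u" where "R1 a z = hmean (\<lambda>g. ip (act g a) z *\<^sub>C act g a)"

lemma R1_cont: "continuous_on UNIV (\<lambda>g. ip (act g a) z *\<^sub>C act g a)"
  by (intro continuous_intros ip_cont act_cont)

lemma R1_A: "a \<in> A \<Longrightarrow> R1 a z \<in> A"
  unfolding R1_def using hmean_linear[OF R1_cont bounded_linear_ch, of a z]
  by (simp add: A_def ch_scaleC ch_act)

lemma R1_add: "R1 a (z + w) = R1 a z + R1 a w"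
  unfolding R1_def by (subst hmean_add[symmetric, OF R1_cont R1_cont]) (simp add: ip_simps scaleC_add_left)

lemma R1_scaleC: "R1 a (c *\<^sub>C z) = c *\<^sub>C R1 a z"
  unfolding R1_def by (subst hmean_linear[OF R1_cont bounded_linear_scaleC, symmetric]) (simp add: ip_simps scaleC_scaleC)

lemma ip_R1: "ip w (R1 a z) = hmean (\<lambda>g. ip (act g a) z * cnj (ip (act g a) w))"
proof -
  have "bounded_linear (\<lambda>x. ip w x)" unfolding ip_def
    by (rule bounded_linear_compose[OF bounded_linear_\<phi> bounded_linear_mult_right])
  from hmean_linear[OF R1_cont this, of a z] have "ip w (R1 a z) = hmean (\<lambda>g. ip w (ip (act g a) z *\<^sub>C act g a))"
    by (simp add: R1_def)
  also have "(\<lambda>g. ip w (ip (act g a) z *\<^sub>C act g a)) = (\<lambda>g. ip (act g a) z * cnj (ip (act g a) w))"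
    using ip_cnj[of w] by (simp add: ip_simps)
  finally show ?thesis .
qed

lemma R1_cont2: "continuous_on UNIV (\<lambda>g. ip (act g a) z * cnj (ip (act g a) w))"
  by (intro continuous_intros ip_cont)

lemma R1_symmetric: "ip (R1 a w) z = ip w (R1 a z)"
proof -
  have "ip (R1 a w) z = cnj (ip z (R1 a w))" by (rule ip_cnj)
  also have "\<dots> = hmean (\<lambda>g. cnj (ip (act g a) w * cnj (ip (act g a) z)))"
    unfolding ip_R1 by (rule hmean_linear[OF R1_cont2 bounded_linear_cnj, symmetric])
  also have "\<dots> = ip w (R1 a z)" unfolding ip_R1 by (simp add: mult.commute)
  finally show ?thesis .
qed

lemma ip_sq_cont: "continuous_on UNIV (\<lambda>g. (cmod (ip (act g a) z))\<^sup>2)"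
  by (intro continuous_intros ip_cont)

lemma R1_form: "ip z (R1 a z) = of_real (hmean (\<lambda>g. (cmod (ip (act g a) z))\<^sup>2))"
  unfolding ip_R1 by (subst hmean_linear[OF ip_sq_cont bounded_linear_of_real, symmetric]) (simp only: complex_norm_square)

lemma R1_form_nonneg: "hmean (\<lambda>g. (cmod (ip (act g a) z))\<^sup>2) \<ge> 0"
  using hmean_mono[OF continuous_on_const ip_sq_cont, of 0 a z] by simp

lemma R1_act: "act h (R1 a z) = R1 a (act h z)"
proof -
  have "act h (R1 a z) = hmean (\<lambda>g. act h (ip (act g a) z *\<^sub>C act g a))"
    unfolding R1_def by (rule hmean_linear[where T="act h", OF R1_cont bounded_linear_act, symmetric])
  also have "(\<lambda>g. act h (ip (act g a) z *\<^sub>C act g a)) = (\<lambda>g. ip (act (h + g) a) (act h z) *\<^sub>C act (h + g) a)"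
    by (simp add: act_scaleC act_plus ip_act)
  also have "hmean \<dots> = R1 a (act h z)" unfolding R1_def by (rule hmean_left_translate[OF R1_cont])
  finally show ?thesis .
qed

lemma R1_norm: "norm (R1 a z) \<le> nph a * norm a * nph z"
proof -
  have "norm (R1 a z) \<le> hmean (\<lambda>g::'g. nph a * norm a * nph z)" unfolding R1_def
  proof (rule hmean_norm_le[OF R1_cont continuous_on_const])
    fix g show "norm (ip (act g a) z *\<^sub>C act g a) \<le> nph a * norm a * nph z"
      using mult_right_mono[OF ip_CS[of "act g a" z], of "norm a"] by (simp add: norm_scaleC nph_act mult_ac)
  qed
  then show ?thesis by simp
qed

text \<open>Bessel's inequality under the mean: the trace of \<open>R1 a\<close> is at most the
  squared length of \<open>a\<close>. This limits the number of orthonormal eigenvectors with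
  eigenvalue above a given level.\<close>

lemma R1_trace:
  assumes "orthonormal S"
  shows "(\<Sum>x\<in>S. hmean (\<lambda>g. (cmod (ip (act g a) x))\<^sup>2)) \<le> (nph a)\<^sup>2"
proof -
  have fin: "finite S" using assms by (simp add: orthonormal_def)
  have "(\<Sum>x\<in>S. hmean (\<lambda>g. (cmod (ip (act g a) x))\<^sup>2)) = hmean (\<lambda>g. \<Sum>x\<in>S. (cmod (ip (act g a) x))\<^sup>2)"
    using fin by (induction S rule: finite_induct) (auto simp: hmean_add ip_sq_cont continuous_on_sum)
  also have "\<dots> \<le> hmean (\<lambda>g::'g. (nph a)\<^sup>2)"
  proof (rule hmean_mono)
    fix g
    have "cmod (ip (act g a) x) = cmod (ip x (act g a))" for x using ip_cnj[of x "act g a"] by simp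
    then show "(\<Sum>x\<in>S. (cmod (ip (act g a) x))\<^sup>2) \<le> (nph a)\<^sup>2" using bessel[OF assms, of "act g a"] by (simp add: nph_act)
  qed (intro continuous_on_sum ip_sq_cont continuous_on_const)+
  finally show ?thesis by simp
qed

text \<open>The integrand takes values in the compact set of multiples
  \<open>c *\<^sub>C act g a\<close> with \<open>c\<close> bounded by \<open>nph a\<close>. The
  resulting compactness is in the C*-norm, although \<open>z\<close> runs over a ball of the weaker
  seminorm.\<close>

lemma R1_compact: "\<exists>K. compact K \<and> (\<forall>z. nph z \<le> 1 \<longrightarrow> R1 a z \<in> K)"
proof -
  define C where "C = (\<lambda>(c, g). c *\<^sub>C act g a) ` (cball 0 (nph a) \<times> UNIV)"
  have "continuous_on (cball 0 (nph a) \<times> UNIV) (\<lambda>p. fst p *\<^sub>C act (snd p) a)"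
    by (intro continuous_intros continuous_on_compose2[OF act_cont]) auto
  then have "compact C" unfolding C_def
    by (intro compact_continuous_image compact_Times compact_G compact_cball) (simp add: case_prod_unfold)
  then obtain K where K: "compact K" "\<And>F::'g \<Rightarrow> 'u. continuous_on UNIV F \<Longrightarrow> range F \<subseteq> C \<Longrightarrow> hmean F \<in> K"
    using compact_hmean_range by blast
  have "R1 a z \<in> K" if "nph z \<le> 1" for z unfolding R1_def
  proof (rule K(2)[OF R1_cont])
    show "range (\<lambda>g. ip (act g a) z *\<^sub>C act g a) \<subseteq> C"
    proof
      fix x assume "x \<in> range (\<lambda>g. ip (act g a) z *\<^sub>C act g a)"
      then obtain g where x: "x = ip (act g a) z *\<^sub>C act g a" by blast
      have "cmod (ip (act g a) z) \<le> nph a * nph z" using ip_CS[of "act g a" z] by (simp add: nph_act)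
      also have "\<dots> \<le> nph a * 1" using that by (intro mult_left_mono) auto
      finally show "x \<in> C" unfolding C_def x by (intro image_eqI[of _ _ "(ip (act g a) z, g)"]) auto
    qed
  qed
  then show ?thesis using K(1) by blast
qed

end

text \<open>Two vectors are treated by one operator \<open>R\<close>, because the flip needs a
  single invariant subspace that nearly contains both.\<close>

locale averaged_projection = excising_sequence act ch e
  for act :: "'g::topological_group_add \<Rightarrow> 'u::unital_cstar \<Rightarrow> 'u" and ch e +
  fixes a0 a1 :: 'u
  assumes a0: "a0 \<in> A" and a1: "a1 \<in> A"
begin

definition R :: "'u \<Rightarrow> 'u" where "R z = R1 a0 z + R1 a1 z"
definition q :: "'u \<Rightarrow> real" where
  "q z = hmean (\<lambda>g. (cmod (ip (act g a0) z))\<^sup>2) + hmean (\<lambda>g. (cmod (ip (act g a1) z))\<^sup>2)"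
definition CR :: real where "CR = nph a0 * norm a0 + nph a1 * norm a1"

lemma CR_nonneg: "CR \<ge> 0" by (simp add: CR_def)

lemma R_A: "R z \<in> A" unfolding R_def by (intro A_closed_ops R1_A a0 a1)
lemma R_add: "R (z + w) = R z + R w" by (simp add: R_def R1_add)
lemma R_scaleC: "R (c *\<^sub>C z) = c *\<^sub>C R z" by (simp add: R_def R1_scaleC scaleC_add_right)
lemma R_diff: "R (z - w) = R z - R w"
  using R_add[of z "(-1) *\<^sub>C w"] by (simp only: R_scaleC) (simp add: scaleC_minus_left)
lemma R_symmetric: "ip (R w) z = ip w (R z)" by (simp add: R_def ip_simps R1_symmetric)
lemma R_act: "act h (R z) = R (act h z)" by (simp add: R_def act_add R1_act)
lemma R_form: "ip z (R z) = of_real (q z)" by (simp add: R_def ip_simps R1_form q_def)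
lemma q_nonneg: "q z \<ge> 0" unfolding q_def by (intro add_nonneg_nonneg R1_form_nonneg)

lemma R_norm: "norm (R z) \<le> CR * nph z"
  using norm_triangle_ineq[of "R1 a0 z" "R1 a1 z"] R1_norm[of a0 z] R1_norm[of a1 z] by (simp add: R_def CR_def algebra_simps)

lemma R_zero: "nph z = 0 \<Longrightarrow> R z = 0" using R_norm[of z] by simp

lemma R_trace: "orthonormal S \<Longrightarrow> (\<Sum>x\<in>S. q x) \<le> (nph a0)\<^sup>2 + (nph a1)\<^sup>2"
  unfolding q_def sum.distrib by (intro add_mono R1_trace)

lemma R_compact: "\<exists>K. compact K \<and> (\<forall>z. nph z \<le> 1 \<longrightarrow> R z \<in> K)"
proof -
  obtain K0 where K0: "compact K0" "\<forall>z. nph z \<le> 1 \<longrightarrow> R1 a0 z \<in> K0" using R1_compact by blast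
  obtain K1 where K1: "compact K1" "\<forall>z. nph z \<le> 1 \<longrightarrow> R1 a1 z \<in> K1" using R1_compact by blast
  show ?thesis using compact_sums[OF K0(1) K1(1)] K0(2) K1(2) unfolding R_def by (intro exI[of _ "{x + y |x y. x \<in> K0 \<and> y \<in> K1}"]) auto
qed

lemma q_le: "q z \<le> CR * (nph z)\<^sup>2"
proof -
  have "q z = cmod (ip z (R z))" using q_nonneg[of z] by (simp add: R_form)
  also have "\<dots> \<le> nph z * nph (R z)" by (rule ip_CS)
  also have "\<dots> \<le> nph z * (CR * nph z)" using R_norm[of z] nph_norm[of "R z"] by (intro mult_left_mono) auto
  finally show ?thesis by (simp add: power2_eq_square mult_ac)
qed

lemma R_CS: "(cmod (ip u (R z)))\<^sup>2 \<le> q u * q z"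
proof -
  define c where "c = ip u (R z)"
  have c': "ip z (R u) = cnj c" unfolding c_def using ip_cnj[of z "R u"] R_symmetric[of u z] by simp
  have quad: "0 \<le> q u - 2 * t * (cmod c)\<^sup>2 + t\<^sup>2 * (cmod c)\<^sup>2 * q z" for t
  proof -
    let ?v = "u - (of_real t * cnj c) *\<^sub>C z"
    have cc: "complex_of_real ((cmod c)\<^sup>2) = c * cnj c" by (rule complex_norm_square)
    have "of_real (q ?v) = ip u (R u) - of_real t * cnj c * ip u (R z) - of_real t * c * ip z (R u) + (of_real t * c) * (of_real t * cnj c) * ip z (R z)"
      unfolding R_form[symmetric] by (simp add: R_diff R_scaleC ip_simps algebra_simps)
    also have "\<dots> = of_real (q u - 2 * t * (cmod c)\<^sup>2 + t\<^sup>2 * (cmod c)\<^sup>2 * q z)"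
      unfolding c' c_def[symmetric] R_form of_real_add of_real_diff of_real_mult cc power2_eq_square[of t] of_real_numeral by (simp only: mult_ac) (simp add: algebra_simps)
    finally have "q ?v = q u - 2 * t * (cmod c)\<^sup>2 + t\<^sup>2 * (cmod c)\<^sup>2 * q z" by (simp only: of_real_eq_iff)
    then show ?thesis using q_nonneg[of ?v] by simp
  qed
  show ?thesis
  proof (cases "q z = 0")
    case True
    have "(cmod c)\<^sup>2 \<le> 0"
    proof (rule ccontr)
      assume "\<not> (cmod c)\<^sup>2 \<le> 0"
      then have pos: "(cmod c)\<^sup>2 > 0" by simp
      have "0 \<le> q u - 2 * ((q u + 1) / (cmod c)\<^sup>2) * (cmod c)\<^sup>2" using quad[of "(q u + 1) / (cmod c)\<^sup>2"] True by simp
      then show False using pos q_nonneg[of u] by simp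
    qed
    then show ?thesis using True by (simp add: c_def)
  next
    case False
    then have qz: "q z > 0" using q_nonneg[of z] by simp
    have "0 \<le> q u - 2 * (1 / q z) * (cmod c)\<^sup>2 + (1 / q z)\<^sup>2 * (cmod c)\<^sup>2 * q z" by (rule quad)
    then have "(cmod c)\<^sup>2 / q z \<le> q u" using qz by (simp add: power2_eq_square field_simps)
    then show ?thesis using qz by (simp add: c_def field_simps)
  qed
qed

text \<open>\<open>R\<close> preserves the complement \<open>W\<close> of \<open>S\<close>, and
  \<open>l\<close> is the supremum of its quadratic form on the unit ball of \<open>W\<close>. A
  maximizing sequence \<open>z n\<close> need not converge, as \<open>nph\<close> is not complete;
  but \<open>R (z n)\<close> has a norm limit point \<open>w\<close> by compactness, and
  \<open>w\<close> is the eigenvector.\<close>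

lemma top_eigenvector:
  assumes S: "orthonormal S" and eig: "\<And>x. x \<in> S \<Longrightarrow> \<exists>l. R x = l *\<^sub>C x"
    and b: "\<And>x. x \<in> S \<Longrightarrow> ip x b = 0" "nph b > 0" "q b \<ge> c * (nph b)\<^sup>2" and c: "c > 0"
  shows "\<exists>w l. l \<ge> c \<and> R w = l *\<^sub>R w \<and> nph w > 0 \<and> (\<forall>x\<in>S. ip x w = 0)"
proof -
  define W where "W = {z. \<forall>x\<in>S. ip x z = 0}"
  have RW: "R z \<in> W" if "z \<in> W" for z
    using that eig by (fastforce simp: W_def ip_simps simp flip: R_symmetric)
  define Q where "Q = q ` {z \<in> W. nph z \<le> 1}"
  define l where "l = Sup Q"
  have CS1: "q z \<le> CR" if "nph z \<le> 1" for z
  proof -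
    have "(nph z)\<^sup>2 \<le> 1" using that by (simp add: power_le_one)
    then have "CR * (nph z)\<^sup>2 \<le> CR * 1" by (intro mult_left_mono CR_nonneg)
    then show ?thesis using q_le[of z] by simp
  qed
  have bdd: "bdd_above Q" using CS1 by (auto simp: Q_def intro!: bdd_aboveI[of _ CR])
  have qsc: "q (of_real r *\<^sub>C z) = r\<^sup>2 * q z" for r z
  proof -
    have "complex_of_real (q (of_real r *\<^sub>C z)) = of_real (r\<^sup>2 * q z)"
      unfolding R_form[symmetric] by (simp add: R_scaleC ip_simps R_form power2_eq_square)
    then show ?thesis by (simp only: of_real_eq_iff)
  qed
  define b' where "b' = of_real (1 / nph b) *\<^sub>C b"
  have b': "b' \<in> W" "nph b' = 1" using b by (auto simp: b'_def W_def ip_simps nph_scale norm_divide)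
  have "q b' \<ge> c" using b unfolding b'_def qsc by (simp add: power_divide field_simps)
  then have lc: "l \<ge> c" unfolding l_def using b' by (intro cSup_upper2[OF _ _ bdd]) (auto simp: Q_def)
  have l0: "l > 0" using lc c by simp
  have ql: "q z \<le> l * (nph z)\<^sup>2" if z: "z \<in> W" for z
  proof (cases "nph z = 0")
    case True then show ?thesis using q_le[of z] by simp
  next
    case False
    then have nz: "nph z > 0" using nph_nonneg[of z] by linarith
    have "q (of_real (1 / nph z) *\<^sub>C z) \<in> Q" unfolding Q_def
      using z nz by (intro imageI) (auto simp: W_def ip_simps nph_scale norm_divide)
    then have "(1 / nph z)\<^sup>2 * q z \<le> l" unfolding l_def qsc[symmetric] by (intro cSup_upper bdd)
    then have "(1 / nph z)\<^sup>2 * q z * (nph z)\<^sup>2 \<le> l * (nph z)\<^sup>2" by (rule mult_right_mono) simp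
    moreover have "(1 / nph z)\<^sup>2 * q z * (nph z)\<^sup>2 = q z" using nz by (simp add: power_divide)
    ultimately show ?thesis by simp
  qed
  have nR: "(nph (R z))\<^sup>2 \<le> l * q z" if z: "z \<in> W" for z
  proof -
    have "(nph (R z))\<^sup>2 * (nph (R z))\<^sup>2 = (cmod (ip (R z) (R z)))\<^sup>2" unfolding ip_self norm_of_real by (simp add: power2_eq_square)
    also have "\<dots> \<le> q (R z) * q z" by (rule R_CS)
    also have "\<dots> \<le> (l * (nph (R z))\<^sup>2) * q z" using ql[OF RW[OF z]] q_nonneg by (intro mult_right_mono) auto
    finally have *: "(nph (R z))\<^sup>2 * (nph (R z))\<^sup>2 \<le> (nph (R z))\<^sup>2 * (l * q z)" by (simp add: mult_ac)
    show ?thesis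
    proof (cases "nph (R z) = 0")
      case True then show ?thesis using l0 q_nonneg[of z] by simp
    next
      case False then show ?thesis by (intro mult_left_le_imp_le[OF *]) simp
    qed
  qed
  have "\<exists>z. z \<in> W \<and> nph z \<le> 1 \<and> q z > l - 1 / real (Suc n)" for n
  proof -
    have "Q \<noteq> {}" using b' by (auto simp: Q_def)
    then obtain s where "s \<in> Q" "s > l - 1 / real (Suc n)" using less_cSupD[of Q "l - 1 / real (Suc n)"] l_def by auto
    then show ?thesis by (auto simp: Q_def)
  qed
  then obtain z where z: "\<And>n. z n \<in> W" "\<And>n. nph (z n) \<le> 1" "\<And>n. q (z n) > l - 1 / real (Suc n)" by metis
  obtain K where K: "compact K" "\<And>z. nph z \<le> 1 \<Longrightarrow> R z \<in> K" using R_compact by blast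
  obtain w r where r: "strict_mono (r::nat \<Rightarrow> nat)" "(\<lambda>n. R (z (r n))) \<longlonglongrightarrow> w"
  proof -
    have "\<forall>n. R (z n) \<in> K" using K(2) z(2) by blast
    then have "\<exists>w\<in>K. \<exists>r. strict_mono (r::nat \<Rightarrow> nat) \<and> ((\<lambda>n. R (z n)) \<circ> r) \<longlonglongrightarrow> w"
      using K(1)[unfolded compact_def, THEN spec[of _ "\<lambda>n. R (z n)"]] by (rule mp[rotated])
    then obtain w r where "strict_mono (r::nat \<Rightarrow> nat)" "((\<lambda>n. R (z n)) \<circ> r) \<longlonglongrightarrow> w" by blast
    from this(1) this(2)[unfolded comp_def] show ?thesis by (rule that)
  qed
  have qlim: "(\<lambda>n. l - q (z (r n))) \<longlonglongrightarrow> 0"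
  proof (rule tendsto_sandwich[OF _ _ tendsto_const])
    have "q (z n) \<le> l" for n
    proof -
      have "(nph (z n))\<^sup>2 \<le> 1" using z(2)[of n] by (simp add: power_le_one)
      then have "l * (nph (z n))\<^sup>2 \<le> l * 1" using l0 by (intro mult_left_mono) auto
      then show ?thesis using ql[OF z(1)[of n]] by simp
    qed
    then show "\<forall>\<^sub>s n. 0 \<le> l - q (z (r n))" by simp
    show "\<forall>\<^sub>s n. l - q (z (r n)) \<le> 1 / real (Suc (r n))"
      using z(3) by (intro always_eventually allI) (smt (verit, best))
    show "(\<lambda>n. 1 / real (Suc (r n))) \<longlonglongrightarrow> 0"
      using LIMSEQ_subseq_LIMSEQ[OF LIMSEQ_Suc[OF lim_1_over_n] r(1)] by (simp add: comp_def)
  qed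
  \<comment> \<open>The squared length of \<open>d n\<close> is at most
    \<open>l q - 2 l q + l^2 = l (l - q)\<close> with \<open>q = q (z (r n))\<close>, which tends to
    0; so applying \<open>R\<close> to \<open>d n\<close> yields the eigenvalue equation for
    \<open>w\<close>.\<close>
  define d where "d n = R (z (r n)) - of_real l *\<^sub>C z (r n)" for n
  have nd: "(nph (d n))\<^sup>2 \<le> l * (l - q (z (r n)))" for n
  proof -
    let ?z = "z (r n)"
    have "complex_of_real ((nph (d n))\<^sup>2) = ip (R ?z) (R ?z) - of_real l * ip (R ?z) ?z - of_real l * ip ?z (R ?z) + of_real l * of_real l * ip ?z ?z"
      unfolding ip_self[symmetric] d_def by (simp add: ip_simps algebra_simps)
    also have "\<dots> = of_real ((nph (R ?z))\<^sup>2 - 2 * l * q ?z + l\<^sup>2 * (nph ?z)\<^sup>2)"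
      unfolding R_symmetric R_form ip_self by (simp add: power2_eq_square)
    finally have "(nph (d n))\<^sup>2 = (nph (R ?z))\<^sup>2 - 2 * l * q ?z + l\<^sup>2 * (nph ?z)\<^sup>2" by (simp only: of_real_eq_iff)
    moreover have "l\<^sup>2 * (nph ?z)\<^sup>2 \<le> l\<^sup>2 * 1" using z(2)[of "r n"] by (intro mult_left_mono) (auto simp: power_le_one)
    ultimately show ?thesis using nR[OF z(1)[of "r n"]] by (simp add: power2_eq_square algebra_simps)
  qed
  have "(\<lambda>n. sqrt (l * (l - q (z (r n))))) \<longlonglongrightarrow> sqrt (l * 0)" by (intro tendsto_intros qlim)
  then have ndlim: "(\<lambda>n. sqrt (l * (l - q (z (r n))))) \<longlonglongrightarrow> 0" by simp
  have nd': "nph (d n) \<le> sqrt (l * (l - q (z (r n))))" for n using nd[of n] by (rule real_le_rsqrt)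
  have Rlim: "(\<lambda>n. R (u n)) \<longlonglongrightarrow> R v" if "(\<lambda>n. nph (u n - v)) \<longlonglongrightarrow> 0" for u v
  proof (rule LIM_zero_cancel, rule Lim_null_comparison)
    show "\<forall>\<^sub>s n. norm (R (u n) - R v) \<le> CR * nph (u n - v)" using R_norm by (simp flip: R_diff)
    show "(\<lambda>n. CR * nph (u n - v)) \<longlonglongrightarrow> 0" using tendsto_mult_left[OF that, of CR] by simp
  qed
  have nw: "(\<lambda>n. nph (R (z (r n)) - w)) \<longlonglongrightarrow> 0"
    by (rule tendsto_sandwich[OF _ _ tendsto_const tendsto_norm_zero[OF LIM_zero[OF r(2)]]]) (auto simp: nph_norm)
  have "(\<lambda>n. R (d n)) \<longlonglongrightarrow> R 0"
  proof (rule Rlim)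
    show "(\<lambda>n. nph (d n - 0)) \<longlonglongrightarrow> 0"
      by (rule tendsto_sandwich[OF _ _ tendsto_const ndlim]) (use nd' in auto)
  qed
  moreover have "(\<lambda>n. R (d n)) \<longlonglongrightarrow> R w - of_real l *\<^sub>C w"
    unfolding d_def R_diff R_scaleC by (intro tendsto_intros Rlim nw r(2))
  ultimately have "R w - of_real l *\<^sub>C w = R 0" using LIMSEQ_unique by blast
  moreover have "R 0 = 0" using R_scaleC[of 0 0] by simp
  ultimately have Rw: "R w = l *\<^sub>R w" by (simp add: scaleC_of_real)
  have "l \<le> nph w"
  proof (rule LIMSEQ_le[of "\<lambda>n. q (z (r n))" _ "\<lambda>n. nph w + nph (R (z (r n)) - w)"])
    show "(\<lambda>n. q (z (r n))) \<longlonglongrightarrow> l" using tendsto_diff[OF tendsto_const qlim, of l] by simp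
    show "(\<lambda>n. nph w + nph (R (z (r n)) - w)) \<longlonglongrightarrow> nph w" using tendsto_add[OF tendsto_const nw] by simp
    show "\<exists>N. \<forall>n\<ge>N. q (z (r n)) \<le> nph w + nph (R (z (r n)) - w)"
    proof (intro exI allI impI)
      fix n
      let ?z = "z (r n)"
      have "q ?z = cmod (ip ?z (R ?z))" using q_nonneg[of ?z] by (simp add: R_form)
      also have "\<dots> \<le> nph ?z * nph (R ?z)" by (rule ip_CS)
      also have "\<dots> \<le> 1 * nph (R ?z)" using z(2) by (intro mult_right_mono) auto
      also have "nph (R ?z) \<le> nph w + nph (R ?z - w)" using nph_tri[of w "R ?z - w"] by simp
      finally show "q ?z \<le> nph w + nph (R ?z - w)" by simp
    qed
  qed
  moreover have "ip x w = 0" if "x \<in> S" for x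
  proof (rule LIMSEQ_unique)
    show "(\<lambda>n. ip x (R (z (r n)))) \<longlonglongrightarrow> ip x w" unfolding ip_def
      by (intro bounded_linear.tendsto[OF bounded_linear_\<phi>] tendsto_intros r(2))
    show "(\<lambda>n. ip x (R (z (r n)))) \<longlonglongrightarrow> 0" using RW[OF z(1)] that by (simp add: W_def)
  qed
  ultimately show ?thesis using lc l0 Rw by (intro exI[of _ w] exI[of _ l]) auto
qed

end

section \<open>Maximal invariant families of eigenvectors\<close>

context excising_sequence
begin

lemma ip_scaleR: "ip z (r *\<^sub>R w) = of_real r * ip z w" unfolding scaleR_scaleC by (rule ip_simps)

lemma pr_zero: "(\<And>x. x \<in> S \<Longrightarrow> ip x z = 0) \<Longrightarrow> pr S z = 0"
  by (simp add: pr_def scaleC_zero_left)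

lemma ip_pr_zero: "(\<And>y. y \<in> S \<Longrightarrow> ip x y = 0) \<Longrightarrow> ip x (pr S z) = 0" "(\<And>y. y \<in> S \<Longrightarrow> ip y x = 0) \<Longrightarrow> ip (pr S z) x = 0"
  by (simp_all add: pr_def ip_sum ip_simps)

lemma pr_Un: "finite S \<Longrightarrow> finite T \<Longrightarrow> S \<inter> T = {} \<Longrightarrow> pr (S \<union> T) z = pr S z + pr T z"
  by (simp add: pr_def sum.union_disjoint)

text \<open>\<open>c\<close> must not depend on \<open>S\<close>, which is later chosen maximal for
  this very \<open>c\<close>. The residual \<open>b\<close> satisfies
  \<open>ip a b = ip b b\<close>; for \<open>act g a\<close> within \<open>r/2\<close> of
  \<open>a\<close>, at least half of this survives, and \<open>nph b > r\<close> makes it comparable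
  to the length of \<open>b\<close>. The bump \<open>\<beta>\<close> integrates the bound over such
  \<open>g\<close>.\<close>

lemma residual_lower_bound:
  assumes r: "r > 0"
  shows "\<exists>c>0. \<forall>S. orthonormal S \<longrightarrow> nph (a - pr S a) > r \<longrightarrow>
    c * (nph (a - pr S a))\<^sup>2 \<le> hmean (\<lambda>g. (cmod (ip (act g a) (a - pr S a)))\<^sup>2)"
proof -
  define \<beta> where "\<beta> g = max 0 (1 - norm (act g a - a) / (r / 2))" for g
  have c\<beta>: "continuous_on UNIV \<beta>" unfolding \<beta>_def using r by (intro continuous_intros act_cont) auto
  have "hmean \<beta> > 0"
    by (rule hmean_pos[OF c\<beta>, of 0]) (simp_all add: \<beta>_def act_zero)
  moreover have "(r\<^sup>2 / 4 * hmean \<beta>) * (nph b)\<^sup>2 \<le> hmean (\<lambda>g. (cmod (ip (act g a) b))\<^sup>2)"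
    if S: "orthonormal S" and b: "b = a - pr S a" and big: "nph b > r" for S b
  proof -
    have "ip (pr S a) b = 0" unfolding b by (rule ip_pr_zero(2)[OF ip_residual[OF S]])
    then have "ip a b = ip b b" using ip_simps(3)[of a "pr S a" b] b by simp
    then have ab: "cmod (ip a b) = (nph b)\<^sup>2" by (simp only: ip_self norm_of_real) simp
    have "((r\<^sup>2 / 4) * (nph b)\<^sup>2) * \<beta> g \<le> (cmod (ip (act g a) b))\<^sup>2" for g
    proof (cases "norm (act g a - a) \<le> r / 2")
      case True
      have "cmod (ip (act g a - a) b) \<le> nph (act g a - a) * nph b" by (rule ip_CS)
      also have "\<dots> \<le> (r / 2) * nph b" using True nph_norm[of "act g a - a"] by (intro mult_right_mono) auto
      also have "\<dots> \<le> (nph b / 2) * nph b" using big by (intro mult_right_mono) auto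
      finally have 1: "cmod (ip (act g a - a) b) \<le> (nph b)\<^sup>2 / 2" by (simp add: power2_eq_square)
      have "cmod (ip a b) \<le> cmod (ip (act g a) b) + cmod (ip (act g a - a) b)"
        using norm_triangle_ineq4[of "ip (act g a) b" "ip (act g a - a) b"] by (simp add: ip_simps)
      then have 2: "(nph b)\<^sup>2 / 2 \<le> cmod (ip (act g a) b)" using 1 ab by simp
      have "r * nph b / 2 \<le> (nph b)\<^sup>2 / 2" using big by (simp add: power2_eq_square mult_right_mono)
      then have "(r * nph b / 2)\<^sup>2 \<le> (cmod (ip (act g a) b))\<^sup>2" using 2 r by (intro power_mono) auto
      moreover have "(r\<^sup>2 / 4) * (nph b)\<^sup>2 * \<beta> g \<le> (r\<^sup>2 / 4) * (nph b)\<^sup>2 * 1"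
        using r by (intro mult_left_mono) (auto simp: \<beta>_def)
      ultimately show ?thesis by (simp add: power_mult_distrib power_divide)
    next
      case False
      then have "\<beta> g = 0" using r by (simp add: \<beta>_def field_simps)
      then show ?thesis by simp
    qed
    then have "hmean (\<lambda>g. ((r\<^sup>2 / 4) * (nph b)\<^sup>2) *\<^sub>R \<beta> g) \<le> hmean (\<lambda>g. (cmod (ip (act g a) b))\<^sup>2)"
      by (intro hmean_mono ip_sq_cont continuous_intros c\<beta>) simp
    then show ?thesis by (simp only: hmean_scaleR[OF c\<beta>]) (simp add: mult_ac)
  qed
  ultimately show ?thesis using r by (intro exI[of _ "r\<^sup>2 / 4 * hmean \<beta>"]) auto
qed

end

lemma exists_max_card: "P k \<Longrightarrow> \<forall>y. P y \<longrightarrow> card y \<le> b \<Longrightarrow> \<exists>x. P x \<and> (\<forall>y. P y \<longrightarrow> card y \<le> card x)"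
  using ex_has_greatest_nat[of P k card "Suc b"] by (simp add: less_Suc_eq_le)

context averaged_projection
begin

lemma eigenvalue_q: "R x = l *\<^sub>R x \<Longrightarrow> ip x x = 1 \<Longrightarrow> q x = l"
proof -
  assume *: "R x = l *\<^sub>R x" "ip x x = 1"
  have "complex_of_real (q x) = of_real l" unfolding R_form[symmetric] *(1) ip_scaleR *(2) by simp
  then show ?thesis by (simp only: of_real_eq_iff)
qed

lemma card_eigenvectors:
  assumes "orthonormal S" "c > 0" "\<And>x. x \<in> S \<Longrightarrow> \<exists>l\<ge>c. R x = l *\<^sub>R x"
  shows "card S \<le> nat \<lceil>((nph a0)\<^sup>2 + (nph a1)\<^sup>2) / c\<rceil>"
proof -
  have "q x \<ge> c" if "x \<in> S" for x
    using assms(3)[OF that] eigenvalue_q[of x] assms(1) that by (auto simp: orthonormal_def)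
  then have "(\<Sum>x\<in>S. c) \<le> (\<Sum>x\<in>S. q x)" by (rule sum_mono)
  then have "real (card S) * c \<le> (nph a0)\<^sup>2 + (nph a1)\<^sup>2" using R_trace[OF assms(1)] by simp
  then have "real (card S) \<le> ((nph a0)\<^sup>2 + (nph a1)\<^sup>2) / c" using assms(2) by (simp add: pos_le_divide_eq)
  then show ?thesis by linarith
qed

definition invariant_eigenbasis :: "real \<Rightarrow> 'u set \<Rightarrow> bool" where
  "invariant_eigenbasis c S \<longleftrightarrow> orthonormal S \<and> S \<subseteq> A \<and> (\<forall>x\<in>S. \<exists>l\<ge>c. R x = l *\<^sub>R x) \<and> (\<forall>g. \<forall>x\<in>S. act g x = pr S (act g x))"

text \<open>Adding \<open>w\<close> alone could destroy the invariance of the span. The whole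
  eigenspace \<open>V\<close> of \<open>l\<close> orthogonal to \<open>S\<close> is invariant, and
  the trace bound makes it finite-dimensional, so an orthonormal basis \<open>T\<close> of it is
  added.\<close>

lemma enlarge_eigenbasis:
  assumes good: "invariant_eigenbasis c S" and c: "c > 0"
    and w: "R w = l *\<^sub>R w" "l \<ge> c" "nph w > 0" "\<And>x. x \<in> S \<Longrightarrow> ip x w = 0"
  shows "\<exists>S'. invariant_eigenbasis c S' \<and> card S < card S'"
proof -
  note S = good[unfolded invariant_eigenbasis_def]
  have l: "l > 0" using w c by simp
  define V where "V = {z. R z = l *\<^sub>R z \<and> (\<forall>x\<in>S. ip x z = 0)}"
  have VD: "R z = l *\<^sub>R z" "x \<in> S \<Longrightarrow> ip x z = 0" if "z \<in> V" for z x using that by (auto simp: V_def)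
  have V_A: "z \<in> A" if "z \<in> V" for z
  proof -
    have "z = (1 / l) *\<^sub>R R z" using VD(1)[OF that] l by simp
    then show ?thesis using A_closed_ops R_A by metis
  qed
  have V_diff: "z - z' \<in> V" if "z \<in> V" "z' \<in> V" for z z'
    using that by (simp add: V_def R_diff ip_simps scaleR_diff_right)
  have V_scaleC: "a *\<^sub>C z \<in> V" if "z \<in> V" for a z
    using that by (simp add: V_def R_scaleC ip_simps scaleR_scaleC scaleC_scaleC mult.commute)
  have V_0: "0 \<in> V" using R_scaleC[of 0 0] by (simp add: V_def ip_simps)
  have V_add: "z + z' \<in> V" if "z \<in> V" "z' \<in> V" for z z'
    using that by (simp add: V_def R_add ip_simps scaleR_add_right)
  have V_sum: "(\<Sum>i\<in>I. f i) \<in> V" if "\<And>i. i \<in> I \<Longrightarrow> f i \<in> V" for I :: "'u set" and f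
    using that by (induction I rule: infinite_finite_induct) (auto simp: V_0 V_add)
  have V_act: "act g z \<in> V" if z: "z \<in> V" for g z
  proof -
    have "ip x (act g z) = 0" if x: "x \<in> S" for x
    proof -
      have "ip x (act g z) = ip (act (-g) x) (act (-g) (act g z))" by (simp only: ip_act)
      also have "act (-g) (act g z) = z" by (simp flip: act_plus add: act_zero)
      also have "act (-g) x = pr S (act (-g) x)" using S x by blast
      also have "ip \<dots> z = 0" by (rule ip_pr_zero(2)[OF VD(2)[OF z]])
      finally show ?thesis .
    qed
    moreover have "R (act g z) = l *\<^sub>R act g z"
      unfolding R_act[symmetric] VD(1)[OF z] by (simp add: scaleR_scaleC act_scaleC)
    ultimately show ?thesis by (simp add: V_def)
  qed
  \<comment> \<open>\<open>nph\<close> is only a seminorm on the algebra. On an eigenspace with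
    \<open>l > 0\<close> it is definite, because \<open>R\<close> annihilates null vectors.\<close>
  have V_definite: "z = 0" if "z \<in> V" "nph z = 0" for z
    using R_zero[OF that(2)] VD(1)[OF that(1)] l by simp
  define P where "P T \<longleftrightarrow> orthonormal T \<and> T \<subseteq> V" for T
  have "P {}" by (simp add: P_def orthonormal_def)
  moreover have "\<forall>T. P T \<longrightarrow> card T \<le> nat \<lceil>((nph a0)\<^sup>2 + (nph a1)\<^sup>2) / c\<rceil>"
  proof (intro allI impI)
    fix T assume T: "P T"
    show "card T \<le> nat \<lceil>((nph a0)\<^sup>2 + (nph a1)\<^sup>2) / c\<rceil>"
      by (rule card_eigenvectors) (use T c w VD(1) in \<open>auto simp: P_def\<close>)
  qed
  ultimately have "\<exists>T. P T \<and> (\<forall>T'. P T' \<longrightarrow> card T' \<le> card T)" by (rule exists_max_card)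
  then obtain T where T: "P T" "\<And>T'. P T' \<Longrightarrow> card T' \<le> card T" by blast
  have oT: "orthonormal T" and TV: "T \<subseteq> V" using T(1) by (auto simp: P_def)
  have fin: "finite T" "finite S" using oT S by (auto simp: orthonormal_def)
  have T_span: "z = pr T z" if z: "z \<in> V" for z
  proof -
    have "z - pr T z \<in> V" unfolding pr_def using TV by (intro V_diff z V_sum V_scaleC) auto
    moreover have "nph (z - pr T z) = 0"
    proof (rule ccontr)
      assume nz: "nph (z - pr T z) \<noteq> 0"
      note ins = orthonormal_insert[OF oT nz ip_residual[OF oT]]
      have "P (insert (of_real (1 / nph (z - pr T z)) *\<^sub>C (z - pr T z)) T)"
        unfolding P_def using ins(1) TV V_scaleC \<open>z - pr T z \<in> V\<close> by blast
      from T(2)[OF this] show False using ins(2) fin by simp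
    qed
    ultimately have "z - pr T z = 0" by (rule V_definite)
    then show ?thesis by simp
  qed
  have "w \<in> V" using w by (simp add: V_def)
  have "T \<noteq> {}"
  proof
    assume "T = {}"
    then have "w = 0" using T_span[OF \<open>w \<in> V\<close>] by (simp add: pr_def)
    then have "ip w w = 0" by (simp add: ip_simps)
    then show False using w(3) by (simp add: ip_self)
  qed
  have ST: "ip x y = 0" "ip y x = 0" if "x \<in> S" "y \<in> T" for x y
    using VD(2)[of y x] TV that ip_cnj[of y x] by auto
  have disj: "S \<inter> T = {}"
  proof (rule ccontr)
    assume "S \<inter> T \<noteq> {}"
    then obtain x where x: "x \<in> S" "x \<in> T" by blast
    have "ip x x = 1" using oT x(2) unfolding orthonormal_def by simp
    then show False using ST(1)[OF x] by simp
  qed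
  have "invariant_eigenbasis c (S \<union> T)"
    unfolding invariant_eigenbasis_def
  proof (intro conjI allI ballI)
    show "orthonormal (S \<union> T)" unfolding orthonormal_def
    proof (intro conjI ballI)
      show "finite (S \<union> T)" using fin by simp
      show "ip x y = (if x = y then 1 else 0)" if "x \<in> S \<union> T" "y \<in> S \<union> T" for x y
        using that S oT ST disj unfolding orthonormal_def by (elim UnE) auto
    qed
    show "S \<union> T \<subseteq> A" using S TV V_A by blast
    show "\<exists>l\<ge>c. R x = l *\<^sub>R x" if "x \<in> S \<union> T" for x
      using that S TV VD(1) w(2) by blast
    show "act g x = pr (S \<union> T) (act g x)" if "x \<in> S \<union> T" for g x
      using that
    proof
      assume x: "x \<in> S"
      then have e: "act g x = pr S (act g x)" using S by blast
      have "ip y (act g x) = 0" if "y \<in> T" for y by (subst e, rule ip_pr_zero(1)[OF ST(2)[OF _ that]])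
      then have "pr T (act g x) = 0" by (rule pr_zero)
      then show ?thesis using e pr_Un[OF fin(2,1) disj] by simp
    next
      assume x: "x \<in> T"
      then have V: "act g x \<in> V" using TV V_act by blast
      have "pr S (act g x) = 0" by (rule pr_zero[OF VD(2)[OF V]])
      then show ?thesis using T_span[OF V] pr_Un[OF fin(2,1) disj] by simp
    qed
  qed
  moreover have "card (S \<union> T) = card S + card T" using fin disj by (intro card_Un_disjoint)
  ultimately show ?thesis using \<open>T \<noteq> {}\<close> fin by (intro exI[of _ "S \<union> T"]) (simp add: card_gt_0_iff)
qed

text \<open>Take \<open>S\<close> maximal among the invariant families with eigenvalues at least
  \<open>c\<close>. A residual longer than \<open>r\<close> would have enough energy for
  \<open>top_eigenvector\<close> to produce a further eigenvector above the level \<open>c\<close>,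
  against maximality.\<close>

lemma eigenbasis_approximates:
  assumes r: "r > 0"
  shows "\<exists>S. orthonormal S \<and> S \<subseteq> A \<and> (\<forall>g. \<forall>x\<in>S. act g x = pr S (act g x))
    \<and> nph (a0 - pr S a0) \<le> r \<and> nph (a1 - pr S a1) \<le> r"
proof -
  obtain c0 where c0: "c0 > 0" "\<And>S. orthonormal S \<Longrightarrow> nph (a0 - pr S a0) > r \<Longrightarrow>
    c0 * (nph (a0 - pr S a0))\<^sup>2 \<le> hmean (\<lambda>g. (cmod (ip (act g a0) (a0 - pr S a0)))\<^sup>2)"
    using residual_lower_bound[OF r, of a0] by blast
  obtain c1 where c1: "c1 > 0" "\<And>S. orthonormal S \<Longrightarrow> nph (a1 - pr S a1) > r \<Longrightarrow>
    c1 * (nph (a1 - pr S a1))\<^sup>2 \<le> hmean (\<lambda>g. (cmod (ip (act g a1) (a1 - pr S a1)))\<^sup>2)"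
    using residual_lower_bound[OF r, of a1] by blast
  define c where "c = min c0 c1"
  have c: "c > 0" "c \<le> c0" "c \<le> c1" using c0 c1 by (auto simp: c_def)
  have "invariant_eigenbasis c {}" by (simp add: invariant_eigenbasis_def orthonormal_def)
  moreover have "\<forall>T. invariant_eigenbasis c T \<longrightarrow> card T \<le> nat \<lceil>((nph a0)\<^sup>2 + (nph a1)\<^sup>2) / c\<rceil>"
  proof (intro allI impI)
    fix T assume T: "invariant_eigenbasis c T"
    show "card T \<le> nat \<lceil>((nph a0)\<^sup>2 + (nph a1)\<^sup>2) / c\<rceil>"
      by (rule card_eigenvectors) (use T c in \<open>auto simp: invariant_eigenbasis_def\<close>)
  qed
  ultimately have "\<exists>T. invariant_eigenbasis c T \<and> (\<forall>T'. invariant_eigenbasis c T' \<longrightarrow> card T' \<le> card T)"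
    by (rule exists_max_card)
  then obtain S where good: "invariant_eigenbasis c S" and max: "\<And>T. invariant_eigenbasis c T \<Longrightarrow> card T \<le> card S"
    by blast
  note S = good[unfolded invariant_eigenbasis_def]
  have small: "nph b \<le> r" if b: "b = a - pr S a" and low: "nph b > r \<Longrightarrow> q b \<ge> c * (nph b)\<^sup>2" for a b
  proof (rule ccontr)
    assume "\<not> nph b \<le> r"
    then have n: "nph b > r" "nph b > 0" using r by auto
    have "\<exists>w l. l \<ge> c \<and> R w = l *\<^sub>R w \<and> nph w > 0 \<and> (\<forall>x\<in>S. ip x w = 0)"
    proof (rule top_eigenvector)
      show "\<exists>l. R x = l *\<^sub>C x" if "x \<in> S" for x using S that by (metis scaleR_scaleC)
    qed (use S b ip_residual n low c in auto)
    then obtain w l where "l \<ge> c" "R w = l *\<^sub>R w" "nph w > 0" "\<And>x. x \<in> S \<Longrightarrow> ip x w = 0" by blast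
    from enlarge_eigenbasis[OF good c(1) this(2,1,3,4)] max show False by (meson not_le)
  qed
  have lower: "q b \<ge> c * (nph b)\<^sup>2" if "c' \<ge> c" "c' * (nph b)\<^sup>2 \<le> q b" for b c'
    using mult_right_mono[OF that(1), of "(nph b)\<^sup>2"] that(2) by simp
  have q1: "hmean (\<lambda>g. (cmod (ip (act g a0) z))\<^sup>2) \<le> q z" "hmean (\<lambda>g. (cmod (ip (act g a1) z))\<^sup>2) \<le> q z" for z
    using R1_form_nonneg[of a0 z] R1_form_nonneg[of a1 z] by (simp_all add: q_def)
  have "nph (a0 - pr S a0) \<le> r"
    by (rule small[OF refl], rule lower[OF c(2)], rule order_trans[OF c0(2) q1(1)]) (use S in auto)
  moreover have "nph (a1 - pr S a1) \<le> r"
    by (rule small[OF refl], rule lower[OF c(3)], rule order_trans[OF c1(2) q1(2)]) (use S in auto)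
  ultimately show ?thesis using S by blast
qed

end

lemma (in excising_sequence) invariant_subspace:
  assumes "a0 \<in> A" "a1 \<in> A" "r > 0"
  shows "\<exists>S. orthonormal S \<and> S \<subseteq> A \<and> (\<forall>g. \<forall>x\<in>S. act g x = pr S (act g x))
    \<and> nph (a0 - pr S a0) \<le> r \<and> nph (a1 - pr S a1) \<le> r"
proof -
  interpret averaged_projection act ch e a0 a1 by unfold_locales (use assms in auto)
  show ?thesis by (rule eigenbasis_approximates[OF assms(3)])
qed

section \<open>The dichotomy: a minimal projection, or infinite-dimensional corners\<close>

context excising_sequence
begin

lemma loc_linear: "0 \<in> loc z" "d \<in> loc z \<Longrightarrow> d' \<in> loc z \<Longrightarrow> d + d' \<in> loc z"
  "d \<in> loc z \<Longrightarrow> d' \<in> loc z \<Longrightarrow> d - d' \<in> loc z" "d \<in> loc z \<Longrightarrow> c *\<^sub>C d \<in> loc z"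
  unfolding loc_def
  by (auto simp: distrib_left distrib_right right_diff_distrib left_diff_distrib mult_scaleC
      intro: B_closed_ops(1-3,7))

lemma loc_sum: "(\<And>i. i \<in> I \<Longrightarrow> f i \<in> loc z) \<Longrightarrow> (\<Sum>i\<in>I. f i) \<in> loc z"
  by (induction I rule: infinite_finite_induct) (auto intro: loc_linear)

lemma nph_sum_le: "nph (\<Sum>i\<in>I. f i) \<le> (\<Sum>i\<in>I. nph (f i))"
proof (induction I rule: infinite_finite_induct)
  case (insert x F)
  then show ?case using nph_tri[of "f x" "sum f F"] by simp
qed (simp_all add: nph_def)

lemma nph_cut: "nph (t - t * e j) = 0"
proof (rule LIMSEQ_unique[OF nlim])
  have "norm ((t - t * e j) * e i) = 0" if "i > j" for i
    using that by (simp add: left_diff_distrib mult.assoc e_mult)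
  then have "\<forall>\<^sub>s i. norm ((t - t * e j) * e i) = 0"
    unfolding eventually_sequentially by (intro exI[of _ "Suc j"]) auto
  then show "(\<lambda>i. norm ((t - t * e j) * e i)) \<longlonglongrightarrow> 0" by (rule tendsto_eventually)
qed

text \<open>\<open>C n\<close> is the trace of \<open>e n * e n\<close> on the span of a maximal
  orthonormal set in \<open>loc (e q)\<close>. The squares decrease, and a positive difference has
  norm at most its trace \<open>C n - C k\<close>; as \<open>C\<close> decreases and is nonnegative,
  the squares form a Cauchy sequence.\<close>

lemma corner_projection:
  assumes fin: "\<forall>S. orthonormal S \<and> S \<subseteq> loc (e q) \<longrightarrow> card S \<le> m"
  shows "\<exists>p\<in>B. pos p \<and> p * p = p \<and> norm p = 1 \<and> (\<forall>y. p * y * p = \<phi> y *\<^sub>C p)"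
proof -
  have "\<exists>S. (orthonormal S \<and> S \<subseteq> loc (e q)) \<and> (\<forall>S'. (orthonormal S' \<and> S' \<subseteq> loc (e q)) \<longrightarrow> card S' \<le> card S)"
    by (rule exists_max_card[OF _ fin, of "{}"]) (simp add: orthonormal_def)
  then obtain S where S: "orthonormal S" "S \<subseteq> loc (e q)"
    and max: "\<And>S'. orthonormal S' \<Longrightarrow> S' \<subseteq> loc (e q) \<Longrightarrow> card S' \<le> card S" by blast
  have finS: "finite S" using S by (simp add: orthonormal_def)
  have span: "nph (d - pr S d) = 0" if d: "d \<in> loc (e q)" for d
  proof (rule ccontr)
    assume nz: "nph (d - pr S d) \<noteq> 0"
    note ins = orthonormal_insert[OF S(1) nz ip_residual[OF S(1)]]
    have "d - pr S d \<in> loc (e q)" unfolding pr_def using S(2) by (intro loc_linear loc_sum d) auto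
    then have "insert (of_real (1 / nph (d - pr S d)) *\<^sub>C (d - pr S d)) S \<subseteq> loc (e q)"
      using S(2) loc_linear(4) by blast
    from max[OF ins(1) this] show False using ins(2) finS by simp
  qed
  define C where "C n = (\<Sum>x\<in>S. Re (ip x (e n * e n * x)))" for n
  have h_pos: "pos (e n * e n - e k * e k)" if "n < k" for n k
  proof -
    have "e n * (e k * e k) * e n \<preceq> e n * of_real 1 * e n"
      by (intro ple_conj_sa ple_norm e_sa sa_mult refl) simp
    moreover have "e n * (e k * e k) * e n = e k * e k" using that by (simp add: mult.assoc e_mult e_mult')
    ultimately show ?thesis by simp
  qed
  have diff: "norm (e n * e n - e k * e k) \<le> C n - C k" if nk: "Suc q < n" "n < k" for n k
  proof -
    define h where "h = e n * e n - e k * e k"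
    have h: "pos h" unfolding h_def by (rule h_pos[OF nk(2)])
    define s where "s = psqrt h"
    have ss: "star s * s = h" "star s = s" using psqrt(1,2)[OF h] pos_star[of s] by (simp_all add: s_def)
    have nphs: "(nph (s * u))\<^sup>2 = cmod (\<phi> (star u * h * u))" for u
    proof -
      have "star (s * u) * (s * u) = star u * (star s * s) * u" by (simp only: star_mult mult.assoc)
      then show ?thesis by (simp only: nph_sq ss(1))
    qed
    have Ch: "(\<Sum>x\<in>S. (nph (s * x))\<^sup>2) = C n - C k"
    proof -
      have "(nph (s * x))\<^sup>2 = Re (ip x (h * x))" for x
      proof -
        have "ip x (h * x) = \<phi> (star (s * x) * (s * x))"
          unfolding ip_def ss(1)[symmetric] by (simp only: star_mult mult.assoc)
        then show ?thesis by (simp add: nph_of_real)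
      qed
      then show ?thesis by (simp add: h_def left_diff_distrib ip_simps C_def sum_subtractf)
    qed
    have c0: "C n - C k \<ge> 0" unfolding Ch[symmetric] by (simp add: sum_nonneg)
    have "norm h \<le> C n - C k"
    proof (rule norm_le_from_\<phi>[OF _ h c0])
      show "h \<in> B" unfolding h_def by (intro B_closed_ops B_mult e_B)
      fix r assume r: "r \<in> B"
      \<comment> \<open>\<open>h\<close> lives under \<open>e (Suc q)\<close>, so \<open>r\<close>
        may be replaced by \<open>t\<close>; and \<open>t\<close> by \<open>d\<close>, which differs
        from it by a null vector and lies in \<open>loc (e q)\<close>, where the span of
        \<open>S\<close> is everything up to null vectors.\<close>
      define t where "t = e (Suc q) * r"
      define d where "d = t * e (Suc q)"
      have d: "d \<in> loc (e q)" unfolding loc_def d_def t_def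
        using r by (auto simp: mult.assoc e_mult e_mult' intro: B_mult e_B)
      have eh: "e (Suc q) * h = h" "h * e (Suc q) = h"
        using nk by (simp_all add: h_def right_diff_distrib left_diff_distrib mult.assoc e_mult e_mult')
      have rt: "star r * h * r = star t * h * t"
      proof -
        have "star t * h * t = star r * (e (Suc q) * h * e (Suc q)) * r" by (simp add: t_def star_mult mult.assoc)
        then show ?thesis by (simp add: eh)
      qed
      have small: "nph (s * (u - v)) = 0" if "nph (u - v) = 0" for u v
        using nph_mult[of s "u - v"] nph_nonneg[of "s * (u - v)"] that by simp
      have "nph (s * t) \<le> nph (s * d)"
        using nph_tri[of "s * d" "s * (t - d)"] small[of t d] nph_cut[of t "Suc q"] by (simp add: d_def right_diff_distrib)
      also have "\<dots> \<le> nph (s * pr S d)"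
        using nph_tri[of "s * pr S d" "s * (d - pr S d)"] small[of d "pr S d"] span[OF d] by (simp add: right_diff_distrib)
      also have "\<dots> \<le> (\<Sum>x\<in>S. cmod (ip x d) * nph (s * x))"
        using nph_sum_le[of "\<lambda>x. ip x d *\<^sub>C (s * x)" S] by (simp add: pr_def sum_distrib_left mult_scaleC_right nph_scale)
      finally have "(nph (s * t))\<^sup>2 \<le> (\<Sum>x\<in>S. cmod (ip x d) * nph (s * x))\<^sup>2" by (intro power_mono) auto
      also have "\<dots> \<le> (\<Sum>x\<in>S. (cmod (ip x d))\<^sup>2) * (\<Sum>x\<in>S. (nph (s * x))\<^sup>2)" by (rule Cauchy_Schwarz_ineq_sum)
      also have "\<dots> \<le> (nph d)\<^sup>2 * (C n - C k)" unfolding Ch by (intro mult_right_mono bessel S c0)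
      also have "\<dots> \<le> (nph r)\<^sup>2 * (C n - C k)"
      proof (intro mult_right_mono power_mono c0)
        have "nph d \<le> nph t"
          using nph_tri_diff[of t "t - d"] nph_cut[of t "Suc q"] by (simp add: d_def)
        also have "\<dots> \<le> nph r" using nph_mult[of "e (Suc q)" r] by (simp add: t_def)
        finally show "nph d \<le> nph r" .
      qed simp
      finally show "cmod (\<phi> (star r * h * r)) \<le> (C n - C k) * (nph r)\<^sup>2" by (simp add: rt nphs mult.commute)
    qed
    then show ?thesis by (simp add: h_def)
  qed
  have C_dec: "C (Suc n) \<le> C n" if "Suc q < n" for n using order_trans[OF norm_ge_zero diff[OF that lessI]] by simp
  have C_nonneg: "C n \<ge> 0" for n unfolding C_def
  proof (rule sum_nonneg)
    fix x
    have "ip x (e n * e n * x) = ip (e n * x) (e n * x)" by (simp add: ip_def star_mult mult.assoc)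
    then show "0 \<le> Re (ip x (e n * e n * x))" by (simp add: ip_self)
  qed
  let ?C = "\<lambda>n. C (n + Suc (Suc q))" and ?e = "\<lambda>n. e (n + Suc (Suc q)) * e (n + Suc (Suc q))"
  have "decseq (\<lambda>n. ?C n)" by (rule decseq_SucI) (simp add: C_dec)
  then have "convergent (\<lambda>n. ?C n)" using C_nonneg decseq_convergent[of "\<lambda>n. ?C n" 0] unfolding convergent_def by metis
  then have CC: "Cauchy (\<lambda>n. ?C n)" by (rule convergent_Cauchy)
  have "Cauchy (\<lambda>n. ?e n)"
  proof (rule CauchyI)
    fix eps :: real assume "eps > 0"
    then obtain M where M: "\<And>i j. i \<ge> M \<Longrightarrow> j \<ge> M \<Longrightarrow> norm (?C i - ?C j) < eps"
      using CauchyD[OF CC] by blast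
    have lt: "norm (?e i - ?e j) < eps" if "i \<ge> M" "i < j" for i j
      using diff[of "i + Suc (Suc q)" "j + Suc (Suc q)"] M[of i j] that by simp
    show "\<exists>M. \<forall>i\<ge>M. \<forall>j\<ge>M. norm (?e i - ?e j) < eps"
    proof (intro exI[of _ M] allI impI)
      fix i j assume ij: "M \<le> i" "M \<le> j"
      consider "i < j" | "j < i" | "i = j" by linarith
      then show "norm (?e i - ?e j) < eps"
      proof cases
        case 1 then show ?thesis using lt ij by blast
      next
        case 2 show ?thesis by (subst norm_minus_commute) (rule lt[OF ij(2) 2])
      next
        case 3 then show ?thesis using \<open>eps > 0\<close> by simp
      qed
    qed
  qed
  then have "convergent (\<lambda>n. e n * e n)" by (simp only: Cauchy_convergent_iff convergent_ignore_initial_segment[of "\<lambda>n. e n * e n"])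
  then obtain p where p: "(\<lambda>n. e n * e n) \<longlonglongrightarrow> p" by (auto simp: convergent_def)
  have pB: "p \<in> B" by (rule closed_sequentially[OF closed_B _ p]) (intro B_mult e_B)
  have pp: "pos p" using closed_sequentially[OF pos_closed _ p] sa_square_pos[OF e_sa] by blast
  have "norm p = 1"
    using LIMSEQ_unique[OF tendsto_norm[OF p]] by simp
  moreover have "p * p = p"
  proof (rule LIMSEQ_unique)
    show "(\<lambda>n. (e n * e n) * (e (Suc n) * e (Suc n))) \<longlonglongrightarrow> p * p" by (intro tendsto_mult p LIMSEQ_Suc[OF p])
    show "(\<lambda>n. (e n * e n) * (e (Suc n) * e (Suc n))) \<longlonglongrightarrow> p"
      using LIMSEQ_Suc[OF p] by (simp add: mult.assoc e_mult e_mult')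
  qed
  moreover have "p * y * p = \<phi> y *\<^sub>C p" for y
  proof (rule LIMSEQ_unique)
    show "(\<lambda>n. (e n * e n) * y * (e n * e n)) \<longlonglongrightarrow> p * y * p" by (intro tendsto_intros p)
    have "(\<lambda>n. e n * dev n y (\<phi> y) * e n) \<longlonglongrightarrow> 0"
    proof (rule Lim_null_comparison)
      show "\<forall>\<^sub>s n. norm (e n * dev n y (\<phi> y) * e n) \<le> norm (dev n y (\<phi> y))"
        by (intro always_eventually allI order_trans[OF norm_mult3]) simp
      show "(\<lambda>n. norm (dev n y (\<phi> y))) \<longlonglongrightarrow> 0"
        using X_D[OF X_UNIV, of y] unfolding ex_def by (rule tendsto_norm_zero)
    qed
    moreover have "(\<lambda>n. \<phi> y *\<^sub>C ((e n * e n) * (e n * e n))) \<longlonglongrightarrow> \<phi> y *\<^sub>C (p * p)" by (intro tendsto_intros p)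
    ultimately have "(\<lambda>n. e n * dev n y (\<phi> y) * e n + \<phi> y *\<^sub>C ((e n * e n) * (e n * e n))) \<longlonglongrightarrow> 0 + \<phi> y *\<^sub>C (p * p)"
      by (rule tendsto_add)
    then show "(\<lambda>n. (e n * e n) * y * (e n * e n)) \<longlonglongrightarrow> \<phi> y *\<^sub>C p"
      using \<open>p * p = p\<close> by (simp add: right_diff_distrib left_diff_distrib mult_scaleC mult.assoc)
  qed
  ultimately show ?thesis using pB pp by blast
qed

text \<open>The orthonormal family must be available under every \<open>e q\<close>: in the
  applications \<open>q\<close> is chosen only after a finite set has been excised at
  \<open>e q\<close>.\<close>

definition infinite_dimensional :: bool where
  "infinite_dimensional \<longleftrightarrow> (\<forall>m q. \<exists>n. (\<forall>l<m::nat. n l \<in> loc (e q)) \<and>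
    (\<forall>l<m. \<forall>k<m. ip (n l) (n k) = (if l = k then 1 else 0)))"

lemma corner_dichotomy:
  assumes "\<not> (\<exists>p\<in>B. pos p \<and> p * p = p \<and> norm p = 1 \<and> (\<forall>y. p * y * p = \<phi> y *\<^sub>C p))"
  shows infinite_dimensional
  unfolding infinite_dimensional_def
proof (intro allI)
  fix m q
  obtain S where S: "orthonormal S" "S \<subseteq> loc (e q)" "card S > m"
    using corner_projection[of q m] assms by (meson not_le)
  have "finite S" using S by (simp add: orthonormal_def)
  then obtain n where n: "bij_betw n {0..<card S} S" using ex_bij_betw_nat_finite by blast
  have nS: "n l \<in> S" if "l < m" for l using n that S(3) by (auto simp: bij_betw_def)
  have "n l = n k \<longleftrightarrow> l = k" if "l < m" "k < m" for l k
    using n that S(3) by (auto simp: bij_betw_def inj_on_def)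
  then show "\<exists>n. (\<forall>l<m. n l \<in> loc (e q)) \<and> (\<forall>l<m. \<forall>k<m. ip (n l) (n k) = (if l = k then 1 else 0))" using nS S by (intro exI[of _ n]) (auto simp: orthonormal_def)
qed

section \<open>Property (BEK) in the presence of a minimal projection\<close>

definition BEK_unit :: bool where
  "BEK_unit \<longleftrightarrow> (\<forall>x\<in>A. \<forall>y\<in>A. \<forall>eps>0. norm x = 1 \<longrightarrow> norm y = 1 \<longrightarrow> (\<exists>b\<in>B. norm b \<le> 1 \<and> norm (x * b * y) \<ge> 1 - eps))"

text \<open>The elements of \<open>B\<close> killed from the left by all \<open>z - E z\<close> form an ideal containing \<open>p\<close>.\<close>

lemma projection_trivial:
  assumes p: "p \<in> B" "pos p" "norm p = 1" "\<And>y. p * y * p = \<phi> y *\<^sub>C p" and z: "z \<in> A"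
  shows "E z = z"
proof -
  have p0: "p \<noteq> 0" using p(3) by auto
  have zp: "(z - E z) * p = 0" if z: "z \<in> A" for z
  proof -
    define u where "u = (z - E z) * p"
    have zE: "z - E z \<in> A" by (intro A_closed_ops z B_A[OF E_in_B])
    define h where "h = E (u * star u)"
    have hB: "h \<in> B" unfolding h_def u_def by (intro E_in_B A_closed_ops zE)
    have hp: "h * b * p = 0" if b: "b \<in> B" for b
    proof -
      have "u * star u * b * p = (z - E z) * p * (p * (star (z - E z) * b) * p)"
        by (simp only: u_def star_mult pos_star[OF p(2)] mult.assoc)
      moreover have "\<phi> (star (z - E z) * b) = 0"
      proof -
        have "\<phi> (star (z - E z) * b) = \<phi> (E (star (z - E z) * b))" by (simp add: \<phi>_E)
        also have "E (star (z - E z) * b) = star (E (z - E z)) * b" by (simp only: E_right[OF B_F[OF b]] E_star)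
        also have "E (z - E z) = 0" by (simp add: E_diff E_fixed E_in_F)
        finally show ?thesis by simp
      qed
      ultimately have "u * star u * b * p = 0" by (simp add: p(4))
      moreover have "h * b * p = E (u * star u * b * p)" by (simp only: h_def E_right[OF B_F[OF b]] E_right[OF B_F[OF p(1)]])
      ultimately show ?thesis by simp
    qed
    define I where "I = {c \<in> B. \<forall>b\<in>B. h * b * c = 0}"
    have "I = {0} \<or> I = B"
    proof (rule simple_B)
      show "closed I"
      proof -
        have "I = B \<inter> (\<Inter>b\<in>B. {c. h * b * c = 0})" by (auto simp: I_def)
        moreover have "closed {c. h * b * c = 0}" for b by (intro closed_Collect_eq continuous_intros)
        ultimately show ?thesis using closed_B by auto
      qed
      show "b * x \<in> I" if b: "b \<in> B" and x: "x \<in> I" for b x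
      proof -
        have "h * c * (b * x) = h * (c * b) * x" for c by (simp only: mult.assoc)
        moreover have "h * (c * b) * x = 0" if "c \<in> B" for c using x B_mult[OF that b] by (simp add: I_def)
        ultimately show ?thesis using B_mult b x by (simp add: I_def)
      qed
      show "x * b \<in> I" if "b \<in> B" "x \<in> I" for b x
        using that B_mult unfolding I_def by (simp flip: mult.assoc)
    qed (auto simp: I_def distrib_left mult_scaleC_right intro: B_closed_ops(1,2,7))
    moreover have "p \<in> I" using hp p(1) by (simp add: I_def)
    ultimately have "I = B" using p0 by auto
    then have "h * h * h = 0" using hB by (auto simp: I_def)
    moreover have hs: "sa h" unfolding h_def by (intro pos_sa E_pos mult_star_pos)
    ultimately have "(h * h) * (h * h) = 0" by (simp add: mult.assoc)
    then have "h * h = 0" using sa_square_zero[OF sa_mult[OF hs hs refl]] by simp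
    then have "h = 0" using hs sa_square_zero by blast
    then have "star u = 0" using E_zeroD[of "star u"] by (simp add: h_def star_star)
    then have "u = 0" using norm_star[of u] by simp
    then show ?thesis by (simp add: u_def)
  qed
  define I where "I = {c \<in> B. \<forall>z\<in>A. (z - E z) * c = 0}"
  have "I = {0} \<or> I = B"
  proof (rule simple_B)
    show "closed I"
    proof -
      have "I = B \<inter> (\<Inter>z\<in>A. {c. (z - E z) * c = 0})" by (auto simp: I_def)
      moreover have "closed {c. (z - E z) * c = 0}" for z by (intro closed_Collect_eq continuous_intros)
      ultimately show ?thesis using closed_B by auto
    qed
    show "b * x \<in> I" if b: "b \<in> B" and x: "x \<in> I" for b x
    proof -
      have "(z - E z) * (b * x) = (z * b - E (z * b)) * x" for z
        by (simp only: E_right[OF B_F[OF b]] left_diff_distrib mult.assoc)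
      moreover have "(z * b - E (z * b)) * x = 0" if "z \<in> A" for z using x A_closed_ops(5)[OF that] by (simp add: I_def)
      ultimately show ?thesis using B_mult b x by (simp add: I_def)
    qed
    show "x * b \<in> I" if "b \<in> B" "x \<in> I" for b x
      using that B_mult unfolding I_def by (simp flip: mult.assoc)
  qed (auto simp: I_def distrib_left mult_scaleC_right intro: B_closed_ops(1,2,7))
  moreover have "p \<in> I" using zp p(1) by (simp add: I_def)
  ultimately have IB: "I = B" using p0 by auto
  obtain s where s: "approx_unit s" using AP_sequence[OF z] by blast
  have "z - E z \<in> A" by (intro A_closed_ops z B_A[OF E_in_B])
  from approx_unit_A(1)[OF s this] have "(\<lambda>k. (z - E z) * s k) \<longlonglongrightarrow> z - E z" .
  moreover have "(z - E z) * s k = 0" for k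
  proof -
    have "s k \<in> I" unfolding IB using s by (simp add: approx_unit_def)
    then show ?thesis using z by (simp add: I_def)
  qed
  ultimately show ?thesis using LIMSEQ_unique[OF tendsto_const, of 0 "z - E z"] by simp
qed

text \<open>Since \<open>A = B\<close>, the GNS space can be realized on the elements
  \<open>z * p\<close>, with \<open>norm (z * p) = nph z\<close>. So
  \<open>norm_le_from_\<phi>\<close> supplies \<open>b\<close> and \<open>c\<close> that nearly
  attain the norms of \<open>x\<close> and \<open>star y\<close>, and
  \<open>b * p * star (c * p)\<close> plays the role of the rank one operator between these
  vectors.\<close>

lemma BEK_projection:
  assumes p: "p \<in> B" "pos p" "p * p = p" "norm p = 1" "\<And>y. p * y * p = \<phi> y *\<^sub>C p"
  shows BEK_unit
proof -
  have AB: "z \<in> B" if "z \<in> A" for z using projection_trivial[OF p(1,2,4,5) that] E_in_B[OF that] by simp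
  have zp: "norm (z * p) = nph z" for z
  proof (rule power2_eq_imp_eq)
    have "star (z * p) * (z * p) = p * (star z * z) * p" by (simp add: star_mult pos_star[OF p(2)] mult.assoc)
    then show "(norm (z * p))\<^sup>2 = (nph z)\<^sup>2" by (simp only: cstar_identity[symmetric] p(5) norm_scaleC p(4) nph_sq mult_1_right)
  qed auto
  have big: "\<exists>b\<in>B. norm (b * p) = 1 \<and> norm (x * b * p) \<ge> 1 - \<delta>" if x: "x \<in> A" "norm x = 1" and d: "\<delta> > 0" "\<delta> < 1" for x \<delta>
  proof -
    have "\<exists>r\<in>B. \<not> cmod (\<phi> (star r * (star x * x) * r)) \<le> (1 - \<delta>)\<^sup>2 * (nph r)\<^sup>2"
    proof (rule ccontr)
      assume "\<not> (\<exists>r\<in>B. \<not> cmod (\<phi> (star r * (star x * x) * r)) \<le> (1 - \<delta>)\<^sup>2 * (nph r)\<^sup>2)"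
      then have "norm (star x * x) \<le> (1 - \<delta>)\<^sup>2"
        by (intro norm_le_from_\<phi> AB A_closed_ops x) auto
      moreover have "(1 - \<delta>)\<^sup>2 < 1" using d by (simp add: power_less_one_iff)
      ultimately show False using x(2) by (simp add: cstar_identity)
    qed
    then obtain r where r: "r \<in> B" "cmod (\<phi> (star r * (star x * x) * r)) > (1 - \<delta>)\<^sup>2 * (nph r)\<^sup>2" by (auto simp: not_le)
    have "star r * (star x * x) * r = star (x * r) * (x * r)" by (simp add: star_mult mult.assoc)
    then have "((1 - \<delta>) * nph r)\<^sup>2 < (nph (x * r))\<^sup>2" using r(2) by (simp add: nph_sq[of "x * r"] power_mult_distrib)
    then have lt: "(1 - \<delta>) * nph r < nph (x * r)" using power2_less_imp_less nph_nonneg by blast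
    have nz: "nph r > 0"
    proof (rule ccontr)
      assume "\<not> nph r > 0"
      then have "nph r = 0" using nph_nonneg[of r] by simp
      then show False using lt nph_mult[of x r] by simp
    qed
    define b where "b = (1 / nph r) *\<^sub>R r"
    have "nph b = 1" "nph (x * b) \<ge> 1 - \<delta>"
      using lt nz by (simp_all add: b_def scaleR_scaleC mult_scaleC_right nph_scale norm_divide pos_le_divide_eq)
    moreover have "b \<in> B" unfolding b_def by (intro B_closed_ops r)
    ultimately show ?thesis by (intro bexI[of _ b]) (simp_all only: zp)
  qed
  show ?thesis unfolding BEK_unit_def
  proof (intro ballI allI impI)
    fix x y :: 'u and eps :: real
    assume xy: "x \<in> A" "y \<in> A" "eps > 0" "norm x = 1" "norm y = 1"
    define \<delta> where "\<delta> = min (eps / 2) (1/2)"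
    have d: "\<delta> > 0" "\<delta> < 1" "2 * \<delta> \<le> eps" using xy(3) by (auto simp: \<delta>_def)
    obtain b where b: "b \<in> B" "norm (b * p) = 1" "norm (x * b * p) \<ge> 1 - \<delta>" using big[OF xy(1,4) d(1,2)] by blast
    obtain c where c: "c \<in> B" "norm (c * p) = 1" "norm (star y * c * p) \<ge> 1 - \<delta>"
      using big[of "star y", OF A_closed_ops(4)[OF xy(2)] _ d(1,2)] xy(5) by auto
    define v where "v = b * p * star (c * p)"
    have "v \<in> B" unfolding v_def using b c p(1) by (intro B_mult B_closed_ops(4))
    moreover have "norm v \<le> 1" using norm_mult_ineq[of "b * p" "star (c * p)"] b c by (simp add: v_def)
    moreover have "norm (x * v * y) \<ge> 1 - eps"
    proof -
      define u w where "u = x * b * p" and "w = star y * c * p"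
      have ps: "star p = p" by (rule pos_star[OF p(2)])
      have "x * v * y = u * star w" by (simp add: v_def u_def w_def star_mult star_star mult.assoc)
      \<comment> \<open>\<open>star u * u\<close> is a scalar multiple of \<open>p\<close>, and
        \<open>w * p = w\<close>; hence the norms multiply exactly.\<close>
      moreover have "(norm (u * star w))\<^sup>2 = (norm u)\<^sup>2 * (norm w)\<^sup>2"
      proof -
        have uu: "star u * u = \<phi> (star (x * b) * (x * b)) *\<^sub>C p"
          unfolding p(5)[symmetric] by (simp add: u_def star_mult ps mult.assoc)
        then have nu: "(norm u)\<^sup>2 = cmod (\<phi> (star (x * b) * (x * b)))"
          by (simp only: cstar_identity[symmetric] norm_scaleC p(4) mult_1_right)
        have wp: "w * p = w" by (simp add: w_def mult.assoc p(3))
        have "star (u * star w) * (u * star w) = w * (star u * u) * star w" by (simp add: star_mult star_star mult.assoc)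
        also have "\<dots> = \<phi> (star (x * b) * (x * b)) *\<^sub>C (w * star w)" by (simp add: uu mult_scaleC wp)
        finally have "norm (star (u * star w) * (u * star w)) = (norm u)\<^sup>2 * norm (w * star w)" by (simp only: norm_scaleC nu)
        then show ?thesis by (simp only: cstar_identity cstar_identity')
      qed
      then have "norm (u * star w) = norm u * norm w"
        unfolding power_mult_distrib[symmetric] by (rule power2_eq_imp_eq) simp_all
      moreover have "(1 - \<delta>) * (1 - \<delta>) \<le> norm u * norm w" using b(3) c(3) d by (intro mult_mono) (auto simp: u_def w_def)
      moreover have "1 - 2 * \<delta> \<le> (1 - \<delta>) * (1 - \<delta>)" by (simp add: algebra_simps)
      ultimately show ?thesis using d(3) by simp
    qed
    ultimately show "\<exists>b\<in>B. norm b \<le> 1 \<and> norm (x * b * y) \<ge> 1 - eps" by blast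
  qed
qed

end

section \<open>Almost isometric copies of tensor products\<close>

context excising_sequence
begin

text \<open>The sum of \<open>T x x\<close> over an orthonormal basis does not depend on the basis
  when \<open>T\<close> is sesquilinear, and \<open>act g\<close> carries \<open>S\<close> to
  another orthonormal basis of the same span.\<close>

lemma invariant_sum:
  assumes S: "orthonormal S" and inv: "\<And>g x. x \<in> S \<Longrightarrow> act g x = pr S (act g x)"
    and add1: "\<And>z z' w. T (z + z') w = T z w + T z' w" and scale1: "\<And>c z w. T (c *\<^sub>C z) w = c *\<^sub>C T z w"
    and add2: "\<And>z w w'. T z (w + w') = T z w + T z w'" and scale2: "\<And>c z w. T z (c *\<^sub>C w) = cnj c *\<^sub>C T z w"
  shows "(\<Sum>i\<in>S. T (act g i) (act g i)) = (\<Sum>i\<in>S. T i i :: 'u)"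
proof -
  have zero: "T 0 w = 0" "T w 0 = 0" for w using scale1[of 0 0 w] scale2[of w 0 0] by simp_all
  have sum1: "T (\<Sum>i\<in>I. f i) w = (\<Sum>i\<in>I. T (f i) w)" for I :: "'u set" and f w
    by (induction I rule: infinite_finite_induct) (simp_all add: zero add1)
  have sum2: "T w (\<Sum>i\<in>I. f i) = (\<Sum>i\<in>I. T w (f i))" for I :: "'u set" and f w
    by (induction I rule: infinite_finite_induct) (simp_all add: zero add2)
  define u where "u x i = ip x (act g i)" for x i
  \<comment> \<open>Unitarity is needed in the form of orthogonal rows. It comes from the invariance
    under \<open>-g\<close>, by which \<open>act (-g) x\<close> is recovered from its coefficients
    with respect to \<open>S\<close>.\<close>
  have unitary: "(\<Sum>i\<in>S. u x i * cnj (u y i)) = (if x = y then 1 else 0)" if xy: "x \<in> S" "y \<in> S" for x y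
  proof -
    have u: "u x i = cnj (ip i (act (-g) x))" for x i
      using ip_act[of "-g" x "act g i"] ip_cnj[of "act (-g) x" i] by (simp add: u_def act_inverse)
    have "(\<Sum>i\<in>S. u x i * cnj (u y i)) = ip (pr S (act (-g) x)) (act (-g) y)"
      by (simp add: u pr_def ip_sum ip_simps)
    also have "\<dots> = ip x y" by (simp only: inv[OF xy(1), symmetric] ip_act)
    finally show ?thesis using S xy by (simp add: orthonormal_def)
  qed
  have "(\<Sum>i\<in>S. T (act g i) (act g i)) = (\<Sum>i\<in>S. \<Sum>x\<in>S. \<Sum>y\<in>S. (u x i * cnj (u y i)) *\<^sub>C T x y)"
  proof (rule sum.cong[OF refl])
    fix i assume "i \<in> S"
    then have i: "act g i = (\<Sum>x\<in>S. u x i *\<^sub>C x)" using inv[of i g] by (simp add: pr_def u_def)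
    show "T (act g i) (act g i) = (\<Sum>x\<in>S. \<Sum>y\<in>S. (u x i * cnj (u y i)) *\<^sub>C T x y)"
      unfolding i sum1 scale1 sum2 scale2 scaleC_sum_right scaleC_scaleC
      by (subst sum.swap) (simp only: mult.commute)
  qed
  also have "\<dots> = (\<Sum>x\<in>S. \<Sum>y\<in>S. \<Sum>i\<in>S. (u x i * cnj (u y i)) *\<^sub>C T x y)"
    by (subst sum.swap, rule sum.cong[OF refl], rule sum.swap)
  also have "\<dots> = (\<Sum>x\<in>S. \<Sum>y\<in>S. (if x = y then T x y else 0))"
  proof (intro sum.cong refl)
    fix x y assume "x \<in> S" "y \<in> S"
    then show "(\<Sum>i\<in>S. (u x i * cnj (u y i)) *\<^sub>C T x y) = (if x = y then T x y else 0)"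
      by (simp add: scaleC_sum_left[symmetric] unitary)
  qed
  also have "\<dots> = (\<Sum>x\<in>S. T x x)" using S by (intro sum.cong refl) (simp add: orthonormal_def)
  finally show ?thesis .
qed

lemma excise_finite:
  assumes "finite W" "eps > 0"
  shows "\<forall>\<^sub>s j. \<forall>z\<in>W. norm (dev j z (\<phi> z)) \<le> eps"
proof (rule eventually_ball_finite[OF assms(1)], intro ballI)
  fix z
  have "\<forall>\<^sub>s j. dist (dev j z (\<phi> z)) 0 < eps"
    using tendstoD[OF X_D[OF X_UNIV, of z, unfolded ex_def] assms(2)] .
  then show "\<forall>\<^sub>s j. norm (dev j z (\<phi> z)) \<le> eps"
    by eventually_elim simp
qed

text \<open>With \<open>n\<^sub>l\<close> orthonormal deep inside the support of the state and \<open>\<Sum> b\<^sub>l\<^sup>* d\<^sup>2 b\<^sub>l \<approx> 1\<close>, the map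
  \<open>z \<mapsto> \<Sum> d b\<^sub>l z n\<^sub>l\<close> is almost isometric on a given finite set, and its values lie under \<open>e\<^sub>p\<close>.\<close>

lemma approximate_isometry:
  assumes inf: infinite_dimensional
    and T: "finite T" "T \<subseteq> A" and r: "r > 0"
  shows "\<exists>J. (\<forall>z z'. J (z + z') = J z + J z') \<and> (\<forall>c z. J (c *\<^sub>C z) = c *\<^sub>C J z) \<and> (\<forall>g z. act g (J z) = J (act g z)) \<and>
    (\<forall>z. e p * J z = J z) \<and> (\<forall>z\<in>T. \<forall>z'\<in>T. cmod (ip (J z) (J z') - ip z z') \<le> r)"
proof -
  define d where "d = e (Suc p)"
  have dB: "d \<in> B" and ds: "star d = d" by (simp_all add: d_def e_B)
  define K where "K = 1 + (\<Sum>z\<in>T. norm z)"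
  have K: "K \<ge> 1" by (simp add: K_def sum_nonneg)
  have TK: "norm z \<le> K" if "z \<in> T" for z
    using member_le_sum[OF that, of norm] T(1) by (simp add: K_def)
  obtain s where s: "approx_unit s" using AP_sequence[OF A_closed_ops(1)] by blast
  have "\<forall>\<^sub>s m. \<forall>z\<in>T. norm (s m * z - z) < r / (4 * K)"
  proof (rule eventually_ball_finite[OF T(1)], intro ballI)
    fix z assume "z \<in> T"
    then have "(\<lambda>m. s m * z) \<longlonglongrightarrow> z" using approx_unit_A(2)[OF s] T(2) by blast
    from tendstoD[OF this, of "r / (4 * K)"] show "\<forall>\<^sub>s m. norm (s m * z - z) < r / (4 * K)"
      using r K by (simp add: dist_norm)
  qed
  then obtain m where m: "\<And>z. z \<in> T \<Longrightarrow> norm (s m * z - z) < r / (4 * K)"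
    unfolding eventually_sequentially by blast
  have hB: "s m \<in> B" using s by (simp add: approx_unit_def)
  \<comment> \<open>Half of \<open>r\<close> pays for replacing \<open>P\<close> by 1 on
    \<open>T\<close>, through the approximate unit \<open>s m\<close>; the other half pays for the
    excision errors \<open>\<delta>\<close> of the \<open>L\<close> times \<open>L\<close> matrix
    entries.\<close>
  obtain L b where b: "\<And>l. l < L \<Longrightarrow> b l \<in> B"
    and P1: "(\<Sum>l<L::nat. star (b l) * (d * d) * b l) \<preceq> 1"
    and Ph: "norm ((1 - (\<Sum>l<L. star (b l) * (d * d) * b l)) * s m) \<le> r / (4 * K\<^sup>2)"
    using approximate_unit[OF hB, of "r / (4 * K\<^sup>2)" "Suc p"] r K unfolding d_def by auto
  define P where "P = (\<Sum>l<L. star (b l) * (d * d) * b l)"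
  have Ppos: "pos P" unfolding P_def d_def by (intro pos_sum pos_conj sa_square_pos e_sa)
  have nP: "norm (1 - P) \<le> 1" using pos_le_norm(1)[of "1 - P" 1] P1 Ppos by (simp add: P_def[symmetric])
  have Pz: "cmod (ip z (P * z') - ip z z') \<le> r / 2" if z: "z \<in> T" "z' \<in> T" for z z'
  proof -
    have "(1 - P) * z' = (1 - P) * s m * z' - (1 - P) * (s m * z' - z')" by (simp add: algebra_simps)
    then have "norm ((1 - P) * z') \<le> norm ((1 - P) * s m * z') + norm ((1 - P) * (s m * z' - z'))"
      using norm_triangle_ineq4 by simp
    also have "\<dots> \<le> norm ((1 - P) * s m) * norm z' + norm (1 - P) * norm (s m * z' - z')"
      by (intro add_mono norm_mult_ineq)
    also have "\<dots> \<le> r / (4 * K\<^sup>2) * K + 1 * (r / (4 * K))"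
      using Ph[folded P_def] TK[OF z(2)] nP m[OF z(2)] r K by (intro add_mono mult_mono) auto
    also have "\<dots> = r / (2 * K)" using K by (simp add: power2_eq_square field_simps)
    finally have n: "norm ((1 - P) * z') \<le> r / (2 * K)" .
    have "cmod (ip z (P * z') - ip z z') = cmod (ip z ((1 - P) * z'))"
      by (simp add: left_diff_distrib ip_simps norm_minus_commute)
    also have "\<dots> \<le> nph z * nph ((1 - P) * z')" by (rule ip_CS)
    also have "\<dots> \<le> K * (r / (2 * K))"
      using order_trans[OF nph_norm TK[OF z(1)]] order_trans[OF nph_norm n] K by (intro mult_mono) auto
    also have "\<dots> = r / 2" using K by simp
    finally show ?thesis .
  qed
  define Z where "Z = (\<lambda>(z, z', l, k). star (d * b l * z) * (d * b k * z'))"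
  define W where "W = Z ` (T \<times> T \<times> {..<L} \<times> {..<L})"
  have "finite W" using T(1) by (simp add: W_def)
  define \<delta> where "\<delta> = r / (2 * (real L * real L + 1))"
  have LL: "real L * real L + 1 > 0" by (rule add_nonneg_pos) simp_all
  have \<delta>: "\<delta> > 0" using r LL by (simp add: \<delta>_def)
  \<comment> \<open>The entries are excised at \<open>e q\<close> before the vectors
    \<open>n l\<close> are chosen under \<open>e q\<close>. In this way each entry acts between
    \<open>n l\<close> and \<open>n k\<close> as a scalar, and orthonormality kills the terms off
    the diagonal.\<close>
  obtain q where q: "\<And>z. z \<in> W \<Longrightarrow> norm (dev q z (\<phi> z)) \<le> \<delta>"
    using excise_finite[OF \<open>finite W\<close> \<delta>] unfolding eventually_sequentially by blast
  obtain n where n: "\<And>l. l < L \<Longrightarrow> n l \<in> loc (e q)" "\<And>l k. l < L \<Longrightarrow> k < L \<Longrightarrow> ip (n l) (n k) = (if l = k then 1 else 0)"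
    using inf[unfolded infinite_dimensional_def, THEN spec[of _ L], THEN spec[of _ q]] by blast
  have nn: "nph (n l) = 1" if "l < L" for l
  proof -
    have "(nph (n l))\<^sup>2 = 1" using n(2)[OF that that] unfolding ip_self by (metis of_real_eq_1_iff)
    then show ?thesis using nph_nonneg[of "n l"] by (simp add: power2_eq_1_iff)
  qed
  define J where "J z = (\<Sum>l<L. d * b l * z * n l)" for z
  have J_add: "J (z + z') = J z + J z'" for z z' by (simp add: J_def distrib_left distrib_right sum.distrib)
  have J_scale: "J (c *\<^sub>C z) = c *\<^sub>C J z" for c z by (simp add: J_def mult_scaleC scaleC_sum_right)
  have nB: "n l \<in> B" if "l < L" for l using n(1)[OF that] by (rule locD(1))
  have J_act: "act g (J z) = J (act g z)" for g z
    unfolding J_def act_sum act_mult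
    by (intro sum.cong refl) (use b nB dB in \<open>simp add: F_D[OF B_F]\<close>)
  have J_e: "e p * J z = J z" for z
    by (simp add: J_def sum_distrib_left d_def mult.assoc e_mult')
  have J_ip: "cmod (ip (J z) (J z') - ip z z') \<le> r" if z: "z \<in> T" "z' \<in> T" for z z'
  proof -
    define w where "w l k = star (d * b l * z) * (d * b k * z')" for l k
    have wW: "w l k \<in> W" if "l < L" "k < L" for l k
      unfolding W_def w_def Z_def using that z by (intro image_eqI[of _ _ "(z, z', l, k)"]) auto
    have entry: "cmod (ip (d * b l * z * n l) (d * b k * z' * n k) - (if l = k then \<phi> (w l k) else 0)) \<le> \<delta>" if lk: "l < L" "k < L" for l k
    proof -
      let ?D = "dev q (w l k) (\<phi> (w l k))"
      have en: "e q * n l = n l" "e q * n k = n k" using n(1) lk locD(2) by blast+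
      have snl: "star (n l) * e q = star (n l)"
        using en(1) star_mult[of "e q" "n l"] by simp
      have "ip (n l) (?D * n k)
          = \<phi> (star (n l) * w l k * n k) - \<phi> (w l k) * ip (n l) (n k)"
      proof -
        have "star (n l) * ((e q * w l k * e q) * n k) = (star (n l) * e q) * w l k * (e q * n k)" by (simp only: mult.assoc)
        then have 1: "ip (n l) ((e q * w l k * e q) * n k) = \<phi> (star (n l) * w l k * n k)" by (simp only: ip_def snl en)
        have "(\<phi> (w l k) *\<^sub>C (e q * e q)) * n k = \<phi> (w l k) *\<^sub>C n k" by (simp add: mult_scaleC_left mult.assoc en)
        then show ?thesis by (simp only: left_diff_distrib ip_simps 1)
      qed
      also have "\<phi> (star (n l) * w l k * n k) = ip (d * b l * z * n l) (d * b k * z' * n k)"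
        by (simp only: ip_def w_def star_mult mult.assoc)
      finally have eq: "ip (d * b l * z * n l) (d * b k * z' * n k) - (if l = k then \<phi> (w l k) else 0)
          = ip (n l) (?D * n k)"
        by (simp add: n(2)[OF lk])
      have "cmod (ip (n l) (?D * n k))
          \<le> nph (n l) * nph (?D * n k)" by (rule ip_CS)
      also have "\<dots> \<le> nph (n l) * (norm ?D * nph (n k))"
        by (intro mult_left_mono nph_mult) simp
      also have "\<dots> \<le> \<delta>" using q[OF wW[OF lk]] nn lk by simp
      finally show ?thesis unfolding eq .
    qed
    have "ip (J z) (J z') - ip z (P * z') = (\<Sum>l<L. \<Sum>k<L. ip (d * b l * z * n l) (d * b k * z' * n k) - (if l = k then \<phi> (w l k) else 0))"
    proof -
      have "ip z (P * z') = (\<Sum>l<L. \<phi> (w l l))"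
      proof -
        have "ip z (star (b l) * (d * d) * b l * z') = \<phi> (w l l)" for l
          by (simp only: ip_def w_def star_mult ds mult.assoc)
        then show ?thesis by (simp only: P_def sum_distrib_right ip_sum)
      qed
      moreover have "ip (J z) (J z') = (\<Sum>l<L. \<Sum>k<L. ip (d * b l * z * n l) (d * b k * z' * n k))"
        unfolding J_def ip_sum by (rule sum.swap)
      ultimately show ?thesis by (simp add: sum_subtractf)
    qed
    also have "cmod \<dots> \<le> (\<Sum>l<L. \<Sum>k<L. \<delta>)" by (intro sum_norm_le entry) auto
    also have "\<dots> \<le> r / 2"
    proof -
      have "real L * real L * r \<le> (real L * real L + 1) * r" using r by (intro mult_right_mono) auto
      then show ?thesis using LL by (simp add: \<delta>_def field_simps)
    qed
    finally show ?thesis using Pz[OF z] norm_triangle_ineq[of "ip (J z) (J z') - ip z (P * z')" "ip z (P * z') - ip z z'"] by simp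
  qed
  show ?thesis using J_add J_scale J_act J_e J_ip by (intro exI[of _ J]) blast
qed

text \<open>The elements \<open>star w * w'\<close> are excised at \<open>e p\<close>, and
  \<open>J\<close> takes values under \<open>e p\<close>. So the middle factor of
  \<open>star (J z) * (star w * w') * J z'\<close> may be replaced by the scalar
  \<open>ip w w'\<close>, and \<open>w * J z\<close> behaves like a tensor product of
  \<open>w\<close> and \<open>z\<close>.\<close>

lemma approximate_tensor:
  assumes inf: infinite_dimensional
    and W: "finite W" and T: "finite T" "T \<subseteq> A" and r: "r > 0"
  shows "\<exists>J. (\<forall>z z'. J (z + z') = J z + J z') \<and> (\<forall>c z. J (c *\<^sub>C z) = c *\<^sub>C J z) \<and> (\<forall>g z. act g (J z) = J (act g z)) \<and>
    (\<forall>w\<in>W. \<forall>w'\<in>W. \<forall>z\<in>T. \<forall>z'\<in>T. cmod (ip (w * J z) (w' * J z') - ip w w' * ip z z') \<le> r)"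
proof -
  define C where "C = 1 + (\<Sum>w\<in>W. nph w) + (\<Sum>z\<in>T. nph z)"
  have C1: "C \<ge> 1" by (simp add: C_def sum_nonneg)
  have C: "nph w \<le> C" if "w \<in> W \<or> w \<in> T" for w
    using that member_le_sum[of w W nph] member_le_sum[of w T nph] W T(1) sum_nonneg[of W nph] sum_nonneg[of T nph]
    by (auto simp: C_def)
  define r1 where "r1 = r / (2 * (C + 1)\<^sup>2)"
  have r1: "r1 > 0" using r C1 by (simp add: r1_def)
  define r2 where "r2 = min 1 (r / (2 * C\<^sup>2))"
  have r2: "r2 > 0" "r2 \<le> 1" "C\<^sup>2 * r2 \<le> r / 2"
  proof -
    show "r2 > 0" "r2 \<le> 1" using r C1 by (simp_all add: r2_def)
    have "C\<^sup>2 * r2 \<le> C\<^sup>2 * (r / (2 * C\<^sup>2))" by (intro mult_left_mono) (simp_all add: r2_def)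
    then show "C\<^sup>2 * r2 \<le> r / 2" using C1 by simp
  qed
  have "finite ((\<lambda>(w, w'). star w * w') ` (W \<times> W))" using W by simp
  from excise_finite[OF this r1] obtain p where p: "\<And>w w'. w \<in> W \<Longrightarrow> w' \<in> W \<Longrightarrow>
      norm (dev p (star w * w') (ip w w')) \<le> r1"
    unfolding eventually_sequentially ip_def by force
  obtain J where J: "\<And>z z'. J (z + z') = J z + J z'" "\<And>c z. J (c *\<^sub>C z) = c *\<^sub>C J z" "\<And>g z. act g (J z) = J (act g z)"
      "\<And>z. e p * J z = J z" "\<And>z z'. z \<in> T \<Longrightarrow> z' \<in> T \<Longrightarrow> cmod (ip (J z) (J z') - ip z z') \<le> r2"
    using approximate_isometry[OF inf T r2(1), of p] by blast
  have nJ: "nph (J z) \<le> C + 1" if z: "z \<in> T" for z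
  proof (rule power2_le_imp_le)
    have "(nph (J z))\<^sup>2 = cmod (ip (J z) (J z))" unfolding ip_self norm_of_real by simp
    also have "\<dots> \<le> cmod (ip z z) + r2" using J(5)[OF z z] norm_triangle_ineq2[of "ip (J z) (J z)" "ip z z"] by linarith
    also have "cmod (ip z z) = (nph z)\<^sup>2" unfolding ip_self norm_of_real by simp
    also have "(nph z)\<^sup>2 + r2 \<le> C\<^sup>2 + 1" using C z r2(2) by (intro add_mono power_mono) auto
    also have "\<dots> \<le> (C + 1)\<^sup>2" using C1 by (simp add: power2_eq_square algebra_simps)
    finally show "(nph (J z))\<^sup>2 \<le> (C + 1)\<^sup>2" .
  qed (use C1 in simp)
  have main: "cmod (ip (w * J z) (w' * J z') - ip w w' * ip z z') \<le> r"
    if w: "w \<in> W" "w' \<in> W" and z: "z \<in> T" "z' \<in> T" for w w' z z'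
  proof -
    let ?R = "dev p (star w * w') (ip w w')"
    have sJ: "star (J z) * e p = star (J z)" using J(4)[of z] star_mult[of "e p" "J z"] by simp
    have eq: "ip (w * J z) (w' * J z') - ip w w' * ip (J z) (J z') = ip (J z) (?R * J z')"
    proof -
      have "star (J z) * ((e p * (star w * w') * e p) * J z') = (star (J z) * e p) * star w * w' * (e p * J z')"
        by (simp only: mult.assoc)
      then have 1: "ip (J z) ((e p * (star w * w') * e p) * J z') = ip (w * J z) (w' * J z')"
        unfolding sJ J(4) by (simp add: ip_def star_mult mult.assoc)
      have "(ip w w' *\<^sub>C (e p * e p)) * J z' = ip w w' *\<^sub>C J z'" by (simp add: mult_scaleC_left mult.assoc J(4))
      then show ?thesis by (simp only: left_diff_distrib ip_simps 1)
    qed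
    have "cmod (ip (J z) (?R * J z')) \<le> nph (J z) * nph (?R * J z')" by (rule ip_CS)
    also have "\<dots> \<le> nph (J z) * (norm ?R * nph (J z'))" by (intro mult_left_mono nph_mult) simp
    also have "\<dots> \<le> (C + 1) * (r1 * (C + 1))"
      using nJ[OF z(1)] nJ[OF z(2)] p[OF w] r1 C1 by (intro mult_mono) auto
    also have "\<dots> = r1 * (C + 1)\<^sup>2" by (simp only: power2_eq_square mult_ac)
    also have "\<dots> = r / 2" using C1 by (simp add: r1_def)
    finally have 1: "cmod (ip (w * J z) (w' * J z') - ip w w' * ip (J z) (J z')) \<le> r / 2" unfolding eq .
    have "cmod (ip w w' * (ip (J z) (J z') - ip z z')) \<le> C\<^sup>2 * r2"
      unfolding norm_mult power2_eq_square
      using order_trans[OF ip_CS[of w w'] mult_mono[of "nph w" C "nph w'" C]] C w J(5)[OF z] C1 by (intro mult_mono) auto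
    then have 2: "cmod (ip w w' * ip (J z) (J z') - ip w w' * ip z z') \<le> r / 2"
      using r2(3) by (simp add: right_diff_distrib)
    show ?thesis
      using norm_triangle_ineq[of "ip (w * J z) (w' * J z') - ip w w' * ip (J z) (J z')" "ip w w' * ip (J z) (J z') - ip w w' * ip z z'"] 1 2 by simp
  qed
  show ?thesis using J(1-3) main by (intro exI[of _ J]) blast
qed

end

section \<open>The flip element and its use\<close>

context excising_sequence
begin

lemma abs_diff_le_of_squares:
  fixes r s h :: real
  assumes "s \<ge> 0" "r \<ge> 0" "h \<ge> 0" "\<bar>s\<^sup>2 - r\<^sup>2\<bar> \<le> h\<^sup>2"
  shows "\<bar>s - r\<bar> \<le> h"
proof (rule power2_le_imp_le[OF _ assms(3)])
  have "\<bar>s - r\<bar>\<^sup>2 = \<bar>s - r\<bar> * \<bar>s - r\<bar>" by (rule power2_eq_square)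
  also have "\<dots> \<le> \<bar>s - r\<bar> * (s + r)" using assms by (intro mult_left_mono) auto
  also have "\<dots> = \<bar>s\<^sup>2 - r\<^sup>2\<bar>" using assms by (simp add: power2_eq_square square_diff_square_factored abs_mult mult.commute)
  finally show "\<bar>s - r\<bar>\<^sup>2 \<le> h\<^sup>2" using assms(4) by simp
qed

text \<open>The element \<open>\<Sum> X\<^sub>i\<^sub>l X\<^sub>l\<^sub>i\<^sup>*\<close>, with \<open>X\<^sub>i\<^sub>l = i J(l) e\<^sub>j\<close> almost isometric copies of \<open>i \<otimes> l\<close>,
  implements the flip of the tensor factors up to a small error. It is fixed by the action because \<open>S\<close> is an orthonormal
  basis of an invariant subspace.\<close>

lemma flip:
  assumes inf: infinite_dimensional
    and S: "orthonormal S" "S \<subseteq> A" and inv: "\<And>g x. x \<in> S \<Longrightarrow> act g x = pr S (act g x)"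
    and a: "pr S a = a" "pr S a' = a'" "nph a \<le> 1" "nph a' \<le> 1" and r: "r > 0"
  shows "\<exists>v H G. v \<in> B \<and> norm v \<le> 1 + r \<and> norm (v * H - G) \<le> r \<and>
    norm H \<le> nph a' * nph a + r \<and> norm G \<ge> nph a * nph a' - r \<and>
    norm (x1 * G) \<le> nph (x1 * a) * nph a' + r \<and> norm (y1 * H) \<le> nph (y1 * a') * nph a + r"
proof -
  have fin: "finite S" using S(1) by (simp add: orthonormal_def)
  define I where "I = S \<times> S"
  have finI: "finite I" using fin by (simp add: I_def)
  define m where "m = real (card I)"
  \<comment> \<open>Three demands: \<open>r0 \<le> 1\<close> keeps the \<open>X b\<close> bounded by
    2; the square of \<open>r/2\<close> is needed since lengths are compared through their squares;
    and the last entry absorbs an error of \<open>8 r0\<close> for each of the \<open>m^2\<close>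
    pairs of indices.\<close>
  define r0 where "r0 = min 1 (min ((r / 2)\<^sup>2) (r / (8 * (m * m) + 8)))"
  have mm: "8 * (m * m) + 8 > 0" by (rule add_nonneg_pos) simp_all
  have r0: "r0 > 0" "r0 \<le> 1" "r0 \<le> (r / 2)\<^sup>2" using r mm by (simp_all add: r0_def)
  have "r0 \<le> r / (8 * (m * m) + 8)" by (simp add: r0_def)
  then have "r0 * (8 * (m * m) + 8) \<le> r" using mm by (simp add: pos_le_divide_eq)
  then have r0m: "m * m * (8 * r0) \<le> r" using r0(1) by (simp add: algebra_simps)
  define W where "W = insert a (insert a' (insert (x1 * a) (insert (y1 * a') S)))"
  define T where "T = insert a (insert a' S)"
  have prA: "pr S z \<in> A" for z unfolding pr_def by (intro A_sum A_closed_ops(7)) (use S(2) in auto)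
  have aA: "a \<in> A" "a' \<in> A" using prA[of a] prA[of a'] a(1,2) by simp_all
  have WT: "finite W" "finite T" "T \<subseteq> A" using fin aA S(2) by (auto simp: W_def T_def)
  obtain J where J: "\<And>z z'. J (z + z') = J z + J z'" "\<And>c z. J (c *\<^sub>C z) = c *\<^sub>C J z" "\<And>g z. act g (J z) = J (act g z)"
    and Jip: "\<And>w w' z z'. w \<in> W \<Longrightarrow> w' \<in> W \<Longrightarrow> z \<in> T \<Longrightarrow> z' \<in> T \<Longrightarrow> cmod (ip (w * J z) (w' * J z') - ip w w' * ip z z') \<le> r0"
    using approximate_tensor[OF inf WT r0(1)] by blast
  have J0: "J 0 = 0" using J(2)[of 0 0] by simp
  have Jsum: "J (\<Sum>i\<in>K. f i) = (\<Sum>i\<in>K. J (f i))" for K :: "'u set" and f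
    by (induction K rule: infinite_finite_induct) (simp_all add: J0 J(1))
  have nphJ: "\<bar>nph (w * J z) - nph w * nph z\<bar> \<le> r / 2" if w: "w \<in> W" and z: "z \<in> T" for w z
  proof (rule abs_diff_le_of_squares)
    have "of_real ((nph (w * J z))\<^sup>2 - (nph w * nph z)\<^sup>2) = ip (w * J z) (w * J z) - ip w w * ip z z"
      by (simp add: ip_self power_mult_distrib)
    then have "\<bar>(nph (w * J z))\<^sup>2 - (nph w * nph z)\<^sup>2\<bar> = cmod (ip (w * J z) (w * J z) - ip w w * ip z z)"
      by (metis norm_of_real)
    then show "\<bar>(nph (w * J z))\<^sup>2 - (nph w * nph z)\<^sup>2\<bar> \<le> (r / 2)\<^sup>2" using Jip[OF w w z z] r0(3) by simp
  qed (use r in simp_all)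
  define Y where "Y b = fst b * J (snd b)" for b
  have gramY: "cmod (ip (Y b) (Y c) - (if b = c then 1 else 0)) \<le> r0" if "b \<in> I" "c \<in> I" for b c
  proof -
    have "ip (fst b) (fst c) * ip (snd b) (snd c) = (if b = c then 1 else 0)"
      using that S(1) by (auto simp: I_def orthonormal_def prod_eq_iff)
    moreover have "fst b \<in> W" "fst c \<in> W" "snd b \<in> T" "snd c \<in> T" using that by (auto simp: I_def W_def T_def)
    ultimately show ?thesis using Jip[of "fst b" "fst c" "snd b" "snd c"] by (simp only: Y_def)
  qed
  have near: "\<forall>\<^sub>s j. norm (z * e (Suc j)) \<le> nph z + r / 2 \<and> norm (z * e (Suc j)) \<ge> nph z - r / 2" for z
    using tendstoD[OF LIMSEQ_Suc[OF nlim[of z]], OF half_gt_zero[OF r]] by eventually_elim (simp only: dist_real_def abs_less_iff, auto)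
  have "finite ((\<lambda>(b, c). star (Y b) * Y c) ` (I \<times> I))" using finI by simp
  from eventually_conj[OF excise_finite[OF this r0(1)]
      eventually_conj[OF near[of "a' * J a"] eventually_conj[OF near[of "a * J a'"] eventually_conj[OF near[of "x1 * a * J a'"] near[of "y1 * a' * J a"]]]]]
  obtain j where gram0: "\<And>b c. b \<in> I \<Longrightarrow> c \<in> I \<Longrightarrow> norm (dev j (star (Y b) * Y c) (ip (Y b) (Y c))) \<le> r0"
    and nn: "norm (a' * J a * e (Suc j)) \<le> nph (a' * J a) + r / 2" "norm (a * J a' * e (Suc j)) \<ge> nph (a * J a') - r / 2"
      "norm (x1 * a * J a' * e (Suc j)) \<le> nph (x1 * a * J a') + r / 2" "norm (y1 * a' * J a * e (Suc j)) \<le> nph (y1 * a' * J a) + r / 2"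
    unfolding eventually_sequentially ip_def by force
  define t where "t = e j"
  \<comment> \<open>\<open>t\<close> is not a projection. The test elements end in \<open>u\<close>,
    one step deeper, where \<open>t * t\<close> acts as a unit, so that
    \<open>Y b * u = X b * u\<close>.\<close>
  define u where "u = e (Suc j)"
  have tu: "t * u = u" by (simp add: t_def u_def e_mult)
  have ts: "star t = t" by (simp add: t_def)
  define D where "D b c = t * (star (Y b) * Y c) * t - (if b = c then 1 else 0) *\<^sub>C (t * t)" for b c
  have D: "norm (D b c) \<le> 2 * r0" if "b \<in> I" "c \<in> I" for b c
  proof -
    have "D b c = (t * (star (Y b) * Y c) * t - ip (Y b) (Y c) *\<^sub>C (t * t)) + (ip (Y b) (Y c) - (if b = c then 1 else 0)) *\<^sub>C (t * t)"
      by (simp add: D_def scaleC_diff_left)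
    also have "norm \<dots> \<le> r0 + r0 * 1"
      using gram0[OF that] gramY[OF that] by (intro order_trans[OF norm_triangle_ineq] add_mono) (simp_all add: norm_scaleC t_def)
    finally show ?thesis by simp
  qed
  have gram: "t * (star (Y b) * Y c) * t = D b c + (if b = c then 1 else 0) *\<^sub>C (t * t)" for b c by (simp add: D_def)
  define X where "X b = Y b * t" for b
  have XX: "star (X b) * X c = t * (star (Y b) * Y c) * t" for b c by (simp add: X_def star_mult ts mult.assoc)
  have nX: "norm (X b) \<le> 2" if b: "b \<in> I" for b
  proof (rule power2_le_imp_le)
    have "(norm (X b))\<^sup>2 = norm (D b b + t * t)" by (simp add: cstar_identity[symmetric] XX gram)
    also have "\<dots> \<le> 2 * 1 + 1" using D[OF b b] r0(2) by (intro order_trans[OF norm_triangle_ineq] add_mono) (simp_all add: t_def)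
    finally show "(norm (X b))\<^sup>2 \<le> 2\<^sup>2" by simp
  qed simp
  define Z where "Z = (\<Sum>b\<in>I. X b * star (X b))"
  have nZ: "norm Z \<le> 1 + r"
  proof -
    \<comment> \<open>The Gram matrix of the \<open>X b\<close> is nearly \<open>t * t\<close> times
      the identity, so \<open>Z * Z\<close> is close to \<open>V\<close> rather than to
      \<open>Z\<close>. It suffices that \<open>V \<preceq> Z\<close>: the square of
      \<open>norm Z\<close> is at most \<open>r + norm Z\<close>, which forces
      \<open>norm Z \<le> 1 + r\<close>.\<close>
    define V where "V = (\<Sum>b\<in>I. X b * (t * t) * star (X b))"
    have "Z * Z = (\<Sum>b\<in>I. \<Sum>c\<in>I. X b * (star (X b) * X c) * star (X c))"
      by (simp add: Z_def sum_product mult.assoc)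
    also have "\<dots> = (\<Sum>b\<in>I. \<Sum>c\<in>I. X b * D b c * star (X c) + (if b = c then X b * (t * t) * star (X b) else 0))"
      by (intro sum.cong refl) (simp add: XX gram distrib_left distrib_right)
    also have "\<dots> = (\<Sum>b\<in>I. \<Sum>c\<in>I. X b * D b c * star (X c)) + V"
      using finI by (simp add: sum.distrib V_def)
    finally have "norm (Z * Z) \<le> norm (\<Sum>b\<in>I. \<Sum>c\<in>I. X b * D b c * star (X c)) + norm V" using norm_triangle_ineq by simp
    also have "norm (\<Sum>b\<in>I. \<Sum>c\<in>I. X b * D b c * star (X c)) \<le> (\<Sum>b\<in>I. \<Sum>c\<in>I. 2 * (2 * r0) * 2)"
    proof (intro sum_norm_le)
      fix b c assume bc: "b \<in> I" "c \<in> I"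
      show "norm (X b * D b c * star (X c)) \<le> 2 * (2 * r0) * 2"
        using nX[OF bc(1)] nX[OF bc(2)] D[OF bc] r0 by (intro order_trans[OF norm_mult3] mult_mono) auto
    qed
    also have "\<dots> \<le> r" using r0m by (simp add: m_def mult.assoc)
    also have "norm V \<le> norm Z"
    proof (rule norm_mono)
      show "pos V" unfolding V_def t_def by (intro pos_sum pos_conj' sa_square_pos e_sa)
      have "Z - V = (\<Sum>b\<in>I. X b * (of_real 1 - t * t) * star (X b))"
        by (simp add: Z_def V_def sum_subtractf[symmetric] right_diff_distrib left_diff_distrib)
      moreover have "t * t \<preceq> of_real 1" unfolding t_def by (intro ple_norm sa_mult e_sa refl) simp
      ultimately show "V \<preceq> Z" by (simp add: pos_sum pos_conj')
    qed
    finally have *: "norm (Z * Z) \<le> r + norm Z" by simp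
    have "sa Z" unfolding Z_def by (intro sa_sum pos_sa mult_star_pos)
    then have "norm Z * norm Z \<le> r + norm Z" using * sa_norm_square[of Z] by (simp add: power2_eq_square)
    show ?thesis
    proof (rule ccontr)
      assume "\<not> norm Z \<le> 1 + r"
      then have z: "norm Z > 1 + r" by simp
      then have "(1 + r) * r < norm Z * (norm Z - 1)" using r by (intro mult_strict_mono) auto
      moreover have "(1 + r) * r \<ge> r" using r by simp
      moreover have "norm Z * (norm Z - 1) = norm Z * norm Z - norm Z" by (simp add: right_diff_distrib)
      ultimately show False using \<open>norm Z * norm Z \<le> r + norm Z\<close> by linarith
    qed
  qed
  let ?s = prod.swap
  have swap: "(\<Sum>b\<in>I. f (?s b)) = (\<Sum>b\<in>I. f b)" for f :: "'u \<times> 'u \<Rightarrow> 'u"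
    by (rule sum.reindex_bij_witness[of _ prod.swap prod.swap]) (auto simp: I_def)
  have swI: "?s b \<in> I" if "b \<in> I" for b using that by (auto simp: I_def)
  define v where "v = (\<Sum>b\<in>I. X b * star (X (?s b)))"
  \<comment> \<open>\<open>v\<close> is the product of the row of the \<open>X b\<close> with the
    column of the adjoints in swapped order. Both have the same sum of squares \<open>Z\<close>,
    because the swap permutes \<open>I\<close>.\<close>
  have nv: "norm v \<le> 1 + r"
  proof -
    have "(norm v)\<^sup>2 \<le> norm Z * norm (\<Sum>b\<in>I. star (star (X (?s b))) * star (X (?s b)))"
      unfolding v_def by (rule norm_row_le) (simp add: Z_def)
    also have "(\<Sum>b\<in>I. star (star (X (?s b))) * star (X (?s b))) = Z"
      unfolding Z_def star_star by (rule swap)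
    finally have "(norm v)\<^sup>2 \<le> (norm Z)\<^sup>2" by (simp add: power2_eq_square)
    then have "norm v \<le> norm Z" by (rule power2_le_imp_le) simp
    then show ?thesis using nZ by simp
  qed
  have vA: "v \<in> A" unfolding v_def
  proof (intro A_sum A_closed_ops(5))
    fix b assume "b \<in> I"
    then show "X b \<in> A" unfolding X_def Y_def using S(2) by (intro A_closed_ops(5)) (auto simp: I_def)
  qed
  \<comment> \<open>\<open>f\<close> is linear in \<open>i\<close> and \<open>l\<close> and
    conjugate linear in \<open>l'\<close> and \<open>i'\<close>. Therefore
    \<open>invariant_sum\<close> removes \<open>g\<close> from the inner pair of arguments and then
    from the outer pair.\<close>
  have vF: "v \<in> F"
  proof -
    define f where "f i l l' i' = (i * J l) * (t * t) * star (l' * J i')" for i l l' i'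
    have v: "v = (\<Sum>i\<in>S. \<Sum>l\<in>S. f i l l i)"
      unfolding v_def I_def sum.cartesian_product
      by (intro sum.cong refl) (simp add: f_def X_def Y_def star_mult ts mult.assoc case_prod_unfold)
    have tF: "act g t = t" for g unfolding t_def by (rule F_D[OF e_F])
    have "act g v = v" for g
    proof -
      have "act g v = (\<Sum>i\<in>S. \<Sum>l\<in>S. f (act g i) (act g l) (act g l) (act g i))"
        unfolding v f_def by (simp add: act_sum act_mult act_star tF J(3))
      also have "\<dots> = (\<Sum>i\<in>S. \<Sum>l\<in>S. f (act g i) l l (act g i))"
      proof (rule sum.cong[OF refl])
        fix i
        show "(\<Sum>l\<in>S. f (act g i) (act g l) (act g l) (act g i)) = (\<Sum>l\<in>S. f (act g i) l l (act g i))"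
          by (rule invariant_sum[where T="\<lambda>l l'. f (act g i) l l' (act g i)", OF S(1) inv])
            (simp_all add: f_def J star_add star_mult star_scaleC distrib_left distrib_right mult_scaleC)
      qed
      also have "\<dots> = (\<Sum>l\<in>S. \<Sum>i\<in>S. f (act g i) l l (act g i))" by (rule sum.swap)
      also have "\<dots> = (\<Sum>l\<in>S. \<Sum>i\<in>S. f i l l i)"
      proof (rule sum.cong[OF refl])
        fix l
        show "(\<Sum>i\<in>S. f (act g i) l l (act g i)) = (\<Sum>i\<in>S. f i l l i)"
          by (rule invariant_sum[where T="\<lambda>i i'. f i l l i'", OF S(1) inv])
            (simp_all add: f_def J star_add star_mult star_scaleC distrib_left distrib_right mult_scaleC)
      qed
      also have "\<dots> = v" unfolding v by (rule sum.swap)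
      finally show ?thesis .
    qed
    then show ?thesis by (simp add: F_def)
  qed
  \<comment> \<open>\<open>H\<close> and \<open>G\<close> are the copies of the tensors of
    \<open>a'\<close> with \<open>a\<close> and of \<open>a\<close> with \<open>a'\<close>, cut down
    by \<open>u\<close>.\<close>
  define H where "H = a' * J a * u"
  define G where "G = a * J a' * u"
  define c where "c b = ip (fst b) a' * ip (snd b) a" for b
  have expand: "z * J z' = (\<Sum>b\<in>I. (ip (fst b) z * ip (snd b) z') *\<^sub>C Y b)" if z: "pr S z = z" "pr S z' = z'" for z z'
  proof -
    have "z * J z' = pr S z * J (pr S z')" by (simp only: z)
    also have "\<dots> = (\<Sum>i\<in>S. \<Sum>l\<in>S. (ip i z * ip l z') *\<^sub>C (i * J l))"
      by (simp add: pr_def Jsum J(2) sum_product mult_scaleC scaleC_scaleC) (simp only: mult.commute)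
    finally show ?thesis by (simp add: I_def sum.cartesian_product Y_def case_prod_unfold)
  qed
  have H: "H = (\<Sum>b\<in>I. c b *\<^sub>C (Y b * u))"
    unfolding H_def expand[OF a(2,1)] c_def by (simp add: sum_distrib_right mult_scaleC_left)
  have G: "G = (\<Sum>b\<in>I. c (?s b) *\<^sub>C (Y b * u))"
    unfolding G_def expand[OF a(1,2)] c_def by (simp add: sum_distrib_right mult_scaleC_left mult.commute)
  have c1: "cmod (c b) \<le> 1" if "b \<in> I" for b
  proof -
    have n1: "nph i = 1" if "i \<in> S" for i
    proof -
      have "complex_of_real ((nph i)\<^sup>2) = 1" using S(1) that unfolding ip_self[symmetric] orthonormal_def by simp
      then have "(nph i)\<^sup>2 = 1" by (simp only: of_real_eq_1_iff)
      then show ?thesis using nph_nonneg[of i] by (simp add: power2_eq_1_iff)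
    qed
    have "cmod (ip (fst b) a') \<le> 1" "cmod (ip (snd b) a) \<le> 1"
      using ip_CS[of "fst b" a'] ip_CS[of "snd b" a] n1 that a(3,4) by (auto simp: I_def)
    then show ?thesis unfolding c_def norm_mult using mult_mono[of _ 1 _ 1] by fastforce
  qed
  have flip: "norm (v * H - G) \<le> r"
  proof -
    have "v * H = (\<Sum>b\<in>I. \<Sum>k\<in>I. c k *\<^sub>C (X b * (star (X (?s b)) * Y k * u)))"
      by (simp add: v_def H sum_product mult_scaleC_right mult.assoc)
    also have "\<dots> = (\<Sum>b\<in>I. \<Sum>k\<in>I. c k *\<^sub>C (X b * (D (?s b) k * u)) + (if ?s b = k then c (?s b) *\<^sub>C (Y b * u) else 0))"
    proof (intro sum.cong refl)
      fix b k
      have "star (X (?s b)) * Y k * u = t * (star (Y (?s b)) * Y k) * t * u"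
        by (simp add: X_def star_mult ts mult.assoc tu)
      also have "\<dots> = D (?s b) k * u + (if ?s b = k then u else 0)"
        unfolding gram by (simp add: distrib_right mult.assoc tu)
      finally have *: "star (X (?s b)) * Y k * u = D (?s b) k * u + (if ?s b = k then u else 0)" .
      show "c k *\<^sub>C (X b * (star (X (?s b)) * Y k * u)) = c k *\<^sub>C (X b * (D (?s b) k * u)) + (if ?s b = k then c (?s b) *\<^sub>C (Y b * u) else 0)"
        unfolding * by (auto simp: distrib_left scaleC_add_right X_def mult.assoc tu)
    qed
    also have "\<dots> = (\<Sum>b\<in>I. \<Sum>k\<in>I. c k *\<^sub>C (X b * (D (?s b) k * u))) + G"
      using finI swI by (simp add: sum.distrib G)
    finally have "v * H - G = (\<Sum>b\<in>I. \<Sum>k\<in>I. c k *\<^sub>C (X b * (D (?s b) k * u)))" by simp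
    also have "norm \<dots> \<le> (\<Sum>b\<in>I. \<Sum>k\<in>I. 1 * (2 * (2 * r0 * 1)))"
    proof (intro sum_norm_le)
      fix b k assume bk: "b \<in> I" "k \<in> I"
      have "norm (X b * (D (?s b) k * u)) \<le> norm (X b) * (norm (D (?s b) k) * norm u)"
        by (intro order_trans[OF norm_mult_ineq] mult_left_mono norm_mult_ineq) simp
      also have "\<dots> \<le> 2 * (2 * r0 * 1)"
        using nX[OF bk(1)] D[OF swI[OF bk(1)] bk(2)] r0 by (intro mult_mono) (auto simp: u_def)
      finally show "norm (c k *\<^sub>C (X b * (D (?s b) k * u))) \<le> 1 * (2 * (2 * r0 * 1))"
        unfolding norm_scaleC using c1[OF bk(2)] by (intro mult_mono) auto
    qed
    also have "\<dots> \<le> r"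
    proof -
      have "m * m * (4 * r0) \<le> m * m * (8 * r0)" using r0 by (intro mult_left_mono) auto
      moreover have "(\<Sum>b\<in>I. \<Sum>k\<in>I. 1 * (2 * (2 * r0 * 1))) = m * m * (4 * r0)" by (simp add: m_def mult.assoc)
      ultimately show ?thesis using r0m by linarith
    qed
    finally show ?thesis .
  qed
  have T: "a \<in> T" "a' \<in> T" and W: "a \<in> W" "a' \<in> W" "x1 * a \<in> W" "y1 * a' \<in> W" by (simp_all add: T_def W_def)
  have "norm H \<le> nph a' * nph a + r" using nn(1) nphJ[OF W(2) T(1)] unfolding H_def u_def by linarith
  moreover have "norm G \<ge> nph a * nph a' - r" using nn(2) nphJ[OF W(1) T(2)] unfolding G_def u_def by linarith
  moreover have "norm (x1 * G) \<le> nph (x1 * a) * nph a' + r"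
    using nn(3) nphJ[OF W(3) T(2)] unfolding G_def u_def mult.assoc by linarith
  moreover have "norm (y1 * H) \<le> nph (y1 * a') * nph a + r"
    using nn(4) nphJ[OF W(4) T(1)] unfolding H_def u_def mult.assoc by linarith
  ultimately show ?thesis using BI[OF vF vA] nv flip by blast
qed

text \<open>The vector is \<open>h b\<close> with \<open>h\<close> the part of \<open>x\<^sup>* x\<close> above \<open>1 - eps\<close>.\<close>

lemma norming_vector:
  assumes x: "x \<in> A" "norm x = 1" and eps: "0 < eps" "eps < 1"
  shows "\<exists>a\<in>A. nph a = 1 \<and> nph ((1 - star x * x) * a) \<le> eps"
proof -
  define r where "r = star x * x - of_real (1 - eps)"
  define h where "h = ppart r"
  have sx: "sa (star x * x)" by (intro pos_sa star_mult_pos)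
  have sr: "sa r" unfolding r_def by (intro sa_diff sx sa_of_real)
  note pp = ppart[OF sr, folded h_def]
  have hA: "h \<in> A" unfolding h_def r_def by (rule A_ppart) (use sx x eps in \<open>auto intro: A_closed_ops(6)\<close>)
  have hs: "sa h" by (rule pos_sa[OF pp(1)])
  have h0: "h \<noteq> 0"
  proof
    assume "h = 0"
    then have "pos (of_real (1 - eps) - star x * x)" using pp(2) by (simp add: r_def)
    from pos_le_norm(1)[OF star_mult_pos this] show False using x(2) eps by (simp add: cstar_identity)
  qed
  have r1: "r \<preceq> of_real eps"
  proof -
    have "star x * x \<preceq> of_real 1" by (rule ple_norm[OF sx]) (simp add: cstar_identity x(2))
    then show ?thesis by (simp add: r_def algebra_simps)
  qed
  have nh: "norm h \<le> eps"
  proof -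
    define s where "s = psqrt h"
    have s: "pos s" "s * s = h" using psqrt(1,2)[OF pp(1)] by (simp_all add: s_def)
    have "r * h = h * r" using pp(5,6) by simp
    then have rs: "r * s = s * r" unfolding s_def by (rule psqrt(3)[OF pp(1)])
    have "s * r * s \<preceq> s * of_real eps * s" by (rule ple_conj_sa[OF r1 pos_sa[OF s(1)]])
    moreover have "s * r * s = h * h" using pp(5) by (simp add: rs[symmetric] mult.assoc s(2))
    moreover have "s * of_real eps * s = eps *\<^sub>R h" by (simp add: of_real_def s(2))
    ultimately have "h * h \<preceq> eps *\<^sub>R h" by (simp only:)
    then have "norm (h * h) \<le> norm (eps *\<^sub>R h)" by (rule norm_mono[OF sa_square_pos[OF hs]])
    then have "norm h * norm h \<le> eps * norm h" using eps sa_norm_square[OF hs] by (simp add: power2_eq_square)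
    then show ?thesis using h0 by (simp add: mult_le_cancel_right)
  qed
  \<comment> \<open>Above the level \<open>1 - eps\<close>, \<open>star x * x\<close> equals
    \<open>1 - eps + h\<close>; thus \<open>1 - star x * x\<close> acts on \<open>h\<close> as
    \<open>eps - h\<close>, of norm at most \<open>eps\<close>.\<close>
  have key: "(1 - star x * x) * h = (of_real eps - h) * h"
  proof -
    have "1 - star x * x = of_real eps - r" by (simp add: r_def)
    then have "(1 - star x * x) * h = of_real eps * h - r * h" by (simp only: left_diff_distrib)
    then show ?thesis by (simp add: pp(5) left_diff_distrib)
  qed
  have ne: "norm (of_real eps - h) \<le> eps" by (rule pos_norm_bound[OF pp(1) nh])
  \<comment> \<open>\<open>h\<close> itself may be a null vector of \<open>\<phi>\<close>. If all
    \<open>h * b\<close> were null, the isometry of the GNS representation on \<open>B\<close> would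
    give \<open>E (star h * h) = 0\<close>, and \<open>E\<close> is faithful.\<close>
  have "\<exists>b\<in>B. nph (h * b) \<noteq> 0"
  proof (rule ccontr)
    assume "\<not> (\<exists>b\<in>B. nph (h * b) \<noteq> 0)"
    then have z: "nph (h * b) = 0" if "b \<in> B" for b using that by blast
    have "norm (E (star h * h)) \<le> 0"
    proof (rule norm_le_from_\<phi>)
      show "E (star h * h) \<in> B" by (intro E_in_B A_closed_ops hA)
      show "pos (E (star h * h))" by (intro E_pos star_mult_pos)
      fix b assume b: "b \<in> B"
      have "\<phi> (star b * E (star h * h) * b) = \<phi> (E (star b * (star h * h) * b))" by (simp only: E_conj[OF B_F[OF b]])
      also have "\<dots> = \<phi> (star b * (star h * h) * b)" by (simp add: \<phi>_E)
      also have "star b * (star h * h) * b = star (h * b) * (h * b)" by (simp add: star_mult mult.assoc)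
      finally have "\<phi> (star b * E (star h * h) * b) = of_real ((nph (h * b))\<^sup>2)" by (simp only: nph_of_real[OF X_UNIV])
      then show "cmod (\<phi> (star b * E (star h * h) * b)) \<le> 0 * (nph b)\<^sup>2" using z[OF b] by simp
    qed simp
    then have "h = 0" using E_zeroD[of h] by simp
    then show False using h0 by simp
  qed
  then obtain b where b: "b \<in> B" "nph (h * b) > 0" using nph_nonneg[of "h * _"] by (metis order_le_less)
  define a where "a = of_real (1 / nph (h * b)) *\<^sub>C (h * b)"
  have "nph a = 1" using b(2) by (simp only: a_def nph_scale) (simp add: norm_divide)
  moreover have "a \<in> A" unfolding a_def by (intro A_closed_ops hA)
  moreover have "nph ((1 - star x * x) * a) \<le> eps"
  proof -
    have "(1 - star x * x) * a = of_real (1 / nph (h * b)) *\<^sub>C ((1 - star x * x) * h * b)" by (simp only: a_def mult_scaleC_right mult.assoc)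
    also have "\<dots> = (of_real eps - h) * a" by (simp only: key a_def mult_scaleC_right mult.assoc)
    finally have "nph ((1 - star x * x) * a) \<le> norm (of_real eps - h) * nph a" using nph_mult by simp
    then show ?thesis using ne \<open>nph a = 1\<close> by simp
  qed
  ultimately show ?thesis by blast
qed

text \<open>Norming vectors are handled through the smallness of
  \<open>(1 - star x * x) * a\<close>, which is linear in \<open>a\<close> and so survives the
  projection to the span of \<open>S\<close> and the passage to tensors. The lower bound for
  \<open>x * K\<close> is recovered from
  \<open>K = star x * (x * K) + (1 - star x * x) * K\<close>.\<close>

lemma BEK_flip:
  assumes inf: infinite_dimensional
  shows BEK_unit
  unfolding BEK_unit_def
proof (intro ballI allI impI)
  fix x y :: 'u and eps :: real
  assume xy: "x \<in> A" "y \<in> A" "eps > 0" "norm x = 1" "norm y = 1"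
  \<comment> \<open>The estimates lose \<open>13 t\<close> before \<open>v\<close> is divided by
    \<open>1 + t\<close>, and \<open>3 t\<close> more through this division.\<close>
  define t where "t = min (eps / 16) (1 / 2)"
  have t: "0 < t" "t < 1" "16 * t \<le> eps" using xy(3) by (auto simp: t_def)
  let ?x = "1 - star x * x" and ?y = "1 - y * star y"
  obtain a0 where a0: "a0 \<in> A" "nph a0 = 1" "nph (?x * a0) \<le> t"
    using norming_vector[OF xy(1,4) t(1,2)] by blast
  obtain a1 where a1: "a1 \<in> A" "nph a1 = 1" "nph (?y * a1) \<le> t"
    using norming_vector[of "star y", OF A_closed_ops(4)[OF xy(2)] _ t(1,2)] xy(5) by (auto simp: star_star)
  obtain S where S: "orthonormal S" "S \<subseteq> A" and inv: "\<And>g x. x \<in> S \<Longrightarrow> act g x = pr S (act g x)"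
    and near: "nph (a0 - pr S a0) \<le> t" "nph (a1 - pr S a1) \<le> t"
    using invariant_subspace[OF a0(1) a1(1) t(1)] by blast
  have idem: "pr S (pr S z) = pr S z" for z
  proof -
    have "(\<Sum>x\<in>S. ip x (pr S z) *\<^sub>C x) = (\<Sum>x\<in>S. ip x z *\<^sub>C x)" by (intro sum.cong refl) (simp add: ip_pr[OF S(1)])
    then show ?thesis by (simp only: pr_def[of S "pr S z"] pr_def[of S z, symmetric])
  qed
  have le1: "nph (pr S z) \<le> nph z" for z
  proof (rule power2_le_imp_le)
    have "(\<Sum>x\<in>S. (cmod (ip x (pr S z)))\<^sup>2) = (\<Sum>x\<in>S. (cmod (ip x z))\<^sup>2)" by (simp add: ip_pr[OF S(1)] cong: sum.cong)
    moreover have "(nph (pr S z))\<^sup>2 = (\<Sum>x\<in>S. (cmod (ip x (pr S z)))\<^sup>2)"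
      by (subst nph_pythagoras[OF S(1)]) (simp add: idem nph_def)
    ultimately show "(nph (pr S z))\<^sup>2 \<le> (nph z)\<^sup>2" using bessel[OF S(1), of z] by simp
  qed simp
  have ge1: "nph (pr S z) \<ge> 1 - t" if "nph z = 1" "nph (z - pr S z) \<le> t" for z
    using nph_tri[of "pr S z" "z - pr S z"] that by simp
  have move: "nph (c * pr S z) \<le> 2 * t" if "norm c \<le> 1" "nph (c * z) \<le> t" "nph (z - pr S z) \<le> t" for c z
  proof -
    have "nph (c * pr S z) \<le> nph (c * z) + nph (c * (z - pr S z))"
      using nph_tri_diff[of "c * z" "c * (z - pr S z)"] by (simp add: right_diff_distrib)
    also have "nph (c * (z - pr S z)) \<le> 1 * t"
      using that by (intro order_trans[OF nph_mult] mult_mono) auto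
    finally show ?thesis using that(2) by simp
  qed
  have n1: "norm (1 - star z * z) \<le> 1" if "norm z = 1" for z :: 'u
  proof (rule pos_le_norm(1))
    have "star z * z \<preceq> of_real 1" by (rule ple_norm[OF pos_sa[OF star_mult_pos]]) (simp add: cstar_identity that)
    then show "pos (1 - star z * z)" by simp
  qed simp
  have n1y: "norm ?y \<le> 1" using n1[of "star y"] xy(5) by (simp add: star_star)
  obtain v H K where v: "v \<in> B" "norm v \<le> 1 + t" "norm (v * H - K) \<le> t"
    and nH: "norm H \<le> nph (pr S a1) * nph (pr S a0) + t" and nK: "norm K \<ge> nph (pr S a0) * nph (pr S a1) - t"
    and xK: "norm (?x * K) \<le> nph (?x * pr S a0) * nph (pr S a1) + t"
    and yH: "norm (?y * H) \<le> nph (?y * pr S a1) * nph (pr S a0) + t"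
    using flip[OF inf S inv idem idem, of a0 a1 t ?x ?y] le1[of a0] le1[of a1] a0(2) a1(2) t(1) by auto
  have p1: "nph (pr S a0) \<le> 1" "nph (pr S a1) \<le> 1" using le1[of a0] le1[of a1] a0(2) a1(2) by simp_all
  have bH: "norm H \<le> 1 + t"
    using nH mult_mono[OF p1(2,1)] by simp
  have bK: "norm K \<ge> 1 - 3 * t"
  proof -
    have "(1 - t) * (1 - t) \<le> nph (pr S a0) * nph (pr S a1)"
      using ge1[OF a0(2) near(1)] ge1[OF a1(2) near(2)] t by (intro mult_mono) auto
    moreover have "1 - 2 * t \<le> (1 - t) * (1 - t)" by (simp add: algebra_simps)
    ultimately show ?thesis using nK by linarith
  qed
  have bx: "norm (?x * K) \<le> 3 * t"
  proof -
    have "nph (?x * pr S a0) * nph (pr S a1) \<le> (2 * t) * 1"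
      using move[OF n1[OF xy(4)] a0(3) near(1)] p1 t by (intro mult_mono) auto
    then show ?thesis using xK by linarith
  qed
  have by': "norm (?y * H) \<le> 3 * t"
  proof -
    have "nph (?y * pr S a1) * nph (pr S a0) \<le> (2 * t) * 1"
      using move[OF n1y a1(3) near(2)] p1 t by (intro mult_mono) auto
    then show ?thesis using yH by linarith
  qed
  have xK': "norm (x * K) \<ge> 1 - 6 * t"
  proof -
    have "K = star x * (x * K) + ?x * K" by (simp add: left_diff_distrib mult.assoc)
    then have "norm K \<le> norm (star x * (x * K)) + norm (?x * K)" by (metis norm_triangle_ineq)
    also have "norm (star x * (x * K)) \<le> norm (x * K)" using norm_mult_ineq[of "star x" "x * K"] xy(4) by simp
    finally show ?thesis using bx bK by simp
  qed
  have low: "norm (x * v * y) * (1 + t) \<ge> 1 - 13 * t"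
  proof -
    \<comment> \<open>\<open>y * star y\<close> nearly fixes \<open>H\<close>, so
      \<open>v * H\<close>, which is close to \<open>K\<close>, nearly factors through
      \<open>v * y\<close>.\<close>
    have "x * K = x * v * y * (star y * H) + x * (v * (?y * H)) - x * (v * H - K)"
      by (simp add: left_diff_distrib right_diff_distrib mult.assoc)
    then have "norm (x * K) \<le> norm (x * v * y * (star y * H) + x * (v * (?y * H))) + norm (x * (v * H - K))"
      using norm_triangle_ineq4 by simp
    also have "\<dots> \<le> norm (x * v * y * (star y * H)) + norm (x * (v * (?y * H))) + norm (x * (v * H - K))"
      by (intro add_mono norm_triangle_ineq order_refl)
    also have "\<dots> \<le> norm (x * v * y) * (1 + t) + (1 + t) * (3 * t) + t"
    proof (intro add_mono)
      have "norm (star y * H) \<le> 1 * (1 + t)" using bH xy(5) by (intro order_trans[OF norm_mult_ineq] mult_mono) auto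
      then show "norm (x * v * y * (star y * H)) \<le> norm (x * v * y) * (1 + t)"
        by (intro order_trans[OF norm_mult_ineq mult_left_mono]) auto
      have "norm (v * (?y * H)) \<le> (1 + t) * (3 * t)"
        using v(2) by' t by - (rule order_trans[OF norm_mult_ineq mult_mono], auto)
      then show "norm (x * (v * (?y * H))) \<le> (1 + t) * (3 * t)"
        using norm_mult_ineq[of x "v * (?y * H)"] xy(4) by simp
      show "norm (x * (v * H - K)) \<le> t" using norm_mult_ineq[of x "v * H - K"] xy(4) v(3) by simp
    qed
    finally have "1 - 6 * t \<le> norm (x * v * y) * (1 + t) + (1 + t) * (3 * t) + t" using xK' by simp
    moreover have "(1 + t) * (3 * t) \<le> 6 * t" using t by (simp add: distrib_right)
    ultimately show ?thesis by linarith
  qed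
  define b where "b = (1 / (1 + t)) *\<^sub>R v"
  have "b \<in> B" unfolding b_def by (intro B_closed_ops v)
  moreover have "norm b \<le> 1" using v(2) t by (simp add: b_def pos_divide_le_eq)
  moreover have "norm (x * b * y) \<ge> 1 - eps"
  proof -
    have "norm (x * b * y) = norm (x * v * y) / (1 + t)" using t by (simp add: b_def)
    then have "norm (x * v * y) = norm (x * b * y) * (1 + t)" using t by simp
    then have 1: "1 - 13 * t \<le> norm (x * b * y) * ((1 + t) * (1 + t))" using low by (simp add: mult.assoc)
    have 2: "(1 + t) * (1 + t) \<le> 1 + 3 * t" using t by (simp add: algebra_simps)
    have nb: "norm (x * b * y) \<le> 1"
      using norm_mult3[of x b y] xy(4,5) \<open>norm b \<le> 1\<close> by simp
    have "norm (x * b * y) * ((1 + t) * (1 + t)) \<le> norm (x * b * y) * (1 + 3 * t)" using 2 by (intro mult_left_mono) auto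
    also have "\<dots> \<le> norm (x * b * y) + 3 * t" using nb t by (simp add: distrib_left mult_left_le_one_le)
    finally show ?thesis using 1 t(3) by linarith
  qed
  ultimately show "\<exists>b\<in>B. norm b \<le> 1 \<and> norm (x * b * y) \<ge> 1 - eps" by blast
qed

theorem BEK_unit: BEK_unit
proof (cases "\<exists>p\<in>B. pos p \<and> p * p = p \<and> norm p = 1 \<and> (\<forall>y. p * y * p = \<phi> y *\<^sub>C p)")
  case True
  then obtain p where "p \<in> B" "pos p" "p * p = p" "norm p = 1" "\<And>y. p * y * p = \<phi> y *\<^sub>C p" by blast
  then show ?thesis by (rule BEK_projection)
next
  case False
  show ?thesis by (rule BEK_flip[OF corner_dichotomy[OF False]])
qed

end

section \<open>The unitization\<close>

datatype 'a unitization = Adjoin (sc: complex) (vec: 'a)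

definition lmult :: "'a::cstar_algebra unitization \<Rightarrow> 'a \<Rightarrow> 'a" where
  "lmult x z = sc x *\<^sub>C z + vec x * z"

lemma bounded_linear_lmult: "bounded_linear (lmult x)"
  unfolding lmult_def by (intro bounded_linear_add bounded_linear_scaleC bounded_linear_mult_right)

text \<open>The maximum keeps the norm definite when the underlying algebra already has a unit.\<close>

instantiation unitization :: (cstar_algebra) real_normed_algebra_1
begin

definition "0 = Adjoin 0 0"
definition "1 = Adjoin 1 0"
definition "x + y = Adjoin (sc x + sc y) (vec x + vec y)"
definition "x - y = Adjoin (sc x - sc y) (vec x - vec y)"
definition "- x = Adjoin (- sc x) (- vec x)"
definition "x * y = Adjoin (sc x * sc y) (sc x *\<^sub>C vec y + sc y *\<^sub>C vec x + vec x * vec y)"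
definition "r *\<^sub>R x = Adjoin (of_real r * sc x) (r *\<^sub>R vec x)"
definition "norm x = max (cmod (sc x)) (onorm (lmult x))"
definition "dist x y = norm (x - y)" for x y :: "'a unitization"
definition "sgn x = inverse (norm x) *\<^sub>R x" for x :: "'a unitization"
definition "(uniformity :: ('a unitization \<times> 'a unitization) filter) = (INF eps\<in>{0<..}. principal {(x, y). dist x y < eps})"
definition "open S \<longleftrightarrow> (\<forall>x\<in>S. \<forall>\<^sub>F (x', y) in uniformity. x' = x \<longrightarrow> y \<in> S)" for S :: "'a unitization set"

lemmas unitization_ops = zero_unitization_def one_unitization_def plus_unitization_def minus_unitization_def
  uminus_unitization_def times_unitization_def scaleR_unitization_def

lemma lmult_ops: "lmult (x + y) z = lmult x z + lmult y z" "lmult (x * y) z = lmult x (lmult y z)"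
  "lmult (r *\<^sub>R x) z = r *\<^sub>R lmult x z" "lmult 1 z = z" "lmult 0 z = 0"
  by (simp_all add: unitization_ops lmult_def distrib_left distrib_right scaleC_add_left scaleC_add_right scaleC_scaleC
      scaleR_add_right mult_scaleC mult.assoc scaleR_scaleC)

lemma onorm_lmult: "norm (lmult x z) \<le> onorm (lmult x) * norm z" "onorm (lmult x) \<ge> 0"
  by (rule onorm[OF bounded_linear_lmult], rule onorm_pos_le[OF bounded_linear_lmult])

text \<open>\<open>vec x * star (vec x)\<close> is \<open>lmult x (star (vec x))\<close> minus a
  scalar multiple of \<open>star (vec x)\<close>. The bound makes the norm definite and lets both
  coordinates of a Cauchy sequence converge.\<close>

lemma norm_vec_le: "norm (vec x) \<le> 2 * norm x"
proof (cases "vec x = 0")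
  case False
  have "(norm (vec x))\<^sup>2 = norm (lmult x (star (vec x)) - sc x *\<^sub>C star (vec x))"
    by (simp add: lmult_def cstar_identity')
  also have "\<dots> \<le> norm (lmult x (star (vec x))) + norm (sc x *\<^sub>C star (vec x))" by (rule norm_triangle_ineq4)
  also have "\<dots> \<le> norm x * norm (vec x) + norm x * norm (vec x)"
  proof (intro add_mono)
    show "norm (lmult x (star (vec x))) \<le> norm x * norm (vec x)"
      using onorm_lmult(1)[of x "star (vec x)"] mult_right_mono[of "onorm (lmult x)" "norm x" "norm (vec x)"]
      by (simp add: norm_unitization_def)
    show "norm (sc x *\<^sub>C star (vec x)) \<le> norm x * norm (vec x)"
      unfolding norm_scaleC norm_star by (intro mult_right_mono) (simp_all add: norm_unitization_def)
  qed
  finally have "norm (vec x) * norm (vec x) \<le> (2 * norm x) * norm (vec x)" by (simp add: power2_eq_square)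
  then show ?thesis using False by simp
qed (simp add: norm_unitization_def le_max_iff_disj)

instance
proof
  fix x y z :: "'a unitization" and r s :: real and S :: "'a unitization set"
  show "x + y + z = x + (y + z)" "x + y = y + x" "0 + x = x" "- x + x = 0" "x - y = x + - y"
    by (simp_all add: unitization_ops)
  show "r *\<^sub>R (x + y) = r *\<^sub>R x + r *\<^sub>R y" "(r + s) *\<^sub>R x = r *\<^sub>R x + s *\<^sub>R x" "r *\<^sub>R s *\<^sub>R x = (r * s) *\<^sub>R x" "1 *\<^sub>R x = x"
    by (simp_all add: unitization_ops algebra_simps)
  show "x * y * z = x * (y * z)" "(x + y) * z = x * z + y * z" "x * (y + z) = x * y + x * z" "1 * x = x" "x * 1 = x" "(0::'a unitization) \<noteq> 1"
    by (simp_all add: unitization_ops distrib_left distrib_right scaleC_add_left scaleC_add_right scaleC_scaleC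
        mult_scaleC mult.assoc algebra_simps)
  show "r *\<^sub>R x * y = r *\<^sub>R (x * y)" "x * r *\<^sub>R y = r *\<^sub>R (x * y)"
    by (simp_all add: unitization_ops scaleC_add_right scaleR_scaleC scaleC_scaleC mult_scaleC mult.commute)
  show "dist x y = norm (x - y)" "sgn x = inverse (norm x) *\<^sub>R x"
    "(uniformity :: ('a unitization \<times> 'a unitization) filter) = (INF eps\<in>{0<..}. principal {(x, y). dist x y < eps})"
    "open S \<longleftrightarrow> (\<forall>x\<in>S. \<forall>\<^sub>F (x', y) in uniformity. x' = x \<longrightarrow> y \<in> S)"
    by (fact dist_unitization_def sgn_unitization_def uniformity_unitization_def open_unitization_def)+
  show "norm x = 0 \<longleftrightarrow> x = 0"
  proof
    assume n: "norm x = 0"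
    then have "vec x = 0" using norm_vec_le[of x] by simp
    moreover have "cmod (sc x) \<le> 0" unfolding n[symmetric] norm_unitization_def by simp
    ultimately show "x = 0" by (cases x) (simp add: unitization_ops)
  next
    assume "x = 0"
    then show "norm x = 0" by (simp add: norm_unitization_def unitization_ops lmult_def[abs_def] onorm_zero)
  qed
  show "norm (x + y) \<le> norm x + norm y"
  proof -
    have "onorm (lmult (x + y)) \<le> onorm (lmult x) + onorm (lmult y)"
      unfolding lmult_ops[abs_def] by (rule onorm_triangle[OF bounded_linear_lmult bounded_linear_lmult])
    moreover have "cmod (sc (x + y)) \<le> cmod (sc x) + cmod (sc y)" by (simp add: unitization_ops norm_triangle_ineq)
    ultimately show ?thesis unfolding norm_unitization_def by (simp add: max_def)
  qed
  show "norm (r *\<^sub>R x) = \<bar>r\<bar> * norm x"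
  proof -
    have "onorm (lmult (r *\<^sub>R x)) = \<bar>r\<bar> * onorm (lmult x)"
      unfolding lmult_ops[abs_def] by (rule onorm_scaleR[OF bounded_linear_lmult])
    then show ?thesis by (simp add: norm_unitization_def norm_mult max_mult_distrib_left scaleR_unitization_def)
  qed
  show "norm (x * y) \<le> norm x * norm y"
  proof -
    have "onorm (lmult (x * y)) \<le> onorm (lmult x) * onorm (lmult y)"
      using onorm_compose[OF bounded_linear_lmult bounded_linear_lmult, of x y] by (simp add: lmult_ops[abs_def] comp_def)
    also have "\<dots> \<le> norm x * norm y" by (intro mult_mono onorm_lmult(2)) (simp_all add: norm_unitization_def le_max_iff_disj)
    finally have 1: "onorm (lmult (x * y)) \<le> norm x * norm y" .
    have "cmod (sc (x * y)) = cmod (sc x) * cmod (sc y)" by (simp add: times_unitization_def norm_mult)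
    also have "\<dots> \<le> norm x * norm y" by (intro mult_mono) (simp_all add: norm_unitization_def le_max_iff_disj)
    finally show ?thesis using 1 unfolding norm_unitization_def[of "x * y"] by simp
  qed
  show "norm (1 :: 'a unitization) = 1"
  proof -
    have "onorm (lmult (1 :: 'a unitization)) \<le> 1" by (rule onorm_bound) (simp_all add: lmult_ops)
    then show ?thesis by (simp add: norm_unitization_def one_unitization_def)
  qed
qed

end

lemma norm_Adjoin_le: "norm (Adjoin c a) \<le> cmod c + norm a"
proof -
  have "onorm (lmult (Adjoin c a)) \<le> cmod c + norm a"
  proof (rule onorm_bound)
    fix z
    have "norm (lmult (Adjoin c a) z) \<le> norm (c *\<^sub>C z) + norm (a * z)" by (simp add: lmult_def norm_triangle_ineq)
    also have "\<dots> \<le> cmod c * norm z + norm a * norm z" by (intro add_mono) (simp_all add: norm_scaleC norm_mult_ineq)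
    finally show "norm (lmult (Adjoin c a) z) \<le> (cmod c + norm a) * norm z" by (simp add: distrib_right)
  qed simp
  then show ?thesis by (simp add: norm_unitization_def)
qed

lemma norm_sc_le: "cmod (sc x) \<le> norm x" by (simp add: norm_unitization_def)

lemma norm_Adjoin_0: "norm (Adjoin 0 a) = norm a"
proof (rule antisym)
  show "norm (Adjoin 0 a) \<le> norm a" using norm_Adjoin_le[of 0 a] by simp
  show "norm a \<le> norm (Adjoin 0 a)"
  proof (cases "a = 0")
    case False
    have "norm a * norm a = norm (lmult (Adjoin 0 a) (star a))" by (simp add: lmult_def cstar_identity' power2_eq_square)
    also have "\<dots> \<le> onorm (lmult (Adjoin 0 a)) * norm a" using onorm_lmult(1)[of "Adjoin 0 a" "star a"] by simp
    finally have "norm a \<le> onorm (lmult (Adjoin 0 a))" using False by simp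
    then show ?thesis by (simp add: norm_unitization_def)
  qed simp
qed

instance unitization :: (cstar_algebra) banach
proof
  fix X :: "nat \<Rightarrow> 'a unitization"
  assume X: "Cauchy X"
  have "Cauchy (\<lambda>n. sc (X n))"
  proof (rule CauchyI)
    fix eps :: real assume "eps > 0"
    then obtain M where M: "\<And>m n. m \<ge> M \<Longrightarrow> n \<ge> M \<Longrightarrow> norm (X m - X n) < eps" using CauchyD[OF X] by blast
    have "norm (sc (X m) - sc (X n)) < eps" if "m \<ge> M" "n \<ge> M" for m n
      using norm_sc_le[of "X m - X n"] M[OF that] by (simp add: minus_unitization_def)
    then show "\<exists>M. \<forall>m\<ge>M. \<forall>n\<ge>M. norm (sc (X m) - sc (X n)) < eps" by blast
  qed
  then obtain c where c: "(\<lambda>n. sc (X n)) \<longlonglongrightarrow> c" using Cauchy_convergent unfolding convergent_def by blast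
  have "Cauchy (\<lambda>n. vec (X n))"
  proof (rule CauchyI)
    fix eps :: real assume "eps > 0"
    then obtain M where M: "\<And>m n. m \<ge> M \<Longrightarrow> n \<ge> M \<Longrightarrow> norm (X m - X n) < eps / 2" using CauchyD[OF X, of "eps / 2"] by auto
    have "norm (vec (X m) - vec (X n)) < eps" if "m \<ge> M" "n \<ge> M" for m n
      using norm_vec_le[of "X m - X n"] M[OF that] by (simp add: minus_unitization_def)
    then show "\<exists>M. \<forall>m\<ge>M. \<forall>n\<ge>M. norm (vec (X m) - vec (X n)) < eps" by blast
  qed
  then obtain a where a: "(\<lambda>n. vec (X n)) \<longlonglongrightarrow> a" using Cauchy_convergent unfolding convergent_def by blast
  have "X \<longlonglongrightarrow> Adjoin c a"
  proof (rule LIM_zero_cancel, rule Lim_null_comparison)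
    show "\<forall>\<^sub>s n. norm (X n - Adjoin c a) \<le> cmod (sc (X n) - c) + norm (vec (X n) - a)"
      by (intro always_eventually allI) (simp add: minus_unitization_def norm_Adjoin_le)
    show "(\<lambda>n. cmod (sc (X n) - c) + norm (vec (X n) - a)) \<longlonglongrightarrow> 0"
      by (intro tendsto_add_zero tendsto_norm_zero LIM_zero a c)
  qed
  then show "convergent X" by (auto simp: convergent_def)
qed

instantiation unitization :: (cstar_algebra) cstar_algebra
begin

definition "c *\<^sub>C x = Adjoin (c * sc x) (c *\<^sub>C vec x)"
definition "star x = Adjoin (cnj (sc x)) (star (vec x))"

text \<open>The source of the C*-identity: the squared norm of \<open>lmult x z\<close> is at most
  the operator norm of left multiplication by \<open>star x * x\<close> times the square of
  \<open>norm z\<close>.\<close>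

lemma star_lmult: "star (lmult x z) * lmult x z = star z * lmult (star x * x) z" for x :: "'a unitization"
  by (simp add: lmult_def star_unitization_def times_unitization_def star_add star_scaleC star_mult distrib_left distrib_right
      scaleC_add_left scaleC_add_right scaleC_scaleC mult_scaleC mult_ac add_ac)

instance
proof
  fix x y :: "'a unitization" and c d :: complex and r :: real
  show "r *\<^sub>R x = complex_of_real r *\<^sub>C x" by (simp add: scaleR_unitization_def scaleC_unitization_def scaleR_scaleC)
  show "c *\<^sub>C (x + y) = c *\<^sub>C x + c *\<^sub>C y" "(c + d) *\<^sub>C x = c *\<^sub>C x + d *\<^sub>C x" "c *\<^sub>C d *\<^sub>C x = (c * d) *\<^sub>C x"
    by (simp_all add: unitization_ops scaleC_unitization_def scaleC_add_left scaleC_add_right scaleC_scaleC algebra_simps)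
  show "(c *\<^sub>C x) * y = c *\<^sub>C (x * y)" "x * (c *\<^sub>C y) = c *\<^sub>C (x * y)"
    by (simp_all add: unitization_ops scaleC_unitization_def scaleC_add_right scaleC_scaleC mult_scaleC mult_ac)
  show "norm (c *\<^sub>C x) = cmod c * norm x"
  proof -
    have le: "norm (c *\<^sub>C x) \<le> cmod c * norm x" for c and x :: "'a unitization"
    proof -
      have "onorm (lmult (c *\<^sub>C x)) \<le> cmod c * onorm (lmult x)"
      proof (rule onorm_bound)
        fix z
        have "lmult (c *\<^sub>C x) z = c *\<^sub>C lmult x z"
          by (simp add: lmult_def scaleC_unitization_def scaleC_add_right scaleC_scaleC mult_scaleC_left)
        then show "norm (lmult (c *\<^sub>C x) z) \<le> cmod c * onorm (lmult x) * norm z"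
          using mult_left_mono[OF onorm_lmult(1)[of x z], of "cmod c"] by (simp add: norm_scaleC mult.assoc)
      qed (simp add: onorm_lmult(2))
      also have "\<dots> \<le> cmod c * norm x" by (intro mult_left_mono) (simp_all add: norm_unitization_def)
      finally have 1: "onorm (lmult (c *\<^sub>C x)) \<le> cmod c * norm x" .
      have "cmod (sc (c *\<^sub>C x)) \<le> cmod c * norm x"
        by (simp add: scaleC_unitization_def norm_mult norm_sc_le mult_left_mono)
      then show ?thesis using 1 unfolding norm_unitization_def[of "c *\<^sub>C x"] by simp
    qed
    show ?thesis
    proof (cases "c = 0")
      case True
      then show ?thesis using le[of c x] by simp
    next
      case False
      have "x = inverse c *\<^sub>C c *\<^sub>C x" using False by (cases x) (simp add: scaleC_unitization_def scaleC_scaleC)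
      then have "norm x \<le> cmod (inverse c) * norm (c *\<^sub>C x)" using le[of "inverse c" "c *\<^sub>C x"] by simp
      from mult_left_mono[OF this norm_ge_zero[of c]]
      have "cmod c * norm x \<le> cmod c * (inverse (cmod c) * norm (c *\<^sub>C x))" by (simp only: norm_inverse)
      then have "cmod c * norm x \<le> norm (c *\<^sub>C x)" using False by (simp only: mult.assoc[symmetric]) simp
      then show ?thesis using le[of c x] by simp
    qed
  qed
  show "star (star x) = x" "star (x + y) = star x + star y" "star (c *\<^sub>C x) = cnj c *\<^sub>C star x" "star (x * y) = star y * star x"
    by (simp_all add: unitization_ops scaleC_unitization_def star_unitization_def star_star star_add star_scaleC star_mult add_ac mult.commute)
  show "norm (star x * x) = (norm x)\<^sup>2"
  proof -
    have le: "(onorm (lmult x))\<^sup>2 \<le> onorm (lmult (star x * x))" for x :: "'a unitization"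
    proof -
      have "onorm (lmult x) \<le> sqrt (onorm (lmult (star x * x)))"
      proof (rule onorm_bound)
        fix z
        have "(norm (lmult x z))\<^sup>2 = norm (star z * lmult (star x * x) z)"
          by (simp only: cstar_identity[symmetric] star_lmult)
        also have "\<dots> \<le> norm z * (onorm (lmult (star x * x)) * norm z)"
          by (rule order_trans[OF norm_mult_ineq]) (simp add: mult_left_mono onorm_lmult(1))
        also have "\<dots> = (sqrt (onorm (lmult (star x * x))) * norm z)\<^sup>2"
          by (simp add: power_mult_distrib onorm_lmult(2)) (simp add: power2_eq_square)
        finally show "norm (lmult x z) \<le> sqrt (onorm (lmult (star x * x))) * norm z"
          by (rule power2_le_imp_le) (simp add: onorm_lmult(2))
      qed (simp add: onorm_lmult(2))
      then have "(onorm (lmult x))\<^sup>2 \<le> (sqrt (onorm (lmult (star x * x))))\<^sup>2" by (intro power_mono onorm_lmult(2))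
      then show ?thesis by (simp add: onorm_lmult(2))
    qed
    have prod: "onorm (lmult (x * y)) \<le> onorm (lmult x) * onorm (lmult y)" for x y :: "'a unitization"
      using onorm_compose[OF bounded_linear_lmult bounded_linear_lmult, of x y] by (simp add: lmult_ops[abs_def] comp_def)
    have star_le: "onorm (lmult x) \<le> onorm (lmult (star x))" for x :: "'a unitization"
    proof (cases "onorm (lmult x) = 0")
      case True then show ?thesis using onorm_lmult(2)[of "star x"] by simp
    next
      case False
      have "onorm (lmult x) * onorm (lmult x) \<le> onorm (lmult (star x)) * onorm (lmult x)"
        using order_trans[OF le prod, of x] by (simp add: power2_eq_square)
      then show ?thesis using False onorm_lmult(2)[of x] by (simp add: mult_le_cancel_right)
    qed
    have ss: "star (star x) = x" by (cases x) (simp add: star_unitization_def star_star)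
    have eq: "onorm (lmult (star x)) = onorm (lmult x)" using star_le[of x] star_le[of "star x"] ss by simp
    have on: "onorm (lmult (star x * x)) = (onorm (lmult x))\<^sup>2"
      using prod[of "star x" x] le[of x] eq by (simp add: power2_eq_square)
    have "cmod (sc (star x * x)) = (cmod (sc x))\<^sup>2" by (simp add: times_unitization_def star_unitization_def norm_mult power2_eq_square)
    then show ?thesis
      unfolding norm_unitization_def on by (auto simp: max_def onorm_lmult(2) power_mono_iff not_le intro!: power_mono)
  qed
qed

end

instance unitization :: (cstar_algebra) unital_cstar ..

lemma bounded_linear_Adjoin: "bounded_linear (Adjoin 0 :: 'a::cstar_algebra \<Rightarrow> _)"
  by (rule bounded_linear_intro[where K=1]) (simp_all add: plus_unitization_def scaleR_unitization_def norm_Adjoin_0)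

lemma bounded_linear_vec: "bounded_linear (vec :: 'a::cstar_algebra unitization \<Rightarrow> 'a)"
proof (rule bounded_linear_intro[where K=2])
  show "norm (vec x) \<le> norm x * 2" for x :: "'a unitization" using norm_vec_le[of x] by simp
qed (simp_all add: plus_unitization_def scaleR_unitization_def)

lemma Adjoin_mult: "Adjoin 0 a * Adjoin 0 b = Adjoin 0 (a * b)"
  by (simp add: times_unitization_def)

lemma Adjoin_linear: "Adjoin 0 a + Adjoin 0 b = Adjoin 0 (a + b)" "Adjoin 0 a - Adjoin 0 b = Adjoin 0 (a - b)"
  "c *\<^sub>C Adjoin 0 a = Adjoin 0 (c *\<^sub>C a)" "Adjoin 0 0 = 0"
  by (simp_all add: unitization_ops scaleC_unitization_def)

section \<open>Transfer of the action and its hypotheses to the unitization\<close>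

definition unitize :: "('g \<Rightarrow> 'a \<Rightarrow> 'a) \<Rightarrow> 'g \<Rightarrow> 'a unitization \<Rightarrow> 'a unitization" where
  "unitize \<alpha> g x = Adjoin (sc x) (\<alpha> g (vec x))"

lemma cstar_actionD:
  assumes "cstar_action \<alpha>"
  shows "\<alpha> g (x + y) = \<alpha> g x + \<alpha> g y" "\<alpha> g (c *\<^sub>C x) = c *\<^sub>C \<alpha> g x" "\<alpha> g (x * y) = \<alpha> g x * \<alpha> g y"
    "\<alpha> g (star x) = star (\<alpha> g x)" "\<alpha> (g + h) x = \<alpha> g (\<alpha> h x)" "\<alpha> 0 x = x" "continuous_on UNIV (\<lambda>g. \<alpha> g x)" "\<alpha> g 0 = 0"
proof -
  show 1: "\<alpha> g (x + y) = \<alpha> g x + \<alpha> g y" "\<alpha> g (c *\<^sub>C x) = c *\<^sub>C \<alpha> g x" "\<alpha> g (x * y) = \<alpha> g x * \<alpha> g y"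
    "\<alpha> g (star x) = star (\<alpha> g x)" for g x y c
    using assms by (auto simp: cstar_action_def star_automorphism_def complex_linear_def)
  show 2: "\<alpha> (g + h) x = \<alpha> g (\<alpha> h x)" for g h x using assms by (simp add: cstar_action_def)
  show "continuous_on UNIV (\<lambda>g. \<alpha> g x)" using assms by (simp add: cstar_action_def)
  have "inj (\<alpha> 0)" using assms by (simp add: cstar_action_def star_automorphism_def bij_def)
  moreover have "\<alpha> 0 (\<alpha> 0 x) = \<alpha> 0 x" using 2[of 0 0 x] by simp
  ultimately show "\<alpha> 0 x = x" by (rule injD)
  show "\<alpha> g 0 = 0" using 1(2)[of g 0 0] by simp
qed

lemma unitized_action_unitize:
  fixes \<alpha> :: "'g::topological_group_add \<Rightarrow> 'a::cstar_algebra \<Rightarrow> 'a"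
  assumes "compact (UNIV :: 'g set)" and act: "cstar_action \<alpha>"
  shows "unitized_action (unitize \<alpha>) sc"
proof
  note D = cstar_actionD[OF act]
  show "compact (UNIV :: 'g set)" by fact
  fix g h :: 'g and x y :: "'a unitization" and c :: complex
  show "unitize \<alpha> g (x + y) = unitize \<alpha> g x + unitize \<alpha> g y" "unitize \<alpha> g (c *\<^sub>C x) = c *\<^sub>C unitize \<alpha> g x"
    "unitize \<alpha> g (x * y) = unitize \<alpha> g x * unitize \<alpha> g y" "unitize \<alpha> g (star x) = star (unitize \<alpha> g x)"
    "unitize \<alpha> g 1 = 1" "unitize \<alpha> (g + h) x = unitize \<alpha> g (unitize \<alpha> h x)" "unitize \<alpha> 0 x = x"
    by (simp_all add: unitize_def unitization_ops scaleC_unitization_def star_unitization_def D)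
  show "continuous_on UNIV (\<lambda>g. unitize \<alpha> g x)"
  proof -
    have "unitize \<alpha> g x = Adjoin (sc x) 0 + Adjoin 0 (\<alpha> g (vec x))" for g by (simp add: unitize_def plus_unitization_def)
    then show ?thesis
      by (simp add: continuous_on_add continuous_on_const bounded_linear.continuous_on[OF bounded_linear_Adjoin D(7)])
  qed
qed (simp_all add: unitize_def plus_unitization_def scaleC_unitization_def times_unitization_def star_unitization_def one_unitization_def)

text \<open>The strict limit of the sequence in the hypothesis is a multiplier commuting with the fixed point algebra.\<close>

lemma minimal_action_limit:
  fixes \<alpha> :: "'g::topological_group_add \<Rightarrow> 'a::cstar_algebra \<Rightarrow> 'a"
  assumes act: "cstar_action \<alpha>" and min: "minimal_action \<alpha>" and bdd: "\<And>k::nat. norm (s k) \<le> K"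
    and L: "\<And>x. (\<lambda>k. s k * x) \<longlonglongrightarrow> L x" and R: "\<And>x. (\<lambda>k. x * s k) \<longlonglongrightarrow> R x"
    and comm: "\<And>b. b \<in> fixed_point_algebra \<alpha> \<Longrightarrow> (\<lambda>k. s k * b - b * s k) \<longlonglongrightarrow> 0"
  shows "\<exists>c. \<forall>x. L x = c *\<^sub>C x"
proof -
  have uniq: "x = y" if "f \<longlonglongrightarrow> x" "f \<longlonglongrightarrow> y" for f :: "nat \<Rightarrow> 'a" and x y using that by (rule LIMSEQ_unique)
  have linL: "L (x + y) = L x + L y" "L (c *\<^sub>C x) = c *\<^sub>C L x" "L (x * y) = L x * y" for x y c
    using uniq[OF L[of "x + y"]] tendsto_add[OF L[of x] L[of y]] uniq[OF L[of "c *\<^sub>C x"]] tendsto_scaleC[OF tendsto_const[of c] L[of x]]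
      uniq[OF L[of "x * y"]] tendsto_mult[OF L[of x] tendsto_const[of y]]
    by (simp_all add: distrib_left mult_scaleC_right mult.assoc)
  have linR: "R (x + y) = R x + R y" "R (c *\<^sub>C x) = c *\<^sub>C R x" "R (x * y) = x * R y" for x y c
    using uniq[OF R[of "x + y"]] tendsto_add[OF R[of x] R[of y]] uniq[OF R[of "c *\<^sub>C x"]] tendsto_scaleC[OF tendsto_const[of c] R[of x]]
      uniq[OF R[of "x * y"]] tendsto_mult[OF tendsto_const[of x] R[of y]]
    by (simp_all add: distrib_right mult_scaleC_left mult.assoc)
  have RL: "R x * y = x * L y" for x y
    using uniq[OF tendsto_mult[OF R[of x] tendsto_const[of y]]] tendsto_mult[OF tendsto_const[of x] L[of y]] by (simp add: mult.assoc)
  have nL: "norm (L x) \<le> norm x * K" for x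
    by (rule Lim_bounded[OF tendsto_norm[OF L[of x]], of 0])
      (use bdd in \<open>auto intro!: order_trans[OF norm_mult_ineq] simp: mult.commute[of _ "norm x"] mult_left_mono\<close>)
  have nR: "norm (R x) \<le> norm x * K" for x
    by (rule Lim_bounded[OF tendsto_norm[OF R[of x]], of 0])
      (use bdd in \<open>auto intro!: order_trans[OF norm_mult_ineq] simp: mult_left_mono\<close>)
  have "(L, R) \<in> multiplier_algebra"
    unfolding multiplier_algebra_def mem_Collect_eq prod.case
  proof (intro conjI allI)
    show "bounded_linear L" by (rule bounded_linear_intro[where K=K]) (simp_all add: linL nL scaleR_scaleC)
    show "bounded_linear R" by (rule bounded_linear_intro[where K=K]) (simp_all add: linR nR scaleR_scaleC)
  qed (simp_all add: complex_linear_def linL linR RL)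
  moreover have "multiplier_mult (L, R) (multiplier_embed b) = multiplier_mult (multiplier_embed b) (L, R)"
    if b: "b \<in> fixed_point_algebra \<alpha>" for b
  proof -
    have 1: "L (b * x) = b * L x" for x
    proof -
      have l: "(\<lambda>k. s k * (b * x) - b * (s k * x)) \<longlonglongrightarrow> L (b * x) - b * L x" by (intro tendsto_intros L)
      have "(\<lambda>k. (s k * b - b * s k) * x) \<longlonglongrightarrow> 0 * x" by (intro tendsto_intros comm b)
      then have "(\<lambda>k. s k * (b * x) - b * (s k * x)) \<longlonglongrightarrow> 0" by (simp add: left_diff_distrib mult.assoc)
      from uniq[OF l this] show ?thesis by simp
    qed
    have 2: "R x * b = R (x * b)" for x
    proof -
      have l: "(\<lambda>k. x * s k * b - (x * b) * s k) \<longlonglongrightarrow> R x * b - R (x * b)" by (intro tendsto_intros R)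
      have "(\<lambda>k. x * (s k * b - b * s k)) \<longlonglongrightarrow> x * 0" by (intro tendsto_intros comm b)
      then have "(\<lambda>k. x * s k * b - (x * b) * s k) \<longlonglongrightarrow> 0" by (simp add: right_diff_distrib mult.assoc)
      from uniq[OF l this] show ?thesis by simp
    qed
    show ?thesis by (simp add: multiplier_mult_def multiplier_embed_def fun_eq_iff 1 2)
  qed
  ultimately have "(L, R) \<in> relative_commutant (fixed_point_algebra \<alpha>)" by (simp add: relative_commutant_def)
  then obtain c where "(L, R) = multiplier_scaleC c multiplier_one" using min by (auto simp: minimal_action_def)
  then show ?thesis by (auto simp: multiplier_scaleC_def multiplier_one_def)
qed

lemma simple_action_unitize:
  fixes \<alpha> :: "'g::topological_group_add \<Rightarrow> 'a::cstar_algebra \<Rightarrow> 'a"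
  assumes G: "compact (UNIV :: 'g set)" and sep: "separable_space (euclidean :: 'a topology)"
    and act: "cstar_action \<alpha>" and min: "minimal_action \<alpha>" and simple: "simple_subalgebra (fixed_point_algebra \<alpha>)"
  shows "simple_action (unitize \<alpha>) sc"
proof -
  interpret unitized_action "unitize \<alpha>" sc by (rule unitized_action_unitize[OF G act])
  note D = cstar_actionD[OF act]
  have A_iff: "x \<in> A \<longleftrightarrow> x = Adjoin 0 (vec x)" for x by (cases x) (simp add: A_def)
  have Adjoin_A: "Adjoin 0 a \<in> A" for a by (simp add: A_def)
  have Adjoin_B: "Adjoin 0 a \<in> B \<longleftrightarrow> a \<in> fixed_point_algebra \<alpha>" for a
    by (simp add: B_def F_def A_def unitize_def fixed_point_algebra_def)
  have B_vec: "x = Adjoin 0 (vec x)" if "x \<in> B" for x using that A_iff B_A by blast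
  show ?thesis
  proof
    fix I :: "'a unitization set"
    assume I: "I \<subseteq> B" "closed I" "0 \<in> I" "\<And>x y. x \<in> I \<Longrightarrow> y \<in> I \<Longrightarrow> x + y \<in> I" "\<And>c x. x \<in> I \<Longrightarrow> c *\<^sub>C x \<in> I"
      "\<And>b x. b \<in> B \<Longrightarrow> x \<in> I \<Longrightarrow> b * x \<in> I" "\<And>b x. b \<in> B \<Longrightarrow> x \<in> I \<Longrightarrow> x * b \<in> I"
    define I' where "I' = Adjoin 0 -` I"
    have II': "I = Adjoin 0 ` I'" unfolding I'_def using I(1) B_vec by force
    have "closed_two_sided_ideal I' (fixed_point_algebra \<alpha>)"
      unfolding closed_two_sided_ideal_def complex_subspace_def
    proof (intro conjI ballI allI)
      show "I' \<subseteq> fixed_point_algebra \<alpha>" using I(1) Adjoin_B by (auto simp: I'_def)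
      show "closed I'" unfolding I'_def
        by (rule continuous_closed_vimage[OF I(2)]) (simp add: bounded_linear.continuous[OF bounded_linear_Adjoin] linear_continuous_at bounded_linear_Adjoin)
      show "0 \<in> I'" using I(3) by (simp add: I'_def Adjoin_linear)
      show "x + y \<in> I'" if "x \<in> I'" "y \<in> I'" for x y using I(4) that by (simp add: I'_def Adjoin_linear(1)[symmetric])
      show "c *\<^sub>C x \<in> I'" if "x \<in> I'" for c x using I(5) that by (simp add: I'_def Adjoin_linear(3)[symmetric])
      show "b * x \<in> I'" "x * b \<in> I'" if "b \<in> fixed_point_algebra \<alpha>" "x \<in> I'" for b x
        using I(6,7)[of "Adjoin 0 b" "Adjoin 0 x"] that by (simp_all add: I'_def Adjoin_B Adjoin_mult)
    qed
    then consider "I' = {0}" | "I' = fixed_point_algebra \<alpha>" using simple by (auto simp: simple_subalgebra_def)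
    then show "I = {0} \<or> I = B"
    proof cases
      case 1 then show ?thesis by (simp add: II' Adjoin_linear)
    next
      case 2
      then have "B \<subseteq> I" unfolding II' using B_vec Adjoin_B by (metis image_eqI subsetI)
      then show ?thesis using I(1) by blast
    qed
  next
    have "0 \<in> fixed_point_algebra \<alpha>" by (simp add: fixed_point_algebra_def D)
    then obtain b where "b \<in> fixed_point_algebra \<alpha>" "b \<noteq> 0" using simple by (auto simp: simple_subalgebra_def)
    then show "\<exists>b\<in>B. b \<noteq> 0" by (intro bexI[of _ "Adjoin 0 b"]) (simp_all add: Adjoin_B zero_unitization_def)
  next
    obtain C :: "'a set" where C: "countable C" "closure C = UNIV"
      using sep by (auto simp: separable_space_def)
    have "C \<noteq> {}" using C(2) by auto
    have "\<exists>n. norm (x - Adjoin 0 (from_nat_into C n)) < eps" if x: "x \<in> A" and eps: "eps > 0" for x eps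
    proof -
      obtain c where "c \<in> C" "dist c (vec x) < eps" using C(2) eps closure_approachable[of "vec x" C] by auto
      moreover obtain n where "from_nat_into C n = c" using from_nat_into_surj[OF C(1) \<open>c \<in> C\<close>] by blast
      moreover have "x - Adjoin 0 c = Adjoin 0 (vec x - c)" using x A_iff Adjoin_linear(2) by metis
      ultimately show ?thesis by (intro exI[of _ n]) (simp add: norm_Adjoin_0 dist_norm norm_minus_commute)
    qed
    then show "\<exists>D::nat \<Rightarrow> 'a unitization. (\<forall>n. D n \<in> A) \<and> (\<forall>x\<in>A. \<forall>e>0. \<exists>n. norm (x - D n) < e)"
      using Adjoin_A by (intro exI[of _ "\<lambda>n. Adjoin 0 (from_nat_into C n)"]) blast
  next
    fix S :: "nat \<Rightarrow> 'a unitization"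
    assume S: "\<And>k. S k \<in> A" "bounded (range S)" "\<And>x. x \<in> A \<Longrightarrow> convergent (\<lambda>k. S k * x)"
      "\<And>x. x \<in> A \<Longrightarrow> convergent (\<lambda>k. x * S k)" "\<And>b. b \<in> B \<Longrightarrow> (\<lambda>k. S k * b - b * S k) \<longlonglongrightarrow> 0"
    define s where "s k = vec (S k)" for k
    have Ss: "S k = Adjoin 0 (s k)" for k using S(1) A_iff unfolding s_def by blast
    obtain K where K: "\<And>k. norm (s k) \<le> K" using S(2) unfolding bounded_iff by (auto simp: Ss norm_Adjoin_0)
    have lim: "\<exists>l. f \<longlonglongrightarrow> l" if "convergent (\<lambda>k. Adjoin 0 (f k))" for f :: "nat \<Rightarrow> 'a"
    proof -
      from that obtain l where "(\<lambda>k. Adjoin 0 (f k)) \<longlonglongrightarrow> l" by (auto simp: convergent_def)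
      from bounded_linear.tendsto[OF bounded_linear_vec this] show ?thesis by auto
    qed
    have "(\<lambda>k. s k * x) \<longlonglongrightarrow> (SOME l. (\<lambda>k. s k * x) \<longlonglongrightarrow> l)" for x
      by (rule someI_ex[OF lim]) (use S(3)[OF Adjoin_A[of x]] in \<open>simp add: Ss Adjoin_mult\<close>)
    then obtain L where L: "\<And>x. (\<lambda>k. s k * x) \<longlonglongrightarrow> L x" by (rule that)
    have "(\<lambda>k. x * s k) \<longlonglongrightarrow> (SOME l. (\<lambda>k. x * s k) \<longlonglongrightarrow> l)" for x
      by (rule someI_ex[OF lim]) (use S(4)[OF Adjoin_A[of x]] in \<open>simp add: Ss Adjoin_mult\<close>)
    then obtain R where R: "\<And>x. (\<lambda>k. x * s k) \<longlonglongrightarrow> R x" by (rule that)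
    have "(\<lambda>k. s k * b - b * s k) \<longlonglongrightarrow> 0" if "b \<in> fixed_point_algebra \<alpha>" for b
    proof -
      have "(\<lambda>k. Adjoin 0 (s k * b - b * s k)) \<longlonglongrightarrow> 0"
        using S(5)[of "Adjoin 0 b"] that by (simp add: Ss Adjoin_B Adjoin_mult Adjoin_linear)
      from bounded_linear.tendsto[OF bounded_linear_vec this] show ?thesis by (simp add: zero_unitization_def)
    qed
    from minimal_action_limit[OF act min K L R this] obtain c where c: "\<And>x. L x = c *\<^sub>C x" by blast
    have "(\<lambda>k. S k * x) \<longlonglongrightarrow> c *\<^sub>C x" if "x \<in> A" for x
    proof -
      have x: "x = Adjoin 0 (vec x)" using that A_iff by blast
      have "(\<lambda>k. Adjoin 0 (s k * vec x)) \<longlonglongrightarrow> Adjoin 0 (c *\<^sub>C vec x)"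
        using bounded_linear.tendsto[OF bounded_linear_Adjoin L[of "vec x"]] by (simp add: c)
      then show ?thesis by (subst (1 2) x) (simp add: Ss Adjoin_mult Adjoin_linear)
    qed
    then show "\<exists>c. \<forall>x\<in>A. (\<lambda>k. S k * x) \<longlonglongrightarrow> c *\<^sub>C x" by blast
  qed
qed

theorem theorem1p1:
  fixes \<alpha> :: "'g::{topological_group_add, t2_space, second_countable_topology} \<Rightarrow> 'a::cstar_algebra \<Rightarrow> 'a"
  assumes "compact (UNIV :: 'g set)"
    and "separable_space (euclidean :: 'a topology)"
    and "cstar_action \<alpha>"
    and "faithful_action \<alpha>"
    and "minimal_action \<alpha>"
    and "simple_subalgebra (fixed_point_algebra \<alpha>)"
  shows "quasi_product \<alpha>"
proof -
  interpret simple_action "unitize \<alpha>" sc by (rule simple_action_unitize) fact+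
  obtain e where e: "\<And>n. valid (e n)" "\<And>n. e (Suc n) \<in> loc (e n)" "\<And>y \<delta>. y \<in> A \<Longrightarrow> \<delta> > 0 \<Longrightarrow> \<exists>n. flat (e n) y \<delta>"
    using flat_sequence_exists by blast
  interpret excising_sequence "unitize \<alpha>" sc e by unfold_locales (use e in auto)
  have B_D: "\<exists>a\<in>fixed_point_algebra \<alpha>. b = Adjoin 0 a" if "b \<in> B" for b
    using that by (cases b) (auto simp: B_def F_def A_def unitize_def fixed_point_algebra_def)
  have unit: "\<exists>b\<in>fixed_point_algebra \<alpha>. norm b \<le> 1 \<and> norm (x * b * y) \<ge> 1 - eps" if xy: "norm x = 1" "norm y = 1" and eps: "eps > 0" for x y :: 'a and eps
  proof -
    have A: "Adjoin 0 x \<in> A" "Adjoin 0 y \<in> A" by (simp_all add: A_def)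
    obtain b where b: "b \<in> B" "norm b \<le> 1" "norm (Adjoin 0 x * b * Adjoin 0 y) \<ge> 1 - eps"
      using BEK_unit[unfolded BEK_unit_def, rule_format, OF A eps] xy by (auto simp: norm_Adjoin_0)
    then show ?thesis using B_D[OF b(1)] by (auto simp: Adjoin_mult norm_Adjoin_0)
  qed
  show ?thesis unfolding quasi_product_def BEK_def
  proof (intro allI antisym)
    fix x y :: 'a
    let ?U = "{b \<in> fixed_point_algebra \<alpha>. norm b \<le> 1}"
    let ?m = "SUP b\<in>?U. norm (x * b * y)"
    have le: "norm (x * b * y) \<le> norm x * norm y" if "b \<in> ?U" for b
    proof -
      have "norm (x * b * y) \<le> norm x * norm b * norm y" by (rule norm_mult3)
      also have "\<dots> \<le> norm x * 1 * norm y" using that by (intro mult_right_mono mult_left_mono) auto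
      finally show ?thesis by simp
    qed
    have zero: "0 \<in> ?U" using cstar_actionD(8)[OF assms(3)] by (simp add: fixed_point_algebra_def)
    then show "?m \<le> norm x * norm y" by (intro cSUP_least le) auto
    have bdd: "bdd_above ((\<lambda>b. norm (x * b * y)) ` ?U)" using le by (intro bdd_aboveI2)
    show "norm x * norm y \<le> ?m"
    proof (cases "x = 0 \<or> y = 0")
      case True
      then have "norm x * norm y = norm (x * 0 * y)" by auto
      also have "\<dots> \<le> ?m" by (rule cSUP_upper[OF zero bdd])
      finally show ?thesis .
    next
      case False
      then have nz: "norm x > 0" "norm y > 0" by auto
      have main: "norm x * norm y * (1 - eps) \<le> ?m" if eps: "eps > 0" for eps
      proof -
        obtain b where b: "b \<in> fixed_point_algebra \<alpha>" "norm b \<le> 1"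
          "norm (((1 / norm x) *\<^sub>R x) * b * ((1 / norm y) *\<^sub>R y)) \<ge> 1 - eps"
          using unit[of "(1 / norm x) *\<^sub>R x" "(1 / norm y) *\<^sub>R y", OF _ _ eps] nz by auto
        have "norm (((1 / norm x) *\<^sub>R x) * b * ((1 / norm y) *\<^sub>R y)) = norm (x * b * y) / (norm x * norm y)"
          using nz by simp
        then have "(1 - eps) * (norm x * norm y) \<le> norm (x * b * y)" using b(3) nz by (simp only: pos_le_divide_eq[OF mult_pos_pos[OF nz]])
        also have "\<dots> \<le> ?m" using b by (intro cSUP_upper[OF _ bdd]) simp
        finally show ?thesis by (simp add: mult.commute)
      qed
      have t: "t \<le> ?m / (norm x * norm y)" if "t < 1" for t
        using main[of "1 - t"] that by (simp add: pos_le_divide_eq[OF mult_pos_pos[OF nz]] mult.commute)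
      have "1 \<le> ?m / (norm x * norm y)" by (rule dense_le) (rule t)
      then show ?thesis by (simp add: pos_le_divide_eq[OF mult_pos_pos[OF nz]])
    qed
  qed
qed

end
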